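(* Let $p\ge 1$ be an integer and let $\lambda>\sqrt{\frac{p+2}{p}}$. There exists a constant $c_{p,\lambda}>0$ such that if $\psi$ is a strictly positive function satisfying $$\frac{\lambda}{2\pi}\int_0^{\frac{2\pi}{\lambda}}\psi(\theta)\,d\theta\ \ge\ c_{p,\lambda}\,\|\psi\|_2 ,$$ then a solution $k$ to the boundary value problem $$\frac{\partial k}{\partial t}=k^2\left(k^{p-1}k_{\theta\theta}+(p-1)k^{p-2}k_\theta^2+\frac1p k^p\right)\ \text{in }\left[0,\tfrac{2\pi}{\lambda}\right]\times(0,T),\qquad k(\theta,0)=\psi(\theta)\ \text{on }\left[0,\tfrac{2\pi}{\lambda}\right],$$ with periodic boundary conditions, is analytic (in $\theta$) and satisfies $$\left\|k(\theta,t)-\hat k(0,t)\right\|_{C^l\left(\left[0,\frac{2\pi}{\lambda}\right]\right)}\le E_{l,p,\lambda}\,(T-t)^{\left(\lambda^2-\frac{p+2}{p}\right)\frac{p}{p+1}},$$ where $0<T<\infty$ is the blow-up time of the solution with initial condition $\psi$, and $E_{l,p,\lambda}$ is a constant.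
   Context: For $f\in L^2([0,\frac{2\pi}{\lambda}])$ write its Fourier expansion as $\sum_{n\in\mathbb Z}\hat f(n)e^{i\lambda n\theta}$, so that $\hat f(0)=\frac{\lambda}{2\pi}\int_0^{2\pi/\lambda}f\,d\theta$. For a function $k(\theta,t)$, $\hat k(n,t)$ denotes the $n$-th Fourier coefficient of $k(\cdot,t)$; in particular $\hat k(0,t)$ is the average of $k(\cdot,t)$. Define the family of seminorms $$\|f\|_\beta=\max\left\{\sup_{n\ne0}|n|^\beta|\mathrm{Re}\,\hat f(n)|,\ \sup_{n\neq 0}|n|^\beta|\mathrm{Im}\,\hat f(n)|\right\};$$ thus $\|\psi\|_2$ is this seminorm with $\beta=2$ (not the $L^2$ norm). $C^l([0,\frac{2\pi}{\lambda}])$ is the space of functions with continuous derivatives of order $l$, with norm $\|f\|_{C^l([0,2\pi/\lambda])}=\max_{j=0,1,\dots,l}\sup_{\theta\in[0,2\pi/\lambda]}\left|\frac{d^jf(\theta)}{d\theta^j}\right|$. By the maximum principle for parabolic equations, a solution of the problem with initial condition $\psi>0$ blows up in finite time.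
   Formalization: The constant E may depend on ψ (scaling k shows that one depending only on l, p, λ is impossible); if ψ is C^l the estimate holds for all t in [0,T), otherwise on [t0,T) for each t0>0 with E depending on t0, as it fails near t=0 for rough ψ. *)

theory Defs
  imports "HOL-Analysis.Analysis" "HOL-Library.Periodic_Fun"
begin

text \<open>
  Functions on the interval from \<open>0\<close> to \<open>2 pi / \<lambda>\<close> with periodic boundary conditions are
  represented by functions on the real line with period \<open>2 pi / \<lambda>\<close>.  Derivatives at the
  endpoints of the interval are then ordinary two-sided derivatives.
\<close>

definition fourier_coeff :: "real \<Rightarrow> (real \<Rightarrow> real) \<Rightarrow> int \<Rightarrow> complex" where
  "fourier_coeff lam f n =
     complex_of_real (lam / (2 * pi)) *
       integral {0..2 * pi / lam} (\<lambda>x. complex_of_real (f x) * cis (- (lam * of_int n * x)))"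

text \<open>
  The seminorm takes values in the extended reals, so that it is \<open>\<infinity>\<close> (and not an arbitrary
  real number) if the weighted coefficients are unbounded.
\<close>

definition fourier_seminorm :: "real \<Rightarrow> real \<Rightarrow> (real \<Rightarrow> real) \<Rightarrow> ereal" where
  "fourier_seminorm lam \<beta> f =
     max (SUP n\<in>{n. n \<noteq> 0}. ereal (\<bar>of_int n\<bar> powr \<beta> * \<bar>Re (fourier_coeff lam f n)\<bar>))
         (SUP n\<in>{n. n \<noteq> 0}. ereal (\<bar>of_int n\<bar> powr \<beta> * \<bar>Im (fourier_coeff lam f n)\<bar>))"

definition C_space :: "nat \<Rightarrow> (real \<Rightarrow> real) \<Rightarrow> bool" where
  "C_space l f \<longleftrightarrow>
     (\<forall>j<l. (deriv ^^ j) f differentiable_on UNIV) \<and> continuous_on UNIV ((deriv ^^ l) f)"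

text \<open>
  The supremum is the genuine one for periodic functions in \<open>C_space l\<close>, for which it ranges
  over a bounded set.
\<close>

definition C_norm :: "real \<Rightarrow> nat \<Rightarrow> (real \<Rightarrow> real) \<Rightarrow> real" where
  "C_norm lam l f = (MAX j\<in>{..l}. SUP x\<in>{0..2 * pi / lam}. \<bar>(deriv ^^ j) f x\<bar>)"

definition real_analytic :: "(real \<Rightarrow> real) \<Rightarrow> bool" where
  "real_analytic f \<longleftrightarrow> (\<forall>x. \<exists>F. (\<lambda>h. f (x + h)) has_fps_expansion F)"

text \<open>
  Classical solutions: continuous up to \<open>t = 0\<close>, once continuously differentiable in \<open>t\<close> and
  twice in \<open>\<theta>\<close> for \<open>0 < t < T\<close>.  The functions \<open>kt\<close>, \<open>kx\<close> and \<open>kxx\<close> are the partial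
  derivatives.  For \<open>p = 1\<close> the exponent \<open>p - 2\<close> is negative, hence the integer power.
\<close>

definition classical_solution ::
    "nat \<Rightarrow> real \<Rightarrow> real \<Rightarrow> (real \<Rightarrow> real) \<Rightarrow> (real \<Rightarrow> real \<Rightarrow> real) \<Rightarrow> bool" where
  "classical_solution p lam T \<psi> k \<longleftrightarrow>
     (\<forall>t\<in>{0..<T}. periodic_fun_simple (\<lambda>\<theta>. k \<theta> t) (2 * pi / lam)) \<and>
     continuous_on (UNIV \<times> {0..<T}) (\<lambda>(\<theta>, t). k \<theta> t) \<and>
     (\<exists>kt kx kxx.
        continuous_on (UNIV \<times> {0<..<T}) (\<lambda>(\<theta>, t). kt \<theta> t) \<and>
        continuous_on (UNIV \<times> {0<..<T}) (\<lambda>(\<theta>, t). kx \<theta> t) \<and>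
        continuous_on (UNIV \<times> {0<..<T}) (\<lambda>(\<theta>, t). kxx \<theta> t) \<and>
        (\<forall>\<theta>. \<forall>t\<in>{0<..<T}.
           ((\<lambda>s. k \<theta> s) has_real_derivative kt \<theta> t) (at t) \<and>
           ((\<lambda>x. k x t) has_real_derivative kx \<theta> t) (at \<theta>) \<and>
           ((\<lambda>x. kx x t) has_real_derivative kxx \<theta> t) (at \<theta>) \<and>
           kt \<theta> t = (k \<theta> t)\<^sup>2 *
             (k \<theta> t ^ (p - 1) * kxx \<theta> t
              + (real p - 1) * k \<theta> t powi (int p - 2) * (kx \<theta> t)\<^sup>2
              + 1 / real p * k \<theta> t ^ p))) \<and>
     (\<forall>\<theta>. k \<theta> 0 = \<psi> \<theta>)"

text \<open>
  Blow-up at time \<open>T\<close>: the limit superior of \<open>sup \<bar>k(\<cdot>, t)\<bar>\<close> as \<open>t\<close> increases to \<open>T\<close> is \<open>\<infinity>\<close>.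
\<close>

definition blows_up_at :: "real \<Rightarrow> (real \<Rightarrow> real \<Rightarrow> real) \<Rightarrow> bool" where
  "blows_up_at T k \<longleftrightarrow> (\<forall>M. \<exists>\<^sub>F t in at_left T. \<exists>\<theta>. M < \<bar>k \<theta> t\<bar>)"

definition solution_with_blowup_time ::
    "nat \<Rightarrow> real \<Rightarrow> real \<Rightarrow> (real \<Rightarrow> real) \<Rightarrow> (real \<Rightarrow> real \<Rightarrow> real) \<Rightarrow> bool" where
  "solution_with_blowup_time p lam T \<psi> k \<longleftrightarrow>
     0 < T \<and> classical_solution p lam T \<psi> k \<and> blows_up_at T k"

end

theory Submission
  imports Defs
begin

text \<open>
  Write \<open>k = a * (1 + v)\<close> with \<open>v\<close> of mean zero and pass to the time \<open>s\<close> with \<open>ds/dt = a^(p + 1)\<close>.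
  The coefficients of \<open>v\<close> solve \<open>v_n' = - (lam^2 n^2 - (p + 1)/p) v_n + N_n(v)\<close> with \<open>N\<close> of order
  two, and \<open>a'/a = 1/p\<close> up to a term of order two.  A contraction argument in spaces of coefficients whose
  weights gain radius of analyticity gives a global solution that decays like \<open>exp (- mu s)\<close>,
  where \<open>mu = lam^2 - (p + 1)/p\<close>.  Since \<open>a\<close> grows like \<open>exp (s/p)\<close>, the remaining life time is
  comparable to \<open>exp (- (p + 1) s/p)\<close> and \<open>a * v\<close> decays like \<open>exp (- (mu - 1/p) s)\<close>, which is the
  asserted power of \<open>T - t\<close>.

  An arbitrary classical solution agrees with the constructed one by the maximum principle applied
  to their difference.  If the data are only \<open>l\<close> times differentiable, then the bounds up to
  \<open>t = 0\<close> come from their Fejer means: the derivatives of these are bounded by those of the data, and the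
  maximum principle for the differentiated equations preserves such bounds for a short time.
\<close>

section \<open>Weighted coefficient sequences under convolution\<close>

text \<open>The obstacle is a loss of derivatives: the equation is quasilinear, so the quadratic
  remainder contains second derivatives, and the smoothing of the linear flow must return both of
  them in full. In sup-type spaces of Fourier coefficients this works mode by mode, because the
  integral of \<open>n^2 exp (- n^2 (t - s) / 4)\<close> over \<open>s\<close> is bounded uniformly
  in \<open>n\<close>. Such spaces are also what the hypothesis offers:
  \<open>fourier_seminorm\<close> with exponent 2 bounds the nonzero coefficients by multiples of
  \<open>1 / n^2\<close>, and the weights \<open>1 / (1 + n^2)\<close> are stable under convolution.
  The price is that second space derivatives may be unbounded at time 0. A further factor
  \<open>1 + y n^2\<close> in the weights, with \<open>y\<close> growing linearly from 0, limits
  them to a singularity \<open>t powr (- 3 / 4)\<close>; this is integrable and can be absorbed by a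
  barrier \<open>exp (L t powr (1 / 4))\<close> in the comparison argument. All smallness is
  relative to the mean: the equation is homogeneous of degree \<open>p + 2\<close>, so division by
  the mean and the change of time reduce it to mean 1, and the constant of the theorem depends on
  \<open>p\<close> and \<open>lam\<close> only.\<close>

definition conv :: "(int \<Rightarrow> complex) \<Rightarrow> (int \<Rightarrow> complex) \<Rightarrow> int \<Rightarrow> complex" where
  "conv a b n = (\<Sum>\<^sub>\<infinity>m. a m * b (n - m))"

text \<open>\<open>e = 0\<close> stands for no loss, \<open>e = 1\<close> for the loss of the two
  space derivatives in the equation.\<close>

definition wt :: "nat \<Rightarrow> int \<Rightarrow> real" where
  "wt e n = (1 + (of_int n)\<^sup>2) ^ e"

text \<open>The convolution inequality for \<open>e = 0\<close> makes the sequences bounded by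
  multiples of \<open>w\<close> an algebra; for \<open>e = 1\<close> it makes those bounded by
  multiples of \<open>wt 1 n * w n\<close> a module over it. So one factor of a product may carry
  two derivatives. All constants are normalised to 1, which lets later constants be the same for
  every profile.\<close>

definition profile :: "(int \<Rightarrow> real) \<Rightarrow> bool" where
  "profile w \<longleftrightarrow> (\<forall>n. 0 < w n) \<and> w summable_on UNIV \<and> infsum w UNIV \<le> 1 \<and>
     (\<forall>e\<le>1. \<forall>n. wt e n * w n \<le> 1 \<and> (\<Sum>\<^sub>\<infinity>m. w m * (wt e (n - m) * w (n - m))) \<le> wt e n * w n)"

definition dominated :: "real \<Rightarrow> nat \<Rightarrow> (int \<Rightarrow> real) \<Rightarrow> (int \<Rightarrow> complex) \<Rightarrow> bool" where
  "dominated c e w a \<longleftrightarrow> (\<forall>n. cmod (a n) \<le> c * (wt e n * w n))"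

definition hermitian :: "(int \<Rightarrow> complex) \<Rightarrow> bool" where
  "hermitian a \<longleftrightarrow> (\<forall>n. a (- n) = cnj (a n))"

lemma wt_ge_1: "1 \<le> wt e n"
  unfolding wt_def by (rule one_le_power) simp

lemma wt_0 [simp]: "wt 0 n = 1"
  by (simp add: wt_def)

lemma profile_pos: "profile w \<Longrightarrow> 0 < w n"
  by (simp add: profile_def)

lemma dominated_mono:
  assumes "dominated c e w a" "c \<le> d" "profile w"
  shows "dominated d e w a"
  unfolding dominated_def
proof
  fix n
  have "0 \<le> wt e n * w n"
    using profile_pos[OF assms(3), of n] wt_ge_1[of e n] by simp
  then show "cmod (a n) \<le> d * (wt e n * w n)"
    using assms(1,2) mult_right_mono[of c d "wt e n * w n"] unfolding dominated_def by (meson order_trans)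
qed

lemma dominated_zero: "0 \<le> c \<Longrightarrow> profile w \<Longrightarrow> dominated c e w (\<lambda>_. 0)"
  using order_trans[OF zero_le_one wt_ge_1] less_imp_le[OF profile_pos]
  by (simp add: dominated_def)

lemma dominated_nonneg:
  assumes "dominated c e w a" "profile w" shows "0 \<le> c"
proof -
  have "0 < wt e 0 * w 0" using profile_pos[OF assms(2), of 0] wt_ge_1[of e 0] by simp
  moreover have "0 \<le> c * (wt e 0 * w 0)" using assms(1) unfolding dominated_def
    by (meson norm_ge_zero order_trans)
  ultimately show ?thesis by (meson not_le mult_neg_pos)
qed

text \<open>The first bound is summed over \<open>m\<close> for the norm estimate. The second uses
  \<open>wt e * w \<le> 1\<close>; being independent of \<open>n\<close>, it is the majorant for
  summability and for continuity in a parameter.\<close>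

lemma conv_term_bound:
  assumes "profile w" "e \<le> 1" "dominated c 0 w a" "dominated d e w b"
  shows "cmod (a m * b (n - m)) \<le> c * d * (w m * (wt e (n - m) * w (n - m)))"
    and "cmod (a m * b (n - m)) \<le> c * d * w m"
proof -
  have c: "0 \<le> c" "0 \<le> d" using dominated_nonneg assms by blast+
  have "cmod (a m) * cmod (b (n - m)) \<le> (c * w m) * (d * (wt e (n - m) * w (n - m)))"
    using assms(3,4) c profile_pos[OF assms(1), of m] by (intro mult_mono) (auto simp: dominated_def)
  then show *: "cmod (a m * b (n - m)) \<le> c * d * (w m * (wt e (n - m) * w (n - m)))"
    by (simp add: norm_mult algebra_simps)
  have "wt e (n - m) * w (n - m) \<le> 1" using assms(1,2) by (auto simp: profile_def)
  then have "w m * (wt e (n - m) * w (n - m)) \<le> w m"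
    using profile_pos[OF assms(1), of m] by (simp add: mult_left_le)
  then show "cmod (a m * b (n - m)) \<le> c * d * w m"
    using * c by (meson mult_left_mono mult_nonneg_nonneg order_trans)
qed

lemma profile_conv_summable:
  assumes "profile w" "e \<le> 1"
  shows "(\<lambda>m. w m * (wt e (n - m) * w (n - m))) summable_on UNIV"
proof (rule summable_on_comparison_test[of w])
  show "w summable_on UNIV" using assms by (simp add: profile_def)
  fix m
  have "wt e (n - m) * w (n - m) \<le> 1" using assms by (auto simp: profile_def)
  then show "w m * (wt e (n - m) * w (n - m)) \<le> w m"
    using profile_pos[OF assms(1), of m] by (simp add: mult_left_le)
  show "0 \<le> w m * (wt e (n - m) * w (n - m))"
    using profile_pos[OF assms(1), of m] profile_pos[OF assms(1), of "n-m"] wt_ge_1[of e "n-m"] by simp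
qed

lemma conv_summable:
  assumes "profile w" "e \<le> 1" "dominated c 0 w a" "dominated d e w b"
  shows "(\<lambda>m. cmod (a m * b (n - m))) summable_on UNIV"
proof (rule summable_on_comparison_test[of "\<lambda>m. c * d * w m"])
  show "(\<lambda>m. c * d * w m) summable_on UNIV"
    using assms(1) by (intro summable_on_cmult_right) (simp add: profile_def)
qed (use conv_term_bound(2)[OF assms] in auto)

lemma conv_dominated:
  assumes "profile w" "e \<le> 1" "dominated c 0 w a" "dominated d e w b"
  shows "dominated (c * d) e w (conv a b)"
  unfolding dominated_def
proof
  fix n
  have cd: "0 \<le> c * d" using dominated_nonneg assms by (meson mult_nonneg_nonneg)
  have "cmod (conv a b n) \<le> (\<Sum>\<^sub>\<infinity>m. c * d * (w m * (wt e (n - m) * w (n - m))))"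
    unfolding conv_def
  proof (rule norm_infsum_le)
    show "((\<lambda>m. a m * b (n - m)) has_sum (\<Sum>\<^sub>\<infinity>m. a m * b (n - m))) UNIV"
      by (rule has_sum_infsum[OF abs_summable_summable[OF conv_summable[OF assms]]])
    show "((\<lambda>m. c * d * (w m * (wt e (n - m) * w (n - m)))) has_sum
        (\<Sum>\<^sub>\<infinity>m. c * d * (w m * (wt e (n - m) * w (n - m))))) UNIV"
      by (rule has_sum_infsum[OF summable_on_cmult_right[OF profile_conv_summable[OF assms(1,2)]]])
  qed (rule conv_term_bound(1)[OF assms])
  also have "\<dots> = c * d * (\<Sum>\<^sub>\<infinity>m. w m * (wt e (n - m) * w (n - m)))"
    by (rule infsum_cmult_right')
  also have "\<dots> \<le> c * d * (wt e n * w n)"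
    using assms(1,2) cd by (intro mult_left_mono) (auto simp: profile_def)
  finally show "cmod (conv a b n) \<le> c * d * (wt e n * w n)" .
qed

lemma conv_diff:
  assumes "profile w" "e \<le> 1" "dominated c 0 w a" "dominated d e w b"
    "dominated c' 0 w a'" "dominated d' e w b'"
  shows "conv a b n - conv a' b' n = conv (\<lambda>m. a m - a' m) b n + conv a' (\<lambda>m. b m - b' m) n"
proof -
  have dd: "dominated (c + c') 0 w (\<lambda>m. a m - a' m)" "dominated (d + d') e w (\<lambda>m. b m - b' m)"
    using assms unfolding dominated_def
    by (auto simp: distrib_right intro!: order_trans[OF norm_triangle_ineq4] add_mono)
  note s = abs_summable_summable[OF conv_summable[OF assms(1,2)]]
  have "(\<lambda>m. (a m * b (n - m) - a' m * b' (n - m))) = (\<lambda>m. (a m - a' m) * b (n - m) + a' m * (b (n - m) - b' (n - m)))"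
    by (simp add: algebra_simps)
  then show ?thesis
    unfolding conv_def
    using infsum_add[OF s[OF assms(3,4)] summable_on_uminus[THEN iffD2, OF s[OF assms(5,6)]], of n n]
      infsum_add[OF s[OF dd(1) assms(4)] s[OF assms(5) dd(2)], of n n]
    by (simp add: infsum_uminus)
qed

lemma conv_hermitian:
  assumes "hermitian a" "hermitian b" shows "hermitian (conv a b)"
  unfolding hermitian_def
proof
  fix n
  have "conv a b (- n) = (\<Sum>\<^sub>\<infinity>m. a (- m) * b (- n + m))"
    unfolding conv_def
    by (rule infsum_reindex_bij_witness[of _ uminus uminus]) auto
  also have "\<dots> = (\<Sum>\<^sub>\<infinity>m. cnj (a m * b (n - m)))"
  proof (rule infsum_cong)
    fix m
    have "b (- n + m) = cnj (b (n - m))" using assms(2) by (metis hermitian_def minus_diff_eq uminus_add_conv_diff)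
    then show "a (- m) * b (- n + m) = cnj (a m * b (n - m))" using assms(1) by (simp add: hermitian_def)
  qed
  also have "\<dots> = cnj (conv a b n)" unfolding conv_def by (rule infsum_cnj)
  finally show "conv a b (- n) = cnj (conv a b n)" .
qed

lemma continuous_on_infsum:
  fixes f :: "'i \<Rightarrow> 'a::topological_space \<Rightarrow> 'b::banach"
  assumes "\<And>m. continuous_on I (f m)" "\<And>m s. s \<in> I \<Longrightarrow> norm (f m s) \<le> g m" "g summable_on UNIV"
  shows "continuous_on I (\<lambda>s. \<Sum>\<^sub>\<infinity>m. f m s)"
proof (rule uniform_limit_theorem)
  show "uniform_limit I (\<lambda>X s. \<Sum>m\<in>X. f m s) (\<lambda>s. \<Sum>\<^sub>\<infinity>m. f m s) (finite_subsets_at_top UNIV)"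
    using assms(2,3) by (intro Weierstrass_m_test_general[of UNIV I f g]) auto
  show "\<forall>\<^sub>F X in finite_subsets_at_top UNIV. continuous_on I (\<lambda>s. \<Sum>m\<in>X. f m s)"
    using assms(1) by (intro always_eventually allI continuous_on_sum)
qed auto

lemma conv_continuous:
  assumes "profile w" "e \<le> 1" "\<And>s. s \<in> I \<Longrightarrow> dominated c 0 w (a s)" "\<And>s. s \<in> I \<Longrightarrow> dominated d e w (b s)"
    "\<And>n. continuous_on I (\<lambda>s. a s n)" "\<And>n. continuous_on I (\<lambda>s. b s n)"
  shows "continuous_on I (\<lambda>s. conv (a s) (b s) n)"
  unfolding conv_def
proof (rule continuous_on_infsum[where g="\<lambda>m. c * d * w m"])
  show "(\<lambda>m. c * d * w m) summable_on UNIV"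
    using assms(1) by (intro summable_on_cmult_right) (simp add: profile_def)
qed (use assms conv_term_bound(2)[OF assms(1,2)] in \<open>auto intro: continuous_on_mult\<close>)

text \<open>Maps on coefficient sequences that are Lipschitz on balls, of order \<open>q + 1\<close> at \<open>0\<close> and losing
  \<open>2 * e\<close> derivatives, with a constant that does not depend on the profile.\<close>

definition order_lipschitz :: "real \<Rightarrow> nat \<Rightarrow> nat \<Rightarrow> ((int \<Rightarrow> complex) \<Rightarrow> int \<Rightarrow> complex) \<Rightarrow> bool" where
  "order_lipschitz C e q F \<longleftrightarrow>
     (\<forall>w r D v v'. profile w \<longrightarrow> 0 \<le> r \<longrightarrow> r \<le> 1 \<longrightarrow> 0 \<le> D \<longrightarrow> dominated r 0 w v \<longrightarrow> dominated r 0 w v' \<longrightarrow>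
         dominated D 0 w (\<lambda>n. v n - v' n) \<longrightarrow> dominated (C * r ^ q * D) e w (\<lambda>n. F v n - F v' n))"

text \<open>These four properties are what the Duhamel iteration asks of its nonlinearity: it fixes
  0, it is Lipschitz, it preserves the symmetry of coefficients of real functions, and it maps
  continuous paths to continuous paths. They are bundled because all of them survive sums,
  multipliers and convolutions.\<close>

definition tame :: "nat \<Rightarrow> nat \<Rightarrow> ((int \<Rightarrow> complex) \<Rightarrow> int \<Rightarrow> complex) \<Rightarrow> bool" where
  "tame e q F \<longleftrightarrow> F (\<lambda>_. 0) = (\<lambda>_. 0) \<and>
     (\<exists>C\<ge>0. order_lipschitz C e q F) \<and>
     (\<forall>v. hermitian v \<longrightarrow> hermitian (F v)) \<and>
     (\<forall>w v (I :: real set). profile w \<and> (\<forall>s\<in>I. dominated 1 0 w (v s)) \<and> (\<forall>n. continuous_on I (\<lambda>s. v s n))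
        \<longrightarrow> (\<forall>n. continuous_on I (\<lambda>s. F (v s) n)))"

lemma tameE:
  assumes "tame e q F"
  obtains C where "0 \<le> C"
    "\<And>w r D v v'. profile w \<Longrightarrow> 0 \<le> r \<Longrightarrow> r \<le> 1 \<Longrightarrow> 0 \<le> D \<Longrightarrow> dominated r 0 w v \<Longrightarrow> dominated r 0 w v' \<Longrightarrow>
       dominated D 0 w (\<lambda>n. v n - v' n) \<Longrightarrow> dominated (C * r ^ q * D) e w (\<lambda>n. F v n - F v' n)"
    "\<And>w r v. profile w \<Longrightarrow> 0 \<le> r \<Longrightarrow> r \<le> 1 \<Longrightarrow> dominated r 0 w v \<Longrightarrow> dominated (C * r ^ q * r) e w (F v)"
proof -
  from assms obtain C where C0: "0 \<le> C" "order_lipschitz C e q F" and z: "F (\<lambda>_. 0) = (\<lambda>_. 0)"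
    unfolding tame_def by auto
  have C: "0 \<le> C"
    "\<And>w r D v v'. profile w \<Longrightarrow> 0 \<le> r \<Longrightarrow> r \<le> 1 \<Longrightarrow> 0 \<le> D \<Longrightarrow> dominated r 0 w v \<Longrightarrow> dominated r 0 w v' \<Longrightarrow>
       dominated D 0 w (\<lambda>n. v n - v' n) \<Longrightarrow> dominated (C * r ^ q * D) e w (\<lambda>n. F v n - F v' n)"
    using C0 unfolding order_lipschitz_def by auto
  show ?thesis
  proof (rule that[OF C])
    fix w r v assume a: "profile w" "0 \<le> r" "r \<le> 1" "dominated r 0 w v"
    show "dominated (C * r ^ q * r) e w (F v)"
      using C(2)[OF a(1-3) a(2) a(4) dominated_zero[OF a(2,1)]] a(4) z by simp
  qed
qed

lemma tame_hermitian: "tame e q F \<Longrightarrow> hermitian v \<Longrightarrow> hermitian (F v)"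
  by (simp add: tame_def)

lemma tame_continuous:
  assumes "tame e q F" "profile w" "\<And>s::real. s \<in> I \<Longrightarrow> dominated 1 0 w (v s)" "\<And>n. continuous_on I (\<lambda>s. v s n)"
  shows "continuous_on I (\<lambda>s. F (v s) n)"
proof -
  have "\<forall>n. continuous_on I (\<lambda>s. F (v s) n)"
    using assms(1)[unfolded tame_def, THEN conjunct2, THEN conjunct2, THEN conjunct2, rule_format, of w I v] assms(2-4)
    by auto
  then show ?thesis by blast
qed

lemma tameI:
  assumes "F (\<lambda>_. 0) = (\<lambda>_. 0)" "0 \<le> C"
    "\<And>w r D v v'. profile w \<Longrightarrow> 0 \<le> r \<Longrightarrow> r \<le> 1 \<Longrightarrow> 0 \<le> D \<Longrightarrow> dominated r 0 w v \<Longrightarrow> dominated r 0 w v' \<Longrightarrow>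
       dominated D 0 w (\<lambda>n. v n - v' n) \<Longrightarrow> dominated (C * r ^ q * D) e w (\<lambda>n. F v n - F v' n)"
    "\<And>v. hermitian v \<Longrightarrow> hermitian (F v)"
    "\<And>w v (I::real set) n. profile w \<Longrightarrow> (\<And>s. s \<in> I \<Longrightarrow> dominated 1 0 w (v s)) \<Longrightarrow> (\<And>n. continuous_on I (\<lambda>s. v s n))
       \<Longrightarrow> continuous_on I (\<lambda>s. F (v s) n)"
  shows "tame e q F"
  unfolding tame_def
proof (intro conjI exI[of _ C] allI impI)
  show "order_lipschitz C e q F"
    unfolding order_lipschitz_def using assms(3) by auto
  show "continuous_on I (\<lambda>s. F (v s) n)"
    if "profile w \<and> (\<forall>s\<in>I. dominated 1 0 w (v s)) \<and> (\<forall>n. continuous_on I (\<lambda>s. v s n))" for w v n and I :: "real set"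
    using that by (intro assms(5)[of w]) auto
qed (use assms in auto)

section \<open>Closure properties of tame maps\<close>

lemma tame_id: "tame 0 0 (\<lambda>v. v)"
  by (rule tameI[of _ 1]) auto

lemma tame_add:
  assumes "tame e q F" "tame e q H"
  shows "tame e q (\<lambda>v n. F v n + H v n)"
proof -
  obtain C where C: "0 \<le> C" "\<And>w r D v v'. profile w \<Longrightarrow> 0 \<le> r \<Longrightarrow> r \<le> 1 \<Longrightarrow> 0 \<le> D \<Longrightarrow> dominated r 0 w v \<Longrightarrow> dominated r 0 w v' \<Longrightarrow>
       dominated D 0 w (\<lambda>n. v n - v' n) \<Longrightarrow> dominated (C * r ^ q * D) e w (\<lambda>n. F v n - F v' n)"
    by (rule tameE[OF assms(1)]) (rule that, assumption+)
  obtain C' where C': "0 \<le> C'" "\<And>w r D v v'. profile w \<Longrightarrow> 0 \<le> r \<Longrightarrow> r \<le> 1 \<Longrightarrow> 0 \<le> D \<Longrightarrow> dominated r 0 w v \<Longrightarrow> dominated r 0 w v' \<Longrightarrow>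
       dominated D 0 w (\<lambda>n. v n - v' n) \<Longrightarrow> dominated (C' * r ^ q * D) e w (\<lambda>n. H v n - H v' n)"
    by (rule tameE[OF assms(2)]) (rule that, assumption+)
  show ?thesis
  proof (rule tameI[of _ "C + C'"])
    fix w r D v v'
    assume *: "profile w" "0 \<le> r" "r \<le> 1" "0 \<le> D" "dominated r 0 w v" "dominated r 0 w v'" "dominated D 0 w (\<lambda>n. v n - v' n)"
    have "cmod (F v n + H v n - (F v' n + H v' n)) \<le> (C + C') * r ^ q * D * (wt e n * w n)" for n
    proof -
      have "cmod (F v n + H v n - (F v' n + H v' n)) \<le> cmod (F v n - F v' n) + cmod (H v n - H v' n)"
        by (metis add_diff_add norm_triangle_ineq)
      then show ?thesis
        using C(2)[OF *] C'(2)[OF *] unfolding dominated_def by (smt (verit) distrib_right)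
    qed
    then show "dominated ((C + C') * r ^ q * D) e w (\<lambda>n. F v n + H v n - (F v' n + H v' n))"
      by (simp add: dominated_def)
  next
    fix w v and I :: "real set" and n
    assume "profile w" "\<And>s. s \<in> I \<Longrightarrow> dominated 1 0 w (v s)" "\<And>n. continuous_on I (\<lambda>s. v s n)"
    then show "continuous_on I (\<lambda>s. F (v s) n + H (v s) n)"
      using tame_continuous[OF assms(1)] tame_continuous[OF assms(2)] by (intro continuous_on_add) blast+
  qed (use assms C C' in \<open>auto simp: tame_def hermitian_def fun_eq_iff\<close>)
qed

lemma tame_mult:
  assumes "tame e q F" "e \<le> e'" "0 \<le> K" "\<And>n. \<bar>f n\<bar> * wt e n \<le> K * wt e' n" "\<And>n. f (- n) = f n"
  shows "tame e' q (\<lambda>v n. complex_of_real (f n) * F v n)"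
proof -
  obtain C where C: "0 \<le> C" "\<And>w r D v v'. profile w \<Longrightarrow> 0 \<le> r \<Longrightarrow> r \<le> 1 \<Longrightarrow> 0 \<le> D \<Longrightarrow> dominated r 0 w v \<Longrightarrow> dominated r 0 w v' \<Longrightarrow>
       dominated D 0 w (\<lambda>n. v n - v' n) \<Longrightarrow> dominated (C * r ^ q * D) e w (\<lambda>n. F v n - F v' n)"
    by (rule tameE[OF assms(1)]) (rule that, assumption+)
  show ?thesis
  proof (rule tameI[of _ "K * C"])
    fix w r D v v'
    assume *: "profile w" "0 \<le> r" "r \<le> 1" "0 \<le> D" "dominated r 0 w v" "dominated r 0 w v'" "dominated D 0 w (\<lambda>n. v n - v' n)"
    have "cmod (complex_of_real (f n) * F v n - complex_of_real (f n) * F v' n) \<le> K * C * r ^ q * D * (wt e' n * w n)" for n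
    proof -
      have "cmod (complex_of_real (f n) * F v n - complex_of_real (f n) * F v' n) = \<bar>f n\<bar> * cmod (F v n - F v' n)"
        by (metis norm_mult norm_of_real right_diff_distrib)
      also have "\<dots> \<le> \<bar>f n\<bar> * (C * r ^ q * D * (wt e n * w n))"
        using C(2)[OF *] by (intro mult_left_mono) (auto simp: dominated_def)
      also have "\<dots> = (\<bar>f n\<bar> * wt e n) * (C * r ^ q * D * w n)" by simp
      also have "\<dots> \<le> (K * wt e' n) * (C * r ^ q * D * w n)"
        using * C(1) profile_pos[OF *(1), of n] by (intro mult_right_mono assms(4)) auto
      finally show ?thesis by (simp add: algebra_simps)
    qed
    then show "dominated (K * C * r ^ q * D) e' w (\<lambda>n. complex_of_real (f n) * F v n - complex_of_real (f n) * F v' n)"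
      by (simp add: dominated_def)
  next
    fix w v and I :: "real set" and n
    assume "profile w" "\<And>s. s \<in> I \<Longrightarrow> dominated 1 0 w (v s)" "\<And>n. continuous_on I (\<lambda>s. v s n)"
    then show "continuous_on I (\<lambda>s. complex_of_real (f n) * F (v s) n)"
      using tame_continuous[OF assms(1)] by (intro continuous_on_mult continuous_on_const) blast
  qed (use assms C in \<open>auto simp: tame_def hermitian_def fun_eq_iff\<close>)
qed

lemma tame_cmult: "tame e q F \<Longrightarrow> tame e q (\<lambda>v n. complex_of_real c * F v n)"
  by (rule tame_mult[where K="\<bar>c\<bar>"]) auto

lemma tame_weaken_derivative: "tame 0 q F \<Longrightarrow> tame 1 q F"
  using tame_mult[of 0 q F 1 1 "\<lambda>_. 1"] wt_ge_1 by simp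

lemma tame_weaken_order:
  assumes "tame e 1 F" shows "tame e 0 F"
proof -
  obtain C where C: "0 \<le> C" "\<And>w r D v v'. profile w \<Longrightarrow> 0 \<le> r \<Longrightarrow> r \<le> 1 \<Longrightarrow> 0 \<le> D \<Longrightarrow> dominated r 0 w v \<Longrightarrow> dominated r 0 w v' \<Longrightarrow>
       dominated D 0 w (\<lambda>n. v n - v' n) \<Longrightarrow> dominated (C * r ^ 1 * D) e w (\<lambda>n. F v n - F v' n)"
    by (rule tameE[OF assms(1)]) (rule that, assumption+)
  show ?thesis
  proof (rule tameI[of _ C])
    fix w r D v v'
    assume *: "profile w" "0 \<le> r" "r \<le> 1" "0 \<le> D" "dominated r 0 w v" "dominated r 0 w v'" "dominated D 0 w (\<lambda>n. v n - v' n)"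
    have "C * r ^ 1 * D \<le> C * r ^ 0 * D" using * C(1) by (simp add: mult_left_le mult_right_mono)
    then show "dominated (C * r ^ 0 * D) e w (\<lambda>n. F v n - F v' n)"
      using dominated_mono[OF C(2)[OF *]] *(1) by blast
  next
    fix w v and I :: "real set" and n
    assume "profile w" "\<And>s. s \<in> I \<Longrightarrow> dominated 1 0 w (v s)" "\<And>n. continuous_on I (\<lambda>s. v s n)"
    then show "continuous_on I (\<lambda>s. F (v s) n)"
      using tame_continuous[OF assms(1)] by blast
  qed (use assms C in \<open>auto simp: tame_def\<close>)
qed

text \<open>In the splitting of \<open>conv_diff\<close> one factor contributes the distance
  \<open>D\<close> and the other the radius \<open>r\<close>, hence the order rises from 0 to 1.
  Only the second factor may lose derivatives, as the module property of profiles permits.\<close>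

lemma tame_conv:
  assumes "tame 0 0 F" "tame e 0 H" "e \<le> 1"
  shows "tame e 1 (\<lambda>v. conv (F v) (H v))"
proof -
  obtain C where C: "0 \<le> C" "\<And>w r D v v'. profile w \<Longrightarrow> 0 \<le> r \<Longrightarrow> r \<le> 1 \<Longrightarrow> 0 \<le> D \<Longrightarrow> dominated r 0 w v \<Longrightarrow> dominated r 0 w v' \<Longrightarrow>
       dominated D 0 w (\<lambda>n. v n - v' n) \<Longrightarrow> dominated (C * r ^ 0 * D) 0 w (\<lambda>n. F v n - F v' n)"
    "\<And>w r v. profile w \<Longrightarrow> 0 \<le> r \<Longrightarrow> r \<le> 1 \<Longrightarrow> dominated r 0 w v \<Longrightarrow> dominated (C * r ^ 0 * r) 0 w (F v)"
    by (rule tameE[OF assms(1)]) (rule that, assumption+)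
  obtain C' where C': "0 \<le> C'" "\<And>w r D v v'. profile w \<Longrightarrow> 0 \<le> r \<Longrightarrow> r \<le> 1 \<Longrightarrow> 0 \<le> D \<Longrightarrow> dominated r 0 w v \<Longrightarrow> dominated r 0 w v' \<Longrightarrow>
       dominated D 0 w (\<lambda>n. v n - v' n) \<Longrightarrow> dominated (C' * r ^ 0 * D) e w (\<lambda>n. H v n - H v' n)"
    "\<And>w r v. profile w \<Longrightarrow> 0 \<le> r \<Longrightarrow> r \<le> 1 \<Longrightarrow> dominated r 0 w v \<Longrightarrow> dominated (C' * r ^ 0 * r) e w (H v)"
    by (rule tameE[OF assms(2)]) (rule that, assumption+)
  show ?thesis
  proof (rule tameI[of _ "2 * (C * C')"])
    fix w r D v v'
    assume *: "profile w" "0 \<le> r" "r \<le> 1" "0 \<le> D" "dominated r 0 w v" "dominated r 0 w v'" "dominated D 0 w (\<lambda>n. v n - v' n)"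
    note F = C(3)[OF *(1-3,5)] C(3)[OF *(1-3,6)] C(2)[OF *]
    note H = C'(3)[OF *(1-3,5)] C'(3)[OF *(1-3,6)] C'(2)[OF *]
    show "dominated (2 * (C * C') * r ^ 1 * D) e w (\<lambda>n. conv (F v) (H v) n - conv (F v') (H v') n)"
      unfolding dominated_def
    proof
      fix n
      have "cmod (conv (F v) (H v) n - conv (F v') (H v') n) \<le>
          cmod (conv (\<lambda>m. F v m - F v' m) (H v) n) + cmod (conv (F v') (\<lambda>m. H v m - H v' m) n)"
        using conv_diff[OF *(1) assms(3) F(1) H(1) F(2) H(2)] norm_triangle_ineq by metis
      also have "\<dots> \<le> (C * r ^ 0 * D) * (C' * r ^ 0 * r) * (wt e n * w n) + (C * r ^ 0 * r) * (C' * r ^ 0 * D) * (wt e n * w n)"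
        using conv_dominated[OF *(1) assms(3) F(3) H(1)] conv_dominated[OF *(1) assms(3) F(2) H(3)]
        by (intro add_mono) (auto simp: dominated_def)
      finally show "cmod (conv (F v) (H v) n - conv (F v') (H v') n) \<le> 2 * (C * C') * r ^ 1 * D * (wt e n * w n)"
        by (simp add: algebra_simps)
    qed
  next
    fix w v and I :: "real set" and n
    assume *: "profile w" "\<And>s. s \<in> I \<Longrightarrow> dominated 1 0 w (v s)" "\<And>n. continuous_on I (\<lambda>s. v s n)"
    show "continuous_on I (\<lambda>s. conv (F (v s)) (H (v s)) n)"
      using tame_continuous[OF assms(1) *] tame_continuous[OF assms(2) *]
        C(3)[OF *(1) _ _ *(2)] C'(3)[OF *(1) _ _ *(2)]
      by (intro conv_continuous[OF *(1) assms(3), of I "C * 1 ^ 0 * 1" _ "C' * 1 ^ 0 * 1"]) auto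
  next
    show "conv (F (\<lambda>_. 0)) (H (\<lambda>_. 0)) = (\<lambda>_. 0)"
      using assms by (simp add: tame_def conv_def fun_eq_iff)
  qed (use assms C C' in \<open>auto intro: conv_hermitian tame_hermitian\<close>)
qed

text \<open>Serves the normalising term of \<open>nonlin\<close>. Since \<open>wt 1 0 = 1\<close>
  and \<open>w 0 \<le> 1\<close>, evaluation at frequency 0 costs no derivative, and the scalar is
  of size \<open>C * r * r\<close>. The product is in fact cubic; one power of
  \<open>r \<le> 1\<close> is given away.\<close>

lemma tame_mult_coefficient_0:
  assumes "tame 1 1 F"
  shows "tame 1 1 (\<lambda>v n. v n * F v 0)"
proof -
  obtain C where C: "0 \<le> C" "\<And>w r D v v'. profile w \<Longrightarrow> 0 \<le> r \<Longrightarrow> r \<le> 1 \<Longrightarrow> 0 \<le> D \<Longrightarrow> dominated r 0 w v \<Longrightarrow> dominated r 0 w v' \<Longrightarrow>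
       dominated D 0 w (\<lambda>n. v n - v' n) \<Longrightarrow> dominated (C * r ^ 1 * D) 1 w (\<lambda>n. F v n - F v' n)"
    "\<And>w r v. profile w \<Longrightarrow> 0 \<le> r \<Longrightarrow> r \<le> 1 \<Longrightarrow> dominated r 0 w v \<Longrightarrow> dominated (C * r ^ 1 * r) 1 w (F v)"
    by (rule tameE[OF assms(1)]) (rule that, assumption+)
  show ?thesis
  proof (rule tameI[of _ "2 * C"])
    fix w r D v v'
    assume *: "profile w" "0 \<le> r" "r \<le> 1" "0 \<le> D" "dominated r 0 w v" "dominated r 0 w v'" "dominated D 0 w (\<lambda>n. v n - v' n)"
    have w0: "w 0 \<le> 1" "0 < w 0" using *(1) by (auto simp: profile_def dest!: spec[of _ "0::nat"] spec[of _ "0::int"])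
    show "dominated (2 * C * r ^ 1 * D) 1 w (\<lambda>n. v n * F v 0 - v' n * F v' 0)"
      unfolding dominated_def
    proof
      fix n
      have wn: "0 < w n" "w n \<le> wt 1 n * w n" using profile_pos[OF *(1)] wt_ge_1[of 1 n] by auto
      have F: "cmod (F v 0) \<le> C * r * r" "cmod (F v 0 - F v' 0) \<le> C * r * D"
      proof -
        have "cmod (F v 0) \<le> C * r * r * w 0" "cmod (F v 0 - F v' 0) \<le> C * r * D * w 0"
          using C(3)[OF *(1-3,5)] C(2)[OF *] by (auto simp: dominated_def wt_def dest: spec[of _ 0])
        moreover have "C * r * r * w 0 \<le> C * r * r * 1" "C * r * D * w 0 \<le> C * r * D * 1"
          using w0 * C(1) by (intro mult_left_mono; simp)+
        ultimately show "cmod (F v 0) \<le> C * r * r" "cmod (F v 0 - F v' 0) \<le> C * r * D" by linarith+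
      qed
      have "v n * F v 0 - v' n * F v' 0 = (v n - v' n) * F v 0 + v' n * (F v 0 - F v' 0)"
        by (simp add: algebra_simps)
      then have "cmod (v n * F v 0 - v' n * F v' 0) \<le> cmod (v n - v' n) * cmod (F v 0) + cmod (v' n) * cmod (F v 0 - F v' 0)"
        by (metis norm_mult norm_triangle_ineq)
      also have "\<dots> \<le> (D * w n) * (C * r * r) + (r * w n) * (C * r * D)"
        using *(4-7) *(2) F wn C(1) by (intro add_mono mult_mono) (auto simp: dominated_def)
      also have "\<dots> = 2 * C * r * D * (r * w n)" by (simp add: algebra_simps)
      also have "\<dots> \<le> 2 * C * r * D * (wt 1 n * w n)"
        using wn * C(1) mult_right_mono[of r 1 "w n"] by (intro mult_left_mono) auto
      finally show "cmod (v n * F v 0 - v' n * F v' 0) \<le> 2 * C * r ^ 1 * D * (wt 1 n * w n)" by simp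
    qed
  next
    fix w v and I :: "real set" and n
    assume *: "profile w" "\<And>s. s \<in> I \<Longrightarrow> dominated 1 0 w (v s)" "\<And>n. continuous_on I (\<lambda>s. v s n)"
    then show "continuous_on I (\<lambda>s. v s n * F (v s) 0)"
      using tame_continuous[OF assms(1) *] by (intro continuous_on_mult) blast+
  next
    fix v assume "hermitian v"
    moreover then have "hermitian (F v)" using assms tame_hermitian by blast
    ultimately show "hermitian (\<lambda>n. v n * F v 0)"
      unfolding hermitian_def by (metis complex_cnj_mult minus_zero)
  qed (use C in auto)
qed

text \<open>\<open>power_rest j v\<close> has the coefficients of \<open>(1 + v)^j - 1 - j * v\<close>.\<close>

primrec power_rest :: "nat \<Rightarrow> (int \<Rightarrow> complex) \<Rightarrow> int \<Rightarrow> complex" where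
  "power_rest 0 v = (\<lambda>_. 0)"
| "power_rest (Suc j) v = (\<lambda>n. power_rest j v n + conv v (\<lambda>m. complex_of_real (real j) * v m + power_rest j v m) n)"

lemma tame_power_rest: "tame 0 1 (power_rest j)"
proof (induction j)
  case 0
  show ?case by (rule tameI[of _ 0]) (auto simp: dominated_def hermitian_def)
next
  case (Suc j)
  have "tame 0 0 (\<lambda>v m. complex_of_real (real j) * v m + power_rest j v m)"
    by (intro tame_add tame_cmult tame_id tame_weaken_order Suc)
  from tame_add[OF Suc tame_conv[OF tame_id this]] show ?case by simp
qed

text \<open>The Fourier multiplier of \<open>f + f_xx\<close>, the combination in which
  \<open>u^p\<close> enters the equation.\<close>

definition symbol :: "real \<Rightarrow> int \<Rightarrow> real" where
  "symbol lam n = 1 - lam\<^sup>2 * (of_int n)\<^sup>2"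

lemma tame_symbol: "tame 0 q F \<Longrightarrow> tame 1 q (\<lambda>v n. complex_of_real (symbol lam n) * F v n)"
proof (rule tame_mult[where K="1 + lam\<^sup>2"])
  fix n
  have "\<bar>symbol lam n\<bar> \<le> 1 + lam\<^sup>2 * (of_int n)\<^sup>2"
    unfolding symbol_def by (smt (verit) mult_nonneg_nonneg zero_le_power2)
  also have "\<dots> \<le> (1 + lam\<^sup>2) * (1 + (of_int n)\<^sup>2)" by (simp add: algebra_simps)
  finally show "\<bar>symbol lam n\<bar> * wt 0 n \<le> (1 + lam\<^sup>2) * wt 1 n" by (simp add: wt_def)
qed (auto simp: symbol_def)

text \<open>The terms of order at least two of \<open>(1/p) * u^2 * ((u^p)_xx + u^p)\<close> at \<open>u = 1 + v\<close>.\<close>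

definition quad_part :: "nat \<Rightarrow> real \<Rightarrow> (int \<Rightarrow> complex) \<Rightarrow> int \<Rightarrow> complex" where
  "quad_part p lam v n = complex_of_real (1 / real p) *
     (conv v v n + (complex_of_real (symbol lam n) * power_rest p v n +
      conv (\<lambda>m. complex_of_real 2 * v m + conv v v m)
        (\<lambda>m. complex_of_real (real p) * (complex_of_real (symbol lam m) * v m)
             + complex_of_real (symbol lam m) * power_rest p v m) n))"

lemma tame_quad_part: "tame 1 1 (quad_part p lam)"
proof -
  have vv: "tame 0 1 (\<lambda>v. conv v v)" using tame_conv[OF tame_id tame_id] by simp
  have "tame 0 0 (\<lambda>v m. complex_of_real 2 * v m + conv v v m)"
    by (intro tame_add tame_cmult tame_id tame_weaken_order vv)
  moreover have "tame 1 0 (\<lambda>v m. complex_of_real (real p) * (complex_of_real (symbol lam m) * v m)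
             + complex_of_real (symbol lam m) * power_rest p v m)"
    by (intro tame_add tame_cmult tame_symbol tame_id tame_weaken_order tame_power_rest)
  ultimately have "tame 1 1 (\<lambda>v. conv (\<lambda>m. complex_of_real 2 * v m + conv v v m)
        (\<lambda>m. complex_of_real (real p) * (complex_of_real (symbol lam m) * v m)
             + complex_of_real (symbol lam m) * power_rest p v m))"
    by (intro tame_conv) auto
  from tame_cmult[OF tame_add[OF tame_weaken_derivative[OF vv] tame_add[OF tame_symbol[OF tame_power_rest] this]]]
  show ?thesis unfolding quad_part_def .
qed

text \<open>The subtracted product is the nonlinear part of the growth rate of the mean, by which \<open>u\<close> is
  normalised.\<close>

definition nonlin :: "nat \<Rightarrow> real \<Rightarrow> (int \<Rightarrow> complex) \<Rightarrow> int \<Rightarrow> complex" where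
  "nonlin p lam v n = quad_part p lam v n + complex_of_real (-1) * (v n * quad_part p lam v 0)"

lemma tame_nonlin: "tame 1 1 (nonlin p lam)"
  using tame_add[OF tame_quad_part tame_cmult[OF tame_mult_coefficient_0[OF tame_quad_part]], of p lam "-1" p lam]
  unfolding nonlin_def by simp

section \<open>Weights and the linearised evolution\<close>

lemma summable_on_int_real:
  fixes f :: "int \<Rightarrow> real"
  assumes "\<And>n. 0 \<le> f n" "summable (\<lambda>n. f (int n))" "summable (\<lambda>n. f (- int n))"
  shows "f summable_on UNIV"
proof -
  have "(\<lambda>n. f (int n)) summable_on UNIV" "(\<lambda>n. f (- int n)) summable_on UNIV"
    using assms by (simp_all add: summable_on_UNIV_nonneg_real_iff)
  then have "f summable_on range int" "f summable_on range (\<lambda>n. - int n)"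
    by (subst summable_on_reindex; force simp: o_def inj_def)+
  then have "f summable_on (range int \<union> range (\<lambda>n. - int n))"
    by (rule summable_on_union)
  moreover have "range int \<union> range (\<lambda>n. - int n) = UNIV"
    by (auto simp: image_iff) (metis int_cases2)
  ultimately show ?thesis by simp
qed

lemma summable_inverse_quadratic: "(\<lambda>n::int. 1 / (1 + (of_int n)\<^sup>2 :: real)) summable_on UNIV"
proof (rule summable_on_int_real)
  have "summable (\<lambda>n. 1 / (1 + (real n)\<^sup>2))"
  proof (rule summable_comparison_test_ev[OF _ inverse_power_summable[of 2]])
    show "\<forall>\<^sub>F n in sequentially. norm (1 / (1 + (real n)\<^sup>2)) \<le> inverse (real n ^ 2)"
      using eventually_gt_at_top[of 0] by eventually_elim (simp add: divide_simps add_pos_pos)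
  qed auto
  then show "summable (\<lambda>n. 1 / (1 + (real_of_int (int n))\<^sup>2))" "summable (\<lambda>n. 1 / (1 + (real_of_int (- int n))\<^sup>2))"
    by simp_all
qed auto

definition quad_sum :: real where
  "quad_sum = (\<Sum>\<^sub>\<infinity>n::int. 1 / (1 + (of_int n)\<^sup>2))"

lemma quad_sum_ge_1: "1 \<le> quad_sum"
proof -
  have "(\<Sum>n\<in>{0::int}. 1 / (1 + (of_int n)\<^sup>2 :: real)) \<le> quad_sum"
    unfolding quad_sum_def by (rule finite_sum_le_infsum[OF summable_inverse_quadratic]) auto
  then show ?thesis by simp
qed

text \<open>The factor \<open>1 / (1 + n^2)\<close> is the decay known of the initial data. The
  other two factors are submultiplicative up to 2 and can be inserted without losing stability under
  convolution. The 8 in the normalisation is this 2 times the 4 that arises when inverse quadratics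
  are convolved, see \<open>WW\<close> and \<open>GG\<close> in
  \<open>profile_decay_profile\<close>.\<close>

definition decay_profile :: "real \<Rightarrow> real \<Rightarrow> int \<Rightarrow> real" where
  "decay_profile y z n = 1 / (8 * quad_sum) / ((1 + (of_int n)\<^sup>2) * ((1 + y * (of_int n)\<^sup>2) * exp (z * \<bar>of_int n\<bar>)))"

lemma decay_weight_submult:
  fixes y z a b :: real
  assumes "0 \<le> y" "0 \<le> z"
  shows "(1 + y * (a + b)\<^sup>2) * exp (z * \<bar>a + b\<bar>) \<le> 2 * (((1 + y * a\<^sup>2) * exp (z * \<bar>a\<bar>)) * ((1 + y * b\<^sup>2) * exp (z * \<bar>b\<bar>)))"
proof -
  have ab: "(a + b)\<^sup>2 \<le> 2 * a\<^sup>2 + 2 * b\<^sup>2"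
    using sum_squares_ge_zero[of "a - b" 0] by (simp add: power2_eq_square algebra_simps)
  have 1: "1 + y * (a + b)\<^sup>2 \<le> 2 * ((1 + y * a\<^sup>2) * (1 + y * b\<^sup>2))"
  proof -
    have "1 + y * (a + b)\<^sup>2 \<le> 2 + 2 * (y * a\<^sup>2) + 2 * (y * b\<^sup>2)"
      using mult_left_mono[OF ab assms(1)] by (simp add: algebra_simps)
    also have "\<dots> \<le> 2 * ((1 + y * a\<^sup>2) * (1 + y * b\<^sup>2))"
      using assms(1) by (simp add: algebra_simps)
    finally show ?thesis .
  qed
  have 2: "exp (z * \<bar>a + b\<bar>) \<le> exp (z * \<bar>a\<bar>) * exp (z * \<bar>b\<bar>)"
    using mult_left_mono[OF abs_triangle_ineq[of a b] assms(2)] by (simp add: distrib_left flip: exp_add)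
  show ?thesis
    using mult_mono[OF 1 2] assms(1) by (simp add: mult_ac)
qed

lemma profile_decay_profile:
  assumes "0 \<le> y" "0 \<le> z"
  shows "profile (decay_profile y z)"
proof -
  define W where "W n = (1 + y * (of_int n)\<^sup>2) * exp (z * \<bar>of_int n\<bar>)" for n :: int
  define g where "g n = 1 / (1 + (of_int n)\<^sup>2 :: real)" for n :: int
  define c where "c = 1 / (8 * quad_sum)"
  have c: "0 < c" "c \<le> 1" "8 * c * quad_sum = 1" using quad_sum_ge_1 by (auto simp: c_def field_simps)
  have W1: "1 \<le> W n" for n
    unfolding W_def using assms mult_mono[of 1 "1 + y * (of_int n)\<^sup>2" 1 "exp (z * \<bar>of_int n\<bar>)"] by simp
  have g0: "0 < g n" "g n \<le> 1" for n by (simp_all add: g_def add_pos_nonneg)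
  have wg: "wt 1 n * g n = 1" for n by (simp add: wt_def g_def add_pos_nonneg add_nonneg_eq_0_iff)
  have eq: "decay_profile y z n = c * (g n / W n)" for n
    by (simp add: decay_profile_def c_def g_def W_def)
  have gs: "g summable_on UNIV" and gi: "infsum g UNIV = quad_sum"
    using summable_inverse_quadratic unfolding g_def[abs_def] quad_sum_def by simp_all
  have gs': "(\<lambda>m. g (n - m)) summable_on UNIV" for n
    using summable_on_reindex_bij_betw[of "\<lambda>m. n - m" UNIV UNIV g] gs
    by (simp add: bij_betw_byWitness[where f'="\<lambda>m. n - m"])
  have gi': "(\<Sum>\<^sub>\<infinity>m. g (n - m)) = quad_sum" for n
    unfolding gi[symmetric] by (rule infsum_reindex_bij_witness[of _ "\<lambda>m. n - m" "\<lambda>m. n - m"]) auto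
  have le_g: "decay_profile y z n \<le> c * g n" for n
    unfolding eq using c g0[of n] W1[of n] by (intro mult_left_mono) (auto simp: field_simps)
  have pos: "0 < decay_profile y z n" for n
    unfolding eq using c g0[of n] W1[of n] by auto
  have s: "decay_profile y z summable_on UNIV"
    by (rule summable_on_comparison_test[OF summable_on_cmult_right[OF gs]]) (use le_g pos in \<open>auto intro: less_imp_le\<close>)
  have i: "infsum (decay_profile y z) UNIV \<le> 1"
  proof -
    have "infsum (decay_profile y z) UNIV \<le> (\<Sum>\<^sub>\<infinity>n. c * g n)"
      by (rule infsum_mono[OF s summable_on_cmult_right[OF gs]]) (rule le_g)
    also have "\<dots> = c * quad_sum" by (simp add: infsum_cmult_right' gi)
    finally show ?thesis using c quad_sum_ge_1 by linarith
  qed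
  have WW: "1 / (W m * W (n - m)) \<le> 2 / W n" for m n
  proof -
    have "W n \<le> 2 * (W m * W (n - m))"
      using decay_weight_submult[OF assms, of "of_int m" "of_int (n - m)"] by (simp add: W_def)
    moreover have "0 < W n" "0 < W m" "0 < W (n - m)" using W1 less_le_trans zero_less_one by metis+
    ultimately show ?thesis by (simp add: field_simps)
  qed
  \<comment> \<open>For \<open>e = 1\<close> the products \<open>wt * g\<close> are 1 and nothing
    remains to be shown. For \<open>e = 0\<close> this is
    \<open>1 + n^2 \<le> 2 (1 + m^2) + 2 (1 + (n - m)^2)\<close> divided by all three
    factors.\<close>
  have GG: "g m * (wt e (n - m) * g (n - m)) \<le> wt e n * g n * (2 * g m + 2 * g (n - m))" if "e \<le> 1" for e m n
  proof (cases "e = 1")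
    case True
    then show ?thesis using wg[of "n-m"] wg[of n] g0[of m] g0[of "n-m"] by (simp del: One_nat_def)
  next
    case False
    then have e: "e = 0" using that by simp
    have "1 + (of_int n)\<^sup>2 \<le> 2 * (1 + (of_int m)\<^sup>2) + 2 * (1 + (of_int (n - m))\<^sup>2 :: real)"
      using sum_squares_ge_zero[of "of_int m - of_int (n - m) :: real" 0]
      by (simp add: power2_eq_square algebra_simps)
    then have "g m * g (n - m) * (1 + (of_int n)\<^sup>2) \<le> g m * g (n - m) * (2 * (1 + (of_int m)\<^sup>2) + 2 * (1 + (of_int (n - m))\<^sup>2))"
      using g0[of m] g0[of "n-m"] by (intro mult_left_mono) auto
    also have "\<dots> = 2 * g m + 2 * g (n - m)"
    proof -
      have "g m * (1 + (of_int m)\<^sup>2) = 1" "g (n - m) * (1 + (of_int (n - m))\<^sup>2) = 1"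
        using wg[of m] wg[of "n-m"] by (simp_all add: wt_def mult.commute)
      then show ?thesis by algebra
    qed
    finally have "g m * g (n - m) * (1 + (of_int n)\<^sup>2) * g n \<le> (2 * g m + 2 * g (n - m)) * g n"
      using g0[of n] by (intro mult_right_mono) auto
    moreover have "(1 + (of_int n)\<^sup>2) * g n = 1" using wg[of n] by (simp add: wt_def)
    ultimately have "g m * g (n - m) \<le> (2 * g m + 2 * g (n - m)) * g n" by (simp only: mult.assoc mult_1_right)
    then show ?thesis using e by (simp add: mult.commute)
  qed
  have conv: "wt e n * decay_profile y z n \<le> 1 \<and>
      (\<Sum>\<^sub>\<infinity>m. decay_profile y z m * (wt e (n - m) * decay_profile y z (n - m))) \<le> wt e n * decay_profile y z n"
    if e: "e \<le> 1" for e n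
  proof
    have "wt e n \<le> wt 1 n" using e by (cases "e = 0") (auto simp: le_Suc_eq wt_ge_1)
    then have "wt e n * decay_profile y z n \<le> wt 1 n * (c * g n)"
      by (rule mult_mono[OF _ le_g]) (use pos[of n] wt_ge_1[of 1 n] in linarith)+
    also have "\<dots> = c" using wg[of n] by (simp add: algebra_simps)
    finally show "wt e n * decay_profile y z n \<le> 1" using c by simp
    define B where "B m = c\<^sup>2 * (2 / W n) * (wt e n * g n) * (2 * g m + 2 * g (n - m))" for m
    have B: "decay_profile y z m * (wt e (n - m) * decay_profile y z (n - m)) \<le> B m" for m
    proof -
      have "decay_profile y z m * (wt e (n - m) * decay_profile y z (n - m)) = c\<^sup>2 * (1 / (W m * W (n - m)) * (g m * (wt e (n - m) * g (n - m))))"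
        by (simp add: eq power2_eq_square)
      also have "\<dots> \<le> c\<^sup>2 * ((2 / W n) * (wt e n * g n * (2 * g m + 2 * g (n - m))))"
      proof -
        have "0 \<le> 2 / W n" using W1[of n] by simp
        moreover have "0 \<le> g m * (wt e (n - m) * g (n - m))"
          using g0(1)[of m] g0(1)[of "n-m"] wt_ge_1[of e "n-m"] by simp
        ultimately show ?thesis by (intro mult_left_mono mult_mono GG[OF e] WW) auto
      qed
      finally show ?thesis by (simp only: B_def mult.assoc)
    qed
    have Bs: "(B has_sum c\<^sup>2 * (2 / W n) * (wt e n * g n) * (2 * quad_sum + 2 * quad_sum)) UNIV"
      unfolding B_def
    proof (intro has_sum_cmult_right has_sum_add)
      show "(g has_sum quad_sum) UNIV" using gs gi by (simp add: has_sum_iff)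
      show "((\<lambda>m. g (n - m)) has_sum quad_sum) UNIV" using gs' gi' by (simp only: has_sum_iff simp_thms)
    qed
    have "(\<Sum>\<^sub>\<infinity>m. decay_profile y z m * (wt e (n - m) * decay_profile y z (n - m))) \<le> infsum B UNIV"
    proof (rule infsum_mono)
      show "B summable_on UNIV" using Bs by (simp add: has_sum_iff)
      then show "(\<lambda>m. decay_profile y z m * (wt e (n - m) * decay_profile y z (n - m))) summable_on UNIV"
      proof (rule summable_on_comparison_test)
        fix m
        show "0 \<le> decay_profile y z m * (wt e (n - m) * decay_profile y z (n - m))"
          using pos[of m] pos[of "n-m"] wt_ge_1[of e "n-m"] by simp
      qed (rule B)
    qed (rule B)
    also have "\<dots> = c\<^sup>2 * (2 / W n) * (wt e n * g n) * (2 * quad_sum + 2 * quad_sum)"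
      using Bs by (simp add: has_sum_iff)
    also have "\<dots> = (8 * c * quad_sum) * (wt e n * (c * (g n / W n)))" by (simp add: power2_eq_square)
    finally show "(\<Sum>\<^sub>\<infinity>m. decay_profile y z m * (wt e (n - m) * decay_profile y z (n - m))) \<le> wt e n * decay_profile y z n"
      using c(3) eq by simp
  qed
  show ?thesis unfolding profile_def using pos s i conv by blast
qed

lemma decay_profile_antimono:
  assumes "0 \<le> y" "0 \<le> z" "y \<le> y'" "z \<le> z'"
  shows "decay_profile y' z' n \<le> decay_profile y z n"
proof -
  have q: "0 < 8 * quad_sum" using quad_sum_ge_1 by simp
  have W: "(1 + y * (of_int n)\<^sup>2) * exp (z * \<bar>of_int n\<bar>) \<le> (1 + y' * (of_int n)\<^sup>2) * exp (z' * \<bar>of_int n\<bar>)"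
    using assms by (intro mult_mono) (auto intro!: mult_right_mono)
  have p: "0 < (1 + y * (of_int n)\<^sup>2) * exp (z * \<bar>of_int n\<bar>)"
    using assms by (intro mult_pos_pos) (auto intro: add_pos_nonneg)
  show ?thesis
    unfolding decay_profile_def using W q less_le_trans[OF p W] p
    by (intro divide_left_mono mult_left_mono mult_pos_pos[OF _ mult_pos_pos[OF _ p]] mult_pos_pos) (auto simp: add_pos_nonneg zero_less_mult_iff)
qed

text \<open>The weights improve linearly in time up to time 1: a gain of analyticity radius together with a
  gain of two derivatives that is needed for integrability of second derivatives at time 0.\<close>

definition time_profile :: "real \<Rightarrow> real \<Rightarrow> int \<Rightarrow> real" where
  "time_profile s0 t = decay_profile (min t 1 / 4) (s0 + min t 1 / 4)"

lemma profile_time_profile: "0 \<le> s0 \<Longrightarrow> 0 \<le> t \<Longrightarrow> profile (time_profile s0 t)"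
  unfolding time_profile_def by (rule profile_decay_profile) auto

lemma time_profile_le: "0 \<le> s0 \<Longrightarrow> 0 \<le> t \<Longrightarrow> time_profile s0 t n \<le> time_profile 0 0 n"
  unfolding time_profile_def by (rule decay_profile_antimono) auto

text \<open>Each of the two improvements is paid for by \<open>exp (d n^2)\<close> with
  \<open>d = (min t 1 - min s 1) / 4\<close>: the algebraic one because
  \<open>1 + d n^2 \<le> exp (d n^2)\<close>, the exponential one because
  \<open>\<bar>n\<bar> \<le> n^2\<close> for integers. Together they give the rate 1/2, small enough
  to be absorbed by the linear decay.\<close>

lemma time_profile_growth:
  assumes "0 \<le> s0" "0 \<le> s" "s \<le> t"
  shows "time_profile s0 s n \<le> time_profile s0 t n * exp ((min t 1 - min s 1) / 2 * (of_int n)\<^sup>2)"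
proof -
  define a b d N where "a = min s 1 / 4" and "b = min t 1 / 4" and "d = b - a" and "N = \<bar>real_of_int n\<bar>"
  have d: "0 \<le> a" "0 \<le> d" using assms by (auto simp: a_def b_def d_def)
  have N: "0 \<le> N" "N \<le> N\<^sup>2"
  proof -
    have "\<bar>n\<bar> \<le> n\<^sup>2" using mult_left_mono[of 1 "\<bar>n\<bar>" "\<bar>n\<bar>"] by (cases "n = 0") (auto simp: power2_eq_square)
    then show "N \<le> N\<^sup>2" unfolding N_def by (metis of_int_abs of_int_le_iff of_int_power power2_abs)
  qed (simp add: N_def)
  have "(1 + b * N\<^sup>2) * exp ((s0 + b) * N) \<le> ((1 + a * N\<^sup>2) * exp (d * N\<^sup>2)) * (exp ((s0 + a) * N) * exp (d * N\<^sup>2))"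
  proof (rule mult_mono)
    have "1 + b * N\<^sup>2 \<le> (1 + a * N\<^sup>2) * (1 + d * N\<^sup>2)"
      using mult_nonneg_nonneg[OF mult_nonneg_nonneg[OF d] zero_le_power[OF zero_le_power2[of N], of 2]]
      by (simp add: d_def algebra_simps power2_eq_square)
    also have "\<dots> \<le> (1 + a * N\<^sup>2) * exp (d * N\<^sup>2)" using d by (intro mult_left_mono exp_ge_add_one_self) auto
    finally show "1 + b * N\<^sup>2 \<le> (1 + a * N\<^sup>2) * exp (d * N\<^sup>2)" .
    have "(s0 + b) * N \<le> (s0 + a) * N + d * N\<^sup>2"
      using mult_left_mono[OF N(2) d(2)] by (simp add: d_def algebra_simps)
    then show "exp ((s0 + b) * N) \<le> exp ((s0 + a) * N) * exp (d * N\<^sup>2)" by (simp flip: exp_add)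
  qed (use d in auto)
  also have "\<dots> = ((1 + a * N\<^sup>2) * exp ((s0 + a) * N)) * exp ((min t 1 - min s 1) / 2 * N\<^sup>2)"
  proof -
    have "exp (d * N\<^sup>2) * exp (d * N\<^sup>2) = exp ((min t 1 - min s 1) / 2 * N\<^sup>2)"
      by (simp add: d_def a_def b_def field_simps flip: exp_add)
    then show ?thesis by (metis mult.assoc mult.left_commute)
  qed
  finally have *: "(1 + b * N\<^sup>2) * exp ((s0 + b) * N) \<le> ((1 + a * N\<^sup>2) * exp ((s0 + a) * N)) * exp ((min t 1 - min s 1) / 2 * N\<^sup>2)" .
  have pos: "0 < (1 + b * N\<^sup>2) * exp ((s0 + b) * N)" "0 < (1 + a * N\<^sup>2) * exp ((s0 + a) * N)" "0 < 1 / (8 * quad_sum)" "0 < 1 + N\<^sup>2"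
    using d quad_sum_ge_1 by (auto simp: d_def intro!: mult_pos_pos add_pos_nonneg)
  have "1 / ((1 + a * N\<^sup>2) * exp ((s0 + a) * N)) \<le> exp ((min t 1 - min s 1) / 2 * N\<^sup>2) / ((1 + b * N\<^sup>2) * exp ((s0 + b) * N))"
    using * pos(1,2) by (simp add: field_simps)
  then have "1 / (8 * quad_sum) / (1 + N\<^sup>2) * (1 / ((1 + a * N\<^sup>2) * exp ((s0 + a) * N))) \<le>
      1 / (8 * quad_sum) / (1 + N\<^sup>2) * (exp ((min t 1 - min s 1) / 2 * N\<^sup>2) / ((1 + b * N\<^sup>2) * exp ((s0 + b) * N)))"
    using pos by (intro mult_left_mono) auto
  then show ?thesis
    unfolding time_profile_def decay_profile_def a_def[symmetric] b_def[symmetric]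
    by (simp only: N_def power2_abs times_divide_eq_right times_divide_eq_left divide_divide_eq_left
        mult_1_left mult_1_right mult.assoc)
qed

section \<open>Decay of the linear modes measured in the moving weights\<close>

locale flow =
  fixes p :: nat and lam :: real
  assumes p: "1 \<le> p" and lam: "sqrt ((real p + 2) / real p) < lam"
begin

definition rate :: "int \<Rightarrow> real" where
  "rate n = lam\<^sup>2 * (of_int n)\<^sup>2 - (real p + 1) / real p"

abbreviation mu :: real where "mu \<equiv> rate 1"

lemma lam_pos: "0 < lam"
  using lam by (smt (verit) divide_nonneg_nonneg of_nat_0_le_iff real_sqrt_ge_zero)

lemma lam2: "(real p + 2) / real p < lam\<^sup>2"
  using lam lam_pos by (metis less_eq_real_def real_less_rsqrt real_sqrt_less_iff real_sqrt_unique)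

lemma lam2_gt_1: "1 < lam\<^sup>2"
proof -
  have "1 < (real p + 2) / real p" using p by (simp add: field_simps)
  then show ?thesis using lam2 by simp
qed

text \<open>Equivalent to the threshold on \<open>lam\<close>: the relative deviation decays at rate
  \<open>mu\<close>, the amplitude grows at rate \<open>1 / p\<close>, and the inequality says that
  their product still decays.\<close>

lemma mu_gt: "1 / real p < mu"
proof -
  have "(real p + 2) / real p = (real p + 1) / real p + 1 / real p" by (simp add: add_divide_distrib)
  then show ?thesis using lam2 by (simp add: rate_def)
qed

lemma mu_pos: "0 < mu"
  using mu_gt p by (smt (verit) divide_nonneg_nonneg of_nat_0_le_iff)

lemma of_int_square_ge_1: "n \<noteq> 0 \<Longrightarrow> 1 \<le> (of_int n :: real)\<^sup>2"
  by (metis of_int_1_le_iff of_int_power one_le_power int_one_le_iff_zero_less zero_less_power2)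

lemma rate_ge: "n \<noteq> 0 \<Longrightarrow> mu * (of_int n)\<^sup>2 \<le> rate n"
  using of_int_square_ge_1[of n] p mult_left_mono[of 1 "(of_int n)\<^sup>2" "(real p + 1) / real p"]
  by (simp add: rate_def algebra_simps)

text \<open>For \<open>\<bar>n\<bar> \<ge> 2\<close> one has
  \<open>rate n - mu = lam^2 (n^2 - 1) \<ge> 3/4 n^2\<close>: one half of \<open>n^2\<close> pays
  for the growth of the weights and one quarter is kept for the time integral. The modes 1 and -1
  have no decay to spare beyond \<open>mu\<close>, but there the weights grow by at most
  \<open>exp (1/2) \<le> 2\<close>.\<close>

lemma kernel_bound:
  assumes "n \<noteq> 0" "0 \<le> s0" "0 \<le> s" "s \<le> t"
  shows "exp (- rate n * (t - s)) * time_profile s0 s n \<le>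
     time_profile s0 t n * exp (- mu * (t - s)) * (if n\<^sup>2 = 1 then 2 else exp (- (of_int n)\<^sup>2 / 4 * (t - s)))"
proof -
  have tp: "0 < time_profile s0 t n" using profile_pos profile_time_profile assms by fastforce
  have "exp (- rate n * (t - s)) * time_profile s0 s n \<le>
      exp (- rate n * (t - s)) * (time_profile s0 t n * exp ((min t 1 - min s 1) / 2 * (of_int n)\<^sup>2))"
    using time_profile_growth[OF assms(2-4)] by (intro mult_left_mono) auto
  also have "\<dots> = time_profile s0 t n * exp (- rate n * (t - s) + (min t 1 - min s 1) / 2 * (of_int n)\<^sup>2)"
    by (simp only: exp_add mult_ac)
  also have "\<dots> \<le> time_profile s0 t n * (exp (- mu * (t - s)) * (if n\<^sup>2 = 1 then 2 else exp (- (of_int n)\<^sup>2 / 4 * (t - s))))"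
  proof (rule mult_left_mono)
    show "exp (- rate n * (t - s) + (min t 1 - min s 1) / 2 * (of_int n)\<^sup>2)
      \<le> exp (- mu * (t - s)) * (if n\<^sup>2 = 1 then 2 else exp (- (of_int n)\<^sup>2 / 4 * (t - s)))"
    proof (cases "n\<^sup>2 = 1")
      case True
      then have n: "(of_int n :: real)\<^sup>2 = 1" by (metis of_int_1 of_int_power)
      have "exp ((min t 1 - min s 1) / 2) \<le> exp (1/2 :: real)" using assms by auto
      also have "\<dots> \<le> 2" using exp_half_le2 by simp
      finally show ?thesis using True n by (simp add: exp_add rate_def)
    next
      case False
      then have "2 \<le> \<bar>n\<bar>" using assms(1) by (smt (verit) one_power2 power2_minus)
      then have "4 \<le> n\<^sup>2" using power_mono[of 2 "\<bar>n\<bar>" 2] by simp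
      then have n: "4 \<le> (of_int n :: real)\<^sup>2" by (metis of_int_le_iff of_int_numeral of_int_power)
      have "(min t 1 - min s 1) / 2 * (of_int n)\<^sup>2 \<le> (t - s) / 2 * (of_int n)\<^sup>2"
        using assms by (intro mult_right_mono) auto
      moreover have "(of_int n)\<^sup>2 / 2 + (of_int n)\<^sup>2 / 4 \<le> rate n - mu"
      proof -
        have "1 * ((of_int n)\<^sup>2 - 1) \<le> lam\<^sup>2 * ((of_int n)\<^sup>2 - 1)"
          using lam2_gt_1 n by (intro mult_right_mono) auto
        then show ?thesis using n by (simp add: rate_def algebra_simps)
      qed
      then have "((of_int n)\<^sup>2 / 2 + (of_int n)\<^sup>2 / 4) * (t - s) \<le> (rate n - mu) * (t - s)"
        using assms by (intro mult_right_mono) auto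
      moreover have "- R * D + M * N \<le> - m * D + - N / 4 * D"
        if "M * N \<le> D / 2 * N" "(N / 2 + N / 4) * D \<le> (R - m) * D" for R D M N m :: real
        using that by (simp add: algebra_simps)
      ultimately have "- rate n * (t - s) + (min t 1 - min s 1) / 2 * (of_int n)\<^sup>2 \<le> - mu * (t - s) + - (of_int n)\<^sup>2 / 4 * (t - s)"
        by blast
      then show ?thesis using False by (simp flip: exp_add)
    qed
  qed (use tp in simp)
  finally show ?thesis by (simp only: mult.assoc)
qed

lemma kernel_bound_initial:
  assumes "n \<noteq> 0" "0 \<le> s0" "0 \<le> t"
  shows "exp (- rate n * t) * time_profile s0 0 n \<le> 2 * exp (- mu * t) * time_profile s0 t n"
proof -
  have tp: "0 < time_profile s0 t n" using profile_pos profile_time_profile assms by fastforce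
  have "exp (- (of_int n)\<^sup>2 / 4 * t) \<le> 2" using assms(3) by (auto intro: order_trans[of _ 1])
  then have "(if n\<^sup>2 = 1 then 2 else exp (- (of_int n)\<^sup>2 / 4 * t)) \<le> 2" by simp
  then have "time_profile s0 t n * exp (- mu * t) * (if n\<^sup>2 = 1 then 2 else exp (- (of_int n)\<^sup>2 / 4 * t)) \<le>
      time_profile s0 t n * exp (- mu * t) * 2"
    using tp by (intro mult_left_mono) auto
  with kernel_bound[OF assms(1,2) order_refl assms(3)]
  show ?thesis unfolding diff_zero by (simp only: mult_ac)
qed

text \<open>A quadratic term decays like \<open>exp (- 2 mu s)\<close>; one of the two factors
  completes the kernel decay to \<open>exp (- mu t)\<close>. The remaining
  \<open>exp (- mu s)\<close> is integrable in time and settles the modes 1 and -1. The other modes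
  pay for the two lost derivatives with \<open>n^2 exp (- n^2 (t - s) / 4)\<close>.\<close>

lemma kernel_bound_nonlin:
  assumes "n \<noteq> 0" "0 \<le> s0" "0 \<le> s" "s \<le> t"
  shows "exp (- rate n * (t - s)) * (exp (- 2 * mu * s) * (wt 1 n * time_profile s0 s n)) \<le>
     2 * exp (- mu * t) * time_profile s0 t n *
       (2 * exp (- mu * s) + 2 * (of_int n)\<^sup>2 * exp (- (of_int n)\<^sup>2 / 4 * (t - s)))"
proof -
  define N where "N = (of_int n :: real)\<^sup>2"
  have N: "1 \<le> N" using of_int_square_ge_1[OF assms(1)] by (simp add: N_def)
  have wt: "wt 1 n = 1 + N" by (simp add: wt_def N_def)
  have tp: "0 < time_profile s0 t n" using profile_pos profile_time_profile assms by fastforce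
  have "exp (- rate n * (t - s)) * (exp (- 2 * mu * s) * (wt 1 n * time_profile s0 s n)) =
     exp (- 2 * mu * s) * (1 + N) * (exp (- rate n * (t - s)) * time_profile s0 s n)"
    by (simp only: wt mult_ac)
  also have "\<dots> \<le> exp (- 2 * mu * s) * (1 + N) * (time_profile s0 t n * exp (- mu * (t - s)) * (if n\<^sup>2 = 1 then 2 else exp (- N / 4 * (t - s))))"
    unfolding N_def by (intro mult_left_mono kernel_bound assms) auto
  also have "\<dots> = exp (- mu * t) * time_profile s0 t n * (exp (- mu * s) * (1 + N) * (if n\<^sup>2 = 1 then 2 else exp (- N / 4 * (t - s))))"
  proof -
    have "exp (- 2 * mu * s) * exp (- mu * (t - s)) = exp (- mu * t) * exp (- mu * s)"
      by (simp add: algebra_simps flip: exp_add)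
    moreover have "a * n * (w * b * x) = a * b * (w * (n * x))" "c * w * (d * n * x) = c * d * (w * (n * x))" for a b c d n w x :: real
      by simp_all
    ultimately show ?thesis by simp
  qed
  also have "\<dots> \<le> exp (- mu * t) * time_profile s0 t n * (2 * (2 * exp (- mu * s) + 2 * N * exp (- N / 4 * (t - s))))"
  proof (rule mult_left_mono)
    show "exp (- mu * s) * (1 + N) * (if n\<^sup>2 = 1 then 2 else exp (- N / 4 * (t - s))) \<le> 2 * (2 * exp (- mu * s) + 2 * N * exp (- N / 4 * (t - s)))"
    proof (cases "n\<^sup>2 = 1")
      case True
      then have "N = 1" unfolding N_def by (metis of_int_1 of_int_power)
      then show ?thesis using True by simp
    next
      case False
      have "exp (- mu * s) * (1 + N) \<le> 1 * (2 * N)" using N mu_pos assms(3) by (intro mult_mono) auto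
      from mult_right_mono[OF this, of "exp (- N / 4 * (t - s))"]
      have "exp (- mu * s) * (1 + N) * exp (- N / 4 * (t - s)) \<le> 2 * (N * exp (- N / 4 * (t - s)))" by simp
      moreover have "0 \<le> N * exp (- N / 4 * (t - s))" "0 \<le> exp (- mu * s)" using N by simp_all
      moreover have "a \<le> 2 * (2 * c + 2 * m * b)" if "a \<le> 2 * (m * b)" "0 \<le> m * b" "0 \<le> c" for a b c m :: real
        using that by simp
      ultimately show ?thesis unfolding if_not_P[OF False] by blast
    qed
  qed (use tp in simp)
  finally show ?thesis by (simp only: N_def mult_ac)
qed

text \<open>The bound is uniform in \<open>n\<close> and \<open>t\<close>: maximal regularity mode
  by mode. This returns the two lost derivatives completely, and \<open>2 / mu + 8\<close> is the
  constant that determines \<open>rad\<close>.\<close>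

lemma kernel_integral:
  assumes "n \<noteq> 0" "0 \<le> t"
  shows "(\<lambda>s. 2 * exp (- mu * s) + 2 * (of_int n)\<^sup>2 * exp (- (of_int n)\<^sup>2 / 4 * (t - s))) integrable_on {0..t}"
    "integral {0..t} (\<lambda>s. 2 * exp (- mu * s) + 2 * (of_int n)\<^sup>2 * exp (- (of_int n)\<^sup>2 / 4 * (t - s))) \<le> 2 / mu + 8"
proof -
  define N where "N = (of_int n :: real)\<^sup>2"
  have N: "1 \<le> N" using of_int_square_ge_1[OF assms(1)] by (simp add: N_def)
  define G where "G s = - (2 / mu) * exp (- mu * s) + 8 * exp (- N / 4 * (t - s))" for s
  have "((\<lambda>s. 2 * exp (- mu * s) + 2 * N * exp (- N / 4 * (t - s))) has_integral (G t - G 0)) {0..t}"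
  proof (rule fundamental_theorem_of_calculus[OF assms(2)])
    show "(G has_vector_derivative 2 * exp (- mu * s) + 2 * N * exp (- N / 4 * (t - s))) (at s within {0..t})" for s
      unfolding G_def has_real_derivative_iff_has_vector_derivative[symmetric]
      using mu_pos by (auto intro!: derivative_eq_intros simp: field_simps)
  qed
  moreover have "G t - G 0 \<le> 2 / mu + 8"
    using mu_pos N assms(2) by (simp add: G_def) (smt (verit) divide_nonneg_nonneg exp_gt_zero mult_nonneg_nonneg)
  ultimately show "(\<lambda>s. 2 * exp (- mu * s) + 2 * (of_int n)\<^sup>2 * exp (- (of_int n)\<^sup>2 / 4 * (t - s))) integrable_on {0..t}"
    "integral {0..t} (\<lambda>s. 2 * exp (- mu * s) + 2 * (of_int n)\<^sup>2 * exp (- (of_int n)\<^sup>2 / 4 * (t - s))) \<le> 2 / mu + 8"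
    unfolding N_def by (auto simp: has_integral_iff)
qed

end

section \<open>Global solution of the coefficient equations\<close>

lemma order_lipschitz_mono:
  assumes "order_lipschitz C e q F" "C \<le> C'"
  shows "order_lipschitz C' e q F"
  unfolding order_lipschitz_def
proof (intro allI impI)
  fix w r D v v'
  assume *: "profile w" "0 \<le> r" "r \<le> 1" "0 \<le> (D::real)" "dominated r 0 w v" "dominated r 0 w v'" "dominated D 0 w (\<lambda>n. v n - v' n)"
  have "C * r ^ q * D \<le> C' * r ^ q * D" using * assms(2) by (intro mult_right_mono) auto
  then show "dominated (C' * r ^ q * D) e w (\<lambda>n. F v n - F v' n)"
    using assms(1) * dominated_mono unfolding order_lipschitz_def by blast
qed

lemma geometric_limit:
  fixes x :: "nat \<Rightarrow> 'a::banach"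
  assumes "\<And>j. norm (x (Suc j) - x j) \<le> c / 2 ^ j"
  shows "x \<longlonglongrightarrow> lim x" "norm (lim x - x j) \<le> 2 * c / 2 ^ j"
proof -
  have s: "(\<lambda>i. c / 2 ^ (i + j)) sums (2 * c / 2 ^ j)" for j
  proof -
    have "(\<lambda>i. (1/2) ^ i) sums (1 / (1 - 1/2 :: real))" by (rule geometric_sums) simp
    from sums_mult[OF this, of "c / 2 ^ j"] show ?thesis by (simp add: power_add power_divide mult_ac)
  qed
  have sn: "summable (\<lambda>i. norm (x (Suc (i + j)) - x (i + j)))" for j
    using s[of j] assms by (intro summable_comparison_test[OF _ sums_summable[OF s[of j]]]) auto
  have "convergent x"
    using summable_norm_cancel[OF sn[of 0]]
    by (simp add: summable_iff_convergent sum_lessThan_telescope convergent_diff_const_right_iff)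
  then show lim: "x \<longlonglongrightarrow> lim x" by (simp add: convergent_LIMSEQ_iff)
  have "(\<lambda>i. x (Suc i + j) - x (i + j)) sums (lim x - x (0 + j))"
    by (rule telescope_sums[OF LIMSEQ_ignore_initial_segment[OF lim, of j]])
  then have "lim x - x j = (\<Sum>i. x (Suc (i + j)) - x (i + j))" by (simp add: sums_iff)
  also have "norm \<dots> \<le> (\<Sum>i. norm (x (Suc (i + j)) - x (i + j)))" by (rule summable_norm[OF sn])
  also have "\<dots> \<le> (\<Sum>i. c / 2 ^ (i + j))"
    using s assms by (intro suminf_le sn) (auto simp: sums_iff)
  finally show "norm (lim x - x j) \<le> 2 * c / 2 ^ j" using s[of j] by (simp add: sums_iff)
qed

context flow
begin

text \<open>One Lipschitz constant for both maps, fixed by choice so that \<open>rad\<close>, and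
  with it the constant of the theorem, is a function of \<open>p\<close> and \<open>lam\<close>
  alone.\<close>

definition lip :: real where
  "lip = (SOME C. 0 \<le> C \<and> order_lipschitz C 1 1 (nonlin p lam) \<and> order_lipschitz C 1 1 (quad_part p lam))"

lemma lip: "0 \<le> lip" "order_lipschitz lip 1 1 (nonlin p lam)" "order_lipschitz lip 1 1 (quad_part p lam)"
proof -
  obtain C where C: "0 \<le> C" "order_lipschitz C 1 1 (nonlin p lam)" using tame_nonlin[of p lam] by (auto simp: tame_def)
  obtain C' where C': "0 \<le> C'" "order_lipschitz C' 1 1 (quad_part p lam)" using tame_quad_part[of p lam] by (auto simp: tame_def)
  have "\<exists>C. 0 \<le> C \<and> order_lipschitz C 1 1 (nonlin p lam) \<and> order_lipschitz C 1 1 (quad_part p lam)"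
    using C C' order_lipschitz_mono[of C 1 1 _ "C + C'"] order_lipschitz_mono[of C' 1 1 _ "C + C'"]
    by (intro exI[of _ "C + C'"]) auto
  from someI_ex[OF this] show "0 \<le> lip" "order_lipschitz lip 1 1 (nonlin p lam)" "order_lipschitz lip 1 1 (quad_part p lam)"
    unfolding lip_def by auto
qed

lemma quadratic_bounds:
  assumes "profile w" "0 \<le> r" "r \<le> 1" "dominated r 0 w v"
  shows "cmod (nonlin p lam v n) \<le> lip * r\<^sup>2 * (wt 1 n * w n)"
    "cmod (quad_part p lam v n) \<le> lip * r\<^sup>2 * (wt 1 n * w n)"
proof -
  have z: "nonlin p lam (\<lambda>_. 0) = (\<lambda>_. 0)" "quad_part p lam (\<lambda>_. 0) = (\<lambda>_. 0)"
    using tame_nonlin tame_quad_part by (auto simp: tame_def)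
  have "dominated r 0 w (\<lambda>n. v n - 0)" using assms by simp
  then have "dominated (lip * r ^ 1 * r) 1 w (\<lambda>n. nonlin p lam v n - nonlin p lam (\<lambda>_. 0) n)"
     "dominated (lip * r ^ 1 * r) 1 w (\<lambda>n. quad_part p lam v n - quad_part p lam (\<lambda>_. 0) n)"
    using lip(2,3) assms dominated_zero[OF assms(2,1)] unfolding order_lipschitz_def by blast+
  then show "cmod (nonlin p lam v n) \<le> lip * r\<^sup>2 * (wt 1 n * w n)"
    "cmod (quad_part p lam v n) \<le> lip * r\<^sup>2 * (wt 1 n * w n)"
    unfolding z dominated_def by (auto simp: power2_eq_square mult_ac)
qed

text \<open>The radius of the ball on which the Duhamel map is a contraction.\<close>

definition rad :: real where
  "rad = 1 / (2 + 4 * lip * (2 / mu + 8))"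

lemma rad: "0 < rad" "rad \<le> 1 / 2" "2 * lip * (2 / mu + 8) * rad \<le> 1 / 2"
proof -
  define K where "K = 4 * lip * (2 / mu + 8)"
  have K: "0 \<le> K" using lip(1) mu_pos by (simp add: K_def)
  have r: "rad = 1 / (2 + K)" by (simp add: rad_def K_def)
  show "0 < rad" "rad \<le> 1 / 2" using K by (simp_all add: r field_simps)
  have "2 * lip * (2 / mu + 8) = K / 2" by (simp add: K_def)
  then show "2 * lip * (2 / mu + 8) * rad \<le> 1 / 2" using K by (simp add: r field_simps)
qed

text \<open>The linear evolution costs a factor 2 in \<open>kernel_bound_initial\<close>, so
  \<open>rad / 4\<close> uses half of the ball of radius \<open>rad\<close> and leaves the other
  half to the nonlinear term. Frequency 0 is left free because deviations have mean zero and
  \<open>duhamel\<close> puts 0 there. The number \<open>s0\<close> is an initial radius of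
  analyticity, 0 for general data.\<close>

definition admissible :: "real \<Rightarrow> (int \<Rightarrow> complex) \<Rightarrow> bool" where
  "admissible s0 phi \<longleftrightarrow> 0 \<le> s0 \<and> hermitian phi \<and> (\<forall>n. n \<noteq> 0 \<longrightarrow> cmod (phi n) \<le> rad / 4 * time_profile s0 0 n)"

section \<open>The Duhamel map: invariance of a ball and contraction\<close>

definition duhamel :: "(int \<Rightarrow> complex) \<Rightarrow> (real \<Rightarrow> int \<Rightarrow> complex) \<Rightarrow> real \<Rightarrow> int \<Rightarrow> complex" where
  "duhamel phi f t n = (if n = 0 then 0
     else exp (- rate n * t) *\<^sub>R phi n + integral {0..t} (\<lambda>s. exp (- rate n * (t - s)) *\<^sub>R f s n))"

lemma duhamel_has_vector_derivative:
  assumes "continuous_on {0..} (\<lambda>s. f s n)" "0 \<le> t" "n \<noteq> 0"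
  shows "((\<lambda>t. duhamel phi f t n) has_vector_derivative (- rate n *\<^sub>R duhamel phi f t n + f t n)) (at t within {0..})"
proof -
  define r where "r = rate n"
  define J where "J t = integral {0..t} (\<lambda>s. exp (r * s) *\<^sub>R f s n)" for t
  \<comment> \<open>Pulling out \<open>exp (- r * t)\<close> leaves an integrand without
    \<open>t\<close>, so the fundamental theorem applies to \<open>J\<close>.\<close>
  have eq: "duhamel phi f t n = exp (- r * t) *\<^sub>R (phi n + J t)" if "0 \<le> t" for t
  proof -
    have "integral {0..t} (\<lambda>s. exp (- r * (t - s)) *\<^sub>R f s n) = integral {0..t} (\<lambda>s. exp (- r * t) *\<^sub>R (exp (r * s) *\<^sub>R f s n))"
      by (intro integral_cong) (simp add: algebra_simps flip: exp_add)
    also have "\<dots> = exp (- r * t) *\<^sub>R J t" unfolding J_def by (rule integral_cmul)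
    finally show ?thesis using assms(3) by (simp add: duhamel_def r_def scaleR_add_right)
  qed
  have c: "continuous_on {0..t + 1} (\<lambda>s. exp (r * s) *\<^sub>R f s n)"
    by (intro continuous_intros continuous_on_subset[OF assms(1)]) auto
  have "(J has_vector_derivative exp (r * t) *\<^sub>R f t n) (at t within {0..t + 1})"
    unfolding J_def by (rule integral_has_vector_derivative[OF c]) (use assms in auto)
  moreover have "at t within {0..t+1} = at t within {0..}"
    by (rule at_within_nhd[of _ "{..<t+1}"]) auto
  ultimately have J: "(J has_vector_derivative exp (r * t) *\<^sub>R f t n) (at t within {0..})" by simp
  have "((\<lambda>t. exp (- r * t)) has_real_derivative - r * exp (- r * t)) (at t within {0..})"
    by (auto intro!: derivative_eq_intros)
  then have "((\<lambda>t. exp (- r * t) *\<^sub>R (phi n + J t)) has_vector_derivative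
      exp (- r * t) *\<^sub>R (exp (r * t) *\<^sub>R f t n) + (- r * exp (- r * t)) *\<^sub>R (phi n + J t)) (at t within {0..})"
    by (intro has_vector_derivative_scaleR) (use has_vector_derivative_add[OF has_vector_derivative_const J] in auto)
  moreover have "exp (- r * t) *\<^sub>R (exp (r * t) *\<^sub>R f t n) + (- r * exp (- r * t)) *\<^sub>R (phi n + J t) = - rate n *\<^sub>R duhamel phi f t n + f t n"
    by (simp add: eq[OF assms(2)] r_def[symmetric] mult_exp_exp)
  ultimately show ?thesis
    using eq assms(2) by (auto intro: has_vector_derivative_transform)
qed

lemma duhamel_continuous:
  assumes "\<And>n. continuous_on {0..} (\<lambda>s. f s n)"
  shows "continuous_on {0..} (\<lambda>t. duhamel phi f t n)"
proof (cases "n = 0")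
  case True
  then show ?thesis by (simp add: duhamel_def)
next
  case False
  show ?thesis
    unfolding continuous_on_eq_continuous_within
    using duhamel_has_vector_derivative[OF assms _ False] has_vector_derivative_continuous by fastforce
qed

lemma duhamel_hermitian:
  assumes "hermitian phi" "\<And>s. 0 \<le> s \<Longrightarrow> hermitian (f s)" "0 \<le> t" "\<And>n. continuous_on {0..} (\<lambda>s. f s n)"
  shows "hermitian (duhamel phi f t)"
  unfolding hermitian_def
proof
  fix n
  have r: "rate (- n) = rate n" by (simp add: rate_def)
  have int: "(\<lambda>s. exp (- rate n * (t - s)) *\<^sub>R f s n) integrable_on {0..t}"
    by (intro integrable_continuous_real continuous_intros continuous_on_subset[OF assms(4)]) auto
  have "integral {0..t} (\<lambda>s. exp (- rate n * (t - s)) *\<^sub>R f s (- n)) = integral {0..t} (cnj \<circ> (\<lambda>s. exp (- rate n * (t - s)) *\<^sub>R f s n))"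
    using assms(2) by (intro integral_cong) (auto simp: hermitian_def)
  also have "\<dots> = cnj (integral {0..t} (\<lambda>s. exp (- rate n * (t - s)) *\<^sub>R f s n))"
    by (rule integral_linear[OF int bounded_linear_cnj])
  finally show "duhamel phi f t (- n) = cnj (duhamel phi f t n)"
    using assms(1) r by (simp add: duhamel_def hermitian_def)
qed

lemma duhamel_integral_bound:
  assumes "continuous_on {0..} (\<lambda>s. f s n)" "0 \<le> t"
    "\<And>s. 0 \<le> s \<Longrightarrow> s \<le> t \<Longrightarrow> exp (- rate n * (t - s)) * cmod (f s n) \<le> h s" "h integrable_on {0..t}"
  shows "cmod (integral {0..t} (\<lambda>s. exp (- rate n * (t - s)) *\<^sub>R f s n)) \<le> integral {0..t} h"
proof (rule integral_norm_bound_integral)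
  show "(\<lambda>s. exp (- rate n * (t - s)) *\<^sub>R f s n) integrable_on {0..t}"
    by (intro integrable_continuous_real continuous_intros continuous_on_subset[OF assms(1)]) auto
qed (use assms in auto)

lemma time_profile_dominated:
  assumes "0 \<le> s0" "0 \<le> t" "dominated c 0 (time_profile s0 t) v" "c \<le> d"
  shows "dominated d 0 (time_profile 0 0) v"
proof -
  have P: "profile (time_profile s0 t)" using assms by (intro profile_time_profile) auto
  have "dominated c 0 (time_profile 0 0) v"
    using assms(3) mult_left_mono[OF time_profile_le[OF assms(1,2)] dominated_nonneg[OF assms(3) P]] unfolding dominated_def
    by (auto intro: order_trans)
  then show ?thesis by (rule dominated_mono[OF _ assms(4)]) (rule profile_time_profile; simp)
qed

definition decaying_path :: "real \<Rightarrow> (real \<Rightarrow> int \<Rightarrow> complex) \<Rightarrow> bool" where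
  "decaying_path s0 v \<longleftrightarrow> (\<forall>n. continuous_on {0..} (\<lambda>t. v t n)) \<and>
     (\<forall>t\<ge>0. hermitian (v t) \<and> v t 0 = 0 \<and> dominated (rad * exp (- mu * t)) 0 (time_profile s0 t) (v t))"

lemma decaying_path_static:
  assumes "decaying_path s0 v" "0 \<le> s0" "0 \<le> t"
  shows "dominated rad 0 (time_profile 0 0) (v t)"
proof (rule time_profile_dominated[OF assms(2,3)])
  show "dominated (rad * exp (- mu * t)) 0 (time_profile s0 t) (v t)" using assms by (simp add: decaying_path_def)
  show "rad * exp (- mu * t) \<le> rad" using rad(1) mu_pos assms(3) by (simp add: mult_left_le)
qed

lemma decaying_path_tame_continuous:
  assumes "decaying_path s0 v" "0 \<le> s0" "tame e q F"
  shows "continuous_on {0..} (\<lambda>s. F (v s) n)"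
proof (rule tame_continuous[OF assms(3), where w="time_profile 0 0"])
  show "profile (time_profile 0 0)" by (rule profile_time_profile) auto
  show "dominated 1 0 (time_profile 0 0) (v s)" if "s \<in> {0..}" for s
    by (rule dominated_mono[OF decaying_path_static[OF assms(1,2)] _ \<open>profile _\<close>]) (use that rad(2) in auto)
qed (use assms in \<open>auto simp: decaying_path_def\<close>)

text \<open>The data and the nonlinear integral contribute at most \<open>rad / 2\<close> each, in
  the weights at time \<open>t\<close>. For the integral this is \<open>kernel_bound_nonlin\<close>,
  \<open>kernel_integral\<close> and the third inequality on \<open>rad\<close>.\<close>

lemma decaying_path_duhamel:
  assumes "decaying_path s0 v" "admissible s0 phi"
  shows "decaying_path s0 (duhamel phi (\<lambda>s. nonlin p lam (v s)))"
  unfolding decaying_path_def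
proof (intro conjI allI impI)
  have s0: "0 \<le> s0" using assms by (simp add: admissible_def)
  note c = decaying_path_tame_continuous[OF assms(1) s0 tame_nonlin]
  show "continuous_on {0..} (\<lambda>t. duhamel phi (\<lambda>s. nonlin p lam (v s)) t n)" for n
    by (rule duhamel_continuous[OF c])
  fix t :: real assume t: "0 \<le> t"
  show "hermitian (duhamel phi (\<lambda>s. nonlin p lam (v s)) t)"
    using assms by (intro duhamel_hermitian c t tame_hermitian[OF tame_nonlin]) (auto simp: decaying_path_def admissible_def)
  show "duhamel phi (\<lambda>s. nonlin p lam (v s)) t 0 = 0" by (simp add: duhamel_def)
  show "dominated (rad * exp (- mu * t)) 0 (time_profile s0 t) (duhamel phi (\<lambda>s. nonlin p lam (v s)) t)"
    unfolding dominated_def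
  proof
    fix n
    have tp: "0 < time_profile s0 t n" using profile_pos profile_time_profile[OF s0 t] by blast
    show "cmod (duhamel phi (\<lambda>s. nonlin p lam (v s)) t n) \<le> rad * exp (- mu * t) * (wt 0 n * time_profile s0 t n)"
    proof (cases "n = 0")
      case True
      then show ?thesis using tp rad(1) by (simp add: duhamel_def)
    next
      case False
      define X where "X = exp (- mu * t) * time_profile s0 t n"
      have X: "0 < X" using tp by (simp add: X_def)
      have 1: "cmod (exp (- rate n * t) *\<^sub>R phi n) \<le> rad / 2 * X"
      proof -
        have "exp (- rate n * t) * cmod (phi n) \<le> exp (- rate n * t) * (rad / 4 * time_profile s0 0 n)"
          using assms(2) False by (intro mult_left_mono) (auto simp: admissible_def)
        also have "\<dots> = rad / 4 * (exp (- rate n * t) * time_profile s0 0 n)" by simp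
        also have "\<dots> \<le> rad / 4 * (2 * exp (- mu * t) * time_profile s0 t n)"
          using rad(1) by (intro mult_left_mono kernel_bound_initial False s0 t) auto
        finally show ?thesis by (simp add: X_def mult_ac)
      qed
      define K where "K s = 2 * exp (- mu * s) + 2 * (of_int n)\<^sup>2 * exp (- (of_int n)\<^sup>2 / 4 * (t - s))" for s
      have "cmod (integral {0..t} (\<lambda>s. exp (- rate n * (t - s)) *\<^sub>R nonlin p lam (v s) n)) \<le> integral {0..t} (\<lambda>s. (lip * rad\<^sup>2 * 2 * X) * K s)"
      proof (rule duhamel_integral_bound[OF c t])
        fix s :: real assume s: "0 \<le> s" "s \<le> t"
        have r: "0 \<le> rad * exp (- mu * s)" "rad * exp (- mu * s) \<le> 1"
          using rad mu_pos s(1) by (auto intro!: mult_le_one)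
        have "cmod (nonlin p lam (v s) n) \<le> lip * (rad * exp (- mu * s))\<^sup>2 * (wt 1 n * time_profile s0 s n)"
          using assms(1) s(1) by (intro quadratic_bounds(1)[OF profile_time_profile[OF s0 s(1)] r]) (simp add: decaying_path_def)
        then have "exp (- rate n * (t - s)) * cmod (nonlin p lam (v s) n) \<le>
            exp (- rate n * (t - s)) * (lip * (rad * exp (- mu * s))\<^sup>2 * (wt 1 n * time_profile s0 s n))"
          by (intro mult_left_mono) auto
        also have "(rad * exp (- mu * s))\<^sup>2 = rad\<^sup>2 * exp (- 2 * mu * s)"
          by (simp add: power_mult_distrib power2_eq_square mult_exp_exp)
        also have "exp (- rate n * (t - s)) * (lip * (rad\<^sup>2 * exp (- 2 * mu * s)) * (wt 1 n * time_profile s0 s n)) =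
            lip * rad\<^sup>2 * (exp (- rate n * (t - s)) * (exp (- 2 * mu * s) * (wt 1 n * time_profile s0 s n)))"
          by (simp only: mult_ac)
        also have "\<dots> \<le> lip * rad\<^sup>2 * (2 * exp (- mu * t) * time_profile s0 t n * K s)"
          unfolding K_def using lip(1) by (intro mult_left_mono kernel_bound_nonlin False s0 s) auto
        finally show "exp (- rate n * (t - s)) * cmod (nonlin p lam (v s) n) \<le> (lip * rad\<^sup>2 * 2 * X) * K s"
          by (simp only: X_def mult_ac)
      next
        show "(\<lambda>s. (lip * rad\<^sup>2 * 2 * X) * K s) integrable_on {0..t}"
          unfolding K_def by (rule integrable_on_mult_right[OF kernel_integral(1)[OF False t]])
      qed
      also have "\<dots> = (lip * rad\<^sup>2 * 2 * X) * integral {0..t} K" by simp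
      also have "\<dots> \<le> (lip * rad\<^sup>2 * 2 * X) * (2 / mu + 8)"
        unfolding K_def using lip(1) X by (intro mult_left_mono kernel_integral(2) False t) auto
      also have "\<dots> = (2 * lip * (2 / mu + 8) * rad) * (rad * X)" by (simp add: power2_eq_square)
      also have "\<dots> \<le> 1 / 2 * (rad * X)" using rad X by (intro mult_right_mono) auto
      finally have 2: "cmod (integral {0..t} (\<lambda>s. exp (- rate n * (t - s)) *\<^sub>R nonlin p lam (v s) n)) \<le> rad / 2 * X" by simp
      have "cmod (duhamel phi (\<lambda>s. nonlin p lam (v s)) t n) \<le> rad / 2 * X + rad / 2 * X"
        unfolding duhamel_def if_not_P[OF False] by (rule order_trans[OF norm_triangle_ineq add_mono[OF 1 2]])
      then show ?thesis by (simp add: X_def mult_ac)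
    qed
  qed
qed

text \<open>Distances are measured in the fixed weights \<open>time_profile 0 0\<close> and without
  decay in time. In these weights the two lost derivatives come back from the plain integral of the
  kernel, since \<open>wt 1 n / rate n \<le> 2 / mu\<close>. The stronger bounds of
  \<open>decaying_path\<close> need no contraction: they pass to limits of iterates mode by
  mode.\<close>

lemma duhamel_contraction:
  assumes "decaying_path s0 v" "decaying_path s0' v'" "0 \<le> s0" "0 \<le> s0'" "0 \<le> D" "0 \<le> t"
    "\<And>s n. 0 \<le> s \<Longrightarrow> cmod (v s n - v' s n) \<le> D * time_profile 0 0 n"
  shows "cmod (duhamel phi (\<lambda>s. nonlin p lam (v s)) t n - duhamel phi (\<lambda>s. nonlin p lam (v' s)) t n) \<le> D / 2 * time_profile 0 0 n"
proof (cases "n = 0")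
  case True
  then show ?thesis using assms(5) profile_pos[OF profile_time_profile, of 0 0 n] by (simp add: duhamel_def)
next
  case False
  define w where "w = time_profile 0 0"
  have w: "profile w" unfolding w_def by (rule profile_time_profile) auto
  have wn: "0 < w n" by (rule profile_pos[OF w])
  have r: "mu * (of_int n)\<^sup>2 \<le> rate n" by (rule rate_ge[OF False])
  have N: "1 \<le> (of_int n :: real)\<^sup>2" by (rule of_int_square_ge_1[OF False])
  have rp: "0 < rate n" using r N mu_pos by (smt (verit) mult_pos_pos)
  note c = decaying_path_tame_continuous[OF assms(1,3) tame_nonlin] decaying_path_tame_continuous[OF assms(2,4) tame_nonlin]
  define B where "B = lip * rad * D * (wt 1 n * w n)"
  have "cmod (integral {0..t} (\<lambda>s. exp (- rate n * (t - s)) *\<^sub>R (nonlin p lam (v s) n - nonlin p lam (v' s) n))) \<le> integral {0..t} (\<lambda>s. B * exp (- rate n * (t - s)))"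
  proof (rule duhamel_integral_bound)
    show "continuous_on {0..} (\<lambda>s. nonlin p lam (v s) n - nonlin p lam (v' s) n)" by (intro continuous_intros c)
    show "(\<lambda>s. B * exp (- rate n * (t - s))) integrable_on {0..t}"
      by (intro integrable_continuous_real continuous_intros)
    fix s assume s: "0 \<le> s" "s \<le> t"
    have "dominated (lip * rad ^ 1 * D) 1 w (\<lambda>n. nonlin p lam (v s) n - nonlin p lam (v' s) n)"
      using lip(2)[unfolded order_lipschitz_def, rule_format, OF w, of rad D "v s" "v' s"] rad assms(5,7) s
        decaying_path_static[OF assms(1,3) s(1)] decaying_path_static[OF assms(2,4) s(1)]
      unfolding w_def dominated_def by auto
    then have "cmod (nonlin p lam (v s) n - nonlin p lam (v' s) n) \<le> B"
      by (simp add: dominated_def B_def)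
    then show "exp (- rate n * (t - s)) * cmod (nonlin p lam (v s) n - nonlin p lam (v' s) n) \<le> B * exp (- rate n * (t - s))"
      by (simp add: mult.commute)
  qed (rule assms(6))
  also have "\<dots> = B * integral {0..t} (\<lambda>s. exp (- rate n * (t - s)))" by simp
  also have "integral {0..t} (\<lambda>s. exp (- rate n * (t - s))) = 1 / rate n * exp (- rate n * (t - t)) - 1 / rate n * exp (- rate n * (t - 0))"
  proof (rule integral_unique, rule fundamental_theorem_of_calculus[OF assms(6)])
    show "((\<lambda>s. 1 / rate n * exp (- rate n * (t - s))) has_vector_derivative exp (- rate n * (t - s))) (at s within {0..t})" for s
      unfolding has_real_derivative_iff_has_vector_derivative[symmetric]
      using rp by (auto intro!: derivative_eq_intros simp: field_simps)
  qed
  also have "B * (1 / rate n * exp (- rate n * (t - t)) - 1 / rate n * exp (- rate n * (t - 0))) \<le> B * (1 / rate n)"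
    using rp lip(1) rad(1) assms(5) wn wt_ge_1[of 1 n] by (intro mult_left_mono) (auto simp: B_def)
  also have "\<dots> = (lip * rad * D * w n) * (wt 1 n / rate n)" by (simp add: B_def)
  also have "\<dots> \<le> (lip * rad * D * w n) * (2 / mu)"
  proof (rule mult_left_mono)
    have "wt 1 n * mu \<le> 2 * (mu * (of_int n)\<^sup>2)" using N mu_pos by (simp add: wt_def algebra_simps)
    also have "\<dots> \<le> 2 * rate n" using r by simp
    finally show "wt 1 n / rate n \<le> 2 / mu" using rp mu_pos by (simp add: divide_simps mult.commute)
  qed (use lip(1) rad(1) assms(5) wn in auto)
  also have "\<dots> \<le> D / 2 * w n"
  proof -
    have "lip * rad * (2 / mu) \<le> 1/2"
    proof -
      have "lip * rad * (2 / mu) \<le> 2 * lip * (2 / mu + 8) * rad"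
      proof -
        have "0 \<le> 2 / mu" using mu_pos by simp
        then have "0 + 2 / mu \<le> (2 / mu + 16) + 2 / mu" by (intro add_right_mono) simp
        also have "\<dots> = 2 * (2 / mu + 8)" by simp
        finally have "2 / mu \<le> 2 * (2 / mu + 8)" by simp
        from mult_left_mono[OF this, of "lip * rad"] have "lip * rad * (2 / mu) \<le> lip * rad * (2 * (2 / mu + 8))"
          using lip(1) rad(1) by (meson mult_nonneg_nonneg less_imp_le)
        also have "\<dots> = 2 * lip * (2 / mu + 8) * rad" by (simp only: mult_ac)
        finally show ?thesis .
      qed
      then show ?thesis using rad(3) by linarith
    qed
    from mult_right_mono[OF this, of "D * w n"] show ?thesis using assms(5) wn by (simp add: mult_ac)
  qed
  finally have "cmod (integral {0..t} (\<lambda>s. exp (- rate n * (t - s)) *\<^sub>R (nonlin p lam (v s) n - nonlin p lam (v' s) n))) \<le> D / 2 * w n" .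
  moreover have "integral {0..t} (\<lambda>s. exp (- rate n * (t - s)) *\<^sub>R (nonlin p lam (v s) n - nonlin p lam (v' s) n)) =
      integral {0..t} (\<lambda>s. exp (- rate n * (t - s)) *\<^sub>R nonlin p lam (v s) n) - integral {0..t} (\<lambda>s. exp (- rate n * (t - s)) *\<^sub>R nonlin p lam (v' s) n)"
  proof -
    have "(\<lambda>s. exp (- rate n * (t - s)) *\<^sub>R f s) integrable_on {0..t}" if "continuous_on {0..} f" for f :: "real \<Rightarrow> complex"
    proof (rule integrable_continuous_real)
      have "continuous_on {0..t} f" by (rule continuous_on_subset[OF that]) auto
      then show "continuous_on {0..t} (\<lambda>s. exp (- rate n * (t - s)) *\<^sub>R f s)" by (intro continuous_intros)
    qed
    then show ?thesis unfolding scaleR_diff_right using c by (intro integral_diff) auto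
  qed
  ultimately show ?thesis using False by (simp add: duhamel_def w_def)
qed

section \<open>Picard iteration and its limit\<close>

primrec picard :: "(int \<Rightarrow> complex) \<Rightarrow> nat \<Rightarrow> real \<Rightarrow> int \<Rightarrow> complex" where
  "picard phi 0 = (\<lambda>_ _. 0)"
| "picard phi (Suc j) = duhamel phi (\<lambda>s. nonlin p lam (picard phi j s))"

definition sol :: "(int \<Rightarrow> complex) \<Rightarrow> real \<Rightarrow> int \<Rightarrow> complex" where
  "sol phi t n = lim (\<lambda>j. picard phi j t n)"

lemma decaying_path_picard:
  assumes "admissible s0 phi" shows "decaying_path s0 (picard phi j)"
proof (induction j)
  case 0
  have "dominated (rad * exp (- mu * t)) 0 (time_profile s0 t) (\<lambda>_. 0)" if "0 \<le> t" for t
    using assms that rad(1) by (intro dominated_zero profile_time_profile) (auto simp: admissible_def)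
  then show ?case by (simp add: decaying_path_def hermitian_def)
next
  case (Suc j)
  then show ?case using decaying_path_duhamel[OF _ assms] by simp
qed

lemma picard_step:
  assumes "admissible s0 phi" "0 \<le> t"
  shows "cmod (picard phi (Suc j) t n - picard phi j t n) \<le> rad * time_profile 0 0 n / 2 ^ j"
  using assms(2)
proof (induction j arbitrary: t n)
  case 0
  have "dominated rad 0 (time_profile 0 0) (picard phi (Suc 0) t)"
    using decaying_path_static[OF decaying_path_picard[OF assms(1)] _ 0] assms(1) unfolding admissible_def by blast
  then show ?case by (simp add: dominated_def)
next
  case (Suc j)
  have s0: "0 \<le> s0" using assms by (simp add: admissible_def)
  have "cmod (duhamel phi (\<lambda>s. nonlin p lam (picard phi (Suc j) s)) t n - duhamel phi (\<lambda>s. nonlin p lam (picard phi j s)) t n)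
      \<le> (rad / 2 ^ j) / 2 * time_profile 0 0 n"
    using rad(1) Suc.IH by (intro duhamel_contraction[OF decaying_path_picard[OF assms(1)] decaying_path_picard[OF assms(1)] s0 s0 _ Suc.prems]) auto
  then show ?case by (simp add: mult_ac)
qed

lemma sol_limit:
  assumes "admissible s0 phi" "0 \<le> t"
  shows "(\<lambda>j. picard phi j t n) \<longlonglongrightarrow> sol phi t n"
    "cmod (sol phi t n - picard phi j t n) \<le> 2 * rad / 2 ^ j * time_profile 0 0 n"
  using geometric_limit[of "\<lambda>j. picard phi j t n", OF picard_step[OF assms]] by (simp_all add: sol_def mult_ac)

lemma decaying_path_sol:
  assumes "admissible s0 phi" shows "decaying_path s0 (sol phi)"
  unfolding decaying_path_def
proof (intro conjI allI impI)
  note decaying_path = decaying_path_picard[OF assms, unfolded decaying_path_def]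
  show "continuous_on {0..} (\<lambda>t. sol phi t n)" for n
  proof (rule uniform_limit_theorem)
    show "\<forall>\<^sub>F j in sequentially. continuous_on {0..} (\<lambda>t. picard phi j t n)"
      using decaying_path by (intro always_eventually) auto
    show "uniform_limit {0..} (\<lambda>j t. picard phi j t n) (\<lambda>t. sol phi t n) sequentially"
    proof (rule uniform_limitI)
      fix e :: real assume "0 < e"
      have "(\<lambda>j. 2 * rad * time_profile 0 0 n * (1/2) ^ j) \<longlonglongrightarrow> 2 * rad * time_profile 0 0 n * 0"
        by (intro tendsto_intros) auto
      then have "\<forall>\<^sub>F j in sequentially. 2 * rad * time_profile 0 0 n * (1/2) ^ j < e"
        using \<open>0 < e\<close> by (intro order_tendstoD(2)) auto
      then show "\<forall>\<^sub>F j in sequentially. \<forall>t\<in>{0..}. dist (picard phi j t n) (sol phi t n) < e"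
      proof eventually_elim
        case (elim j)
        show ?case
        proof
          fix t :: real assume "t \<in> {0..}"
          then have "cmod (sol phi t n - picard phi j t n) \<le> 2 * rad / 2 ^ j * time_profile 0 0 n"
            using sol_limit(2)[OF assms] by simp
          then show "dist (picard phi j t n) (sol phi t n) < e"
            using elim by (simp add: dist_norm norm_minus_commute power_one_over)
        qed
      qed
    qed
  qed auto
  fix t :: real assume t: "0 \<le> t"
  note L = sol_limit(1)[OF assms t]
  show "hermitian (sol phi t)"
    unfolding hermitian_def
  proof
    fix n
    have "(\<lambda>j. cnj (picard phi j t n)) \<longlonglongrightarrow> cnj (sol phi t n)" by (intro tendsto_cnj L)
    moreover have "cnj (picard phi j t n) = picard phi j t (- n)" for j using decaying_path t by (auto simp: hermitian_def)
    ultimately show "sol phi t (- n) = cnj (sol phi t n)" using L[of "- n"] LIMSEQ_unique by auto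
  qed
  show "sol phi t 0 = 0"
  proof -
    have "(\<lambda>j. picard phi j t 0) = (\<lambda>_. 0)" using decaying_path t by auto
    then show ?thesis using L[of 0] LIMSEQ_unique[OF _ tendsto_const] by metis
  qed
  show "dominated (rad * exp (- mu * t)) 0 (time_profile s0 t) (sol phi t)"
    unfolding dominated_def
  proof
    fix n
    show "cmod (sol phi t n) \<le> rad * exp (- mu * t) * (wt 0 n * time_profile s0 t n)"
      using decaying_path t by (intro tendsto_upperbound[OF tendsto_norm[OF L]] always_eventually) (auto simp: dominated_def)
  qed
qed

text \<open>Both sides are within a multiple of \<open>2^(-j)\<close> of iterate
  \<open>Suc j\<close>: the left one by the rate of convergence, the right one by contraction
  applied to iterate \<open>j\<close>.\<close>

lemma sol_fixed_point:
  assumes "admissible s0 phi" "0 \<le> t"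
  shows "sol phi t n = duhamel phi (\<lambda>s. nonlin p lam (sol phi s)) t n"
proof -
  have s0: "0 \<le> s0" using assms by (simp add: admissible_def)
  define d where "d = cmod (sol phi t n - duhamel phi (\<lambda>s. nonlin p lam (sol phi s)) t n)"
  have "d \<le> 2 * (rad * time_profile 0 0 n) * (1/2) ^ j" for j
  proof -
    have "cmod (sol phi t n - picard phi (Suc j) t n) \<le> 2 * rad / 2 ^ Suc j * time_profile 0 0 n"
      by (rule sol_limit(2)[OF assms])
    moreover have "cmod (picard phi (Suc j) t n - duhamel phi (\<lambda>s. nonlin p lam (sol phi s)) t n) \<le> (2 * rad / 2 ^ j) / 2 * time_profile 0 0 n"
      unfolding picard.simps
      using rad(1) sol_limit(2)[OF assms(1)]
      by (intro duhamel_contraction[OF decaying_path_picard[OF assms(1)] decaying_path_sol[OF assms(1)] s0 s0 _ assms(2)])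
        (auto simp: norm_minus_commute)
    ultimately have "d \<le> 2 * rad / 2 ^ Suc j * time_profile 0 0 n + (2 * rad / 2 ^ j) / 2 * time_profile 0 0 n"
      unfolding d_def using norm_triangle_ineq4[of "sol phi t n - picard phi (Suc j) t n" "duhamel phi (\<lambda>s. nonlin p lam (sol phi s)) t n - picard phi (Suc j) t n"] by (simp add: norm_minus_commute)
    then show ?thesis by (simp add: power_one_over field_simps)
  qed
  moreover have "(\<lambda>j. 2 * (rad * time_profile 0 0 n) * (1/2) ^ j) \<longlonglongrightarrow> 2 * (rad * time_profile 0 0 n) * 0"
    by (intro tendsto_intros) auto
  ultimately have "d \<le> 0" by (intro LIMSEQ_le_const[of _ 0 d]) auto
  then show ?thesis by (simp add: d_def)
qed

lemma sol_initial:
  assumes "admissible s0 phi" "n \<noteq> 0" shows "sol phi 0 n = phi n"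
  using sol_fixed_point[OF assms(1), of 0 n] assms(2) by (simp add: duhamel_def)

lemma sol_has_vector_derivative:
  assumes "admissible s0 phi" "0 \<le> t" "n \<noteq> 0"
  shows "((\<lambda>t. sol phi t n) has_vector_derivative (- rate n *\<^sub>R sol phi t n + nonlin p lam (sol phi t) n)) (at t within {0..})"
proof -
  have s0: "0 \<le> s0" using assms by (simp add: admissible_def)
  have "((\<lambda>t. duhamel phi (\<lambda>s. nonlin p lam (sol phi s)) t n) has_vector_derivative
     (- rate n *\<^sub>R duhamel phi (\<lambda>s. nonlin p lam (sol phi s)) t n + nonlin p lam (sol phi t) n)) (at t within {0..})"
    by (rule duhamel_has_vector_derivative[OF decaying_path_tame_continuous[OF decaying_path_sol[OF assms(1)] s0 tame_nonlin] assms(2,3)])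
  then show ?thesis
    using sol_fixed_point[OF assms(1)] assms(2) by (auto intro: has_vector_derivative_transform)
qed

end

section \<open>Real Fourier series\<close>

lemma power_le_fact_exp:
  fixes y :: real
  assumes "0 \<le> y" shows "y ^ j \<le> fact j * exp y"
proof -
  have "(\<Sum>i\<in>{j}. y ^ i /\<^sub>R fact i) \<le> (\<Sum>i. y ^ i /\<^sub>R fact i)"
    using assms by (intro sum_le_suminf summable_exp_generic) auto
  then have "y ^ j / fact j \<le> exp y" by (simp add: exp_def divide_inverse mult.commute)
  then show ?thesis by (simp add: field_simps)
qed

lemma power_exp_decay_bound:
  fixes y :: real
  assumes "0 \<le> y" "0 < e" shows "y ^ j * exp (- e * y) \<le> fact j * (2 / e) ^ j * exp (- (e / 2) * y)"
proof -
  have "y ^ j = (2 / e) ^ j * (e / 2 * y) ^ j" using assms by (simp flip: power_mult_distrib)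
  also have "\<dots> \<le> (2 / e) ^ j * (fact j * exp (e / 2 * y))"
    using assms by (intro mult_left_mono power_le_fact_exp) auto
  finally have "y ^ j * exp (- e * y) \<le> (2 / e) ^ j * (fact j * exp (e / 2 * y)) * exp (- e * y)"
    by (rule mult_right_mono) simp
  also have "\<dots> = fact j * (2 / e) ^ j * exp (- (e / 2) * y)"
    by (simp add: mult_ac flip: exp_add)
  finally show ?thesis .
qed

lemma summable_exp_decay:
  assumes "0 < (e::real)"
  shows "(\<lambda>n::int. \<bar>of_int n\<bar> ^ j * exp (- e * \<bar>of_int n\<bar>)) summable_on UNIV"
proof -
  have "summable (\<lambda>n. exp (- (e / 2)) ^ n)" using assms by (intro summable_geometric) auto
  then have s: "summable (\<lambda>n. fact j * (2 / e) ^ j * exp (- (e / 2) * real n))"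
    by (intro summable_mult) (simp add: exp_of_nat_mult[symmetric] mult.commute)
  show ?thesis
  proof (rule summable_on_int_real)
    show "summable (\<lambda>n. \<bar>real_of_int (int n)\<bar> ^ j * exp (- e * \<bar>real_of_int (int n)\<bar>))"
      "summable (\<lambda>n. \<bar>real_of_int (- int n)\<bar> ^ j * exp (- e * \<bar>real_of_int (- int n)\<bar>))"
      using power_exp_decay_bound[OF _ assms, of "real _" j]
      by (auto intro!: summable_comparison_test[OF _ s])
  qed simp
qed

text \<open>The sum over the integers becomes a series along \<open>int_decode\<close>, to which
  termwise differentiation under uniform convergence applies.\<close>

lemma has_real_derivative_infsum:
  fixes f f' :: "int \<Rightarrow> real \<Rightarrow> real"
  assumes "convex S" "open S" "\<And>n x. x \<in> S \<Longrightarrow> (f n has_real_derivative f' n x) (at x)"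
    "\<And>n x. x \<in> S \<Longrightarrow> \<bar>f' n x\<bar> \<le> g n" "g summable_on UNIV"
    "\<And>x. x \<in> S \<Longrightarrow> (\<lambda>n. f n x) summable_on UNIV" "x \<in> S"
  shows "((\<lambda>x. \<Sum>\<^sub>\<infinity>n. f n x) has_real_derivative (\<Sum>\<^sub>\<infinity>n. f' n x)) (at x)"
proof -
  have enum: "(\<Sum>\<^sub>\<infinity>n. h n) = (\<Sum>i. h (int_decode i))" if "h summable_on UNIV" for h :: "int \<Rightarrow> real"
  proof -
    have "((\<lambda>i. h (int_decode i)) has_sum infsum h UNIV) UNIV"
      using has_sum_reindex_bij_betw[OF bij_int_decode, of h "infsum h UNIV"] that by simp
    then show ?thesis using has_sum_imp_sums sums_unique by blast
  qed
  have gs: "summable (\<lambda>i. g (int_decode i))"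
    using summable_on_reindex_bij_betw[OF bij_int_decode, of g] assms(5) summable_on_imp_summable by blast
  have f's: "(\<lambda>n. f' n y) summable_on UNIV" if "y \<in> S" for y
    by (rule abs_summable_summable, rule summable_on_comparison_test[OF assms(5)]) (use assms(4)[OF that] in auto)
  have "((\<lambda>x. \<Sum>i. f (int_decode i) x) has_field_derivative (\<Sum>i. f' (int_decode i) x)) (at x)"
  proof (rule has_field_derivative_series'(2)[where S=S and ?x0.0=x])
    show "uniformly_convergent_on S (\<lambda>n x. \<Sum>i<n. f' (int_decode i) x)"
      using assms(4) by (intro Weierstrass_m_test'[OF _ gs]) auto
    show "summable (\<lambda>i. f (int_decode i) x)"
      using summable_on_reindex_bij_betw[OF bij_int_decode, of "\<lambda>n. f n x"] assms(6,7) summable_on_imp_summable by blast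
  qed (use assms in \<open>auto intro: has_field_derivative_at_within simp: interior_open\<close>)
  moreover have "\<forall>\<^sub>F y in nhds x. (\<Sum>\<^sub>\<infinity>n. f n y) = (\<Sum>i. f (int_decode i) y)"
    using eventually_nhds_in_open[OF assms(2,7)] by eventually_elim (rule enum[OF assms(6)])
  moreover have "(\<Sum>\<^sub>\<infinity>n. f' n x) = (\<Sum>i. f' (int_decode i) x)" by (rule enum[OF f's[OF assms(7)]])
  ultimately show ?thesis by (simp only: DERIV_cong_ev)
qed

definition fser :: "real \<Rightarrow> (int \<Rightarrow> complex) \<Rightarrow> real \<Rightarrow> complex" where
  "fser lam a x = (\<Sum>\<^sub>\<infinity>n. a n * cis (lam * of_int n * x))"

abbreviation coeff_summable :: "(int \<Rightarrow> complex) \<Rightarrow> bool" where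
  "coeff_summable a \<equiv> (\<lambda>n. cmod (a n)) summable_on UNIV"

lemma fser_term_summable:
  assumes "coeff_summable a" shows "(\<lambda>n. a n * cis (lam * of_int n * x)) summable_on UNIV"
  by (rule abs_summable_summable) (use assms in \<open>simp add: norm_mult\<close>)

lemma fser_add: "coeff_summable a \<Longrightarrow> coeff_summable b \<Longrightarrow> fser lam (\<lambda>n. a n + b n) x = fser lam a x + fser lam b x"
  unfolding fser_def distrib_right by (rule infsum_add[OF fser_term_summable fser_term_summable])

lemma fser_cmult: "fser lam (\<lambda>n. c * a n) x = c * fser lam a x"
  unfolding fser_def mult.assoc by (rule infsum_cmult_right')

lemma fser_single: "fser lam (\<lambda>n. if n = 0 then c else 0) x = c"
proof -
  have "fser lam (\<lambda>n. if n = 0 then c else 0) x = (\<Sum>\<^sub>\<infinity>n\<in>{0::int}. c)"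
    unfolding fser_def by (rule infsum_cong_neutral) auto
  then show ?thesis by simp
qed

lemma coeff_summable_single: "coeff_summable (\<lambda>n. if n = 0 then c else 0)"
  by (rule finite_nonzero_values_imp_summable_on) (auto intro: finite_subset[of _ "{0}"])

lemma coeff_summable_add:
  assumes "coeff_summable a" "coeff_summable b" shows "coeff_summable (\<lambda>n. a n + b n)"
  by (rule summable_on_comparison_test[OF summable_on_add[OF assms]]) (auto intro: norm_triangle_ineq)

lemma coeff_summable_cmult: "coeff_summable a \<Longrightarrow> coeff_summable (\<lambda>n. c * a n)"
  by (simp add: norm_mult summable_on_cmult_right)

lemma fser_hermitian:
  assumes "hermitian a" shows "fser lam a x = complex_of_real (Re (fser lam a x))"
proof -
  have "fser lam a x = (\<Sum>\<^sub>\<infinity>n. a (- n) * cis (lam * of_int (- n) * x))"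
    unfolding fser_def by (rule infsum_reindex_bij_witness[of _ uminus uminus]) auto
  also have "\<dots> = (\<Sum>\<^sub>\<infinity>n. cnj (a n * cis (lam * of_int n * x)))"
    using assms by (simp add: hermitian_def cis_cnj)
  also have "\<dots> = cnj (fser lam a x)" unfolding fser_def by (rule infsum_cnj)
  finally show ?thesis by (metis Reals_cnj_iff of_real_Re)
qed

lemma norm_fser_le:
  assumes "\<And>n. cmod (a n) \<le> g n" "g summable_on UNIV"
  shows "cmod (fser lam a x) \<le> infsum g UNIV"
proof -
  have "coeff_summable a" by (rule summable_on_comparison_test[OF assms(2)]) (use assms in auto)
  then show ?thesis
    unfolding fser_def using assms
    by (intro norm_infsum_le[OF has_sum_infsum[OF fser_term_summable] has_sum_infsum]) (auto simp: norm_mult)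
qed

text \<open>Fubini for the absolutely summable double family, followed by the shift of
  \<open>n\<close> by \<open>m\<close>.\<close>

lemma fser_mult:
  assumes "coeff_summable a" "coeff_summable b"
  shows "fser lam (conv a b) x = fser lam a x * fser lam b x"
proof -
  define E where "E n = cis (lam * of_int n * x)" for n :: int
  have bs: "coeff_summable (\<lambda>n. b (n - m))" and bi: "(\<Sum>\<^sub>\<infinity>n. cmod (b (n - m))) = (\<Sum>\<^sub>\<infinity>n. cmod (b n))" for m
  proof -
    have *: "bij (\<lambda>n. n - m)" by (rule bij_betw_byWitness[where f'="\<lambda>n. n + m"]) auto
    show "coeff_summable (\<lambda>n. b (n - m))" using summable_on_reindex_bij_betw[OF *, of "\<lambda>n. cmod (b n)"] assms(2) by simp
    show "(\<Sum>\<^sub>\<infinity>n. cmod (b (n - m))) = (\<Sum>\<^sub>\<infinity>n. cmod (b n))" using infsum_reindex_bij_betw[OF *, of "\<lambda>n. cmod (b n)"] by simp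
  qed
  have "(\<lambda>z. norm (case z of (m, n) \<Rightarrow> a m * b (n - m) * E n)) summable_on Sigma UNIV (\<lambda>_. UNIV)"
      by (rule Infinite_Sum.abs_summable_on_Sigma_iff[THEN iffD2])
        (use bs assms(1) in \<open>simp add: norm_mult E_def infsum_cmult_right' bi abs_mult summable_on_cmult_left summable_on_cmult_right\<close>)
  then have sum: "(\<lambda>(m, n). a m * b (n - m) * E n) summable_on UNIV \<times> UNIV"
    by (rule abs_summable_summable)
  have "fser lam (conv a b) x = (\<Sum>\<^sub>\<infinity>n. \<Sum>\<^sub>\<infinity>m. a m * b (n - m) * E n)"
    unfolding fser_def conv_def E_def by (simp add: infsum_cmult_left')
  also have "\<dots> = (\<Sum>\<^sub>\<infinity>m. \<Sum>\<^sub>\<infinity>n. a m * b (n - m) * E n)"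
    by (rule infsum_swap_banach[symmetric, OF sum])
  also have "\<dots> = (\<Sum>\<^sub>\<infinity>m. a m * E m * fser lam b x)"
  proof (rule infsum_cong)
    fix m
    have "(\<Sum>\<^sub>\<infinity>n. a m * b (n - m) * E n) = (\<Sum>\<^sub>\<infinity>n. a m * b n * E (n + m))"
      by (rule infsum_reindex_bij_witness[of _ "\<lambda>n. n + m" "\<lambda>n. n - m"]) auto
    also have "\<dots> = (\<Sum>\<^sub>\<infinity>n. (a m * E m) * (b n * E n))"
      by (intro infsum_cong) (simp add: E_def algebra_simps flip: cis_mult)
    finally show "(\<Sum>\<^sub>\<infinity>n. a m * b (n - m) * E n) = a m * E m * fser lam b x"
      by (simp add: infsum_cmult_right' fser_def E_def)
  qed
  also have "\<dots> = fser lam a x * fser lam b x" by (simp add: infsum_cmult_left' fser_def E_def)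
  finally show ?thesis .
qed

definition dcoeff :: "real \<Rightarrow> (int \<Rightarrow> complex) \<Rightarrow> int \<Rightarrow> complex" where
  "dcoeff lam a n = \<i> * complex_of_real (lam * of_int n) * a n"

lemma dcoeff_hermitian: "hermitian a \<Longrightarrow> hermitian (dcoeff lam a)"
  by (simp add: hermitian_def dcoeff_def)

lemma dcoeff_iterate: "(dcoeff lam ^^ j) a n = (\<i> * complex_of_real (lam * of_int n)) ^ j * a n"
  by (induction j) (auto simp: dcoeff_def)

lemma fser_has_real_derivative:
  assumes "coeff_summable a" "coeff_summable (dcoeff lam a)"
  shows "((\<lambda>x. Re (fser lam a x)) has_real_derivative Re (fser lam (dcoeff lam a) x)) (at x)"
proof -
  have "((\<lambda>x. \<Sum>\<^sub>\<infinity>n. Re (a n * cis (lam * of_int n * x))) has_real_derivative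
      (\<Sum>\<^sub>\<infinity>n. Re (dcoeff lam a n * cis (lam * of_int n * x)))) (at x)"
  proof (rule has_real_derivative_infsum[of UNIV])
    show "((\<lambda>x. Re (a n * cis (lam * of_int n * x))) has_real_derivative Re (dcoeff lam a n * cis (lam * of_int n * y))) (at y)" for n y
      by (auto intro!: derivative_eq_intros simp: dcoeff_def algebra_simps)
    show "\<bar>Re (dcoeff lam a n * cis (lam * of_int n * y))\<bar> \<le> cmod (dcoeff lam a n)" for n y
      using abs_Re_le_cmod[of "dcoeff lam a n * cis (lam * of_int n * y)"] by (simp add: norm_mult)
    show "(\<lambda>n. Re (a n * cis (lam * of_int n * y))) summable_on UNIV" for y
      by (rule summable_on_Re[OF fser_term_summable[OF assms(1)]])
  qed (use assms in auto)
  then show ?thesis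
    unfolding fser_def using infsum_Re[OF fser_term_summable[OF assms(1)]] infsum_Re[OF fser_term_summable[OF assms(2)]] by simp
qed

lemma fser_has_real_derivative_param:
  assumes "\<And>n t. t \<in> {c<..<d} \<Longrightarrow> ((\<lambda>t. a t n) has_vector_derivative a' t n) (at t)"
    "\<And>n t. t \<in> {c<..<d} \<Longrightarrow> cmod (a' t n) \<le> g n" "g summable_on UNIV"
    "\<And>t. t \<in> {c<..<d} \<Longrightarrow> coeff_summable (a t)" "t \<in> {c<..<d}"
  shows "((\<lambda>t. Re (fser lam (a t) x)) has_real_derivative Re (fser lam (a' t) x)) (at t)"
proof -
  have s': "coeff_summable (a' t)" if "t \<in> {c<..<d}" for t
    by (rule summable_on_comparison_test[OF assms(3)]) (use assms(2) that in auto)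
  have "((\<lambda>t. \<Sum>\<^sub>\<infinity>n. Re (a t n * cis (lam * of_int n * x))) has_real_derivative
      (\<Sum>\<^sub>\<infinity>n. Re (a' t n * cis (lam * of_int n * x)))) (at t)"
  proof (rule has_real_derivative_infsum[of "{c<..<d}"])
    fix n s assume s: "s \<in> {c<..<d}"
    have "((\<lambda>t. Re (a t n * cis (lam * of_int n * x))) has_vector_derivative Re (a' s n * cis (lam * of_int n * x))) (at s)"
      by (rule bounded_linear.has_vector_derivative[OF bounded_linear_compose[OF bounded_linear_Re bounded_linear_mult_left] assms(1)[OF s]])
    then show "((\<lambda>t. Re (a t n * cis (lam * of_int n * x))) has_real_derivative Re (a' s n * cis (lam * of_int n * x))) (at s)"
      by (simp add: has_real_derivative_iff_has_vector_derivative)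
    show "\<bar>Re (a' s n * cis (lam * of_int n * x))\<bar> \<le> g n"
      using abs_Re_le_cmod[of "a' s n * cis (lam * of_int n * x)"] assms(2)[OF s, of n] by (simp add: norm_mult)
  next
    fix s assume "s \<in> {c<..<d}"
    then show "(\<lambda>n. Re (a s n * cis (lam * of_int n * x))) summable_on UNIV"
      by (intro summable_on_Re fser_term_summable assms(4))
  qed (use assms in auto)
  moreover have "\<forall>\<^sub>F s in nhds t. Re (fser lam (a s) x) = (\<Sum>\<^sub>\<infinity>n. Re (a s n * cis (lam * of_int n * x)))"
    using eventually_nhds_in_open[OF open_greaterThanLessThan assms(5)]
    by eventually_elim (unfold fser_def, rule infsum_Re[symmetric, OF fser_term_summable[OF assms(4)]])
  moreover have "Re (fser lam (a' t) x) = (\<Sum>\<^sub>\<infinity>n. Re (a' t n * cis (lam * of_int n * x)))"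
    unfolding fser_def by (rule infsum_Re[symmetric, OF fser_term_summable[OF s'[OF assms(5)]]])
  ultimately show ?thesis by (simp only: DERIV_cong_ev)
qed

lemma fser_continuous:
  assumes "\<And>n. continuous_on I (\<lambda>t. a t n)" "\<And>n t. t \<in> I \<Longrightarrow> cmod (a t n) \<le> g n" "g summable_on UNIV"
  shows "continuous_on (UNIV \<times> I) (\<lambda>(x, t). Re (fser lam (a t) x))"
proof -
  have "continuous_on (UNIV \<times> I) (\<lambda>z. \<Sum>\<^sub>\<infinity>n. a (snd z) n * cis (lam * of_int n * fst z))"
  proof (rule continuous_on_infsum[OF _ _ assms(3)])
    show "continuous_on (UNIV \<times> I) (\<lambda>z. a (snd z) m * cis (lam * of_int m * fst z))" for m
      by (intro continuous_on_mult continuous_on_compose2[OF assms(1)] continuous_on_cis continuous_intros) auto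
  qed (use assms in \<open>auto simp: norm_mult\<close>)
  then show ?thesis unfolding fser_def case_prod_unfold by (rule continuous_on_Re)
qed

lemma fser_periodic:
  assumes "lam \<noteq> 0" shows "fser lam a (x + 2 * pi / lam) = fser lam a x"
proof -
  have "cis (lam * of_int n * (x + 2 * pi / lam)) = cis (lam * of_int n * x)" for n
  proof -
    have "lam * of_int n * (x + 2 * pi / lam) = lam * of_int n * x + 2 * pi * of_int n"
      using assms by (simp add: field_simps)
    then show ?thesis by (metis cis_multiple_2pi Ints_of_int cis_mult mult.right_neutral)
  qed
  then show ?thesis by (simp add: fser_def)
qed

text \<open>An explicit primitive replaces the exchange of sum and integral: division of the nonzero
  coefficients by \<open>\<i> * lam * n\<close> keeps them summable and yields a periodic series, so
  only the linear part \<open>a 0 * x\<close> contributes over a period.\<close>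

lemma fser_mean:
  assumes "coeff_summable a" "0 < lam"
  shows "((\<lambda>x. Re (fser lam a x)) has_integral 2 * pi / lam * Re (a 0)) {0..2 * pi / lam}"
proof -
  define b where "b n = (if n = 0 then 0 else a n / (\<i> * complex_of_real (lam * of_int n)))" for n
  define a1 where "a1 n = (if n = 0 then 0 else a n)" for n
  have b: "dcoeff lam b n = a1 n" for n using assms by (simp add: b_def a1_def dcoeff_def)
  have a1s: "coeff_summable a1"
    by (rule summable_on_comparison_test[OF assms(1)]) (auto simp: a1_def)
  have bs: "coeff_summable b"
  proof (rule summable_on_comparison_test[OF summable_on_cmult_right[OF assms(1), of "1 / lam"]])
    fix n
    have "1 \<le> \<bar>real_of_int n\<bar>" if "n \<noteq> 0" using that by linarith
    then show "cmod (b n) \<le> 1 / lam * cmod (a n)"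
      using assms(2) mult_right_mono[of 1 "\<bar>real_of_int n\<bar>" "cmod (a n)"]
      by (auto simp: b_def norm_divide norm_mult field_simps)
  qed auto
  have db: "dcoeff lam b = a1" using b by auto
  have "((\<lambda>x. Re (fser lam a x)) has_integral
     (Re (a 0) * (2 * pi / lam) + Re (fser lam b (2 * pi / lam))) - (Re (a 0) * 0 + Re (fser lam b 0))) {0..2 * pi / lam}"
  proof (rule fundamental_theorem_of_calculus)
    fix x
    have "fser lam (\<lambda>n. (if n = 0 then a 0 else 0) + a1 n) x = a 0 + fser lam a1 x"
      by (subst fser_add[OF coeff_summable_single a1s]) (simp add: fser_single)
    moreover have "(\<lambda>n. (if n = 0 then a 0 else 0) + a1 n) = a" by (auto simp: a1_def)
    ultimately have "Re (fser lam a x) = Re (a 0) + Re (fser lam a1 x)" by simp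
    moreover have "((\<lambda>x. Re (a 0) * x + Re (fser lam b x)) has_real_derivative Re (a 0) + Re (fser lam a1 x)) (at x)"
      using fser_has_real_derivative[OF bs, of lam x] a1s
      by (intro DERIV_add) (auto intro!: derivative_eq_intros simp: db)
    ultimately show "((\<lambda>x. Re (a 0) * x + Re (fser lam b x)) has_vector_derivative Re (fser lam a x)) (at x within {0..2 * pi / lam})"
      by (metis has_real_derivative_iff_has_vector_derivative has_vector_derivative_at_within)
  qed (use assms in auto)
  then show ?thesis using fser_periodic[of lam b 0] assms by (simp add: mult.commute)
qed

lemma fser_real_analytic:
  assumes "\<And>n. cmod (a n) \<le> C * exp (- e * \<bar>of_int n\<bar>)" "0 < e"
  shows "real_analytic (\<lambda>x. Re (fser lam a x))"
  unfolding real_analytic_def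
proof
  fix x
  \<comment> \<open>For \<open>\<bar>h\<bar> < d\<close> the factor
    \<open>exp \<bar>lam n h\<bar>\<close> uses at most half of the decay rate \<open>e\<close>, and
    the other half keeps the double sum absolutely convergent. The added 1 keeps the denominator
    positive if \<open>lam = 0\<close>.\<close>
  define d where "d = e / (2 * (\<bar>lam\<bar> + 1))"
  have d: "0 < d" using assms(2) by (simp add: d_def)
  define q where "q n = \<i> * complex_of_real (lam * of_int n)" for n :: int
  define A where "A n = a n * cis (lam * of_int n * x)" for n
  have A: "cmod (A n) \<le> C * exp (- e * \<bar>of_int n\<bar>)" for n using assms(1) by (simp add: A_def norm_mult)
  have C: "0 \<le> C" using order_trans[OF norm_ge_zero assms(1)[of 0]] by simp
  define c where "c j = (\<Sum>\<^sub>\<infinity>n. A n * (q n ^ j / fact j))" for j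
  have main: "((\<lambda>j. Re (c j) * h ^ j) sums Re (fser lam a (x + h)))" if h: "\<bar>h\<bar> < d" for h
  proof -
    define z where "z = complex_of_real h"
    define F where "F n j = A n * (q n ^ j / fact j) * z ^ j" for n j
    have Fn: "((\<lambda>j. F n j) has_sum (A n * exp (q n * z))) UNIV" and Fa: "((\<lambda>j. cmod (F n j)) has_sum (cmod (A n) * exp (cmod (q n * z)))) UNIV" for n
    proof -
      have e1: "((\<lambda>j. (q n * z) ^ j /\<^sub>R fact j) sums exp (q n * z))" by (rule exp_converges)
      have e2: "((\<lambda>j. cmod (q n * z) ^ j /\<^sub>R fact j) sums exp (cmod (q n * z)))" by (rule exp_converges)
      have eq: "F n j = A n * ((q n * z) ^ j /\<^sub>R fact j)" for j
        by (simp add: F_def power_mult_distrib scaleR_conv_of_real divide_inverse mult_ac)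
      have eqa: "cmod (F n j) = cmod (A n) * (cmod (q n * z) ^ j /\<^sub>R fact j)" for j
        by (simp add: eq norm_mult norm_power divide_inverse)
      have "(\<lambda>j. cmod (F n j)) sums (cmod (A n) * exp (cmod (q n * z)))" unfolding eqa by (rule sums_mult[OF e2])
      then show "((\<lambda>j. cmod (F n j)) has_sum (cmod (A n) * exp (cmod (q n * z)))) UNIV"
        by (intro sums_nonneg_imp_has_sum) auto
      have "(\<lambda>j. F n j) sums (A n * exp (q n * z))" unfolding eq by (rule sums_mult[OF e1])
      then show "((\<lambda>j. F n j) has_sum (A n * exp (q n * z))) UNIV"
        using norm_summable_imp_has_sum[of "F n"] sums_summable[OF \<open>(\<lambda>j. cmod (F n j)) sums _\<close>] by blast
    qed
    have outer: "(\<lambda>n. cmod (A n) * exp (cmod (q n * z))) summable_on UNIV"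
    proof (rule summable_on_comparison_test)
      show "(\<lambda>n::int. C * (\<bar>of_int n\<bar> ^ 0 * exp (- (e / 2) * \<bar>of_int n\<bar>))) summable_on UNIV"
        using assms(2) by (intro summable_on_cmult_right summable_exp_decay) auto
      fix n
      have "cmod (q n * z) = \<bar>h\<bar> * \<bar>lam\<bar> * \<bar>of_int n\<bar>" by (simp add: q_def z_def norm_mult abs_mult)
      also have "\<dots> \<le> d * (\<bar>lam\<bar> + 1) * \<bar>of_int n\<bar>" using h d by (intro mult_right_mono mult_mono) auto
      also have "d * (\<bar>lam\<bar> + 1) = e / 2" by (simp add: d_def field_simps)
      finally have "cmod (A n) * exp (cmod (q n * z)) \<le> (C * exp (- e * \<bar>of_int n\<bar>)) * exp (e / 2 * \<bar>of_int n\<bar>)"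
        using A[of n] C by (intro mult_mono) auto
      also have "\<dots> = C * (\<bar>of_int n\<bar> ^ 0 * exp (- (e / 2) * \<bar>of_int n\<bar>))" by (simp flip: exp_add)
      finally show "cmod (A n) * exp (cmod (q n * z)) \<le> C * (\<bar>of_int n\<bar> ^ 0 * exp (- (e / 2) * \<bar>of_int n\<bar>))" .
    qed auto
    have "(\<lambda>w. norm (case w of (n, j) \<Rightarrow> F n j)) summable_on Sigma UNIV (\<lambda>_. UNIV)"
      by (rule Infinite_Sum.abs_summable_on_Sigma_iff[THEN iffD2]) (use Fa outer in \<open>simp add: has_sum_iff\<close>)
    then have sum: "(\<lambda>(n, j). F n j) summable_on UNIV \<times> UNIV" by (rule abs_summable_summable)
    have "fser lam a (x + h) = (\<Sum>\<^sub>\<infinity>n. \<Sum>\<^sub>\<infinity>j. F n j)"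
    proof -
      have "a n * cis (lam * of_int n * (x + h)) = A n * exp (q n * z)" for n
        by (simp add: A_def q_def z_def distrib_left mult_ac cis_conv_exp exp_add)
      then show ?thesis unfolding fser_def using Fn by (simp add: has_sum_iff)
    qed
    also have "\<dots> = (\<Sum>\<^sub>\<infinity>j. \<Sum>\<^sub>\<infinity>n. F n j)" by (rule infsum_swap_banach[OF sum])
    also have "(\<lambda>j. \<Sum>\<^sub>\<infinity>n. F n j) = (\<lambda>j. c j * z ^ j)" by (simp only: F_def c_def infsum_cmult_left')
    finally have fs: "fser lam a (x + h) = (\<Sum>\<^sub>\<infinity>j. c j * z ^ j)" .
    have "(\<lambda>(j, n). F n j) summable_on UNIV \<times> UNIV" using sum summable_on_swap[of "\<lambda>(n, j). F n j" UNIV UNIV] by (simp add: case_prod_unfold)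
    then have "(\<lambda>j. \<Sum>\<^sub>\<infinity>n. F n j) summable_on UNIV"
      using summable_on_Sigma_banach[of "\<lambda>j n. F n j" UNIV "\<lambda>_. UNIV"] by (simp add: case_prod_unfold)
    then have "(\<lambda>j. c j * z ^ j) summable_on UNIV" by (simp only: F_def c_def infsum_cmult_left')
    then have "((\<lambda>j. c j * z ^ j) has_sum fser lam a (x + h)) UNIV"
      unfolding fs by (rule has_sum_infsum)
    from sums_Re[OF has_sum_imp_sums[OF this]] show ?thesis by (simp add: z_def flip: of_real_power)
  qed
  define P where "P = Abs_fps (\<lambda>j. Re (c j))"
  have P: "fps_nth P j = Re (c j)" for j by (simp add: P_def)
  have rad: "0 < fps_conv_radius P"
  proof -
    have "summable (\<lambda>j. fps_nth P j * (d / 2) ^ j)" using main[of "d/2"] d by (auto simp: P sums_iff)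
    then have "ereal (norm (d / 2)) \<le> fps_conv_radius P" unfolding fps_conv_radius_def by (rule conv_radius_geI)
    moreover have "0 < ereal (norm (d / 2))" using d by simp
    ultimately show ?thesis by (rule less_le_trans[rotated])
  qed
  have "\<forall>\<^sub>F h in nhds 0. eval_fps P h = Re (fser lam a (x + h))"
  proof -
    have "\<forall>\<^sub>F h in nhds (0::real). h \<in> {-d<..<d}" using d by (intro eventually_nhds_in_open) auto
    then show ?thesis
      by eventually_elim (use main in \<open>auto simp: eval_fps_def P sums_iff abs_less_iff\<close>)
  qed
  then show "\<exists>F. (\<lambda>h. Re (fser lam a (x + h))) has_fps_expansion F"
    using rad unfolding has_fps_expansion_def by blast
qed

section \<open>The right-hand side in terms of coefficients\<close>

lemma norm_dcoeff_iterate: "cmod ((dcoeff lam ^^ j) a n) = \<bar>lam\<bar> ^ j * (\<bar>of_int n\<bar> ^ j * cmod (a n))"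
  by (simp add: dcoeff_iterate norm_mult norm_power abs_mult power_mult_distrib)

lemma dcoeff_iterate_bound:
  assumes "cmod (a n) \<le> C * exp (- e * \<bar>of_int n\<bar>)"
  shows "cmod ((dcoeff lam ^^ j) a n) \<le> C * \<bar>lam\<bar> ^ j * (\<bar>of_int n\<bar> ^ j * exp (- e * \<bar>of_int n\<bar>))"
proof -
  have "\<bar>lam\<bar> ^ j * (\<bar>of_int n\<bar> ^ j * cmod (a n)) \<le> \<bar>lam\<bar> ^ j * (\<bar>of_int n\<bar> ^ j * (C * exp (- e * \<bar>of_int n\<bar>)))"
    by (intro mult_left_mono assms) auto
  then show ?thesis by (simp add: norm_dcoeff_iterate mult_ac)
qed

lemma dcoeff_iterate_summable:
  assumes "\<And>n. cmod (a n) \<le> C * exp (- e * \<bar>of_int n\<bar>)" "0 < e"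
  shows "coeff_summable ((dcoeff lam ^^ j) a)"
proof (rule summable_on_comparison_test)
  show "(\<lambda>n. C * \<bar>lam\<bar> ^ j * (\<bar>of_int n\<bar> ^ j * exp (- e * \<bar>of_int n\<bar>))) summable_on (UNIV :: int set)"
    by (rule summable_on_cmult_right[OF summable_exp_decay[OF assms(2)]])
qed (rule dcoeff_iterate_bound[OF assms(1)] norm_ge_zero)+

lemma exp_decay_summable:
  assumes "\<And>n. cmod (a n) \<le> C * exp (- e * \<bar>of_int n\<bar>)" "0 < e"
  shows "coeff_summable a" "coeff_summable (dcoeff lam a)" "coeff_summable (dcoeff lam (dcoeff lam a))"
  using dcoeff_iterate_summable[OF assms, where j=0] dcoeff_iterate_summable[OF assms, where j=1 and lam=lam]
    dcoeff_iterate_summable[OF assms, where j=2 and lam=lam]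
  by (simp_all add: numeral_2_eq_2)

text \<open>The quadratic denominator of the profile cancels \<open>wt 1\<close>, so exponential
  decay survives even after the loss of two derivatives.\<close>

lemma wt_time_profile_le:
  assumes "0 \<le> s0" "0 \<le> t" "e \<le> 1"
  shows "wt e n * time_profile s0 t n \<le> exp (- (s0 + min t 1 / 4) * \<bar>of_int n\<bar>)"
proof -
  have q: "1 / (8 * quad_sum) \<le> 1" "0 < 1 / (8 * quad_sum)" using quad_sum_ge_1 by simp_all
  define Y where "Y = 1 + min t 1 / 4 * (real_of_int n)\<^sup>2"
  define Z where "Z = (s0 + min t 1 / 4) * \<bar>real_of_int n\<bar>"
  define N where "N = 1 + (real_of_int n)\<^sup>2"
  have Y: "1 \<le> Y" using assms by (simp add: Y_def)
  have N: "0 < N" by (simp add: N_def add_pos_nonneg)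
  have "wt e n \<le> N" using assms(3) by (cases "e = 0") (auto simp: le_Suc_eq wt_def N_def)
  then have "wt e n * time_profile s0 t n \<le> N * time_profile s0 t n"
    using profile_pos[OF profile_time_profile[OF assms(1,2)], of n] by (intro mult_right_mono) auto
  also have "\<dots> = 1 / (8 * quad_sum) * (1 / Y * exp (- Z))"
    using N unfolding time_profile_def decay_profile_def Y_def[symmetric] Z_def[symmetric] N_def[symmetric]
    by (simp add: exp_minus divide_simps)
  also have "\<dots> \<le> 1 * (1 * exp (- Z))"
    using q Y by (intro mult_mono) auto
  finally show ?thesis by (simp only: Z_def mult_minus_left mult_1_left)
qed

lemma tame_exp_decay:
  assumes "tame e q F" "e \<le> 1"
  obtains C where "0 \<le> C" "\<And>s0 t v n. 0 \<le> s0 \<Longrightarrow> 0 \<le> t \<Longrightarrow> dominated 1 0 (time_profile s0 t) v \<Longrightarrow>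
    cmod (F v n) \<le> C * exp (- (s0 + min t 1 / 4) * \<bar>of_int n\<bar>)"
proof -
  obtain C where C: "0 \<le> C" "\<And>w r v. profile w \<Longrightarrow> 0 \<le> r \<Longrightarrow> r \<le> 1 \<Longrightarrow> dominated r 0 w v \<Longrightarrow> dominated (C * r ^ q * r) e w (F v)"
    by (rule tameE[OF assms(1)]) (rule that, assumption+)
  show ?thesis
  proof (rule that[OF C(1)])
    fix s0 t v n assume *: "0 \<le> s0" "0 \<le> (t::real)" "dominated 1 0 (time_profile s0 t) v"
    have "dominated (C * 1 ^ q * 1) e (time_profile s0 t) (F v)"
      by (rule C(2)[OF profile_time_profile[OF *(1,2)] _ _ *(3)]) auto
    then have "cmod (F v n) \<le> C * (wt e n * time_profile s0 t n)" by (simp add: dominated_def)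
    also have "\<dots> \<le> C * exp (- (s0 + min t 1 / 4) * \<bar>of_int n\<bar>)"
      by (rule mult_left_mono[OF wt_time_profile_le[OF *(1,2) assms(2)] C(1)])
    finally show "cmod (F v n) \<le> C * exp (- (s0 + min t 1 / 4) * \<bar>of_int n\<bar>)" .
  qed
qed

lemma fser_symbol:
  assumes "coeff_summable a" "coeff_summable (dcoeff lam (dcoeff lam a))"
  shows "fser lam (\<lambda>n. complex_of_real (symbol lam n) * a n) x = fser lam a x + fser lam (dcoeff lam (dcoeff lam a)) x"
proof -
  have "(\<lambda>n. complex_of_real (symbol lam n) * a n) = (\<lambda>n. a n + dcoeff lam (dcoeff lam a) n)"
    by (auto simp: symbol_def dcoeff_def power2_eq_square algebra_simps)
  then show ?thesis using fser_add[OF assms] by simp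
qed

context flow
begin

definition u_coeff :: "(int \<Rightarrow> complex) \<Rightarrow> int \<Rightarrow> complex" where
  "u_coeff v n = v n + (if n = 0 then 1 else 0)"

text \<open>Fourier coefficients of the right-hand side, i.e. of \<open>(1/p) * u^2 * ((u^p)_xx + u^p)\<close> for \<open>u = 1 + v\<close>.\<close>

definition rhs_coeff :: "(int \<Rightarrow> complex) \<Rightarrow> int \<Rightarrow> complex" where
  "rhs_coeff v n = (dcoeff lam (dcoeff lam v) n + complex_of_real ((real p + 1) / real p) * v n)
     + (quad_part p lam v n + complex_of_real (1 / real p) * u_coeff v n)"

lemma u_coeff_hermitian: "hermitian v \<Longrightarrow> hermitian (u_coeff v)"
  by (simp add: hermitian_def u_coeff_def)

lemma fser_u_coeff:
  assumes "coeff_summable v" shows "fser lam (u_coeff v) x = 1 + fser lam v x"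
  unfolding u_coeff_def using fser_add[OF assms coeff_summable_single[of 1], of lam x] by (simp add: fser_single)

text \<open>The argument is a jet: \<open>z j\<close> stands for the \<open>j\<close>-th space
  derivative. With \<open>k^2\<close> multiplied into the bracket the negative power that occurs for
  \<open>p = 1\<close> disappears and a polynomial in the jet remains.\<close>

definition rhs_poly :: "(nat \<Rightarrow> real) \<Rightarrow> real" where
  "rhs_poly z = z 0 ^ (p + 1) * z 2 + (real p - 1) * z 0 ^ p * (z 1)\<^sup>2 + z 0 ^ (p + 2) / real p"

text \<open>The passage from coefficients back to the pointwise equation. The series of
  \<open>power_rest\<close> is evaluated by induction with \<open>fser_mult\<close>; its second
  derivative is identified by uniqueness of derivatives, termwise differentiation against the chain
  rule. The condition \<open>0 < s0 + t\<close> provides the exponential decay behind all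
  summability.\<close>

lemma fser_rhs_coeff:
  assumes "0 \<le> s0" "0 \<le> t" "0 < s0 + t" "dominated 1 0 (time_profile s0 t) v" "hermitian v"
  shows "Re (fser lam (rhs_coeff v) x) = rhs_poly (\<lambda>j. Re (fser lam ((dcoeff lam ^^ j) (u_coeff v)) x))"
proof -
  define e where "e = s0 + min t 1 / 4"
  have e: "0 < e" using assms(1-3) by (auto simp: e_def min_def)
  have pp: "0 < real p" using p by simp
  have ex: "\<exists>C. \<forall>n. cmod (F v n) \<le> C * exp (- e * \<bar>of_int n\<bar>)" if "tame i q F" "i \<le> 1" for i q F
    using tame_exp_decay[OF that] assms(1,2,4) unfolding e_def by metis
  have summ: "coeff_summable (F v)" "coeff_summable (dcoeff lam (F v))" "coeff_summable (dcoeff lam (dcoeff lam (F v)))"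
    if "tame i q F" "i \<le> 1" for i q F
    using ex[OF that] exp_decay_summable[OF _ e] by metis+
  define V where "V x = Re (fser lam v x)" for x
  define V1 where "V1 x = Re (fser lam (dcoeff lam v) x)" for x
  define V2 where "V2 x = Re (fser lam (dcoeff lam (dcoeff lam v)) x)" for x
  have vs: "coeff_summable v" "coeff_summable (dcoeff lam v)" "coeff_summable (dcoeff lam (dcoeff lam v))"
    using summ[OF tame_id] by auto
  have fv: "fser lam v x = complex_of_real (V x)" "fser lam (dcoeff lam (dcoeff lam v)) x = complex_of_real (V2 x)" for x
    unfolding V_def V2_def by (rule fser_hermitian assms dcoeff_hermitian)+
  have dV: "(V has_real_derivative V1 x) (at x)" "(V1 has_real_derivative V2 x) (at x)" for x
    unfolding V_def V1_def V2_def by (rule fser_has_real_derivative vs)+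
  have R: "fser lam (power_rest j v) x = complex_of_real ((1 + V x) ^ j - 1 - real j * V x)" for j x
  proof (induction j)
    case 0
    then show ?case by (simp add: fser_def)
  next
    case (Suc j)
    note pr = summ[OF tame_power_rest, of j]
    have cs: "coeff_summable (\<lambda>m. complex_of_real (real j) * v m + power_rest j v m)"
      using pr vs by (intro coeff_summable_add coeff_summable_cmult) auto
    have "coeff_summable (conv v (\<lambda>m. complex_of_real (real j) * v m + power_rest j v m))"
      by (rule summ(1)[OF tame_conv[OF tame_id tame_add[OF tame_cmult[OF tame_id] tame_weaken_order[OF tame_power_rest]]]]) auto
    then have "fser lam (power_rest (Suc j) v) x = fser lam (power_rest j v) x +
        fser lam v x * (complex_of_real (real j) * fser lam v x + fser lam (power_rest j v) x)"
      using pr by (simp only: power_rest.simps fser_add fser_mult[OF vs(1) cs] fser_cmult coeff_summable_cmult vs le_numeral_extra)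
    also have "\<dots> = complex_of_real ((1 + V x) ^ Suc j - 1 - real (Suc j) * V x)"
      unfolding Suc.IH fv by (simp add: algebra_simps)
    finally show ?case .
  qed
  \<comment> \<open>The second derivative of \<open>(1 + V) ^ p\<close>. For \<open>p = 1\<close>
    the exponent \<open>p - 2\<close> is truncated to 0, which is harmless because its prefactor
    \<open>real p - 1\<close> vanishes.\<close>
  define P2 where "P2 x = real p * ((1 + V x) ^ (p - 1) * V2 x + (real p - 1) * (1 + V x) ^ (p - 2) * (V1 x)\<^sup>2)" for x
  have R2: "fser lam (dcoeff lam (dcoeff lam (power_rest p v))) x = complex_of_real (P2 x - real p * V2 x)" for x
  proof -
    note pr = summ[OF tame_power_rest, of p]
    have h: "hermitian (power_rest p v)" by (rule tame_hermitian[OF tame_power_rest assms(5)])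
    have d1: "Re (fser lam (dcoeff lam (power_rest p v)) y) = real p * (1 + V y) ^ (p - 1) * V1 y - real p * V1 y" for y
    proof (rule DERIV_unique)
      show "((\<lambda>x. Re (fser lam (power_rest p v) x)) has_real_derivative Re (fser lam (dcoeff lam (power_rest p v)) y)) (at y)"
        by (rule fser_has_real_derivative) (use pr in auto)
      show "((\<lambda>x. Re (fser lam (power_rest p v) x)) has_real_derivative real p * (1 + V y) ^ (p - 1) * V1 y - real p * V1 y) (at y)"
        unfolding R Re_complex_of_real by (auto intro!: derivative_eq_intros dV)
    qed
    have "Re (fser lam (dcoeff lam (dcoeff lam (power_rest p v))) x) = P2 x - real p * V2 x"
    proof (rule DERIV_unique)
      show "((\<lambda>x. Re (fser lam (dcoeff lam (power_rest p v)) x)) has_real_derivative Re (fser lam (dcoeff lam (dcoeff lam (power_rest p v))) x)) (at x)"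
        by (rule fser_has_real_derivative) (use pr in auto)
      have "p - 1 - Suc 0 = p - 2" "real (p - Suc 0) = real p - 1" using p by auto
      then show "((\<lambda>x. Re (fser lam (dcoeff lam (power_rest p v)) x)) has_real_derivative P2 x - real p * V2 x) (at x)"
        unfolding d1 P2_def by (auto intro!: derivative_eq_intros dV simp: algebra_simps power2_eq_square)
    qed
    then show ?thesis using fser_hermitian[OF dcoeff_hermitian[OF dcoeff_hermitian[OF h]], of lam lam lam x] by simp
  qed
  define r where "r = (1 + V x) ^ p - 1 - real p * V x"
  define r2 where "r2 = P2 x - real p * V2 x"
  have sv: "fser lam (\<lambda>m. complex_of_real (symbol lam m) * v m) x = complex_of_real (V x + V2 x)"
    by (simp add: fser_symbol vs fv)
  have sR: "fser lam (\<lambda>m. complex_of_real (symbol lam m) * power_rest p v m) x = complex_of_real (r + r2)"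
    using summ[OF tame_power_rest, of p] by (simp add: fser_symbol R R2 r_def r2_def)
  have cvv: "coeff_summable (conv v v)" by (rule summ(1)[OF tame_conv[OF tame_id tame_id]]) auto
  have fvv: "fser lam (conv v v) x = complex_of_real ((V x)\<^sup>2)"
    using fser_mult[OF vs(1) vs(1), of lam x] by (simp add: fv power2_eq_square)
  have ch: "coeff_summable (\<lambda>m. complex_of_real 2 * v m + conv v v m)"
    by (intro coeff_summable_add coeff_summable_cmult vs cvv)
  have fh: "fser lam (\<lambda>m. complex_of_real 2 * v m + conv v v m) x = complex_of_real (2 * V x + (V x)\<^sup>2)"
    using fser_add[OF coeff_summable_cmult[OF vs(1), of "complex_of_real 2"] cvv, of lam x] fser_cmult[of lam "complex_of_real 2" v x] by (simp add: fv fvv)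
  have csv: "coeff_summable (\<lambda>m. complex_of_real (symbol lam m) * v m)"
    by (rule summ(1)[OF tame_symbol[OF tame_id]]) auto
  have csR: "coeff_summable (\<lambda>m. complex_of_real (symbol lam m) * power_rest p v m)"
    by (rule summ(1)[OF tame_symbol[OF tame_power_rest]]) auto
  define g where "g = (\<lambda>m. complex_of_real (real p) * (complex_of_real (symbol lam m) * v m) + complex_of_real (symbol lam m) * power_rest p v m)"
  have cg: "coeff_summable g" unfolding g_def by (intro coeff_summable_add coeff_summable_cmult csv csR)
  have fg: "fser lam g x = complex_of_real (real p * (V x + V2 x) + (r + r2))"
    unfolding g_def
    using fser_add[OF coeff_summable_cmult[OF csv, of "complex_of_real (real p)"] csR, of lam x]
      fser_cmult[of lam "complex_of_real (real p)" "\<lambda>m. complex_of_real (symbol lam m) * v m" x] by (simp add: sv sR)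
  have chg: "coeff_summable (conv (\<lambda>m. complex_of_real 2 * v m + conv v v m) g)"
  proof -
    have vv: "tame 0 1 (\<lambda>v. conv v v)" using tame_conv[OF tame_id tame_id] by simp
    have "tame 0 0 (\<lambda>v m. complex_of_real 2 * v m + conv v v m)"
      by (intro tame_add tame_cmult tame_id tame_weaken_order vv)
    moreover have "tame 1 0 (\<lambda>v m. complex_of_real (real p) * (complex_of_real (symbol lam m) * v m)
             + complex_of_real (symbol lam m) * power_rest p v m)"
      by (intro tame_add tame_cmult tame_symbol tame_id tame_weaken_order tame_power_rest)
    ultimately have "tame 1 1 (\<lambda>v. conv (\<lambda>m. complex_of_real 2 * v m + conv v v m)
        (\<lambda>m. complex_of_real (real p) * (complex_of_real (symbol lam m) * v m)
             + complex_of_real (symbol lam m) * power_rest p v m))"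
      by (intro tame_conv) auto
    then show ?thesis unfolding g_def by (rule summ(1)) simp
  qed
  have Q: "fser lam (quad_part p lam v) x = complex_of_real (1 / real p * ((V x)\<^sup>2 + ((r + r2) + (2 * V x + (V x)\<^sup>2) * (real p * (V x + V2 x) + (r + r2)))))"
  proof -
    have "fser lam (quad_part p lam v) x = complex_of_real (1 / real p) * (fser lam (conv v v) x +
        (fser lam (\<lambda>m. complex_of_real (symbol lam m) * power_rest p v m) x + fser lam (conv (\<lambda>m. complex_of_real 2 * v m + conv v v m) g) x))"
      unfolding quad_part_def g_def[symmetric]
      by (simp only: fser_cmult fser_add[OF cvv coeff_summable_add[OF csR chg]] fser_add[OF csR chg])
    then show ?thesis by (simp only: fser_mult[OF ch cg] fvv sR fh fg of_real_mult of_real_add)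
  qed
  have cQ: "coeff_summable (quad_part p lam v)" by (rule summ(1)[OF tame_quad_part]) auto
  have cu: "coeff_summable (u_coeff v)" unfolding u_coeff_def by (intro coeff_summable_add coeff_summable_single vs)
  have "fser lam (rhs_coeff v) x = (fser lam (dcoeff lam (dcoeff lam v)) x + complex_of_real ((real p + 1) / real p) * fser lam v x)
      + (fser lam (quad_part p lam v) x + complex_of_real (1 / real p) * fser lam (u_coeff v) x)"
    unfolding rhs_coeff_def
    by (simp only: fser_cmult fser_add coeff_summable_add coeff_summable_cmult vs cQ cu)
  also have "\<dots> = complex_of_real (V2 x + (real p + 1) / real p * V x + (1 / real p * ((V x)\<^sup>2 + ((r + r2) + (2 * V x + (V x)\<^sup>2) * (real p * (V x + V2 x) + (r + r2))))
      + 1 / real p * (1 + V x)))"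
    by (simp only: fv Q fser_u_coeff[OF vs(1)] of_real_add of_real_mult of_real_1)
  finally have main: "Re (fser lam (rhs_coeff v) x) = V2 x + (real p + 1) / real p * V x + (1 / real p * ((V x)\<^sup>2 + ((r + r2) + (2 * V x + (V x)\<^sup>2) * (real p * (V x + V2 x) + (r + r2))))
      + 1 / real p * (1 + V x))" by (simp only: Re_complex_of_real)
  \<comment> \<open>Once the denominator \<open>p\<close> is cleared, the claim is a polynomial
    identity in \<open>V x\<close>, \<open>V2 x\<close>, \<open>P2 x\<close> and the power
    \<open>(1 + V x) ^ p\<close>.\<close>
  have "real p * (V2 x + (real p + 1) / real p * V x + (1 / real p * ((V x)\<^sup>2 + ((r + r2) + (2 * V x + (V x)\<^sup>2) * (real p * (V x + V2 x) + (r + r2))))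
      + 1 / real p * (1 + V x))) = real p * V2 x + (real p + 1) * V x + ((V x)\<^sup>2 + ((r + r2) + (2 * V x + (V x)\<^sup>2) * (real p * (V x + V2 x) + (r + r2)))) + (1 + V x)"
    using pp by (simp add: distrib_left)
  also have "\<dots> = (1 + V x)\<^sup>2 * ((1 + V x) ^ p + P2 x)"
    unfolding r_def r2_def by algebra
  finally have "real p * Re (fser lam (rhs_coeff v) x) = (1 + V x)\<^sup>2 * ((1 + V x) ^ p + P2 x)"
    unfolding main .
  then have "Re (fser lam (rhs_coeff v) x) = (1 + V x)\<^sup>2 * ((1 + V x) ^ p + P2 x) / real p"
    using pp by (simp add: field_simps)
  also have "\<dots> = (1 + V x) ^ (p + 1) * V2 x + (real p - 1) * (1 + V x) ^ p * (V1 x)\<^sup>2 + (1 + V x) ^ (p + 2) / real p"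
  proof -
    have 1: "(1 + V x)\<^sup>2 * (1 + V x) ^ p = (1 + V x) ^ (p + 2)" by (simp add: power_add power2_eq_square)
    have 2: "(1 + V x)\<^sup>2 * (1 + V x) ^ (p - 1) = (1 + V x) ^ (p + 1)" using p by (simp flip: power_add)
    have 3: "(real p - 1) * ((1 + V x)\<^sup>2 * (1 + V x) ^ (p - 2)) = (real p - 1) * (1 + V x) ^ p"
    proof (cases "p = 1")
      case False
      then have "2 + (p - 2) = p" using p by simp
      then show ?thesis by (metis power_add)
    qed simp
    have "(1 + V x)\<^sup>2 * ((1 + V x) ^ p + P2 x) = (1 + V x)\<^sup>2 * (1 + V x) ^ p + real p * (((1 + V x)\<^sup>2 * (1 + V x) ^ (p - 1)) * V2 x
        + ((real p - 1) * ((1 + V x)\<^sup>2 * (1 + V x) ^ (p - 2))) * (V1 x)\<^sup>2)"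
      unfolding P2_def by (simp only: algebra_simps)
    then show ?thesis unfolding 1 2 3 using pp by (simp add: field_simps)
  qed
  also have "\<dots> = rhs_poly (\<lambda>j. Re (fser lam ((dcoeff lam ^^ j) (u_coeff v)) x))"
  proof -
    have "dcoeff lam (u_coeff v) = dcoeff lam v" by (auto simp: dcoeff_def u_coeff_def)
    then show ?thesis
      by (simp add: rhs_poly_def numeral_2_eq_2 fser_u_coeff[OF vs(1)] V_def V1_def V2_def)
  qed
  finally show ?thesis .
qed

end

section \<open>Amplitude and time change\<close>

context flow
begin

lemma u_coeff_bound:
  assumes "0 \<le> s0" "0 \<le> t" "dominated 1 0 (time_profile s0 t) v"
  shows "cmod (u_coeff v n) \<le> 2 * exp (- (s0 + min t 1 / 4) * \<bar>of_int n\<bar>)"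
proof -
  have "cmod (v n) \<le> exp (- (s0 + min t 1 / 4) * \<bar>of_int n\<bar>)"
    using assms(3) wt_time_profile_le[OF assms(1,2), of 0 n] by (auto simp: dominated_def intro: order_trans)
  then show ?thesis
    using norm_triangle_ineq[of "v n" 1]
    by (cases "n = 0") (auto simp: u_coeff_def intro: order_trans[of _ "exp _"])
qed

lemma rhs_coeff_bound:
  obtains C where "0 \<le> C" "\<And>s0 t v n. 0 \<le> s0 \<Longrightarrow> 0 \<le> t \<Longrightarrow> dominated 1 0 (time_profile s0 t) v \<Longrightarrow>
    cmod (rhs_coeff v n) \<le> C * exp (- (s0 + min t 1 / 4) * \<bar>of_int n\<bar>)"
proof -
  obtain C where C: "0 \<le> C" "\<And>s0 t v n. 0 \<le> s0 \<Longrightarrow> 0 \<le> t \<Longrightarrow> dominated 1 0 (time_profile s0 t) v \<Longrightarrow>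
    cmod (quad_part p lam v n) \<le> C * exp (- (s0 + min t 1 / 4) * \<bar>of_int n\<bar>)"
    by (rule tame_exp_decay[OF tame_quad_part]) (simp, rule that, assumption+)
  define K where "K = lam\<^sup>2 + (real p + 1) / real p + (C + 1 / real p * 2)"
  show ?thesis
  proof (rule that[of K])
    show "0 \<le> K" using C(1) by (simp add: K_def)
    fix s0 t v n assume *: "0 \<le> s0" "0 \<le> (t::real)" "dominated 1 0 (time_profile s0 t) v"
    define X where "X = exp (- (s0 + min t 1 / 4) * \<bar>real_of_int n\<bar>)"
    have v: "cmod (v n) \<le> time_profile s0 t n" using *(3) by (simp add: dominated_def)
    have tp: "0 < time_profile s0 t n" by (rule profile_pos[OF profile_time_profile[OF *(1,2)]])
    have 1: "cmod (dcoeff lam (dcoeff lam v) n) \<le> lam\<^sup>2 * X"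
    proof -
      have "cmod (dcoeff lam (dcoeff lam v) n) = lam\<^sup>2 * ((of_int n)\<^sup>2 * cmod (v n))"
        using norm_dcoeff_iterate[where lam=lam and j=2 and a=v and n=n] by (simp add: numeral_2_eq_2)
      also have "\<dots> \<le> lam\<^sup>2 * (wt 1 n * time_profile s0 t n)"
        using v tp by (intro mult_left_mono mult_mono) (auto simp: wt_def)
      also have "\<dots> \<le> lam\<^sup>2 * X" unfolding X_def by (intro mult_left_mono wt_time_profile_le *) auto
      finally show ?thesis .
    qed
    have 2: "cmod (v n) \<le> X" using v wt_time_profile_le[OF *(1,2), of 0 n] by (simp add: X_def)
    have 3: "cmod (quad_part p lam v n) \<le> C * X" unfolding X_def by (rule C(2)[OF *])
    have 4: "cmod (u_coeff v n) \<le> 2 * X" unfolding X_def by (rule u_coeff_bound[OF *])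
    have "cmod (rhs_coeff v n) \<le> (lam\<^sup>2 * X + (real p + 1) / real p * X) + (C * X + 1 / real p * (2 * X))"
      unfolding rhs_coeff_def
    proof (intro order_trans[OF norm_triangle_ineq] add_mono 1 3)
      show "cmod (complex_of_real ((real p + 1) / real p) * v n) \<le> (real p + 1) / real p * X"
        unfolding norm_mult norm_of_real using 2 by (intro mult_mono) auto
      show "cmod (complex_of_real (1 / real p) * u_coeff v n) \<le> 1 / real p * (2 * X)"
        unfolding norm_mult norm_of_real using 4 by (intro mult_mono) auto
    qed
    then show "cmod (rhs_coeff v n) \<le> K * X" by (simp add: K_def distrib_right)
  qed
qed

text \<open>Homogeneity of degree \<open>p + 2\<close>. One of these powers belongs to the amplitude
  itself, the other \<open>p + 1\<close> are removed by the change of time.\<close>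

lemma rhs_poly_scale: "rhs_poly (\<lambda>j. a * z j) = a ^ (p + 2) * rhs_poly z"
proof -
  have 1: "(a * z 0) ^ (p + 1) * (a * z 2) = a ^ (p + 2) * (z 0 ^ (p + 1) * z 2)" by (simp add: power_mult_distrib)
  have 2: "(real p - 1) * (a * z 0) ^ p * (a * z 1)\<^sup>2 = a ^ (p + 2) * ((real p - 1) * z 0 ^ p * (z 1)\<^sup>2)"
    by (simp add: power_mult_distrib power_add power2_eq_square)
  have 3: "(a * z 0) ^ (p + 2) / real p = a ^ (p + 2) * (z 0 ^ (p + 2) / real p)"
    by (simp add: power_mult_distrib)
  show ?thesis unfolding rhs_poly_def 1 2 3 by (simp only: distrib_left)
qed

end

locale flow_solution = flow +
  fixes s0 :: real and phi :: "int \<Rightarrow> complex" and m :: real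
  assumes adm: "admissible s0 phi" and m: "0 < m"
begin

lemma s0: "0 \<le> s0" using adm by (simp add: admissible_def)

lemma sol_dominated: "0 \<le> t \<Longrightarrow> dominated (rad * exp (- mu * t)) 0 (time_profile s0 t) (sol phi t)"
  using decaying_path_sol[OF adm] by (simp add: decaying_path_def)

lemma rad_exp: "0 \<le> t \<Longrightarrow> rad * exp (- mu * t) \<le> 1 / 2" "0 \<le> rad * exp (- mu * t)"
  using rad(1,2) mu_pos mult_mono[of rad "1/2" "exp (- mu * t)" 1] by auto

lemma sol_dominated_1: "0 \<le> t \<Longrightarrow> dominated 1 0 (time_profile s0 t) (sol phi t)"
  using dominated_mono[OF sol_dominated _ profile_time_profile[OF s0]] rad_exp(1) by fastforce

lemma sol_hermitian: "0 \<le> t \<Longrightarrow> hermitian (sol phi t)"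
  using decaying_path_sol[OF adm] by (simp add: decaying_path_def)

lemma sol_0: "0 \<le> t \<Longrightarrow> sol phi t 0 = 0"
  using decaying_path_sol[OF adm] by (simp add: decaying_path_def)

lemma sol_continuous: "continuous_on {0..} (\<lambda>t. sol phi t n)"
  using decaying_path_sol[OF adm] by (simp add: decaying_path_def)

lemma quad_part_continuous: "continuous_on {0..} (\<lambda>t. quad_part p lam (sol phi t) n)"
  by (rule decaying_path_tame_continuous[OF decaying_path_sol[OF adm] s0 tame_quad_part])

section \<open>Growth of the amplitude\<close>

definition growth :: "real \<Rightarrow> real" where
  "growth t = 1 / real p + Re (quad_part p lam (sol phi t) 0)"

lemma growth_continuous: "continuous_on {0..} growth"
  unfolding growth_def by (intro continuous_intros quad_part_continuous)

lemma lip_rad: "lip * rad\<^sup>2 / mu \<le> 1"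
proof -
  have "lip * rad / mu = lip * rad * (1 / mu)" by simp
  also have "\<dots> \<le> lip * rad * (2 * (2 / mu + 8))"
  proof (rule mult_left_mono)
    have "0 \<le> 1 / mu" using mu_pos by simp
    then have "0 + 1 / mu \<le> (3 * (1 / mu) + 16) + 1 / mu" by (intro add_right_mono) simp
    then show "1 / mu \<le> 2 * (2 / mu + 8)" by (simp add: algebra_simps)
  qed (use lip(1) rad(1) in auto)
  also have "\<dots> \<le> 1 / 2" using rad(3) by (simp only: mult_ac)
  finally have "lip * rad / mu \<le> 1 / 2" .
  then have "lip * rad / mu * rad \<le> 1 / 2 * (1 / 2)" by (rule mult_mono[OF _ rad(2)]) (use rad(1) in auto)
  moreover have "lip * rad / mu * rad = lip * rad\<^sup>2 / mu" by (simp add: power2_eq_square)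
  ultimately have "lip * rad\<^sup>2 / mu \<le> 1 / 2 * (1 / 2)" by (simp only:)
  also have "\<dots> \<le> 1" by simp
  finally show ?thesis .
qed

lemma growth_bound: "0 \<le> t \<Longrightarrow> \<bar>growth t - 1 / real p\<bar> \<le> lip * rad\<^sup>2 * exp (- mu * t)"
proof -
  assume t: "0 \<le> t"
  have "cmod (quad_part p lam (sol phi t) 0) \<le> lip * (rad * exp (- mu * t))\<^sup>2 * (wt 1 0 * time_profile s0 t 0)"
    by (rule quadratic_bounds(2)[OF profile_time_profile[OF s0 t] rad_exp(2) _ sol_dominated[OF t]])
      (use rad_exp(1)[OF t] in simp)
  also have "\<dots> \<le> lip * (rad * exp (- mu * t))\<^sup>2 * 1"
    using lip(1) wt_time_profile_le[OF s0 t, of 1 0] by (intro mult_left_mono) auto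
  also have "(rad * exp (- mu * t))\<^sup>2 \<le> rad\<^sup>2 * exp (- mu * t)"
  proof -
    have "exp (- mu * t) * exp (- mu * t) \<le> 1 * exp (- mu * t)" using t mu_pos by (intro mult_right_mono) auto
    from mult_left_mono[OF this, of "rad\<^sup>2"] show ?thesis
      unfolding power_mult_distrib by (simp add: power2_eq_square)
  qed
  finally show ?thesis
    using lip(1) abs_Re_le_cmod[of "quad_part p lam (sol phi t) 0"] by (simp add: growth_def mult_left_mono mult.assoc)
qed

text \<open>The quadratic correction to the growth rate \<open>1 / p\<close> decays like
  \<open>exp (- mu t)\<close> and integrates to at most \<open>lip * rad^2 / mu \<le> 1\<close>.
  Hence \<open>amp t\<close> stays within a factor \<open>exp 1\<close> of
  \<open>m * exp (t / p)\<close> for all times.\<close>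

lemma growth_integral: "0 \<le> t \<Longrightarrow> \<bar>integral {0..t} growth - t / real p\<bar> \<le> 1"
proof -
  assume t: "0 \<le> t"
  define G where "G s = - (lip * rad\<^sup>2 / mu) * exp (- mu * s)" for s
  have gi: "growth integrable_on {0..t}"
    by (intro integrable_continuous_real continuous_on_subset[OF growth_continuous]) auto
  have G: "((\<lambda>s. lip * rad\<^sup>2 * exp (- mu * s)) has_integral (G t - G 0)) {0..t}"
  proof (rule fundamental_theorem_of_calculus[OF t])
    show "(G has_vector_derivative lip * rad\<^sup>2 * exp (- mu * s)) (at s within {0..t})" for s
      unfolding G_def has_real_derivative_iff_has_vector_derivative[symmetric]
      using mu_pos by (auto intro!: derivative_eq_intros)
  qed
  have "norm (integral {0..t} (\<lambda>s. growth s - 1 / real p)) \<le> integral {0..t} (\<lambda>s. lip * rad\<^sup>2 * exp (- mu * s))"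
    using growth_bound G gi by (intro integral_norm_bound_integral integrable_diff) (auto simp: has_integral_iff)
  also have "\<dots> = G t - G 0" using G by (simp add: has_integral_iff)
  also have "\<dots> \<le> lip * rad\<^sup>2 / mu" using lip(1) mu_pos by (simp add: G_def)
  also note lip_rad
  finally show ?thesis using t by (simp add: integral_diff[OF gi integrable_const_ivl])
qed

definition amp :: "real \<Rightarrow> real" where
  "amp t = m * exp (integral {0..t} growth)"

lemma amp_0: "amp 0 = m" by (simp add: amp_def)

lemma amp_bounds:
  assumes "0 \<le> t" shows "m * exp (t / real p - 1) \<le> amp t" "amp t \<le> m * exp (t / real p + 1)"
  using growth_integral[OF assms] m by (auto simp: amp_def abs_le_iff)

lemma amp_pos: "0 < amp t" using m by (simp add: amp_def)

lemma amp_has_derivative: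
  assumes "0 \<le> t" shows "(amp has_real_derivative growth t * amp t) (at t within {0..})"
proof -
  have "((\<lambda>u. integral {0..u} growth) has_vector_derivative growth t) (at t within {0..t + 1})"
    using assms by (intro integral_has_vector_derivative continuous_on_subset[OF growth_continuous]) auto
  moreover have "at t within {0..t+1} = at t within {0..}"
    by (rule at_within_nhd[of _ "{..<t+1}"]) auto
  ultimately have "((\<lambda>u. integral {0..u} growth) has_real_derivative growth t) (at t within {0..})"
    by (simp add: has_real_derivative_iff_has_vector_derivative)
  then show ?thesis unfolding amp_def by (auto intro!: derivative_eq_intros)
qed

lemma amp_continuous: "continuous_on {0..} amp"
  using amp_has_derivative by (intro DERIV_continuous_on) auto

text \<open>The original time as a function of the new one; \<open>tau\<close> is its inverse. Its
  range is bounded, since \<open>amp\<close> grows exponentially, and the supremum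
  \<open>life\<close> of the range is the blow-up time.\<close>

definition clock :: "real \<Rightarrow> real" where
  "clock t = integral {0..t} (\<lambda>s. 1 / amp s ^ (p + 1))"

lemma clock_integrand_continuous: "continuous_on {0..} (\<lambda>s. 1 / amp s ^ (p + 1))"
  using amp_pos by (intro continuous_intros amp_continuous) (simp add: less_imp_neq[symmetric])

lemma clock_has_derivative:
  assumes "0 \<le> t" shows "(clock has_real_derivative 1 / amp t ^ (p + 1)) (at t within {0..})"
proof -
  have "(clock has_vector_derivative 1 / amp t ^ (p + 1)) (at t within {0..t + 1})"
    unfolding clock_def
    using assms by (intro integral_has_vector_derivative continuous_on_subset[OF clock_integrand_continuous]) auto
  moreover have "at t within {0..t+1} = at t within {0..}"
    by (rule at_within_nhd[of _ "{..<t+1}"]) auto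
  ultimately show ?thesis by (simp add: has_real_derivative_iff_has_vector_derivative)
qed

lemma clock_continuous: "continuous_on {0..} clock"
  using clock_has_derivative by (intro DERIV_continuous_on) auto

lemma at_within_0_infinity: "0 < (t::real) \<Longrightarrow> at t within {0..} = at t"
  by (rule at_within_interior) (simp add: interior_real_atLeast)

lemma clock_mvt:
  assumes "0 \<le> s" "s < t"
  shows "\<exists>z. s < z \<and> z < t \<and> clock t - clock s = (t - s) * (1 / amp z ^ (p + 1))"
proof -
  have "\<exists>z. s < z \<and> z < t \<and> clock t - clock s = (\<lambda>h. h * (1 / amp z ^ (p + 1))) (t - s)"
  proof (rule mvt[OF assms(2)])
    show "continuous_on {s..t} clock" using assms by (intro continuous_on_subset[OF clock_continuous]) auto
    fix z assume "s < z" "z < t"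
    then show "(clock has_derivative (\<lambda>h. h * (1 / amp z ^ (p + 1)))) (at z)"
      using clock_has_derivative[of z] assms at_within_0_infinity[of z] unfolding has_field_derivative_def
      by (simp only: less_imp_le less_le_trans mult.commute[of _ "1 / amp z ^ (p + 1)"] simp_thms)
  qed blast
  then show ?thesis by simp
qed

lemma clock_strict_mono: "0 \<le> s \<Longrightarrow> s < t \<Longrightarrow> clock s < clock t"
  using clock_mvt[of s t] amp_pos by (smt (verit) mult_pos_pos zero_less_divide_1_iff zero_less_power)

lemma clock_inj: "inj_on clock {0..}"
  using clock_strict_mono by (intro linorder_inj_onI') (auto simp: less_le)

lemma clock_0: "clock 0 = 0" by (simp add: clock_def)

lemma clock_increment:
  assumes "0 \<le> s" "s < t"
  shows "(t - s) / (m * exp (t / real p + 1)) ^ (p + 1) \<le> clock t - clock s"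
    "clock t - clock s \<le> (t - s) / (m * exp (s / real p - 1)) ^ (p + 1)"
proof -
  obtain z where z: "s < z" "z < t" "clock t - clock s = (t - s) * (1 / amp z ^ (p + 1))"
    using clock_mvt[OF assms] by blast
  have "amp z \<le> m * exp (z / real p + 1)" using z assms by (intro amp_bounds(2)) auto
  also have "\<dots> \<le> m * exp (t / real p + 1)" using z m p by (simp add: divide_right_mono)
  finally have "amp z ^ (p + 1) \<le> (m * exp (t / real p + 1)) ^ (p + 1)" using amp_pos[of z] by (intro power_mono) auto
  then have "1 / (m * exp (t / real p + 1)) ^ (p + 1) \<le> 1 / amp z ^ (p + 1)"
    using amp_pos[of z] by (intro divide_left_mono mult_pos_pos zero_less_power) (auto simp: m)
  from mult_left_mono[OF this, of "t - s"] show "(t - s) / (m * exp (t / real p + 1)) ^ (p + 1) \<le> clock t - clock s"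
    using z(3) assms by simp
  have "m * exp (s / real p - 1) \<le> m * exp (z / real p - 1)" using z m p by (simp add: divide_right_mono)
  also have "\<dots> \<le> amp z" using z assms by (intro amp_bounds(1)) auto
  finally have "(m * exp (s / real p - 1)) ^ (p + 1) \<le> amp z ^ (p + 1)" using m by (intro power_mono) auto
  then have "1 / amp z ^ (p + 1) \<le> 1 / (m * exp (s / real p - 1)) ^ (p + 1)"
    using amp_pos[of z] by (intro divide_left_mono mult_pos_pos zero_less_power) (auto simp: m)
  from mult_left_mono[OF this, of "t - s"] show "clock t - clock s \<le> (t - s) / (m * exp (s / real p - 1)) ^ (p + 1)"
    using z(3) assms by simp
qed

lemma power_exp_shift: "(m * exp (t / real p + c)) ^ (p + 1) = (m * exp c) ^ (p + 1) * exp ((real p + 1) / real p * t)"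
proof -
  have "exp (t / real p) ^ (p + 1) = exp (real (p + 1) * (t / real p))" by (rule exp_of_nat_mult[symmetric])
  also have "real (p + 1) * (t / real p) = (real p + 1) / real p * t" by simp
  finally show ?thesis by (simp only: exp_add power_mult_distrib mult_ac)
qed

lemma clock_bounded: "bdd_above (clock ` {0..})"
proof -
  define q where "q = (real p + 1) / real p"
  have q: "0 < q" using p by (simp add: q_def)
  define c where "c = 1 / (m * exp (- 1)) ^ (p + 1)"
  have c: "0 < c" using m by (simp add: c_def)
  define G where "G s = - (c / q) * exp (- q * s)" for s
  have "clock t \<le> c / q" if t: "0 \<le> t" for t
  proof -
    have G: "((\<lambda>s. c * exp (- q * s)) has_integral (G t - G 0)) {0..t}"
    proof (rule fundamental_theorem_of_calculus[OF t])
      show "(G has_vector_derivative c * exp (- q * s)) (at s within {0..t})" for s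
        unfolding G_def has_real_derivative_iff_has_vector_derivative[symmetric]
        using q by (auto intro!: derivative_eq_intros)
    qed
    have "clock t \<le> integral {0..t} (\<lambda>s. c * exp (- q * s))"
      unfolding clock_def
    proof (rule integral_le)
      show "(\<lambda>s. 1 / amp s ^ (p + 1)) integrable_on {0..t}"
        by (intro integrable_continuous_real continuous_on_subset[OF clock_integrand_continuous]) auto
      show "(\<lambda>s. c * exp (- q * s)) integrable_on {0..t}" using G by (simp add: has_integral_iff)
      fix s assume s: "s \<in> {0..t}"
      have "(m * exp (s / real p + - 1)) ^ (p + 1) \<le> amp s ^ (p + 1)"
        using amp_bounds(1)[of s] s m by (intro power_mono) auto
      then have "1 / amp s ^ (p + 1) \<le> 1 / ((m * exp (- 1)) ^ (p + 1) * exp (q * s))"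
        unfolding power_exp_shift q_def using amp_pos[of s] m by (intro divide_left_mono mult_pos_pos) auto
      also have "\<dots> = c * exp (- q * s)" by (simp add: c_def exp_minus divide_inverse)
      finally show "1 / amp s ^ (p + 1) \<le> c * exp (- q * s)" .
    qed
    also have "\<dots> = G t - G 0" using G by (simp add: has_integral_iff)
    also have "\<dots> \<le> c / q" using c q by (simp add: G_def)
    finally show ?thesis .
  qed
  then show ?thesis by (auto intro!: bdd_aboveI[of _ "c / q"])
qed

definition life :: real where
  "life = (SUP t\<in>{0..}. clock t)"

lemma clock_less_life: assumes "0 \<le> t" shows "clock t < life"
proof -
  have "clock t < clock (t + 1)" using assms by (intro clock_strict_mono) auto
  also have "\<dots> \<le> life" unfolding life_def using assms by (intro cSUP_upper clock_bounded) auto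
  finally show ?thesis .
qed

text \<open>The unit interval from \<open>t\<close> to \<open>t + 1\<close> alone already
  contributes the right order \<open>exp (- (p + 1) t / p)\<close>. A lower bound is the direction
  required, because it turns decay in the new time into a positive power of the remaining life
  time.\<close>

lemma life_minus_clock:
  assumes "0 \<le> t"
  shows "exp (- ((real p + 1) / real p) * t) / (m * exp (1 / real p + 1)) ^ (p + 1) \<le> life - clock t"
proof -
  have "exp (- ((real p + 1) / real p) * t) / (m * exp (1 / real p + 1)) ^ (p + 1) = 1 / (m * exp ((t + 1) / real p + 1)) ^ (p + 1)"
  proof -
    have eq: "(t + 1) / real p + 1 = t / real p + (1 / real p + 1)" by (simp add: add_divide_distrib)
    show ?thesis
      unfolding eq power_exp_shift mult_minus_left exp_minus by (simp add: divide_inverse)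
  qed
  also have "\<dots> \<le> clock (t + 1) - clock t" using clock_increment(1)[of t "t + 1"] assms by simp
  also have "\<dots> \<le> life - clock t" using clock_less_life[of "t + 1"] assms by simp
  finally show ?thesis .
qed

lemma clock_surj:
  assumes "0 \<le> y" "y < life" shows "y \<in> clock ` {0..}"
proof -
  obtain t where t: "0 \<le> t" "y < clock t"
    using assms(2) less_cSUP_iff[OF _ clock_bounded] unfolding life_def by auto
  have "\<exists>x\<ge>0. x \<le> t \<and> clock x = y"
    using t assms clock_0 by (intro IVT' continuous_on_subset[OF clock_continuous]) auto
  then show ?thesis by auto
qed

definition tau :: "real \<Rightarrow> real" where
  "tau = inv_into {0..} clock"

lemma tau:
  assumes "0 \<le> y" "y < life" shows "0 \<le> tau y" "clock (tau y) = y"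
  using inv_into_into[OF clock_surj[OF assms]] f_inv_into_f[OF clock_surj[OF assms]] by (auto simp: tau_def)

lemma tau_clock: "0 \<le> t \<Longrightarrow> tau (clock t) = t"
  unfolding tau_def by (intro inv_into_f_f clock_inj) auto

lemma tau_0: "tau 0 = 0" using tau_clock[of 0] clock_0 by simp

lemma life_pos: "0 < life" using clock_less_life[of 0] clock_0 by simp

lemma tau_mono: "0 \<le> y \<Longrightarrow> y < z \<Longrightarrow> z < life \<Longrightarrow> tau y < tau z"
  using tau[of y] tau[of z] clock_strict_mono[of "tau z" "tau y"] by (smt (verit))

lemma tau_pos: "0 < y \<Longrightarrow> y < life \<Longrightarrow> 0 < tau y"
  using tau_mono[of 0 y] tau_0 by simp

text \<open>The inverse is continuous on the image of each compact interval, and every point below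
  \<open>life\<close> has a neighbourhood within \<open>{0..<life}\<close> that lies in such an
  image.\<close>

lemma tau_continuous: "continuous_on {0..<life} tau"
proof -
  have "continuous_on {0..<clock b} tau" if "0 \<le> b" for b
  proof (rule continuous_on_subset)
    show "continuous_on (clock ` {0..b}) tau"
      by (rule continuous_on_inv[OF continuous_on_subset[OF clock_continuous]]) (auto simp: tau_clock)
    show "{0..<clock b} \<subseteq> clock ` {0..b}"
    proof
      fix y assume "y \<in> {0..<clock b}"
      then have "0 \<le> tau y" "clock (tau y) = y" "y < clock b" using tau[of y] clock_less_life[OF that] by auto
      moreover then have "tau y \<le> b" using clock_strict_mono[OF that, of "tau y"] by force
      ultimately show "y \<in> clock ` {0..b}" by force
    qed
  qed
  note * = this
  show ?thesis
    unfolding continuous_on_eq_continuous_within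
  proof
    fix y assume y: "y \<in> {0..<life}"
    define b where "b = tau y + 1"
    have b: "0 \<le> b" "y < clock b" using y tau[of y] clock_strict_mono[of "tau y" b] by (auto simp: b_def)
    have "continuous (at y within {0..<clock b}) tau"
      using *[OF b(1)] y b by (simp add: continuous_on_eq_continuous_within)
    moreover have "at y within {0..<clock b} = at y within {0..<life}"
      by (rule at_within_nhd[of _ "{..<clock b}"]) (use b clock_less_life[OF b(1)] in auto)
    ultimately show "continuous (at y within {0..<life}) tau" by simp
  qed
qed

lemma tau_has_derivative:
  assumes "0 < y" "y < life" shows "(tau has_real_derivative amp (tau y) ^ (p + 1)) (at y)"
proof -
  have "(tau has_real_derivative inverse (1 / amp (tau y) ^ (p + 1))) (at y)"
  proof (rule DERIV_inverse_function[where f=clock and a=0 and b=life])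
    show "DERIV clock (tau y) :> 1 / amp (tau y) ^ (p + 1)"
      using clock_has_derivative[of "tau y"] tau_pos[OF assms] at_within_0_infinity by simp
    show "isCont tau y" using tau_continuous assms
      by (metis continuous_on_interior greaterThanLessThan_iff interior_atLeastLessThan)
    show "1 / amp (tau y) ^ (p + 1) \<noteq> 0" using amp_pos[of "tau y"] by simp
  qed (use assms tau in auto)
  then show ?thesis by simp
qed

end

section \<open>The classical solution\<close>

lemma fourier_coeff_0:
  assumes "(f has_integral I) {0..2 * pi / lam}"
  shows "fourier_coeff lam f 0 = complex_of_real (lam / (2 * pi) * I)"
proof -
  have "((\<lambda>x. complex_of_real (f x)) has_integral complex_of_real I) {0..2 * pi / lam}"
    using has_integral_linear[OF assms bounded_linear_of_real] by (simp add: o_def)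
  then show ?thesis by (simp add: fourier_coeff_def integral_unique)
qed

lemma powr_le_one_plus:
  fixes z :: real
  assumes "0 \<le> z" "0 \<le> a" "a \<le> 1" shows "z powr a \<le> 1 + z"
proof (cases "z \<le> 1")
  case True
  then have "z powr a \<le> 1 powr a" using assms by (intro powr_mono2) auto
  then show ?thesis using assms by simp
next
  case False
  then have "z powr a \<le> z powr 1" using assms by (intro powr_mono) auto
  then show ?thesis using False by simp
qed

lemma summable_int_powr:
  assumes "(s::real) < -1" shows "(\<lambda>n::int. \<bar>of_int n\<bar> powr s) summable_on UNIV"
  by (rule summable_on_int_real) (use assms summable_real_powr_iff[of s] in auto)

text \<open>Interpolation: \<open>(y n^2) powr a \<le> 1 + y n^2\<close> trades \<open>2 a\<close>
  further powers of decay in \<open>n\<close> for a factor \<open>y powr (- a)\<close>. With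
  \<open>y\<close> of the order of the time, the singularity is integrable for
  \<open>a < 1\<close>.\<close>

lemma decay_profile_le_powr:
  assumes "0 < y" "0 \<le> z" "0 \<le> a" "a \<le> 1" "n \<noteq> 0"
  shows "decay_profile y z n \<le> y powr (- a) * \<bar>of_int n\<bar> powr (- 2 - 2 * a)"
proof -
  define N where "N = \<bar>real_of_int n\<bar>"
  have N: "1 \<le> N" using assms(5) unfolding N_def by linarith
  have N2: "N powr 2 = N\<^sup>2" using N by simp
  have q: "1 / (8 * quad_sum) \<le> 1" "0 < 1 / (8 * quad_sum)" using quad_sum_ge_1 by simp_all
  have "(y * N\<^sup>2) powr a \<le> 1 + y * N\<^sup>2" using assms by (intro powr_le_one_plus) auto
  moreover have "(y * N\<^sup>2) powr a = y powr a * N powr (2 * a)"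
  proof -
    have "N\<^sup>2 powr a = N powr (2 * a)" unfolding N2[symmetric] by (rule powr_powr)
    then show ?thesis using assms(1) by (simp add: powr_mult)
  qed
  ultimately have 1: "y powr a * N powr (2 * a) \<le> 1 + y * N\<^sup>2" by simp
  have "N powr 2 * (y powr a * N powr (2 * a)) \<le> (1 + N\<^sup>2) * ((1 + y * N\<^sup>2) * exp (z * N))"
  proof (rule mult_mono)
    have "(1 + y * N\<^sup>2) * 1 \<le> (1 + y * N\<^sup>2) * exp (z * N)" using assms N by (intro mult_left_mono) auto
    then show "y powr a * N powr (2 * a) \<le> (1 + y * N\<^sup>2) * exp (z * N)" using 1 by simp
  qed (use N2 in auto)
  then have "1 / (8 * quad_sum) / ((1 + N\<^sup>2) * ((1 + y * N\<^sup>2) * exp (z * N))) \<le> 1 / (N powr 2 * (y powr a * N powr (2 * a)))"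
    using q assms N by (intro frac_le) (auto intro!: mult_pos_pos)
  also have "\<dots> = y powr (- a) * N powr (- 2 - 2 * a)"
    using N assms(1) by (simp add: powr_diff powr_minus divide_simps)
  finally show ?thesis by (simp add: decay_profile_def N_def)
qed

context flow_solution
begin

definition vjet :: "nat \<Rightarrow> real \<Rightarrow> real \<Rightarrow> real" where
  "vjet j x s = Re (fser lam ((dcoeff lam ^^ j) (sol phi s)) x)"

definition ujet :: "nat \<Rightarrow> real \<Rightarrow> real \<Rightarrow> real" where
  "ujet j x s = Re (fser lam ((dcoeff lam ^^ j) (u_coeff (sol phi s))) x)"

definition rjet :: "nat \<Rightarrow> real \<Rightarrow> real \<Rightarrow> real" where
  "rjet j x s = Re (fser lam ((dcoeff lam ^^ j) (rhs_coeff (sol phi s))) x)"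

text \<open>\<open>kk 0\<close> is the solution, \<open>kk j\<close> its \<open>j\<close>-th space derivative and \<open>kdot j\<close> the time derivative of \<open>kk j\<close>.\<close>

definition kk :: "nat \<Rightarrow> real \<Rightarrow> real \<Rightarrow> real" where
  "kk j x t = amp (tau t) * ujet j x (tau t)"

definition kdot :: "nat \<Rightarrow> real \<Rightarrow> real \<Rightarrow> real" where
  "kdot j x t = amp (tau t) ^ (p + 2) * rjet j x (tau t)"

abbreviation radius :: "real \<Rightarrow> real" where "radius s \<equiv> s0 + min s 1 / 4"

lemma radius_pos: "0 \<le> s \<Longrightarrow> 0 < s0 + s \<Longrightarrow> 0 < radius s"
  using s0 by (auto simp: min_def)

lemma radius_mono: "c \<le> s \<Longrightarrow> radius c \<le> radius s"
  by (simp add: min_def)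

lemma exp_radius_mono: "c \<le> s \<Longrightarrow> exp (- radius s * \<bar>of_int n\<bar>) \<le> exp (- radius c * \<bar>of_int n :: real\<bar>)"
  using radius_mono[of c s] by (simp add: mult_right_mono)

lemma sol_decay:
  assumes "0 \<le> c" "c \<le> s"
  shows "cmod (sol phi s n) \<le> rad * exp (- mu * s) * exp (- radius c * \<bar>of_int n\<bar>)"
proof -
  have s: "0 \<le> s" using assms by simp
  have "cmod (sol phi s n) \<le> rad * exp (- mu * s) * (wt 0 n * time_profile s0 s n)"
    using sol_dominated[OF s] by (simp add: dominated_def)
  also have "\<dots> \<le> rad * exp (- mu * s) * exp (- radius c * \<bar>of_int n\<bar>)"
    by (intro mult_left_mono order_trans[OF wt_time_profile_le[OF s0 s] exp_radius_mono[OF assms(2)]] rad_exp(2)) auto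
  finally show ?thesis .
qed

lemma u_coeff_decay:
  assumes "0 \<le> c" "c \<le> s"
  shows "cmod (u_coeff (sol phi s) n) \<le> 2 * exp (- radius c * \<bar>of_int n\<bar>)"
proof -
  have s: "0 \<le> s" using assms by simp
  show ?thesis
    using u_coeff_bound[OF s0 s sol_dominated_1[OF s], of n] exp_radius_mono[OF assms(2), of n] by linarith
qed

definition rhs_const :: real where
  "rhs_const = (SOME C. 0 \<le> C \<and> (\<forall>s\<ge>0. \<forall>n. cmod (rhs_coeff (sol phi s) n) \<le> C * exp (- radius s * \<bar>of_int n\<bar>)))"

lemma rhs_coeff_decay:
  assumes "0 \<le> c" "c \<le> s"
  shows "cmod (rhs_coeff (sol phi s) n) \<le> rhs_const * exp (- radius c * \<bar>of_int n\<bar>)" "0 \<le> rhs_const"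
proof -
  have s: "0 \<le> s" using assms by simp
  have "\<exists>C. 0 \<le> C \<and> (\<forall>s\<ge>0. \<forall>n. cmod (rhs_coeff (sol phi s) n) \<le> C * exp (- radius s * \<bar>of_int n\<bar>))"
    by (rule rhs_coeff_bound) (use s0 sol_dominated_1 in blast)
  from someI_ex[OF this] have *: "0 \<le> rhs_const" "cmod (rhs_coeff (sol phi s) n) \<le> rhs_const * exp (- radius s * \<bar>of_int n\<bar>)"
    using s unfolding rhs_const_def by blast+
  then show "0 \<le> rhs_const" "cmod (rhs_coeff (sol phi s) n) \<le> rhs_const * exp (- radius c * \<bar>of_int n\<bar>)"
    using mult_left_mono[OF exp_radius_mono[OF assms(2), of n] *(1)] by linarith+
qed

lemma jet_x_derivative:
  assumes "0 \<le> s" "0 < s0 + s"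
  shows "((\<lambda>x. ujet j x s) has_real_derivative ujet (Suc j) x s) (at x)"
    "((\<lambda>x. rjet j x s) has_real_derivative rjet (Suc j) x s) (at x)"
proof -
  note r = radius_pos[OF assms]
  note u = dcoeff_iterate_summable[OF u_coeff_decay[OF assms(1) order_refl] r]
  note h = dcoeff_iterate_summable[OF rhs_coeff_decay(1)[OF assms(1) order_refl] r]
  show "((\<lambda>x. ujet j x s) has_real_derivative ujet (Suc j) x s) (at x)"
    unfolding ujet_def using fser_has_real_derivative[of "(dcoeff lam ^^ j) (u_coeff (sol phi s))"] u[where lam=lam and j=j] u[where lam=lam and j="Suc j"] by simp
  show "((\<lambda>x. rjet j x s) has_real_derivative rjet (Suc j) x s) (at x)"
    unfolding rjet_def using fser_has_real_derivative[of "(dcoeff lam ^^ j) (rhs_coeff (sol phi s))"] h[where lam=lam and j=j] h[where lam=lam and j="Suc j"] by simp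
qed

lemma rjet_0:
  assumes "0 \<le> s" "0 < s0 + s" shows "rjet 0 x s = rhs_poly (\<lambda>j. ujet j x s)"
  unfolding rjet_def ujet_def using fser_rhs_coeff[OF s0 assms sol_dominated_1 sol_hermitian] assms(1) by simp

text \<open>The equation normalised to mean 1. At frequency 0 both sides vanish, because
  \<open>growth\<close> is the coefficient 0 of the right-hand side; that this coefficient is real
  follows from hermitian symmetry.\<close>

lemma sol_coeff_derivative:
  assumes "0 < s"
  shows "((\<lambda>s. u_coeff (sol phi s) n) has_vector_derivative (rhs_coeff (sol phi s) n - complex_of_real (growth s) * u_coeff (sol phi s) n)) (at s)"
proof -
  have s: "0 \<le> s" using assms by simp
  define Q where "Q n = quad_part p lam (sol phi s) n" for n
  have Q0: "complex_of_real (growth s) = complex_of_real (1 / real p) + Q 0"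
  proof -
    have "Q (- 0) = cnj (Q 0)" using tame_hermitian[OF tame_quad_part sol_hermitian[OF s]] unfolding Q_def hermitian_def by blast
    then have "Q 0 = complex_of_real (Re (Q 0))" by (metis Reals_cnj_iff minus_zero of_real_Re)
    then show ?thesis by (simp add: growth_def Q_def)
  qed
  show ?thesis
  proof (cases "n = 0")
    case True
    have "((\<lambda>s. 1 :: complex) has_vector_derivative 0) (at s)" by (rule has_vector_derivative_const)
    then have "((\<lambda>s. u_coeff (sol phi s) 0) has_vector_derivative 0) (at s)"
      by (rule has_vector_derivative_transform_within_open[OF _ open_greaterThan[of 0]])
        (use assms sol_0 in \<open>auto simp: u_coeff_def\<close>)
    moreover have "rhs_coeff (sol phi s) 0 - complex_of_real (growth s) * u_coeff (sol phi s) 0 = 0"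
      using sol_0[OF s] by (simp add: rhs_coeff_def u_coeff_def dcoeff_def Q0 Q_def)
    ultimately show ?thesis using True by simp
  next
    case False
    have "((\<lambda>s. sol phi s n) has_vector_derivative (- rate n *\<^sub>R sol phi s n + nonlin p lam (sol phi s) n)) (at s)"
      using sol_has_vector_derivative[OF adm s False] at_within_0_infinity[OF assms] by simp
    moreover have "- rate n *\<^sub>R sol phi s n + nonlin p lam (sol phi s) n = rhs_coeff (sol phi s) n - complex_of_real (growth s) * u_coeff (sol phi s) n"
    proof -
      have "dcoeff lam (dcoeff lam (sol phi s)) n = - complex_of_real (lam\<^sup>2 * (of_int n)\<^sup>2) * sol phi s n"
        by (simp add: dcoeff_def power2_eq_square algebra_simps)
      then show ?thesis
        unfolding Q0 using False by (simp add: rhs_coeff_def u_coeff_def nonlin_def Q_def rate_def scaleR_conv_of_real algebra_simps)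
    qed
    ultimately show ?thesis using False by (simp add: u_coeff_def)
  qed
qed

lemma ujet_s_derivative:
  assumes "0 < s"
  shows "((\<lambda>s. ujet j x s) has_real_derivative rjet j x s - growth s * ujet j x s) (at s)"
proof -
  \<comment> \<open>Termwise differentiation needs one majorant for all times near \<open>s\<close>;
    the analyticity radius reached at time \<open>s / 2\<close> is available at all later
    times.\<close>
  define c where "c = s / 2"
  have c: "0 < c" "s \<in> {c<..<s + 1}" using assms by (auto simp: c_def)
  have r: "0 < radius c" using radius_pos[of c] c s0 by auto
  define Kg where "Kg = 1 / real p + lip * rad\<^sup>2"
  have growth: "\<bar>growth y\<bar> \<le> Kg" if "c < y" for y
  proof -
    have "lip * rad\<^sup>2 * exp (- mu * y) \<le> lip * rad\<^sup>2 * 1" using lip(1) mu_pos that c by (intro mult_left_mono) auto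
    moreover have "\<bar>growth y\<bar> \<le> \<bar>growth y - 1 / real p\<bar> + \<bar>1 / real p\<bar>" by linarith
    ultimately show ?thesis using growth_bound[of y] that c by (simp add: Kg_def)
  qed
  define a' where "a' y n = rhs_coeff (sol phi y) n - complex_of_real (growth y) * u_coeff (sol phi y) n" for y n
  have a': "cmod (a' y n) \<le> (rhs_const + Kg * 2) * exp (- radius c * \<bar>of_int n\<bar>)" if "c < y" for y n
  proof -
    have "cmod (a' y n) \<le> cmod (rhs_coeff (sol phi y) n) + \<bar>growth y\<bar> * cmod (u_coeff (sol phi y) n)"
      unfolding a'_def by (metis norm_mult norm_of_real norm_triangle_ineq4)
    also have "\<dots> \<le> rhs_const * exp (- radius c * \<bar>of_int n\<bar>) + Kg * (2 * exp (- radius c * \<bar>of_int n\<bar>))"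
      using that c growth[OF that] by (intro add_mono mult_mono rhs_coeff_decay u_coeff_decay) auto
    finally show ?thesis by (simp add: algebra_simps)
  qed
  have "((\<lambda>s. Re (fser lam ((dcoeff lam ^^ j) (u_coeff (sol phi s))) x)) has_real_derivative Re (fser lam ((dcoeff lam ^^ j) (a' s)) x)) (at s)"
  proof (rule fser_has_real_derivative_param[OF _ _ _ _ c(2)])
    fix n y assume y: "y \<in> {c<..<s + 1}"
    show "((\<lambda>s. (dcoeff lam ^^ j) (u_coeff (sol phi s)) n) has_vector_derivative (dcoeff lam ^^ j) (a' y) n) (at y)"
      unfolding dcoeff_iterate a'_def using y c
      by (intro bounded_linear.has_vector_derivative[OF bounded_linear_mult_right] sol_coeff_derivative) auto
    show "cmod ((dcoeff lam ^^ j) (a' y) n) \<le> (rhs_const + Kg * 2) * \<bar>lam\<bar> ^ j * (\<bar>of_int n\<bar> ^ j * exp (- radius c * \<bar>of_int n\<bar>))"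
      using y by (intro dcoeff_iterate_bound a') auto
  next
    fix y assume y: "y \<in> {c<..<s + 1}"
    show "coeff_summable ((dcoeff lam ^^ j) (u_coeff (sol phi y)))"
      by (rule dcoeff_iterate_summable[OF u_coeff_decay r]) (use y c in auto)
  qed (intro summable_on_cmult_right summable_exp_decay r)
  moreover have "Re (fser lam ((dcoeff lam ^^ j) (a' s)) x) = rjet j x s - growth s * ujet j x s"
  proof -
    have "(dcoeff lam ^^ j) (a' s) = (\<lambda>n. (dcoeff lam ^^ j) (rhs_coeff (sol phi s)) n + complex_of_real (- growth s) * (dcoeff lam ^^ j) (u_coeff (sol phi s)) n)"
      by (auto simp: dcoeff_iterate a'_def algebra_simps)
    moreover have "coeff_summable ((dcoeff lam ^^ j) (rhs_coeff (sol phi s)))" "coeff_summable ((dcoeff lam ^^ j) (u_coeff (sol phi s)))"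
      using c by (auto intro!: dcoeff_iterate_summable[OF rhs_coeff_decay(1) r] dcoeff_iterate_summable[OF u_coeff_decay r])
    ultimately show ?thesis
      by (simp only: fser_add coeff_summable_cmult fser_cmult rjet_def ujet_def) simp
  qed
  ultimately show ?thesis unfolding ujet_def by simp
qed

lemma coeff_continuous:
  "continuous_on {0..} (\<lambda>s. u_coeff (sol phi s) n)" "continuous_on {0..} (\<lambda>s. rhs_coeff (sol phi s) n)"
  unfolding u_coeff_def rhs_coeff_def dcoeff_def
  by (intro continuous_intros sol_continuous quad_part_continuous)+

lemma jet_continuous:
  assumes "0 \<le> c" "0 < s0 + c"
  shows "continuous_on (UNIV \<times> {c..}) (\<lambda>(x, s). ujet j x s)" "continuous_on (UNIV \<times> {c..}) (\<lambda>(x, s). rjet j x s)"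
proof -
  note r = radius_pos[OF assms]
  have sum: "(\<lambda>n::int. C * \<bar>lam\<bar> ^ j * (\<bar>of_int n\<bar> ^ j * exp (- radius c * \<bar>of_int n\<bar>))) summable_on UNIV" for C
    by (intro summable_on_cmult_right summable_exp_decay r)
  have cont: "continuous_on {c..} (\<lambda>s. (dcoeff lam ^^ j) (u_coeff (sol phi s)) n)" "continuous_on {c..} (\<lambda>s. (dcoeff lam ^^ j) (rhs_coeff (sol phi s)) n)" for n
    unfolding dcoeff_iterate using assms(1)
    by (auto intro!: continuous_on_mult continuous_on_const continuous_on_subset[OF coeff_continuous(1)] continuous_on_subset[OF coeff_continuous(2)])
  show "continuous_on (UNIV \<times> {c..}) (\<lambda>(x, s). ujet j x s)"
    unfolding ujet_def
    by (rule fser_continuous[OF cont(1) _ sum[of 2]], rule dcoeff_iterate_bound[OF u_coeff_decay]) (use assms in auto)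
  show "continuous_on (UNIV \<times> {c..}) (\<lambda>(x, s). rjet j x s)"
    unfolding rjet_def
    by (rule fser_continuous[OF cont(2) _ sum[of rhs_const]], rule dcoeff_iterate_bound[OF rhs_coeff_decay(1)]) (use assms in auto)
qed

text \<open>Continuity down to time 0, where there may be no analyticity radius: without derivatives
  the inverse quadratic weights are a summable majorant.\<close>

lemma ujet_0_continuous: "continuous_on (UNIV \<times> {0..}) (\<lambda>(x, s). ujet 0 x s)"
proof -
  have P: "profile (time_profile 0 0)" by (rule profile_time_profile) auto
  have "continuous_on (UNIV \<times> {0..}) (\<lambda>(x, s). Re (fser lam (sol phi s) x))"
  proof (rule fser_continuous[OF sol_continuous, where g="\<lambda>n. rad * time_profile 0 0 n"])
    show "cmod (sol phi s n) \<le> rad * time_profile 0 0 n" if "s \<in> {0..}" for n s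
      using decaying_path_static[OF decaying_path_sol[OF adm] s0, of s] that by (simp add: dominated_def)
    show "(\<lambda>n. rad * time_profile 0 0 n) summable_on UNIV"
      using P by (intro summable_on_cmult_right) (simp add: profile_def)
  qed
  then have "continuous_on (UNIV \<times> {0..}) (\<lambda>z. 1 + Re (fser lam (sol phi (snd z)) (fst z)))"
    by (intro continuous_on_add continuous_on_const) (simp add: case_prod_unfold)
  moreover have "ujet 0 x s = 1 + Re (fser lam (sol phi s) x)" if "0 \<le> s" for x s
  proof -
    have "coeff_summable (sol phi s)"
      by (rule summable_on_comparison_test[of "\<lambda>n. rad * time_profile 0 0 n"])
        (use decaying_path_static[OF decaying_path_sol[OF adm] s0 that] P in \<open>auto simp: dominated_def profile_def intro: summable_on_cmult_right\<close>)
    then show ?thesis by (simp add: ujet_def fser_u_coeff)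
  qed
  ultimately show ?thesis
    by (subst continuous_on_cong[OF refl, where g="\<lambda>z. 1 + Re (fser lam (sol phi (snd z)) (fst z))"]) auto
qed

lemma sol_coeff_summable: assumes "0 \<le> s" shows "coeff_summable (sol phi s)"
proof (rule summable_on_comparison_test[of "\<lambda>n. rad * time_profile 0 0 n"])
  show "(\<lambda>n. rad * time_profile 0 0 n) summable_on UNIV"
    using profile_time_profile[of 0 0] by (intro summable_on_cmult_right) (simp add: profile_def)
qed (use decaying_path_static[OF decaying_path_sol[OF adm] s0 assms] in \<open>auto simp: dominated_def\<close>)

lemma ujet_vjet:
  assumes "0 \<le> s" shows "ujet j x s = vjet j x s + (if j = 0 then 1 else 0)"
proof (cases j)
  case 0
  then show ?thesis using fser_u_coeff[OF sol_coeff_summable[OF assms]] by (simp add: ujet_def vjet_def)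
next
  case (Suc i)
  have "(dcoeff lam ^^ j) (u_coeff (sol phi s)) n = (dcoeff lam ^^ j) (sol phi s) n" for n
    unfolding dcoeff_iterate u_coeff_def using Suc by (cases "n = 0") auto
  then have "(dcoeff lam ^^ j) (u_coeff (sol phi s)) = (dcoeff lam ^^ j) (sol phi s)" by blast
  then show ?thesis using Suc unfolding ujet_def vjet_def by simp
qed

lemma vjet_decay:
  assumes "0 \<le> c" "c \<le> s" "0 < s0 + c"
  shows "\<bar>vjet j x s\<bar> \<le> exp (- mu * s) * (rad * (\<bar>lam\<bar> ^ j * (\<Sum>\<^sub>\<infinity>n::int. \<bar>of_int n\<bar> ^ j * exp (- radius c * \<bar>of_int n\<bar>))))"
proof -
  have "cmod (fser lam ((dcoeff lam ^^ j) (sol phi s)) x) \<le>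
      (\<Sum>\<^sub>\<infinity>n::int. rad * exp (- mu * s) * \<bar>lam\<bar> ^ j * (\<bar>of_int n\<bar> ^ j * exp (- radius c * \<bar>of_int n\<bar>)))"
    using assms by (intro norm_fser_le dcoeff_iterate_bound sol_decay summable_on_cmult_right summable_exp_decay radius_pos) auto
  also have "\<dots> = exp (- mu * s) * (rad * (\<bar>lam\<bar> ^ j * (\<Sum>\<^sub>\<infinity>n::int. \<bar>of_int n\<bar> ^ j * exp (- radius c * \<bar>of_int n\<bar>))))"
    unfolding infsum_cmult_right' by simp
  finally show ?thesis using abs_Re_le_cmod order_trans unfolding vjet_def by blast
qed

text \<open>A profile has total mass at most 1 and \<open>rad \<le> 1 / 2\<close>. This keeps the
  solution positive and comparable to its mean.\<close>

lemma vjet_0_bound: assumes "0 \<le> s" shows "\<bar>vjet 0 x s\<bar> \<le> 1 / 2"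
proof -
  have P: "profile (time_profile 0 0)" by (rule profile_time_profile) auto
  have "cmod (fser lam (sol phi s) x) \<le> (\<Sum>\<^sub>\<infinity>n. rad * time_profile 0 0 n)"
    using decaying_path_static[OF decaying_path_sol[OF adm] s0 assms] P
    by (intro norm_fser_le summable_on_cmult_right) (auto simp: dominated_def profile_def)
  also have "\<dots> = rad * infsum (time_profile 0 0) UNIV" by (rule infsum_cmult_right')
  also have "\<dots> \<le> rad * 1" using P rad(1) by (intro mult_left_mono) (auto simp: profile_def)
  finally show ?thesis using rad(2) abs_Re_le_cmod[of "fser lam (sol phi s) x"] by (simp add: vjet_def)
qed

lemma kk_0_bounds:
  assumes "0 \<le> t" "t < life"
  shows "amp (tau t) / 2 \<le> kk 0 x t" "kk 0 x t \<le> 2 * amp (tau t)"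
proof -
  have "\<bar>ujet 0 x (tau t) - 1\<bar> \<le> 1 / 2" using vjet_0_bound[of "tau t" x] ujet_vjet[of "tau t" 0 x] tau(1)[OF assms] by simp
  then have "1 / 2 \<le> ujet 0 x (tau t)" "ujet 0 x (tau t) \<le> 2" by linarith+
  from mult_left_mono[OF this(1), of "amp (tau t)"] mult_left_mono[OF this(2), of "amp (tau t)"]
  show "amp (tau t) / 2 \<le> kk 0 x t" "kk 0 x t \<le> 2 * amp (tau t)" using amp_pos[of "tau t"] by (simp_all add: kk_def)
qed

lemma kk_0_pos: "0 \<le> t \<Longrightarrow> t < life \<Longrightarrow> 0 < kk 0 x t"
  using kk_0_bounds(1)[of t x] amp_pos[of "tau t"] by linarith

lemma kk_0_blowup: "\<exists>t1. 0 \<le> t1 \<and> t1 < life \<and> (\<forall>t x. t1 < t \<and> t < life \<longrightarrow> M < kk 0 x t)"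
proof -
  \<comment> \<open>Chosen so that \<open>m * exp (B / p - 1) \<ge> 2 * (\<bar>M\<bar> + 1)\<close>;
    half of the amplitude then exceeds \<open>M\<close> from time \<open>clock B\<close> on.\<close>
  define B where "B = real p * (\<bar>ln (2 * (\<bar>M\<bar> + 1) / m)\<bar> + 1)"
  have B: "0 \<le> B" by (simp add: B_def)
  have "M < kk 0 x t" if t: "clock B < t" "t < life" for x t
  proof -
    have t0: "0 \<le> t" using t clock_strict_mono[of 0 B] clock_0 B by (cases "B = 0") auto
    have "\<not> tau t < B" using clock_strict_mono[of "tau t" B] tau[OF t0 t(2)] t(1) by auto
    then have "B / real p \<le> tau t / real p" by (intro divide_right_mono) auto
    then have "\<bar>ln (2 * (\<bar>M\<bar> + 1) / m)\<bar> \<le> tau t / real p - 1" using p by (simp add: B_def)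
    then have "exp (ln (2 * (\<bar>M\<bar> + 1) / m)) \<le> exp (tau t / real p - 1)" by simp
    then have "2 * (\<bar>M\<bar> + 1) / m \<le> exp (tau t / real p - 1)" using m by simp
    then have "2 * (\<bar>M\<bar> + 1) \<le> m * exp (tau t / real p - 1)" using m by (simp add: field_simps)
    also have "\<dots> \<le> amp (tau t)" using tau(1)[OF t0 t(2)] by (rule amp_bounds(1))
    finally show ?thesis using kk_0_bounds(1)[OF t0 t(2), of x] by simp
  qed
  moreover have "0 \<le> clock B" using clock_strict_mono[of 0 B] clock_0 B by (cases "B = 0") auto
  ultimately show ?thesis using clock_less_life[OF B] by blast
qed

lemma amp_tau_bound:
  assumes "0 \<le> t" "t \<le> T'" "T' < life" shows "amp (tau t) \<le> m * exp (tau T' / real p + 1)"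
proof -
  have "tau t \<le> tau T'" using tau_mono[of t T'] assms by (cases "t = T'") auto
  then have "m * exp (tau t / real p + 1) \<le> m * exp (tau T' / real p + 1)" using m by (simp add: divide_right_mono)
  then show ?thesis using amp_bounds(2)[of "tau t"] tau(1)[of t] assms by linarith
qed

lemma kk_x_derivative:
  assumes "0 \<le> t" "t < life" "0 < s0 + t"
  shows "((\<lambda>x. kk j x t) has_real_derivative kk (Suc j) x t) (at x)"
    "((\<lambda>x. kdot j x t) has_real_derivative kdot (Suc j) x t) (at x)"
proof -
  have "0 \<le> tau t" "0 < s0 + tau t" using tau(1)[OF assms(1,2)] s0 assms tau_pos[of t] by (cases "t = 0"; force)+
  note jet_x_derivative[OF this]
  then show "((\<lambda>x. kk j x t) has_real_derivative kk (Suc j) x t) (at x)"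
    "((\<lambda>x. kdot j x t) has_real_derivative kdot (Suc j) x t) (at x)"
    unfolding kk_def kdot_def by (intro DERIV_cmult; blast)+
qed

text \<open>The growth of \<open>amp\<close> cancels the term subtracted in the normalised equation,
  and the factor \<open>amp ^ (p + 1)\<close> from \<open>tau\<close> raises \<open>amp\<close> to
  the power \<open>p + 2\<close>, the degree of homogeneity of the right-hand side.\<close>

lemma kk_t_derivative:
  assumes "0 < t" "t < life"
  shows "((\<lambda>t. kk j x t) has_real_derivative kdot j x t) (at t)"
proof -
  note s = tau_pos[OF assms]
  have "((\<lambda>s. amp s * ujet j x s) has_real_derivative amp (tau t) * rjet j x (tau t)) (at (tau t))"
  proof -
    have "(amp has_real_derivative growth (tau t) * amp (tau t)) (at (tau t))"
      using amp_has_derivative[of "tau t"] s at_within_0_infinity[OF s] by simp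
    from DERIV_mult[OF this ujet_s_derivative[OF s, of j x]] show ?thesis
      by (rule DERIV_cong) (simp add: algebra_simps)
  qed
  from DERIV_chain2[OF this tau_has_derivative[OF assms]] show ?thesis
    unfolding kk_def kdot_def by (rule DERIV_cong) (simp add: mult_ac)
qed

lemma kdot_0:
  assumes "0 \<le> t" "t < life" "0 < s0 + t" shows "kdot 0 x t = rhs_poly (\<lambda>j. kk j x t)"
proof -
  have "0 \<le> tau t" "0 < s0 + tau t" using tau(1)[OF assms(1,2)] s0 assms tau_pos[of t] by (cases "t = 0"; force)+
  then show ?thesis unfolding kdot_def kk_def rhs_poly_scale using rjet_0 by simp
qed

lemma compose_tau_continuous:
  assumes "continuous_on (UNIV \<times> S) (\<lambda>(x, s). f x s)" "I \<subseteq> {0..<life}" "tau ` I \<subseteq> S" "S \<subseteq> {0..}"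
  shows "continuous_on (UNIV \<times> I) (\<lambda>(x, t). amp (tau t) ^ i * f x (tau t))"
proof -
  have t: "continuous_on (UNIV \<times> I) (\<lambda>z. tau (snd z))"
    by (rule continuous_on_compose2[OF continuous_on_subset[OF tau_continuous assms(2)]]) (auto intro: continuous_intros)
  have a: "continuous_on (UNIV \<times> I) (\<lambda>z. amp (tau (snd z)))"
    by (rule continuous_on_compose2[OF amp_continuous t]) (use assms(3,4) in fastforce)
  have f: "continuous_on (UNIV \<times> I) (\<lambda>z. (\<lambda>(x, s). f x s) (fst z, tau (snd z)))"
    by (rule continuous_on_compose2[OF assms(1) continuous_on_Pair[OF _ t]]) (use assms(3) in \<open>auto intro: continuous_intros\<close>)
  show ?thesis using continuous_on_mult[OF continuous_on_power[OF a] f] by (simp add: case_prod_unfold)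
qed

lemma continuous_on_open_right_half:
  assumes "\<And>c. 0 < c \<Longrightarrow> continuous_on (UNIV \<times> {c..}) f"
  shows "continuous_on (UNIV \<times> {0<..} :: (real \<times> real) set) f"
proof -
  have "continuous (at (x, s)) f" if "0 < s" for x s
  proof (rule continuous_on_interior[OF assms[of "s / 2"]])
    show "(x, s) \<in> interior (UNIV \<times> {s / 2..})" using that by (simp add: interior_Times interior_real_atLeast)
  qed (use that in auto)
  then show ?thesis by (auto intro!: continuous_at_imp_continuous_on)
qed

lemma kk_continuous:
  "continuous_on (UNIV \<times> {0<..<life}) (\<lambda>(x, t). kk j x t)"
  "continuous_on (UNIV \<times> {0<..<life}) (\<lambda>(x, t). kdot j x t)"
  "continuous_on (UNIV \<times> {0..<life}) (\<lambda>(x, t). kk 0 x t)"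
  "0 < s0 \<Longrightarrow> continuous_on (UNIV \<times> {0..<life}) (\<lambda>(x, t). kk j x t)"
proof -
  have u: "continuous_on (UNIV \<times> {0<..}) (\<lambda>(x, s). ujet j x s)" and r: "continuous_on (UNIV \<times> {0<..}) (\<lambda>(x, s). rjet j x s)"
    using jet_continuous s0 by (intro continuous_on_open_right_half; fastforce)+
  have sub: "tau ` {0<..<life} \<subseteq> {0<..}" "tau ` {0..<life} \<subseteq> {0..}" using tau_pos tau(1) by auto
  show "continuous_on (UNIV \<times> {0<..<life}) (\<lambda>(x, t). kk j x t)"
    using compose_tau_continuous[OF u _ sub(1), of 1] by (force simp: kk_def)
  show "continuous_on (UNIV \<times> {0<..<life}) (\<lambda>(x, t). kdot j x t)"
    using compose_tau_continuous[OF r _ sub(1), of "p + 2"] by (force simp: kdot_def)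
  show "continuous_on (UNIV \<times> {0..<life}) (\<lambda>(x, t). kk 0 x t)"
    using compose_tau_continuous[OF ujet_0_continuous _ sub(2), of 1] by (simp add: kk_def)
  show "continuous_on (UNIV \<times> {0..<life}) (\<lambda>(x, t). kk j x t)" if "0 < s0"
    using compose_tau_continuous[OF jet_continuous(1)[of 0 j] _ sub(2), of 1] that by (simp add: kk_def)
qed

lemma jet_periodic: "kk j (x + 2 * pi / lam) t = kk j x t"
  using fser_periodic[of lam] lam_pos by (simp add: kk_def ujet_def)

lemma kk_classical_solution: "classical_solution p lam life (\<lambda>x. kk 0 x 0) (kk 0)"
  unfolding classical_solution_def
proof (intro conjI exI ballI allI)
  show "periodic_fun_simple (\<lambda>\<theta>. kk 0 \<theta> t) (2 * pi / lam)" for t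
    by unfold_locales (rule jet_periodic)
  show "continuous_on (UNIV \<times> {0..<life}) (\<lambda>(\<theta>, t). kk 0 \<theta> t)" by (rule kk_continuous)
  show "continuous_on (UNIV \<times> {0<..<life}) (\<lambda>(\<theta>, t). kdot 0 \<theta> t)" by (rule kk_continuous)
  show "continuous_on (UNIV \<times> {0<..<life}) (\<lambda>(\<theta>, t). kk 1 \<theta> t)" by (rule kk_continuous)
  show "continuous_on (UNIV \<times> {0<..<life}) (\<lambda>(\<theta>, t). kk 2 \<theta> t)" by (rule kk_continuous)
  fix x t assume t: "t \<in> {0<..<life}"
  then have t': "0 \<le> t" "t < life" "0 < s0 + t" "0 < t" using s0 by auto
  show "((\<lambda>s. kk 0 x s) has_real_derivative kdot 0 x t) (at t)" using kk_t_derivative t' by blast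
  show "((\<lambda>x. kk 0 x t) has_real_derivative kk 1 x t) (at x)" using kk_x_derivative(1)[OF t'(1-3), of 0] by simp
  show "((\<lambda>x. kk 1 x t) has_real_derivative kk 2 x t) (at x)" using kk_x_derivative(1)[OF t'(1-3), of 1] by (simp add: numeral_2_eq_2)
  define y where "y = kk 0 x t"
  have y: "0 < y" unfolding y_def by (rule kk_0_pos[OF t'(1,2)])
  have 1: "y\<^sup>2 * y ^ (p - 1) = y ^ (p + 1)" using p by (simp flip: power_add)
  have 2: "y\<^sup>2 * y powi (int p - 2) = y ^ p"
    using y power_int_add[of y 2 "int p - 2"] by (simp add: power_int_of_nat flip: power_int_numeral)
  have "kdot 0 x t = y\<^sup>2 * y ^ (p - 1) * kk 2 x t + (real p - 1) * (y\<^sup>2 * y powi (int p - 2)) * (kk 1 x t)\<^sup>2 + 1 / real p * (y\<^sup>2 * y ^ p)"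
    unfolding 1 2 kdot_0[OF t'(1-3)] rhs_poly_def y_def[symmetric] by (simp add: power_add power2_eq_square)
  then show "kdot 0 x t = (kk 0 x t)\<^sup>2 * (kk 0 x t ^ (p - 1) * kk 2 x t + (real p - 1) * kk 0 x t powi (int p - 2) * (kk 1 x t)\<^sup>2 + 1 / real p * kk 0 x t ^ p)"
    by (simp add: y_def algebra_simps)
qed simp

lemma kk_mean:
  assumes "0 \<le> t" "t < life" shows "Re (fourier_coeff lam (\<lambda>x. kk 0 x t) 0) = amp (tau t)"
proof -
  have s: "0 \<le> tau t" by (rule tau(1)[OF assms])
  have cu: "coeff_summable (u_coeff (sol phi (tau t)))"
    unfolding u_coeff_def by (intro coeff_summable_add coeff_summable_single sol_coeff_summable s)
  have "((\<lambda>x. amp (tau t) * Re (fser lam (u_coeff (sol phi (tau t))) x)) has_integral amp (tau t) * (2 * pi / lam * Re (u_coeff (sol phi (tau t)) 0))) {0..2 * pi / lam}"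
    by (intro has_integral_mult_right fser_mean cu lam_pos)
  then have "((\<lambda>x. kk 0 x t) has_integral amp (tau t) * (2 * pi / lam)) {0..2 * pi / lam}"
    by (simp add: kk_def ujet_def u_coeff_def sol_0[OF s])
  from fourier_coeff_0[OF this] lam_pos show ?thesis by simp
qed

lemma kk_analytic:
  assumes "0 < t" "t < life" shows "real_analytic (\<lambda>x. kk 0 x t)"
proof -
  have s: "0 < tau t" by (rule tau_pos[OF assms])
  have "real_analytic (\<lambda>x. Re (fser lam (\<lambda>n. complex_of_real (amp (tau t)) * u_coeff (sol phi (tau t)) n) x))"
  proof (rule fser_real_analytic)
    show "cmod (complex_of_real (amp (tau t)) * u_coeff (sol phi (tau t)) n) \<le> amp (tau t) * 2 * exp (- radius (tau t) * \<bar>of_int n\<bar>)" for n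
      using mult_left_mono[OF u_coeff_decay[of "tau t" "tau t" n], of "amp (tau t)"] s amp_pos[of "tau t"]
      by (simp add: norm_mult mult.assoc)
    show "0 < radius (tau t)" using radius_pos[of "tau t"] s s0 by simp
  qed
  then show ?thesis by (simp add: fser_cmult kk_def ujet_def)
qed

definition decay_exponent :: real where
  "decay_exponent = (lam\<^sup>2 - (real p + 2) / real p) * (real p / (real p + 1))"

lemma decay_exponent_pos: "0 < decay_exponent"
  unfolding decay_exponent_def using lam2 p by (intro mult_pos_pos) auto

lemma kk_decay:
  assumes "0 \<le> t0" "t0 < life" "0 < s0 + t0"
  shows "\<exists>E\<ge>0. \<forall>t x. t0 \<le> t \<and> t < life \<longrightarrow> \<bar>kk j x t - (if j = 0 then amp (tau t) else 0)\<bar> \<le> E * (life - t) powr decay_exponent"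
proof -
  define c where "c = tau t0"
  have c: "0 \<le> c" "0 < s0 + c" using tau(1)[OF assms(1,2)] s0 assms tau_pos[of t0] by (cases "t0 = 0"; force simp: c_def)+
  define S where "S = rad * (\<bar>lam\<bar> ^ j * (\<Sum>\<^sub>\<infinity>n::int. \<bar>of_int n\<bar> ^ j * exp (- radius c * \<bar>of_int n\<bar>)))"
  have S: "0 \<le> S" unfolding S_def using rad(1) by (intro mult_nonneg_nonneg infsum_nonneg) auto
  define L where "L = 1 / (m * exp (1 / real p + 1)) ^ (p + 1)"
  have L: "0 < L" using m by (simp add: L_def)
  define g where "g = decay_exponent"
  \<comment> \<open>Converts the rate \<open>mu - 1 / p\<close> in the new time into the exponent
    for \<open>life - t\<close>, which is at least \<open>L * exp (- (p + 1) s / p)\<close>.\<close>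
  have g: "(real p + 1) / real p * g = mu - 1 / real p"
  proof -
    have "(real p + 1) / real p * (real p / (real p + 1)) = 1" using p by simp
    then have "(real p + 1) / real p * g = lam\<^sup>2 - (real p + 2) / real p" unfolding g_def decay_exponent_def by (metis mult.left_commute mult.right_neutral)
    also have "\<dots> = mu - 1 / real p" by (simp add: rate_def diff_divide_distrib add_divide_distrib)
    finally show ?thesis .
  qed
  define E where "E = m * exp 1 * S / L powr g"
  have "\<bar>kk j x t - (if j = 0 then amp (tau t) else 0)\<bar> \<le> E * (life - t) powr g" if t: "t0 \<le> t" "t < life" for x t
  proof -
    have t0: "0 \<le> t" using t assms by simp
    define s where "s = tau t"
    have s: "0 \<le> s" "c \<le> s" "clock s = t" using tau[OF t0 t(2)] tau_mono[of t0 t] t assms by (cases "t = t0"; force simp: s_def c_def)+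
    have "\<bar>kk j x t - (if j = 0 then amp (tau t) else 0)\<bar> = amp s * \<bar>vjet j x s\<bar>"
      using ujet_vjet[OF s(1), of j x] amp_pos[of s] by (auto simp: kk_def s_def[symmetric] abs_mult algebra_simps)
    also have "\<dots> \<le> (m * exp (s / real p + 1)) * (exp (- mu * s) * S)"
      unfolding S_def by (intro mult_mono amp_bounds(2) s vjet_decay c) (auto simp: m less_imp_le)
    also have "\<dots> = m * exp 1 * S * exp (- (mu - 1 / real p) * s)"
      by (simp add: exp_add algebra_simps flip: exp_add)
    also have "\<dots> \<le> m * exp 1 * S * ((life - t) powr g / L powr g)"
    proof (rule mult_left_mono)
      have "exp (- ((real p + 1) / real p) * s) * L \<le> life - t"
        using life_minus_clock[OF s(1)] s(3) by (simp add: L_def)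
      then have "(exp (- ((real p + 1) / real p) * s) * L) powr g \<le> (life - t) powr g"
        using L decay_exponent_pos by (intro powr_mono2) (auto simp: g_def)
      moreover have "(exp (- ((real p + 1) / real p) * s) * L) powr g = exp (- (mu - 1 / real p) * s) * L powr g"
        unfolding g[symmetric] using L by (simp add: powr_mult exp_powr_real mult_ac)
      ultimately show "exp (- (mu - 1 / real p) * s) \<le> (life - t) powr g / L powr g"
        using L by (simp add: field_simps)
    qed (use m S in auto)
    finally show ?thesis by (simp add: E_def)
  qed
  moreover have "0 \<le> E" using m S by (simp add: E_def)
  ultimately show ?thesis unfolding g_def by blast
qed

text \<open>Coefficients of order \<open>n^(-2)\<close> do not make the data twice differentiable.
  Interpolation with exponent \<open>a\<close> needs \<open>j - 2 - 2 a < -1\<close>, that is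
  \<open>a > 1/2\<close> for \<open>j = 2\<close>. The choice \<open>a = 3/4\<close> there and
  \<open>a = 3/8\<close> for \<open>j = 1\<close>, where the square is taken, gives both terms of
  the equation the same integrable rate.\<close>

lemma kk_singular_bound:
  assumes "T' < life"
  shows "\<exists>H\<ge>0. \<forall>t x. 0 < t \<and> t \<le> T' \<longrightarrow> (kk 1 x t)\<^sup>2 \<le> H * t powr (- 3 / 4) \<and> \<bar>kk 2 x t\<bar> \<le> H * t powr (- 3 / 4)"
proof -
  define A where "A = m * exp (tau T' / real p + 1)"
  have A: "0 < A" using m by (simp add: A_def)
  \<comment> \<open>Makes \<open>c * t\<close> a lower bound for the weight parameter
    \<open>min s 1 / 4\<close> at \<open>s = tau t\<close>: \<open>clock_increment\<close> bounds
    \<open>s\<close> from below by a multiple of \<open>t\<close>, and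
    \<open>t / life \<le> 1\<close>.\<close>
  define c where "c = min ((m * exp (- 1)) ^ (p + 1)) (1 / life) / 4"
  have c: "0 < c" using m life_pos by (simp add: c_def)
  define B where "B j a = A * (\<bar>lam\<bar> ^ j * (\<Sum>\<^sub>\<infinity>n::int. \<bar>of_int n\<bar> powr (real j - 2 - 2 * a)))" for j a
  have B: "0 \<le> B j a" for j a unfolding B_def using A by (intro mult_nonneg_nonneg infsum_nonneg) auto
  have bound: "\<bar>kk j x t\<bar> \<le> B j a * (c * t) powr (- a)"
    if t: "0 < t" "t \<le> T'" and j: "0 < j" "0 \<le> a" "a \<le> 1" "real j - 2 - 2 * a < -1" for j a x t
  proof -
    define s where "s = tau t"
    have tl: "t < life" using t assms by simp
    have s: "0 < s" "clock s = t" using tau[of t] tau_pos[of t] t tl by (auto simp: s_def)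
    define y where "y = min s 1 / 4"
    have y: "0 < y" using s by (simp add: y_def)
    have "t \<le> s / (m * exp (0 / real p - 1)) ^ (p + 1)" using clock_increment(2)[of 0 s] s clock_0 by simp
    then have "(m * exp (- 1)) ^ (p + 1) * t \<le> s" using m by (simp add: field_simps)
    moreover have "1 / life * t \<le> 1" using tl life_pos by simp
    moreover have "4 * c * t \<le> (m * exp (- 1)) ^ (p + 1) * t" "4 * c * t \<le> 1 / life * t"
      using t by (intro mult_right_mono; simp add: c_def)+
    ultimately have cy: "c * t \<le> y" unfolding y_def by linarith
    have "cmod (fser lam ((dcoeff lam ^^ j) (sol phi s)) x) \<le> (\<Sum>\<^sub>\<infinity>n::int. \<bar>lam\<bar> ^ j * (y powr (- a) * \<bar>of_int n\<bar> powr (real j - 2 - 2 * a)))"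
    proof (rule norm_fser_le)
      show "(\<lambda>n::int. \<bar>lam\<bar> ^ j * (y powr (- a) * \<bar>of_int n\<bar> powr (real j - 2 - 2 * a))) summable_on UNIV"
        by (intro summable_on_cmult_right summable_int_powr j)
      fix n
      have "\<bar>of_int n\<bar> ^ j * cmod (sol phi s n) \<le> y powr (- a) * \<bar>of_int n\<bar> powr (real j - 2 - 2 * a)"
      proof (cases "n = 0")
        case True
        then show ?thesis using j by (simp add: zero_power)
      next
        case False
        have "cmod (sol phi s n) \<le> decay_profile y (s0 + y) n"
          using sol_dominated_1[of s] s(1) by (simp add: dominated_def time_profile_def y_def)
        also have "\<dots> \<le> y powr (- a) * \<bar>of_int n\<bar> powr (- 2 - 2 * a)"
          using y s0 j False by (intro decay_profile_le_powr) auto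
        finally have "\<bar>of_int n\<bar> ^ j * cmod (sol phi s n) \<le> \<bar>of_int n\<bar> powr real j * (y powr (- a) * \<bar>of_int n\<bar> powr (- 2 - 2 * a))"
          using False by (intro mult_mono) (auto simp: powr_realpow)
        also have "\<dots> = y powr (- a) * \<bar>of_int n\<bar> powr (real j - 2 - 2 * a)"
        proof -
          have eq: "real j - 2 - 2 * a = real j + (- 2 - 2 * a)" by simp
          show ?thesis unfolding eq powr_add by simp
        qed
        finally show ?thesis .
      qed
      then show "cmod ((dcoeff lam ^^ j) (sol phi s) n) \<le> \<bar>lam\<bar> ^ j * (y powr (- a) * \<bar>of_int n\<bar> powr (real j - 2 - 2 * a))"
        unfolding norm_dcoeff_iterate by (intro mult_left_mono) auto
    qed
    then have v: "\<bar>vjet j x s\<bar> \<le> y powr (- a) * (\<bar>lam\<bar> ^ j * (\<Sum>\<^sub>\<infinity>n::int. \<bar>of_int n\<bar> powr (real j - 2 - 2 * a)))"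
      using abs_Re_le_cmod[of "fser lam ((dcoeff lam ^^ j) (sol phi s)) x"] by (simp add: vjet_def infsum_cmult_right' mult_ac)
    have "\<bar>kk j x t\<bar> = amp s * \<bar>vjet j x s\<bar>"
      using ujet_vjet[of s j x] s j amp_pos[of s] by (simp add: kk_def s_def[symmetric] abs_mult)
    also have "\<dots> \<le> A * (y powr (- a) * (\<bar>lam\<bar> ^ j * (\<Sum>\<^sub>\<infinity>n::int. \<bar>of_int n\<bar> powr (real j - 2 - 2 * a))))"
      using amp_tau_bound[of t T'] t assms v A unfolding A_def s_def by (intro mult_mono) auto
    also have "\<dots> = B j a * y powr (- a)" by (simp add: B_def)
    also have "\<dots> \<le> B j a * (c * t) powr (- a)"
      using B c t cy j by (intro mult_left_mono powr_mono2') auto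
    finally show ?thesis .
  qed
  define H where "H = (B 1 (3/8))\<^sup>2 * c powr (- 3 / 4) + B 2 (3/4) * c powr (- 3 / 4)"
  have H0: "0 \<le> H" using B by (simp add: H_def)
  have "(kk 1 x t)\<^sup>2 \<le> H * t powr (- 3 / 4) \<and> \<bar>kk 2 x t\<bar> \<le> H * t powr (- 3 / 4)" if t: "0 < t" "t \<le> T'" for x t
  proof
    have p34: "(c * t) powr (- 3 / 4) = c powr (- 3 / 4) * t powr (- 3 / 4)" using c t by (simp add: powr_mult)
    have "\<bar>kk 1 x t\<bar> \<le> B 1 (3/8) * (c * t) powr (- (3/8))" by (rule bound[OF t]) auto
    then have "(kk 1 x t)\<^sup>2 \<le> (B 1 (3/8) * (c * t) powr (- (3/8)))\<^sup>2" by (simp add: abs_le_square_iff[symmetric] abs_mult B)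
    also have "\<dots> = (B 1 (3/8))\<^sup>2 * (c * t) powr (- 3 / 4)" by (simp add: power_mult_distrib power2_eq_square[of "_ powr _"] flip: powr_add)
    also have "\<dots> = (B 1 (3/8))\<^sup>2 * c powr (- 3 / 4) * t powr (- 3 / 4)" unfolding p34 by simp
    also have "\<dots> \<le> H * t powr (- 3 / 4)" using B by (intro mult_right_mono) (auto simp: H_def)
    finally show "(kk 1 x t)\<^sup>2 \<le> H * t powr (- 3 / 4)" .
    have "\<bar>kk 2 x t\<bar> \<le> B 2 (3/4) * (c * t) powr (- (3/4))" by (rule bound[OF t]) auto
    also have "\<dots> = B 2 (3/4) * c powr (- 3 / 4) * t powr (- 3 / 4)" using p34 by simp
    also have "\<dots> \<le> H * t powr (- 3 / 4)" using B by (intro mult_right_mono) (auto simp: H_def)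
    finally show "\<bar>kk 2 x t\<bar> \<le> H * t powr (- 3 / 4)" .
  qed
  then show ?thesis using H0 by blast
qed

lemma kk_initial:
  assumes "phi 0 = 0"
  shows "ujet j x 0 = Re (fser lam ((dcoeff lam ^^ j) (u_coeff phi)) x)" "kk j x 0 = m * ujet j x 0"
proof -
  have "sol phi 0 = phi" using sol_initial[OF adm] sol_0[of 0] assms by (metis order_refl ext)
  then show "ujet j x 0 = Re (fser lam ((dcoeff lam ^^ j) (u_coeff phi)) x)" by (simp add: ujet_def)
  show "kk j x 0 = m * ujet j x 0" by (simp add: kk_def tau_0 amp_0)
qed

text \<open>The bound involves \<open>m\<close> and \<open>p\<close> alone, so all approximating
  solutions with the same mean live at least this long.\<close>

lemma life_lower_bound: "1 / (m * exp (1 / real p + 1)) ^ (p + 1) \<le> life"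
  using life_minus_clock[of 0] clock_0 by simp

end

section \<open>Maximum principle, stability and derivative bounds\<close>

text \<open>Periodicity makes the set of contact points compact, so an earliest contact time exists.
  It is positive by the strict initial inequality, and \<open>w \<le> b\<close> holds at that time
  by continuity from the left.\<close>

lemma first_touch:
  fixes w :: "real \<Rightarrow> real \<Rightarrow> real" and b :: "real \<Rightarrow> real"
  assumes L: "0 < L" and per: "\<And>t. t \<in> {0..T} \<Longrightarrow> periodic_fun_simple (\<lambda>x. w x t) L"
    and cont: "continuous_on (UNIV \<times> {0..T}) (\<lambda>(x, t). w x t)" "continuous_on {0..T} b"
    and init: "\<And>x. w x 0 < b 0" and fail: "t1 \<in> {0..T}" "b t1 \<le> w x1 t1"
  obtains x0 t0 where "0 < t0" "t0 \<le> T" "w x0 t0 = b t0" "\<And>x. w x t0 \<le> b t0" "\<And>x s. 0 \<le> s \<Longrightarrow> s < t0 \<Longrightarrow> w x s < b s"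
proof -
  have red: "\<exists>y\<in>{0..L}. \<forall>t\<in>{0..T}. w y t = w x t" for x
  proof -
    define y where "y = x - of_int \<lfloor>x / L\<rfloor> * L"
    have "of_int \<lfloor>x / L\<rfloor> * L \<le> x" by (rule pos_le_divide_eq[THEN iffD1, OF L of_int_floor_le])
    moreover have "x < (of_int \<lfloor>x / L\<rfloor> + 1) * L" by (rule pos_divide_less_eq[THEN iffD1, OF L]) linarith
    ultimately have "y \<in> {0..L}" by (simp add: y_def algebra_simps)
    moreover have "w y t = w x t" if "t \<in> {0..T}" for t
    proof -
      interpret periodic_fun_simple "\<lambda>x. w x t" L by (rule per[OF that])
      show ?thesis unfolding y_def by (rule minus_of_int)
    qed
    ultimately show ?thesis by blast
  qed
  define D where "D = {0..L} \<times> {0..T}"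
  define f where "f z = w (fst z) (snd z) - b (snd z)" for z
  have f: "continuous_on D f"
    unfolding f_def
  proof (rule continuous_on_diff)
    show "continuous_on D (\<lambda>z. w (fst z) (snd z))"
      using continuous_on_subset[OF cont(1), of D] by (auto simp: D_def case_prod_unfold)
    show "continuous_on D (\<lambda>z. b (snd z))"
      by (rule continuous_on_compose2[OF cont(2)]) (auto simp: D_def intro: continuous_intros)
  qed
  have D: "compact D" unfolding D_def by (intro compact_Times) auto
  define K where "K = D \<inter> f -` {0..}"
  have "compact K" unfolding K_def
    using continuous_closed_preimage[OF f compact_imp_closed[OF D]] compact_Int_closed[OF D] by (metis Int_absorb closed_atLeast inf_assoc)
  moreover have "K \<noteq> {}"
  proof -
    obtain y where "y \<in> {0..L}" "\<forall>t\<in>{0..T}. w y t = w x1 t" using red by blast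
    then have "(y, t1) \<in> K" using fail by (simp add: K_def D_def f_def)
    then show ?thesis by blast
  qed
  moreover have "continuous_on K snd" by (intro continuous_intros)
  ultimately obtain z where z: "z \<in> K" "\<forall>y\<in>K. snd z \<le> snd y"
    using continuous_attains_inf[of K snd] by blast
  define x0 t0 where "x0 = fst z" and "t0 = snd z"
  have t0: "0 \<le> t0" "t0 \<le> T" "b t0 \<le> w x0 t0" using z(1) by (auto simp: K_def D_def f_def x0_def t0_def)
  have before: "w x s < b s" if "0 \<le> s" "s < t0" for x s
  proof (rule ccontr)
    assume "\<not> w x s < b s"
    moreover obtain y where "y \<in> {0..L}" "\<forall>t\<in>{0..T}. w y t = w x t" using red by blast
    ultimately have "(y, s) \<in> K" using that t0 by (auto simp: K_def D_def f_def)
    then show False using z(2) that by (force simp: t0_def)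
  qed
  have pos: "0 < t0" using t0 init[of x0] by (cases "t0 = 0") auto
  have le: "w x t0 \<le> b t0" for x
  proof -
    have "continuous_on {0..T} (\<lambda>s. w x s - b s)"
    proof (rule continuous_on_diff[OF _ cont(2)])
      show "continuous_on {0..T} (\<lambda>s. w x s)"
      proof -
        have "continuous_on {0..T} (\<lambda>s. (x, s))" by (intro continuous_intros)
        from continuous_on_compose2[OF cont(1) this] show ?thesis by auto
      qed
    qed
    then have "((\<lambda>s. w x s - b s) \<longlongrightarrow> w x t0 - b t0) (at t0 within {0..T})" using t0 by (auto simp: continuous_on_def)
    then have "((\<lambda>s. w x s - b s) \<longlongrightarrow> w x t0 - b t0) (at t0 within {0..<t0})"
      by (rule tendsto_within_subset) (use t0 in auto)
    moreover have "\<forall>\<^sub>F s in at t0 within {0..<t0}. w x s - b s \<le> 0"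
      using before by (auto simp: eventually_at_filter less_imp_le intro!: always_eventually)
    moreover have "at t0 within {0..<t0} \<noteq> bot"
      using pos by (simp add: at_within_eq_bot_iff trivial_limit_within islimpt_greaterThanLessThan2)
    ultimately have "w x t0 - b t0 \<le> 0" by (rule tendsto_upperbound)
    then show ?thesis by simp
  qed
  show ?thesis using that[OF pos t0(2) _ le before] le[of x0] t0(3) by force
qed

text \<open>If \<open>D\<close> were positive, \<open>f'\<close> would be positive just to the right
  of \<open>x0\<close>, and the mean value theorem would give a larger value of
  \<open>f\<close>.\<close>

lemma DERIV_global_max:
  fixes f :: "real \<Rightarrow> real"
  assumes "\<And>x. (f has_real_derivative f' x) (at x)" "(f' has_real_derivative D) (at x0)" "\<And>x. f x \<le> f x0"
  shows "f' x0 = 0" "D \<le> 0"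
proof -
  show z: "f' x0 = 0" by (rule DERIV_local_max[OF assms(1), of 1]) (use assms(3) in auto)
  show "D \<le> 0"
  proof (rule ccontr)
    assume "\<not> D \<le> 0"
    then obtain d where d: "0 < d" "\<And>h. 0 < h \<Longrightarrow> h < d \<Longrightarrow> 0 < f' (x0 + h)"
      using DERIV_pos_inc_right[OF assms(2)] z by force
    obtain y where y: "x0 < y" "y < x0 + d / 2" "f (x0 + d / 2) - f x0 = (x0 + d / 2 - x0) * f' y"
      using MVT2[of x0 "x0 + d / 2" f f'] assms(1) d by auto
    have "0 < f' y" using d(2)[of "y - x0"] y d(1) by auto
    then have "0 < d / 2 * f' y" using d(1) by simp
    then have "f x0 < f (x0 + d / 2)" using y(3) by simp
    then show False using assms(3)[of "x0 + d / 2"] by simp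
  qed
qed

text \<open>The differential inequality is demanded only at contact points that can be spatial
  maxima. Its strictness replaces the usual perturbation by epsilon: at the first contact
  \<open>w - b\<close> would be strictly decreasing in time, although it was negative just before
  and is 0 there.\<close>

lemma max_principle:
  fixes w wt wx wxx :: "real \<Rightarrow> real \<Rightarrow> real" and b b' :: "real \<Rightarrow> real"
  assumes L: "0 < L" and per: "\<And>t. t \<in> {0..T} \<Longrightarrow> periodic_fun_simple (\<lambda>x. w x t) L"
    and cont: "continuous_on (UNIV \<times> {0..T}) (\<lambda>(x, t). w x t)" "continuous_on {0..T} b"
    and init: "\<And>x. w x 0 < b 0"
    and deriv: "\<And>x t. t \<in> {0<..T} \<Longrightarrow> ((\<lambda>s. w x s) has_real_derivative wt x t) (at t)"
      "\<And>x t. t \<in> {0<..T} \<Longrightarrow> ((\<lambda>x. w x t) has_real_derivative wx x t) (at x)"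
      "\<And>x t. t \<in> {0<..T} \<Longrightarrow> ((\<lambda>x. wx x t) has_real_derivative wxx x t) (at x)"
      "\<And>t. t \<in> {0<..T} \<Longrightarrow> (b has_real_derivative b' t) (at t)"
    and touch: "\<And>x t. t \<in> {0<..T} \<Longrightarrow> w x t = b t \<Longrightarrow> wx x t = 0 \<Longrightarrow> wxx x t \<le> 0 \<Longrightarrow> wt x t < b' t"
    and t: "t \<in> {0..T}"
  shows "w x t < b t"
proof (rule ccontr)
  assume "\<not> w x t < b t"
  then obtain x0 t0 where 0: "0 < t0" "t0 \<le> T" "w x0 t0 = b t0" "\<And>x. w x t0 \<le> b t0" "\<And>x s. 0 \<le> s \<Longrightarrow> s < t0 \<Longrightarrow> w x s < b s"
    using first_touch[OF L per cont init t, of x] by (metis not_less)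
  have t0: "t0 \<in> {0<..T}" using 0 by simp
  have mx: "wx x0 t0 = 0" "wxx x0 t0 \<le> 0"
    using DERIV_global_max[of "\<lambda>x. w x t0" "\<lambda>x. wx x t0", OF deriv(2)[OF t0] deriv(3)[OF t0]] 0(3,4) by auto
  have D: "((\<lambda>s. w x0 s - b s) has_real_derivative wt x0 t0 - b' t0) (at t0)"
    by (intro DERIV_diff deriv t0)
  have "wt x0 t0 - b' t0 < 0" using touch[OF t0 0(3) mx] by simp
  from DERIV_neg_dec_left[OF D this] obtain d where d: "0 < d" "\<forall>h>0. h < d \<longrightarrow> w x0 t0 - b t0 < w x0 (t0 - h) - b (t0 - h)" by blast
  define h where "h = min d t0 / 2"
  have h: "0 < h" "h < d" "h < t0" using d 0(1) by (auto simp: h_def)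
  then have "0 < w x0 (t0 - h) - b (t0 - h)" using d(2) 0(3) by force
  then show False using 0(5)[of "t0 - h" x0] h by simp
qed

text \<open>The constant depends on \<open>n\<close> and not on \<open>j\<close>, so a single one
  serves the powers \<open>p\<close>, \<open>p + 1\<close> and \<open>p + 2\<close> in the
  equation.\<close>

lemma abs_power_diff_le:
  fixes x y :: real
  assumes "\<bar>x\<bar> \<le> K" "\<bar>y\<bar> \<le> K" "1 \<le> K" "j \<le> n"
  shows "\<bar>x ^ j - y ^ j\<bar> \<le> real n * K ^ n * \<bar>x - y\<bar>"
proof -
  have "\<bar>x ^ j - y ^ j\<bar> \<le> real j * K ^ j * \<bar>x - y\<bar>"
  proof (induction j)
    case (Suc j)
    have "x ^ Suc j - y ^ Suc j = x * (x ^ j - y ^ j) + (x - y) * y ^ j" by (simp add: algebra_simps)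
    then have "\<bar>x ^ Suc j - y ^ Suc j\<bar> \<le> \<bar>x\<bar> * \<bar>x ^ j - y ^ j\<bar> + \<bar>x - y\<bar> * \<bar>y\<bar> ^ j"
      by (metis abs_mult abs_triangle_ineq power_abs)
    also have "\<dots> \<le> K * (real j * K ^ j * \<bar>x - y\<bar>) + \<bar>x - y\<bar> * (K * K ^ j)"
    proof (intro add_mono mult_mono Suc.IH assms order_refl)
      have "\<bar>y\<bar> ^ j \<le> K ^ j" using assms by (intro power_mono) auto
      also have "\<dots> \<le> K * K ^ j" using assms by simp
      finally show "\<bar>y\<bar> ^ j \<le> K * K ^ j" .
    qed (use assms in auto)
    also have "\<dots> = real (Suc j) * K ^ Suc j * \<bar>x - y\<bar>" by (simp add: algebra_simps)
    finally show ?case .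
  qed simp
  also have "\<dots> \<le> real n * K ^ n * \<bar>x - y\<bar>"
    using assms by (intro mult_right_mono mult_mono power_increasing) auto
  finally show ?thesis .
qed

lemma classical_solution_positive_pde:
  assumes "(y::real) \<noteq> 0" "1 \<le> p"
  shows "y\<^sup>2 * (y ^ (p - 1) * q + (real p - 1) * y powi (int p - 2) * r\<^sup>2 + 1 / real p * y ^ p) =
    y ^ (p + 1) * q + (real p - 1) * y ^ p * r\<^sup>2 + y ^ (p + 2) / real p"
proof -
  have 1: "y\<^sup>2 * y ^ (p - 1) = y ^ (p + 1)" using assms(2) by (simp flip: power_add)
  have 2: "y\<^sup>2 * y powi (int p - 2) = y ^ p"
    using assms(1) power_int_add[of y 2 "int p - 2"] by (simp add: power_int_of_nat flip: power_int_numeral)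
  have "y\<^sup>2 * (y ^ (p - 1) * q + (real p - 1) * y powi (int p - 2) * r\<^sup>2 + 1 / real p * y ^ p) =
    (y\<^sup>2 * y ^ (p - 1)) * q + (real p - 1) * (y\<^sup>2 * y powi (int p - 2)) * r\<^sup>2 + (y\<^sup>2 * y ^ p) / real p"
    by (simp add: algebra_simps)
  then show ?thesis unfolding 1 2 by (simp add: power_add mult.commute power2_eq_square)
qed

text \<open>Only the derivatives of the reference solution \<open>k2\<close> enter, and they may blow up at time 0 at an
  integrable rate.\<close>

lemma stability:
  fixes k2 :: "real \<Rightarrow> real \<Rightarrow> real"
  assumes p: "1 \<le> p" and lam: "0 < lam" and T': "0 < T'" and c: "0 < c" and H: "0 \<le> H"
    and per: "\<And>t. t \<in> {0..T'} \<Longrightarrow> periodic_fun_simple (\<lambda>x. k2 x t) (2 * pi / lam)"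
    and cont: "continuous_on (UNIV \<times> {0..T'}) (\<lambda>(x, t). k2 x t)"
    and bounds: "\<And>x t. t \<in> {0..T'} \<Longrightarrow> c \<le> k2 x t" "\<And>x t. t \<in> {0..T'} \<Longrightarrow> k2 x t \<le> M"
    and deriv: "\<And>x t. t \<in> {0<..T'} \<Longrightarrow> ((\<lambda>s. k2 x s) has_real_derivative k2t x t) (at t)"
      "\<And>x t. t \<in> {0<..T'} \<Longrightarrow> ((\<lambda>x. k2 x t) has_real_derivative k2x x t) (at x)"
      "\<And>x t. t \<in> {0<..T'} \<Longrightarrow> ((\<lambda>x. k2x x t) has_real_derivative k2xx x t) (at x)"
    and pde: "\<And>x t. t \<in> {0<..T'} \<Longrightarrow> k2t x t = k2 x t ^ (p + 1) * k2xx x t + (real p - 1) * k2 x t ^ p * (k2x x t)\<^sup>2 + k2 x t ^ (p + 2) / real p"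
    and sing: "\<And>x t. t \<in> {0<..T'} \<Longrightarrow> (k2x x t)\<^sup>2 \<le> H * t powr (- 3 / 4)" "\<And>x t. t \<in> {0<..T'} \<Longrightarrow> \<bar>k2xx x t\<bar> \<le> H * t powr (- 3 / 4)"
  obtains C e0 where "0 < C" "0 < e0"
    "\<And>k1 psi T1 e x t. T' < T1 \<Longrightarrow> classical_solution p lam T1 psi k1 \<Longrightarrow> 0 < e \<Longrightarrow> e \<le> e0 \<Longrightarrow>
       (\<And>x. \<bar>psi x - k2 x 0\<bar> < e) \<Longrightarrow> t \<in> {0..T'} \<Longrightarrow> \<bar>k1 x t - k2 x t\<bar> < C * e"
proof -
  define K where "K = \<bar>M\<bar> + 1"
  define D where "D = real (p + 2) * K ^ (p + 2)"
  \<comment> \<open>One summand for each of the three terms of the equation. The last term carries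
    no singular factor; \<open>1 \<le> T' powr (3 / 4) * t powr (- 3 / 4)\<close> puts it on the
    same footing as the others.\<close>
  define S where "S = D * H + (real p - 1) * D * H + D * T' powr (3 / 4)"
  define L where "L = 4 * (S + 1)"
  define C where "C = exp (L * T' powr (1 / 4))"
  \<comment> \<open>Keeps the barrier below \<open>min (c / 2) 1\<close> up to time
    \<open>T'\<close>, so at a contact \<open>k1\<close> is still positive and at most
    \<open>K\<close>.\<close>
  define e0 where "e0 = min (c / 2) 1 / C"
  have K: "1 \<le> K" by (simp add: K_def)
  have D: "0 \<le> D" using K by (simp add: D_def)
  have S: "0 \<le> S" unfolding S_def using D H p by (intro add_nonneg_nonneg mult_nonneg_nonneg) auto
  have C: "0 < C" by (simp add: C_def)
  have e0: "0 < e0" using c C by (simp add: e0_def)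
  have main: "\<bar>k1 x t - k2 x t\<bar> < C * e"
    if k1: "T' < T1" "classical_solution p lam T1 psi k1" and e: "0 < e" "e \<le> e0"
      and init: "\<And>x. \<bar>psi x - k2 x 0\<bar> < e" and t: "t \<in> {0..T'}" for k1 psi T1 e x t
  proof -
    obtain kt kx kxx where k1d: "\<And>x t. t \<in> {0<..<T1} \<Longrightarrow> ((\<lambda>s. k1 x s) has_real_derivative kt x t) (at t)"
      "\<And>x t. t \<in> {0<..<T1} \<Longrightarrow> ((\<lambda>x. k1 x t) has_real_derivative kx x t) (at x)"
      "\<And>x t. t \<in> {0<..<T1} \<Longrightarrow> ((\<lambda>x. kx x t) has_real_derivative kxx x t) (at x)"
      "\<And>x t. t \<in> {0<..<T1} \<Longrightarrow> kt x t = (k1 x t)\<^sup>2 * (k1 x t ^ (p - 1) * kxx x t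
          + (real p - 1) * k1 x t powi (int p - 2) * (kx x t)\<^sup>2 + 1 / real p * k1 x t ^ p)"
      using k1(2) unfolding classical_solution_def by blast
    have k1p: "\<And>t. t \<in> {0..<T1} \<Longrightarrow> periodic_fun_simple (\<lambda>x. k1 x t) (2 * pi / lam)"
      and k1c: "continuous_on (UNIV \<times> {0..<T1}) (\<lambda>(x, t). k1 x t)" and k10: "\<And>x. k1 x 0 = psi x"
      using k1(2) unfolding classical_solution_def by blast+
    \<comment> \<open>The derivative of this barrier is
      \<open>b t * (S + 1) * t powr (- 3 / 4)\<close>: it has exactly the singularity allowed for
      the derivatives of \<open>k2\<close>, and the barrier stays bounded because that singularity
      is integrable.\<close>
    define b where "b t = e * exp (L * t powr (1 / 4))" for t
    define b' where "b' t = b t * (L * (1 / 4 * t powr (- 3 / 4)))" for t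
    have bpos: "0 < b t" for t using e by (simp add: b_def)
    have bC: "b t \<le> e * C" if "t \<in> {0..T'}" for t
    proof -
      have "t powr (1/4) \<le> T' powr (1/4)" using that by (intro powr_mono2) auto
      then show ?thesis using e S by (simp add: b_def C_def L_def mult_left_mono)
    qed
    have eC: "e * C \<le> c / 2" "e * C \<le> 1"
    proof -
      have "e * C \<le> e0 * C" using e C by (intro mult_right_mono) auto
      also have "\<dots> = min (c / 2) 1" using C by (simp add: e0_def)
      finally show "e * C \<le> c / 2" "e * C \<le> 1" by auto
    qed
    have bd: "(b has_real_derivative b' t) (at t)" if "t \<in> {0<..T'}" for t
    proof -
      have "((\<lambda>t. e * exp (L * t powr (1 / 4))) has_real_derivative e * (exp (L * t powr (1/4)) * (L * (1 / 4 * t powr (1/4 - 1))))) (at t)"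
        using that by (auto intro!: derivative_eq_intros)
      then show ?thesis by (simp add: b_def[abs_def] b'_def mult.assoc)
    qed
    have bc: "continuous_on {0..T'} b"
      unfolding b_def by (intro continuous_intros continuous_on_powr') auto
    \<comment> \<open>At a contact the gradients agree, hence a single \<open>r\<close>. Of the two
      second derivatives only that of \<open>k2\<close> is bounded; \<open>q1 \<le> q2\<close>
      permits replacing the other one by it. The disjunction in the last premise lets the same
      estimate serve the upper and the lower barrier.\<close>
    have est: "y1 ^ (p + 1) * q1 + (real p - 1) * y1 ^ p * r\<^sup>2 + y1 ^ (p + 2) / real p
        - (y2 ^ (p + 1) * q2 + (real p - 1) * y2 ^ p * r\<^sup>2 + y2 ^ (p + 2) / real p) < b' t"
      if t: "t \<in> {0<..T'}" and y: "0 \<le> y1" "y1 \<le> K" "0 \<le> y2" "y2 \<le> K" "\<bar>y1 - y2\<bar> = b t" and q: "q1 \<le> q2"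
        and r: "r\<^sup>2 \<le> H * t powr (- 3 / 4)" and qb: "\<bar>q1\<bar> \<le> H * t powr (- 3 / 4) \<or> \<bar>q2\<bar> \<le> H * t powr (- 3 / 4)"
      for y1 y2 q1 q2 r t
    proof -
      define P where "P = t powr (- 3 / 4)"
      have P: "0 < P" "1 \<le> T' powr (3 / 4) * P"
      proof -
        have "t powr (3/4) \<le> T' powr (3/4)" using t by (intro powr_mono2) auto
        then have "t powr (3/4) * P \<le> T' powr (3/4) * P" by (intro mult_right_mono) (auto simp: P_def)
        then show "1 \<le> T' powr (3 / 4) * P" using t by (simp add: P_def flip: powr_add)
      qed (use t in \<open>simp add: P_def\<close>)
      have pw: "\<bar>y1 ^ j - y2 ^ j\<bar> \<le> D * b t" if "j \<le> p + 2" for j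
        using abs_power_diff_le[of y1 K y2 j "p + 2"] y K that by (simp add: D_def)
      obtain q where qq: "y1 ^ (p + 1) * q1 - y2 ^ (p + 1) * q2 \<le> (y1 ^ (p + 1) - y2 ^ (p + 1)) * q" "\<bar>q\<bar> \<le> H * P"
        using qb
      proof
        assume "\<bar>q1\<bar> \<le> H * t powr (- 3 / 4)"
        moreover have "y2 ^ (p + 1) * q1 \<le> y2 ^ (p + 1) * q2" using y q by (intro mult_left_mono) auto
        ultimately show ?thesis using that[of q1] by (simp add: P_def algebra_simps)
      next
        assume "\<bar>q2\<bar> \<le> H * t powr (- 3 / 4)"
        moreover have "y1 ^ (p + 1) * q1 \<le> y1 ^ (p + 1) * q2" using y q by (intro mult_left_mono) auto
        ultimately show ?thesis using that[of q2] by (simp add: P_def algebra_simps)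
      qed
      have 1: "(y1 ^ (p + 1) - y2 ^ (p + 1)) * q \<le> (D * b t) * (H * P)"
      proof -
        have "(y1 ^ (p + 1) - y2 ^ (p + 1)) * q \<le> \<bar>y1 ^ (p + 1) - y2 ^ (p + 1)\<bar> * \<bar>q\<bar>" by (metis abs_ge_self abs_mult)
        also have "\<dots> \<le> (D * b t) * (H * P)" using qq(2) D bpos[of t] by (intro mult_mono pw) auto
        finally show ?thesis .
      qed
      have 2: "(real p - 1) * (y1 ^ p - y2 ^ p) * r\<^sup>2 \<le> (real p - 1) * (D * b t) * (H * P)"
      proof -
        have "(y1 ^ p - y2 ^ p) * r\<^sup>2 \<le> (D * b t) * (H * P)"
          using pw[of p] r D bpos[of t] unfolding P_def by (intro mult_mono) auto
        then show ?thesis using p mult_left_mono[of "(y1 ^ p - y2 ^ p) * r\<^sup>2" "(D * b t) * (H * P)" "real p - 1"] by (simp add: mult.assoc)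
      qed
      have 3: "(y1 ^ (p + 2) - y2 ^ (p + 2)) / real p \<le> D * b t * (T' powr (3 / 4) * P)"
      proof -
        have "(y1 ^ (p + 2) - y2 ^ (p + 2)) / real p \<le> (D * b t) / 1"
          using pw[of "p + 2"] p D bpos[of t] by (intro frac_le) auto
        also have "\<dots> \<le> D * b t * (T' powr (3 / 4) * P)" using P(2) D bpos[of t] mult_left_mono[OF P(2), of "D * b t"] by simp
        finally show ?thesis .
      qed
      have "y1 ^ (p + 1) * q1 + (real p - 1) * y1 ^ p * r\<^sup>2 + y1 ^ (p + 2) / real p
        - (y2 ^ (p + 1) * q2 + (real p - 1) * y2 ^ p * r\<^sup>2 + y2 ^ (p + 2) / real p)
        = (y1 ^ (p + 1) * q1 - y2 ^ (p + 1) * q2) + (real p - 1) * (y1 ^ p - y2 ^ p) * r\<^sup>2 + (y1 ^ (p + 2) - y2 ^ (p + 2)) / real p"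
        by (simp add: algebra_simps diff_divide_distrib)
      also have "\<dots> \<le> (D * b t) * (H * P) + (real p - 1) * (D * b t) * (H * P) + D * b t * (T' powr (3 / 4) * P)"
        using qq(1) 1 2 3 by linarith
      also have "\<dots> = b t * P * S" by (simp add: S_def algebra_simps)
      also have "\<dots> < b t * P * (S + 1)" using bpos[of t] P(1) by simp
      also have "\<dots> = b' t" by (simp add: b'_def L_def P_def)
      finally show ?thesis .
    qed
    have sub: "{0..T'} \<subseteq> {0..<T1}" "{0<..T'} \<subseteq> {0<..<T1}" using k1(1) by auto
    have cont1: "continuous_on (UNIV \<times> {0..T'}) (\<lambda>(x, t). k1 x t)"
      by (rule continuous_on_subset[OF k1c]) (use sub in auto)
    have kMK: "k2 x t \<le> K - 1" if "t \<in> {0..T'}" for x t using bounds(2)[OF that, of x] by (simp add: K_def)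
    have d1: "((\<lambda>s. k1 x s) has_real_derivative kt x t) (at t)" "((\<lambda>x. k1 x t) has_real_derivative kx x t) (at x)"
      "((\<lambda>x. kx x t) has_real_derivative kxx x t) (at x)" if "t \<in> {0<..T'}" for x t using k1d sub that by blast+
    \<comment> \<open>Positivity of \<open>k1\<close> is obtained at contact points from closeness
      to \<open>k2\<close>, and there its equation can be put into polynomial form.\<close>
    have near: "0 < k1 x t" "k1 x t \<le> K" "0 < k2 x t" "k2 x t \<le> K" if "t \<in> {0<..T'}" "\<bar>k1 x t - k2 x t\<bar> = b t" for x t
      using that bC[of t] eC bounds(1)[of t x] kMK[of t x] c by auto
    have k1pde: "kt x t = k1 x t ^ (p + 1) * kxx x t + (real p - 1) * k1 x t ^ p * (kx x t)\<^sup>2 + k1 x t ^ (p + 2) / real p"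
      if "t \<in> {0<..T'}" "0 < k1 x t" for x t
      using k1d(4)[of t x] that sub classical_solution_positive_pde[of "k1 x t" p "kxx x t" "kx x t"] p by auto
    have up: "k1 x t - k2 x t < b t"
    proof (rule max_principle[where L="2 * pi / lam" and T=T' and w="\<lambda>x t. k1 x t - k2 x t" and b=b and wt="\<lambda>x t. kt x t - k2t x t"
          and wx="\<lambda>x t. kx x t - k2x x t" and wxx="\<lambda>x t. kxx x t - k2xx x t" and b'=b'])
      show "periodic_fun_simple (\<lambda>x. k1 x t - k2 x t) (2 * pi / lam)" if "t \<in> {0..T'}" for t
        using k1p[of t] per[OF that] that sub by (auto simp: periodic_fun_simple_def)
      show "continuous_on (UNIV \<times> {0..T'}) (\<lambda>(x, t). k1 x t - k2 x t)"
        using continuous_on_diff[OF cont1 cont] by (simp add: case_prod_unfold)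
      show "k1 x 0 - k2 x 0 < b 0" for x using init[of x] k10[of x] by (simp add: b_def)
      show "kt x t - k2t x t < b' t" if *: "t \<in> {0<..T'}" "k1 x t - k2 x t = b t" "kx x t - k2x x t = 0" "kxx x t - k2xx x t \<le> 0" for x t
      proof -
        have a: "\<bar>k1 x t - k2 x t\<bar> = b t" using *(2) bpos[of t] by simp
        note n = near[OF *(1) a]
        show ?thesis
          unfolding k1pde[OF *(1) n(1)] pde[OF *(1)]
          using est[OF *(1), of "k1 x t" "k2 x t" "kxx x t" "k2xx x t" "k2x x t"] n a * sing[OF *(1), of x] by simp
      qed
    qed (use lam bc bd t d1 deriv in \<open>auto intro!: DERIV_diff\<close>)
    have lo: "k2 x t - k1 x t < b t"
    proof (rule max_principle[where L="2 * pi / lam" and T=T' and w="\<lambda>x t. k2 x t - k1 x t" and b=b and wt="\<lambda>x t. k2t x t - kt x t"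
          and wx="\<lambda>x t. k2x x t - kx x t" and wxx="\<lambda>x t. k2xx x t - kxx x t" and b'=b'])
      show "periodic_fun_simple (\<lambda>x. k2 x t - k1 x t) (2 * pi / lam)" if "t \<in> {0..T'}" for t
        using k1p[of t] per[OF that] that sub by (auto simp: periodic_fun_simple_def)
      show "continuous_on (UNIV \<times> {0..T'}) (\<lambda>(x, t). k2 x t - k1 x t)"
        using continuous_on_diff[OF cont cont1] by (simp add: case_prod_unfold)
      show "k2 x 0 - k1 x 0 < b 0" for x using init[of x] k10[of x] by (simp add: b_def)
      show "k2t x t - kt x t < b' t" if *: "t \<in> {0<..T'}" "k2 x t - k1 x t = b t" "k2x x t - kx x t = 0" "k2xx x t - kxx x t \<le> 0" for x t
      proof -
        have a: "\<bar>k1 x t - k2 x t\<bar> = b t" "\<bar>k2 x t - k1 x t\<bar> = b t" using *(2) bpos[of t] by simp_all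
        note n = near[OF *(1) a(1)]
        show ?thesis
          unfolding k1pde[OF *(1) n(1)] pde[OF *(1)]
          using est[OF *(1), of "k2 x t" "k1 x t" "k2xx x t" "kxx x t" "k2x x t"] n a * sing[OF *(1), of x] by simp
      qed
    qed (use lam bc bd t d1 deriv in \<open>auto intro!: DERIV_diff\<close>)
    show ?thesis
    proof (cases "t = 0")
      case True
      have "1 \<le> C" using S by (simp add: C_def L_def)
      then have "e \<le> C * e" using e by simp
      then show ?thesis using True init[of x] k10[of x] by simp
    next
      case False
      then have "b t \<le> C * e" using bC[OF t] by (simp add: mult.commute)
      then show ?thesis using up lo by linarith
    qed
  qed
  show ?thesis using main by (intro that[OF C e0]) blast
qed

text \<open>Polynomials in the derivatives of order at most \<open>l\<close>. The inductive form
  yields boundedness on bounded jets and the shape of the total derivative by induction.\<close>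

inductive jet_poly :: "nat \<Rightarrow> ((nat \<Rightarrow> real) \<Rightarrow> real) \<Rightarrow> bool" for l where
  jet_const: "jet_poly l (\<lambda>z. c)"
| jet_var: "j \<le> l \<Longrightarrow> jet_poly l (\<lambda>z. z j)"
| jet_add: "jet_poly l R \<Longrightarrow> jet_poly l S \<Longrightarrow> jet_poly l (\<lambda>z. R z + S z)"
| jet_mult: "jet_poly l R \<Longrightarrow> jet_poly l S \<Longrightarrow> jet_poly l (\<lambda>z. R z * S z)"

lemma jet_power: "jet_poly l R \<Longrightarrow> jet_poly l (\<lambda>z. R z ^ i)"
  by (induction i) (auto intro: jet_const jet_mult)

lemma jet_poly_mono: "jet_poly l R \<Longrightarrow> l \<le> l' \<Longrightarrow> jet_poly l' R"
  by (induction rule: jet_poly.induct) (auto intro: jet_poly.intros)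

lemma jet_poly_bounded: "jet_poly l R \<Longrightarrow> \<exists>C. \<forall>z. (\<forall>j\<le>l. \<bar>z j\<bar> \<le> M) \<longrightarrow> \<bar>R z\<bar> \<le> C"
proof (induction rule: jet_poly.induct)
  case (jet_add R S)
  then obtain C D where "\<And>z. (\<forall>j\<le>l. \<bar>z j\<bar> \<le> M) \<Longrightarrow> \<bar>R z\<bar> \<le> C" "\<And>z. (\<forall>j\<le>l. \<bar>z j\<bar> \<le> M) \<Longrightarrow> \<bar>S z\<bar> \<le> D" by blast
  then have "\<bar>R z + S z\<bar> \<le> C + D" if "\<forall>j\<le>l. \<bar>z j\<bar> \<le> M" for z using that abs_triangle_ineq[of "R z" "S z"] by force
  then show ?case by blast
next
  case (jet_mult R S)
  then obtain C D where CD: "\<And>z. (\<forall>j\<le>l. \<bar>z j\<bar> \<le> M) \<Longrightarrow> \<bar>R z\<bar> \<le> C" "\<And>z. (\<forall>j\<le>l. \<bar>z j\<bar> \<le> M) \<Longrightarrow> \<bar>S z\<bar> \<le> D" by blast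
  have "\<bar>R z * S z\<bar> \<le> \<bar>C\<bar> * \<bar>D\<bar>" if "\<forall>j\<le>l. \<bar>z j\<bar> \<le> M" for z
    using CD(1)[OF that] CD(2)[OF that] unfolding abs_mult by (intro mult_mono) auto
  then show ?case by blast
qed auto

definition jet_chain :: "(nat \<Rightarrow> real \<Rightarrow> real) \<Rightarrow> bool" where
  "jet_chain z \<longleftrightarrow> (\<forall>j x. ((\<lambda>x. z j x) has_real_derivative z (Suc j) x) (at x))"

text \<open>The total derivative is affine in the one new variable \<open>z (Suc l)\<close>, with
  coefficients again of order \<open>l\<close>: the chain rule with the top-order partial derivative
  \<open>S\<close> kept apart.\<close>

lemma jet_poly_derivative:
  "jet_poly l R \<Longrightarrow> \<exists>S R'. jet_poly l S \<and> jet_poly l R' \<and> (\<forall>z x. jet_chain z \<longrightarrow>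
     ((\<lambda>x. R (\<lambda>j. z j x)) has_real_derivative S (\<lambda>j. z j x) * z (Suc l) x + R' (\<lambda>j. z j x)) (at x))"
proof (induction rule: jet_poly.induct)
  case (jet_const c)
  show ?case
    by (rule exI[of _ "\<lambda>_. 0"], rule exI[of _ "\<lambda>_. 0"]) (simp add: jet_poly.jet_const)
next
  case (jet_var j)
  show ?case
  proof (cases "j = l")
    case True
    show ?thesis unfolding True
      by (rule exI[of _ "\<lambda>_. 1"], rule exI[of _ "\<lambda>_. 0"]) (simp add: jet_chain_def jet_poly.jet_const)
  next
    case False
    then have "Suc j \<le> l" using jet_var by simp
    show ?thesis
      by (rule exI[of _ "\<lambda>_. 0"], rule exI[of _ "\<lambda>z. z (Suc j)"])
        (simp add: jet_chain_def jet_poly.jet_const jet_poly.jet_var \<open>Suc j \<le> l\<close>)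
  qed
next
  case (jet_add R S)
  then obtain A B A' B' where *: "jet_poly l A" "jet_poly l B" "jet_poly l A'" "jet_poly l B'"
    "\<And>z x. jet_chain z \<Longrightarrow> ((\<lambda>x. R (\<lambda>j. z j x)) has_real_derivative A (\<lambda>j. z j x) * z (Suc l) x + B (\<lambda>j. z j x)) (at x)"
    "\<And>z x. jet_chain z \<Longrightarrow> ((\<lambda>x. S (\<lambda>j. z j x)) has_real_derivative A' (\<lambda>j. z j x) * z (Suc l) x + B' (\<lambda>j. z j x)) (at x)"
    by metis
  show ?case
  proof (rule exI[of _ "\<lambda>z. A z + A' z"], rule exI[of _ "\<lambda>z. B z + B' z"], intro conjI allI impI)
    fix z x assume "jet_chain z"
    show "((\<lambda>x. R (\<lambda>j. z j x) + S (\<lambda>j. z j x)) has_real_derivative (A (\<lambda>j. z j x) + A' (\<lambda>j. z j x)) * z (Suc l) x + (B (\<lambda>j. z j x) + B' (\<lambda>j. z j x))) (at x)"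
      by (rule DERIV_cong[OF DERIV_add[OF *(5)[OF \<open>jet_chain z\<close>] *(6)[OF \<open>jet_chain z\<close>]]]) (simp add: algebra_simps)
  qed (intro jet_poly.jet_add *)+
next
  case (jet_mult R S)
  then obtain A B A' B' where *: "jet_poly l A" "jet_poly l B" "jet_poly l A'" "jet_poly l B'"
    "\<And>z x. jet_chain z \<Longrightarrow> ((\<lambda>x. R (\<lambda>j. z j x)) has_real_derivative A (\<lambda>j. z j x) * z (Suc l) x + B (\<lambda>j. z j x)) (at x)"
    "\<And>z x. jet_chain z \<Longrightarrow> ((\<lambda>x. S (\<lambda>j. z j x)) has_real_derivative A' (\<lambda>j. z j x) * z (Suc l) x + B' (\<lambda>j. z j x)) (at x)"
    by metis
  show ?case
  proof (rule exI[of _ "\<lambda>z. A z * S z + A' z * R z"], rule exI[of _ "\<lambda>z. B z * S z + B' z * R z"], intro conjI allI impI)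
    fix z x assume "jet_chain z"
    show "((\<lambda>x. R (\<lambda>j. z j x) * S (\<lambda>j. z j x)) has_real_derivative
        (A (\<lambda>j. z j x) * S (\<lambda>j. z j x) + A' (\<lambda>j. z j x) * R (\<lambda>j. z j x)) * z (Suc l) x + (B (\<lambda>j. z j x) * S (\<lambda>j. z j x) + B' (\<lambda>j. z j x) * R (\<lambda>j. z j x))) (at x)"
      by (rule DERIV_cong[OF DERIV_mult[OF *(5)[OF \<open>jet_chain z\<close>] *(6)[OF \<open>jet_chain z\<close>]]]) (simp add: algebra_simps)
  qed (intro jet_poly.jet_add jet_poly.jet_mult * jet_mult)+
qed

text \<open>Differentiating the equation \<open>l\<close> times in space gives an equation for \<open>z l\<close> whose lowest order part
  only involves \<open>z 0, \<dots>, z l\<close>; the drift coefficient \<open>B\<close> is irrelevant at spatial extrema.\<close>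

lemma (in flow) jet_structure:
  "\<exists>B R. jet_poly 1 B \<and> jet_poly l R \<and> (\<forall>z y. jet_chain z \<longrightarrow> jet_chain y \<longrightarrow> (\<forall>x. y 0 x = rhs_poly (\<lambda>j. z j x)) \<longrightarrow>
     (\<forall>x. y l x = z 0 x ^ (p + 1) * z (l + 2) x + B (\<lambda>j. z j x) * z (l + 1) x + R (\<lambda>j. z j x)))"
proof (induction l)
  case 0
  show ?case
  proof (rule exI[of _ "\<lambda>z. (real p - 1) * z 0 ^ p * z 1"], rule exI[of _ "\<lambda>z. z 0 ^ (p + 2) * (1 / real p)"], intro conjI allI impI)
    fix z y x assume "\<forall>x. y 0 x = rhs_poly (\<lambda>j. z j x)"
    then show "y 0 x = z 0 x ^ (p + 1) * z (0 + 2) x + (real p - 1) * z 0 x ^ p * z 1 x * z (0 + 1) x + z 0 x ^ (p + 2) * (1 / real p)"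
      by (simp add: rhs_poly_def power2_eq_square numeral_2_eq_2)
  qed (intro jet_mult jet_const jet_power jet_var; simp)+
next
  case (Suc l)
  then obtain B R where BR: "jet_poly 1 B" "jet_poly l R" "\<And>z y x. jet_chain z \<Longrightarrow> jet_chain y \<Longrightarrow> (\<And>x. y 0 x = rhs_poly (\<lambda>j. z j x)) \<Longrightarrow>
     y l x = z 0 x ^ (p + 1) * z (l + 2) x + B (\<lambda>j. z j x) * z (l + 1) x + R (\<lambda>j. z j x)" by blast
  obtain SB RB where B: "jet_poly 1 SB" "jet_poly 1 RB" "\<And>z x. jet_chain z \<Longrightarrow>
     ((\<lambda>x. B (\<lambda>j. z j x)) has_real_derivative SB (\<lambda>j. z j x) * z (Suc 1) x + RB (\<lambda>j. z j x)) (at x)"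
    using jet_poly_derivative[OF BR(1)] by blast
  obtain SR RR where R: "jet_poly l SR" "jet_poly l RR" "\<And>z x. jet_chain z \<Longrightarrow>
     ((\<lambda>x. R (\<lambda>j. z j x)) has_real_derivative SR (\<lambda>j. z j x) * z (Suc l) x + RR (\<lambda>j. z j x)) (at x)"
    using jet_poly_derivative[OF BR(2)] by blast
  \<comment> \<open>The leading coefficient \<open>z 0 ^ (p + 1)\<close>, when differentiated,
    multiplies \<open>z (l + 2)\<close>, which is the drift variable at the next order.\<close>
  define B1 where "B1 z = real (p + 1) * z 0 ^ p * z 1 + B z" for z
  have B1: "jet_poly 1 B1" unfolding B1_def by (intro jet_add jet_mult jet_const jet_power jet_var BR) auto
  have step: "y (Suc l) x = z 0 x ^ (p + 1) * z (Suc l + 2) x + B1 (\<lambda>j. z j x) * z (Suc l + 1) x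
      + ((SB (\<lambda>j. z j x) * z 2 x + RB (\<lambda>j. z j x)) * z (Suc l) x + (SR (\<lambda>j. z j x) * z (Suc l) x + RR (\<lambda>j. z j x)))"
    if zy: "jet_chain z" "jet_chain y" "\<forall>x. y 0 x = rhs_poly (\<lambda>j. z j x)" for z y x
  proof (rule DERIV_unique)
    show "((\<lambda>x. y l x) has_real_derivative y (Suc l) x) (at x)" using zy(2) by (simp add: jet_chain_def)
    have eq: "y l x = z 0 x ^ (p + 1) * z (l + 2) x + B (\<lambda>j. z j x) * z (l + 1) x + R (\<lambda>j. z j x)" for x
      using BR(3)[OF zy(1,2)] zy(3) by blast
    have dz: "((\<lambda>x. z j x) has_real_derivative z (Suc j) x) (at x)" for j x using zy(1) by (simp add: jet_chain_def)
    have "((\<lambda>x. z 0 x ^ (p + 1) * z (l + 2) x + B (\<lambda>j. z j x) * z (l + 1) x + R (\<lambda>j. z j x)) has_real_derivative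
       (real (p + 1) * z 0 x ^ p * z 1 x * z (l + 2) x + z (Suc (l + 2)) x * z 0 x ^ (p + 1))
       + ((SB (\<lambda>j. z j x) * z (Suc 1) x + RB (\<lambda>j. z j x)) * z (l + 1) x + z (Suc (l + 1)) x * B (\<lambda>j. z j x))
       + (SR (\<lambda>j. z j x) * z (Suc l) x + RR (\<lambda>j. z j x))) (at x)"
    proof (intro DERIV_add DERIV_mult dz B(3) R(3) zy(1))
      show "((\<lambda>x. z 0 x ^ (p + 1)) has_real_derivative real (p + 1) * z 0 x ^ p * z 1 x) (at x)"
        using DERIV_power[OF dz[of 0 x], of "p + 1"] by (simp add: mult_ac)
    qed
    then show "((\<lambda>x. y l x) has_real_derivative z 0 x ^ (p + 1) * z (Suc l + 2) x + B1 (\<lambda>j. z j x) * z (Suc l + 1) x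
      + ((SB (\<lambda>j. z j x) * z 2 x + RB (\<lambda>j. z j x)) * z (Suc l) x + (SR (\<lambda>j. z j x) * z (Suc l) x + RR (\<lambda>j. z j x)))) (at x)"
      unfolding eq by (rule DERIV_cong) (simp add: B1_def algebra_simps numeral_2_eq_2)
  qed
  \<comment> \<open>The derivative of \<open>B\<close> brings in \<open>z 2\<close>. For
    \<open>l = 0\<close> this is the drift variable itself, so \<open>SB * z 1\<close> moves into
    the drift coefficient; for \<open>l > 0\<close> it is one of the variables up to order
    \<open>Suc l\<close> and belongs to the remainder.\<close>
  show ?case
  proof (cases "l = 0")
    case True
    show ?thesis
    proof (rule exI[of _ "\<lambda>z. B1 z + SB z * z 1"], rule exI[of _ "\<lambda>z. RB z * z 1 + (SR z * z 1 + RR z)"], intro conjI allI impI)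
      show "jet_poly (Suc l) (\<lambda>z. RB z * z 1 + (SR z * z 1 + RR z))"
        using True by (intro jet_add jet_mult jet_var jet_poly_mono[OF B(2)] jet_poly_mono[OF R(1)] jet_poly_mono[OF R(2)]) auto
      fix z y x assume "jet_chain z" "jet_chain y" "\<forall>x. y 0 x = rhs_poly (\<lambda>j. z j x)"
      from step[OF this, of x] show "y (Suc l) x = z 0 x ^ (p + 1) * z (Suc l + 2) x + (B1 (\<lambda>j. z j x) + SB (\<lambda>j. z j x) * z 1 x) * z (Suc l + 1) x
         + (RB (\<lambda>j. z j x) * z 1 x + (SR (\<lambda>j. z j x) * z 1 x + RR (\<lambda>j. z j x)))"
        using True by (simp add: algebra_simps numeral_2_eq_2)
    qed (intro jet_add jet_mult jet_var B1 B(1) order_refl)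
  next
    case False
    show ?thesis
    proof (rule exI[of _ B1], rule exI[of _ "\<lambda>z. (SB z * z 2 + RB z) * z (Suc l) + (SR z * z (Suc l) + RR z)"], intro conjI allI impI)
      show "jet_poly (Suc l) (\<lambda>z. (SB z * z 2 + RB z) * z (Suc l) + (SR z * z (Suc l) + RR z))"
        using False by (intro jet_add jet_mult jet_var jet_poly_mono[OF B(1)] jet_poly_mono[OF B(2)] jet_poly_mono[OF R(1)] jet_poly_mono[OF R(2)]) auto
    qed (use B1 step in auto)
  qed
qed

context flow
begin

text \<open>An abstract notion, so that the bounds below can be quantified before the solution and
  are uniform over all approximations. \<open>z j\<close> is the \<open>j\<close>-th space
  derivative and \<open>y j\<close> its time derivative.\<close>

definition smooth_flow :: "real \<Rightarrow> (nat \<Rightarrow> real \<Rightarrow> real \<Rightarrow> real) \<Rightarrow> (nat \<Rightarrow> real \<Rightarrow> real \<Rightarrow> real) \<Rightarrow> bool" where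
  "smooth_flow T z y \<longleftrightarrow>
     (\<forall>j. \<forall>t\<in>{0..T}. periodic_fun_simple (\<lambda>x. z j x t) (2 * pi / lam)) \<and>
     (\<forall>j. continuous_on (UNIV \<times> {0..T}) (\<lambda>(x, t). z j x t)) \<and>
     (\<forall>x. \<forall>t\<in>{0<..T}. 0 \<le> z 0 x t) \<and>
     (\<forall>t\<in>{0<..T}. jet_chain (\<lambda>j x. z j x t) \<and> jet_chain (\<lambda>j x. y j x t) \<and>
        (\<forall>x. y 0 x t = rhs_poly (\<lambda>j. z j x t)) \<and>
        (\<forall>j x. ((\<lambda>s. z j x s) has_real_derivative y j x t) (at t)))"

text \<open>At a contact of \<open>z l\<close> with the linear barrier
  \<open>\<bar>K\<bar> + 1 + c * t\<close> the drift vanishes, the diffusion has the right sign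
  because \<open>z 0 \<ge> 0\<close>, and the remainder is at most \<open>C\<close>: lower orders
  are bounded by induction, and \<open>\<bar>z l\<bar>\<close> equals the barrier. There is no
  circularity, since \<open>K' = \<bar>K\<bar> + 2\<close> is fixed before \<open>C\<close> and
  \<open>t0 \<le> 1 / c\<close> keeps the barrier below \<open>K'\<close>.\<close>

lemma smooth_flow_bounds:
  assumes "0 < T"
  shows "\<exists>M t0. 0 < t0 \<and> t0 \<le> T \<and> (\<forall>z y. smooth_flow T z y \<longrightarrow> (\<forall>j<l. \<forall>x. \<bar>z j x 0\<bar> \<le> K) \<longrightarrow>
     (\<forall>j<l. \<forall>x. \<forall>t\<in>{0..t0}. \<bar>z j x t\<bar> \<le> M))"
proof (induction l)
  case 0
  show ?case by (rule exI[of _ 0], rule exI[of _ T]) (use assms in auto)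
next
  case (Suc l)
  then obtain M1 t1 where IH: "0 < t1" "t1 \<le> T" "\<And>z y j x t. smooth_flow T z y \<Longrightarrow> (\<forall>j<l. \<forall>x. \<bar>z j x 0\<bar> \<le> K) \<Longrightarrow>
     j < l \<Longrightarrow> t \<in> {0..t1} \<Longrightarrow> \<bar>z j x t\<bar> \<le> M1" by blast
  obtain B R where BR: "jet_poly l R" "\<And>z y x. jet_chain z \<Longrightarrow> jet_chain y \<Longrightarrow> (\<And>x. y 0 x = rhs_poly (\<lambda>j. z j x)) \<Longrightarrow>
     y l x = z 0 x ^ (p + 1) * z (l + 2) x + B (\<lambda>j. z j x) * z (l + 1) x + R (\<lambda>j. z j x)"
    using jet_structure[of l] by blast
  define K' where "K' = \<bar>K\<bar> + 2"
  define M where "M = max M1 K'"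
  obtain C where C: "\<And>z. (\<forall>j\<le>l. \<bar>z j\<bar> \<le> M) \<Longrightarrow> \<bar>R z\<bar> \<le> C" using jet_poly_bounded[OF BR(1), of M] by blast
  define c where "c = \<bar>C\<bar> + 1"
  define t0 where "t0 = min t1 (1 / c)"
  have t0: "0 < t0" "t0 \<le> t1" "c * t0 \<le> 1" using IH(1) by (auto simp: t0_def c_def min_def field_simps)
  define b where "b t = \<bar>K\<bar> + 1 + c * t" for t
  have bK: "b t \<le> K'" if "t \<in> {0..t0}" for t
  proof -
    have "c * t \<le> c * t0" using that by (intro mult_left_mono) (auto simp: c_def)
    then show ?thesis using t0(3) by (simp add: b_def K'_def)
  qed
  have b0: "0 \<le> b t" if "0 \<le> t" for t using that by (simp add: b_def c_def)
  have main: "\<bar>z l x t\<bar> < b t" if sf: "smooth_flow T z y" and init: "\<forall>j<Suc l. \<forall>x. \<bar>z j x 0\<bar> \<le> K" and t: "t \<in> {0..t0}" for z y x t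
  proof -
    have sub: "{0<..t0} \<subseteq> {0<..T}" "{0..t0} \<subseteq> {0..T}" using t0 IH(2) by auto
    have per: "periodic_fun_simple (\<lambda>x. z l x t) (2 * pi / lam)" if "t \<in> {0..t0}" for t using sf sub that unfolding smooth_flow_def by blast
    have cont: "continuous_on (UNIV \<times> {0..t0}) (\<lambda>(x, t). z l x t)"
      using sf sub unfolding smooth_flow_def by (blast intro: continuous_on_subset)
    have jc: "jet_chain (\<lambda>j x. z j x t)" "jet_chain (\<lambda>j x. y j x t)" "y 0 x t = rhs_poly (\<lambda>j. z j x t)"
      "((\<lambda>s. z j x s) has_real_derivative y j x t) (at t)" "0 \<le> z 0 x t" if "t \<in> {0<..t0}" for j x t
      using sf sub that unfolding smooth_flow_def by blast+
    have dx: "((\<lambda>x. z j x t) has_real_derivative z (Suc j) x t) (at x)" if "t \<in> {0<..t0}" for j x t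
      using jc(1)[OF that] by (simp add: jet_chain_def)
    have RC: "\<bar>R (\<lambda>j. z j x t)\<bar> \<le> C" if "t \<in> {0<..t0}" "\<bar>z l x t\<bar> = b t" for x t
    proof (rule C, intro allI impI)
      fix j assume "j \<le> l"
      show "\<bar>z j x t\<bar> \<le> M"
      proof (cases "j = l")
        case True
        then show ?thesis using that bK[of t] by (simp add: M_def)
      next
        case False
        have "\<bar>z j x t\<bar> \<le> M1" by (rule IH(3)[OF sf]) (use False \<open>j \<le> l\<close> init that t0 in auto)
        then show ?thesis by (simp add: M_def)
      qed
    qed
    have str: "y l x t = z 0 x t ^ (p + 1) * z (l + 2) x t + B (\<lambda>j. z j x t) * z (l + 1) x t + R (\<lambda>j. z j x t)" if "t \<in> {0<..t0}" for x t
      by (rule BR(2)[OF jc(1)[OF that] jc(2)[OF that] jc(3)[OF that]])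
    have bd: "(b has_real_derivative c) (at t)" for t unfolding b_def by (auto intro!: derivative_eq_intros)
    have bc: "continuous_on {0..t0} b" unfolding b_def by (intro continuous_intros)
    have Lp: "0 < 2 * pi / lam" using lam_pos by simp
    have up: "z l x t < b t"
    proof (rule max_principle[OF Lp per cont bc, where wt="y l" and wx="z (Suc l)" and wxx="z (Suc (Suc l))" and b'="\<lambda>_. c"])
      show "z l x 0 < b 0" for x
      proof -
        have "\<bar>z l x 0\<bar> \<le> K" using init by simp
        then show ?thesis unfolding b_def by simp
      qed
      show "y l x t < c" if *: "t \<in> {0<..t0}" "z l x t = b t" "z (Suc l) x t = 0" "z (Suc (Suc l)) x t \<le> 0" for x t
      proof -
        have "z 0 x t ^ (p + 1) * z (l + 2) x t \<le> 0" using jc(5)[OF *(1), of x] *(4) by (simp add: mult_nonneg_nonpos)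
        moreover have "\<bar>R (\<lambda>j. z j x t)\<bar> \<le> C" using RC[OF *(1)] *(2) b0[of t] *(1) by simp
        ultimately show ?thesis using str[OF *(1), of x] *(3) by (simp add: c_def)
      qed
    qed (assumption | rule jc(4) dx bd t)+
    have lo: "- z l x t < b t"
    proof (rule max_principle[OF Lp _ _ bc, where w="\<lambda>x t. - z l x t" and wt="\<lambda>x t. - y l x t" and wx="\<lambda>x t. - z (Suc l) x t" and wxx="\<lambda>x t. - z (Suc (Suc l)) x t" and b'="\<lambda>_. c"])
      show "periodic_fun_simple (\<lambda>x. - z l x t) (2 * pi / lam)" if "t \<in> {0..t0}" for t
        using per[OF that] by (simp add: periodic_fun_simple_def)
      show "continuous_on (UNIV \<times> {0..t0}) (\<lambda>(x, t). - z l x t)"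
        using continuous_on_minus[OF cont] by (simp add: case_prod_unfold)
      show "- z l x 0 < b 0" for x
      proof -
        have "\<bar>z l x 0\<bar> \<le> K" using init by simp
        then show ?thesis unfolding b_def by simp
      qed
      show "- y l x t < c" if *: "t \<in> {0<..t0}" "- z l x t = b t" "- z (Suc l) x t = 0" "- z (Suc (Suc l)) x t \<le> 0" for x t
      proof -
        have "0 \<le> z 0 x t ^ (p + 1) * z (l + 2) x t" using jc(5)[OF *(1), of x] *(4) by simp
        moreover have "\<bar>R (\<lambda>j. z j x t)\<bar> \<le> C"
        proof (rule RC[OF *(1)])
          show "\<bar>z l x t\<bar> = b t" using *(2) b0[of t] *(1) by auto
        qed
        ultimately show ?thesis using str[OF *(1), of x] *(3) by (simp add: c_def)
      qed
    qed (assumption | rule DERIV_minus[OF jc(4)] DERIV_minus[OF dx] bd t)+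
    show ?thesis using up lo by linarith
  qed
  have "\<bar>z j x t\<bar> \<le> M" if sf: "smooth_flow T z y" "\<forall>j<Suc l. \<forall>x. \<bar>z j x 0\<bar> \<le> K" "j < Suc l" "t \<in> {0..t0}" for z y j x t
  proof (cases "j = l")
    case True
    then show ?thesis using main[OF sf(1,2,4), of x] bK[OF sf(4)] by (simp add: M_def)
  next
    case False
    have "\<bar>z j x t\<bar> \<le> M1" by (rule IH(3)[OF sf(1)]) (use False sf t0 in auto)
    then show ?thesis by (simp add: M_def)
  qed
  moreover have "0 < t0 \<and> t0 \<le> T" using t0 IH(2) by simp
  ultimately show ?case by blast
qed

end

section \<open>Fejer means and Fourier inversion\<close>

text \<open>For \<open>N = 0\<close> the quotient is 0 by convention and all weights are 1; the
  kernel identities therefore assume \<open>0 < N\<close>, and the approximations of the data use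
  \<open>Suc N\<close>.\<close>

definition fejer_weight :: "nat \<Rightarrow> int \<Rightarrow> real" where
  "fejer_weight N n = max 0 (1 - \<bar>of_int n\<bar> / real N)"

definition fejer_kernel :: "real \<Rightarrow> nat \<Rightarrow> real \<Rightarrow> complex" where
  "fejer_kernel lam N z = (\<Sum>n\<in>{- int N..int N}. complex_of_real (fejer_weight N n) * cis (lam * of_int n * z))"

lemma fejer_weight_bounds: "0 \<le> fejer_weight N n" "fejer_weight N n \<le> 1"
  by (auto simp: fejer_weight_def)

lemma fejer_weight_0: "fejer_weight N 0 = 1"
  by (simp add: fejer_weight_def)

lemma fejer_weight_minus: "fejer_weight N (- n) = fejer_weight N n"
  by (simp add: fejer_weight_def)

lemma fejer_weight_eq_0: "0 < N \<Longrightarrow> n \<notin> {- int N..int N} \<Longrightarrow> fejer_weight N n = 0"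
proof -
  assume N: "0 < N" and n: "n \<notin> {- int N..int N}"
  have "real N \<le> \<bar>of_int n\<bar>" using n by (auto simp: abs_if)
  then have "1 \<le> \<bar>of_int n\<bar> / real N" using N by simp
  then show ?thesis by (simp add: fejer_weight_def)
qed

lemma card_difference: "card {q \<in> {..<N} \<times> {..<N}. int (fst q) - int (snd q) = n} = N - nat \<bar>n\<bar>"
proof (cases "0 \<le> n")
  case True
  have "bij_betw (\<lambda>k. (k + nat n, k)) {..<N - nat n} {q \<in> {..<N} \<times> {..<N}. int (fst q) - int (snd q) = n}"
    using True by (intro bij_betw_byWitness[where f'=snd]) auto
  then show ?thesis using True by (auto dest: bij_betw_same_card)
next
  case False
  have "bij_betw (\<lambda>k. (k, k + nat (- n))) {..<N - nat (- n)} {q \<in> {..<N} \<times> {..<N}. int (fst q) - int (snd q) = n}"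
    using False by (intro bij_betw_byWitness[where f'=fst]) auto
  then show ?thesis using False by (auto dest: bij_betw_same_card)
qed

text \<open>Expanding the square, each difference \<open>n\<close> of two indices below
  \<open>N\<close> occurs \<open>N - \<bar>n\<bar>\<close> times. The identity shows that the kernel
  is nonnegative, the property for which Fejer means are used.\<close>

lemma fejer_kernel_eq:
  assumes "0 < N"
  shows "fejer_kernel lam N z = complex_of_real ((cmod (\<Sum>j<N. cis (lam * real j * z)))\<^sup>2 / real N)"
proof -
  define a where "a j = cis (lam * real j * z)" for j :: nat
  define S where "S = {..<N} \<times> {..<N}"
  define h where "h q = int (fst q) - int (snd q)" for q :: "nat \<times> nat"
  have aq: "a (fst q) * cnj (a (snd q)) = cis (lam * of_int (h q) * z)" for q
    by (simp add: a_def h_def cis_cnj cis_mult algebra_simps)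
  have "(\<Sum>j<N. a j) * cnj (\<Sum>j<N. a j) = (\<Sum>q\<in>S. a (fst q) * cnj (a (snd q)))"
    unfolding S_def cnj_sum sum_product by (simp add: sum.cartesian_product case_prod_unfold)
  also have "\<dots> = (\<Sum>q\<in>S. cis (lam * of_int (h q) * z))" by (simp add: aq)
  also have "\<dots> = (\<Sum>n\<in>{- int N..int N}. \<Sum>q\<in>{q \<in> S. h q = n}. cis (lam * of_int (h q) * z))"
    by (rule sum.group[symmetric]) (auto simp: S_def h_def)
  also have "\<dots> = (\<Sum>n\<in>{- int N..int N}. of_nat (N - nat \<bar>n\<bar>) * cis (lam * of_int n * z))"
  proof (rule sum.cong[OF refl])
    fix n
    have "(\<Sum>q\<in>{q \<in> S. h q = n}. cis (lam * of_int (h q) * z)) = (\<Sum>q\<in>{q \<in> S. h q = n}. cis (lam * of_int n * z))"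
      by (rule sum.cong) auto
    also have "\<dots> = of_nat (card {q \<in> S. h q = n}) * cis (lam * of_int n * z)" by simp
    also have "card {q \<in> S. h q = n} = N - nat \<bar>n\<bar>" unfolding S_def h_def by (rule card_difference)
    finally show "(\<Sum>q\<in>{q \<in> S. h q = n}. cis (lam * of_int (h q) * z)) = of_nat (N - nat \<bar>n\<bar>) * cis (lam * of_int n * z)" .
  qed
  also have "\<dots> = of_nat N * fejer_kernel lam N z"
  proof -
    have "of_nat (N - nat \<bar>n\<bar>) = complex_of_real (real N * fejer_weight N n)" if "n \<in> {- int N..int N}" for n
    proof -
      have "nat \<bar>n\<bar> \<le> N" using that by auto
      then have "real (N - nat \<bar>n\<bar>) = real N - \<bar>of_int n\<bar>" by (simp add: of_nat_diff)
      also have "\<dots> = real N * fejer_weight N n"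
      proof -
        have "\<bar>real_of_int n\<bar> \<le> real N" using \<open>nat \<bar>n\<bar> \<le> N\<close> by linarith
        then show ?thesis using assms by (simp add: fejer_weight_def right_diff_distrib max_def)
      qed
      finally show ?thesis by (metis of_real_of_nat_eq)
    qed
    then show ?thesis by (simp add: fejer_kernel_def sum_distrib_left mult.assoc)
  qed
  finally have "of_nat N * fejer_kernel lam N z = (\<Sum>j<N. a j) * cnj (\<Sum>j<N. a j)" by simp
  also have "\<dots> = complex_of_real ((cmod (\<Sum>j<N. a j))\<^sup>2)" by (simp only: complex_norm_square)
  finally have "fejer_kernel lam N z = complex_of_real ((cmod (\<Sum>j<N. a j))\<^sup>2) / of_nat N"
    using assms by (simp add: field_simps)
  then show ?thesis by (simp add: a_def)
qed

lemma integral_cis: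
  assumes "0 < lam"
  shows "((\<lambda>y. cis (lam * of_int n * (x - y))) has_integral (if n = 0 then complex_of_real (2 * pi / lam) else 0)) {0..2 * pi / lam}"
proof (cases "n = 0")
  case True
  then show ?thesis using has_integral_const_real[of "1::complex" 0 "2 * pi / lam"] assms by (simp add: scaleR_conv_of_real)
next
  case False
  define c where "c = lam * of_int n"
  have c: "c \<noteq> 0" using False assms by (simp add: c_def)
  have "((\<lambda>y. cis (c * (x - y))) has_integral (- cis (c * (x - 2 * pi / lam)) / (\<i> * complex_of_real c) - (- cis (c * (x - 0)) / (\<i> * complex_of_real c)))) {0..2 * pi / lam}"
  proof (rule fundamental_theorem_of_calculus)
    fix y
    show "((\<lambda>y. - cis (c * (x - y)) / (\<i> * complex_of_real c)) has_vector_derivative cis (c * (x - y))) (at y within {0..2 * pi / lam})"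
      unfolding has_vector_derivative_def
      by (rule derivative_eq_intros refl)+ (use c in \<open>auto simp: fun_eq_iff scaleR_conv_of_real field_simps\<close>)
  qed (use assms in auto)
  moreover have "cis (c * (x - 2 * pi / lam)) = cis (c * x)"
  proof -
    have "c * (x - 2 * pi / lam) = c * x + 2 * pi * of_int (- n)" using assms by (simp add: c_def field_simps)
    then show ?thesis by (metis cis_multiple_2pi Ints_of_int cis_mult mult.right_neutral)
  qed
  ultimately show ?thesis using False by (simp add: c_def)
qed

text \<open>The integrals needed for Korovkin's argument: of the kernel itself and, through the real
  part of the second one, of the kernel against the cosine. Multiplication by \<open>cis\<close>
  shifts frequencies by one, so only \<open>n = - 1\<close> contributes.\<close>

lemma fejer_kernel_integrals:
  assumes "0 < lam" "0 < N"
  shows "((\<lambda>y. fejer_kernel lam N (x - y)) has_integral complex_of_real (2 * pi / lam)) {0..2 * pi / lam}"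
    "((\<lambda>y. cis (lam * (x - y)) * fejer_kernel lam N (x - y)) has_integral complex_of_real (2 * pi / lam * fejer_weight N 1)) {0..2 * pi / lam}"
proof -
  have "((\<lambda>y. \<Sum>n\<in>{- int N..int N}. complex_of_real (fejer_weight N n) * cis (lam * of_int n * (x - y))) has_integral
     (\<Sum>n\<in>{- int N..int N}. complex_of_real (fejer_weight N n) * (if n = 0 then complex_of_real (2 * pi / lam) else 0))) {0..2 * pi / lam}"
    by (intro has_integral_sum has_integral_mult_right integral_cis assms) auto
  moreover have "(\<Sum>n\<in>{- int N..int N}. complex_of_real (fejer_weight N n) * (if n = 0 then complex_of_real (2 * pi / lam) else 0)) = complex_of_real (2 * pi / lam)"
    by (simp add: if_distrib[of "(*) _"] sum.delta fejer_weight_0 cong: if_cong)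
  ultimately show "((\<lambda>y. fejer_kernel lam N (x - y)) has_integral complex_of_real (2 * pi / lam)) {0..2 * pi / lam}"
    by (simp add: fejer_kernel_def)
  have "((\<lambda>y. \<Sum>n\<in>{- int N..int N}. complex_of_real (fejer_weight N n) * cis (lam * of_int (n + 1) * (x - y))) has_integral
     (\<Sum>n\<in>{- int N..int N}. complex_of_real (fejer_weight N n) * (if n + 1 = 0 then complex_of_real (2 * pi / lam) else 0))) {0..2 * pi / lam}"
    by (intro has_integral_sum has_integral_mult_right integral_cis assms) auto
  moreover have "(\<Sum>n\<in>{- int N..int N}. complex_of_real (fejer_weight N n) * (if n + 1 = 0 then complex_of_real (2 * pi / lam) else 0)) = complex_of_real (2 * pi / lam * fejer_weight N 1)"
  proof -
    have "(\<Sum>n\<in>{- int N..int N}. complex_of_real (fejer_weight N n) * (if n + 1 = 0 then complex_of_real (2 * pi / lam) else 0)) =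
       (\<Sum>n\<in>{- int N..int N}. if n = - 1 then complex_of_real (fejer_weight N (- 1)) * complex_of_real (2 * pi / lam) else 0)"
      by (rule sum.cong) auto
    also have "\<dots> = complex_of_real (fejer_weight N (- 1)) * complex_of_real (2 * pi / lam)"
      using assms(2) by (subst sum.delta) auto
    finally show ?thesis unfolding fejer_weight_minus by (simp add: mult.commute)
  qed
  moreover have "(\<Sum>n\<in>{- int N..int N}. complex_of_real (fejer_weight N n) * cis (lam * of_int (n + 1) * (x - y))) = cis (lam * (x - y)) * fejer_kernel lam N (x - y)" for y
  proof -
    have "cis (lam * of_int (n + 1) * (x - y)) = cis (lam * (x - y)) * cis (lam * of_int n * (x - y))" for n
      unfolding cis_mult by (simp add: algebra_simps)
    then show ?thesis unfolding fejer_kernel_def sum_distrib_left by (simp only: mult_ac)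
  qed
  ultimately show "((\<lambda>y. cis (lam * (x - y)) * fejer_kernel lam N (x - y)) has_integral complex_of_real (2 * pi / lam * fejer_weight N 1)) {0..2 * pi / lam}"
    by simp
qed

definition fejer_coeff :: "nat \<Rightarrow> (int \<Rightarrow> complex) \<Rightarrow> int \<Rightarrow> complex" where
  "fejer_coeff N a n = complex_of_real (fejer_weight N n) * a n"

lemma fourier_coeff_has_integral:
  assumes "continuous_on UNIV f" "0 < lam"
  shows "((\<lambda>y. complex_of_real (f y) * cis (- (lam * of_int n * y))) has_integral complex_of_real (2 * pi / lam) * fourier_coeff lam f n) {0..2 * pi / lam}"
proof -
  have "(\<lambda>y. complex_of_real (f y) * cis (- (lam * of_int n * y))) integrable_on {0..2 * pi / lam}"
    by (intro integrable_continuous_real continuous_intros continuous_on_cis continuous_on_subset[OF assms(1)]) auto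
  then show ?thesis using assms(2) by (simp add: fourier_coeff_def has_integral_integral)
qed

lemma fejer_mean_integral:
  assumes "continuous_on UNIV f" "0 < lam" "0 < N"
  shows "((\<lambda>y. complex_of_real (f y) * fejer_kernel lam N (x - y)) has_integral complex_of_real (2 * pi / lam) * fser lam (fejer_coeff N (fourier_coeff lam f)) x) {0..2 * pi / lam}"
proof -
  have "((\<lambda>y. \<Sum>n\<in>{- int N..int N}. (complex_of_real (fejer_weight N n) * cis (lam * of_int n * x)) * (complex_of_real (f y) * cis (- (lam * of_int n * y)))) has_integral
    (\<Sum>n\<in>{- int N..int N}. (complex_of_real (fejer_weight N n) * cis (lam * of_int n * x)) * (complex_of_real (2 * pi / lam) * fourier_coeff lam f n))) {0..2 * pi / lam}"
    by (intro has_integral_sum has_integral_mult_right fourier_coeff_has_integral assms) auto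
  moreover have "(\<Sum>n\<in>{- int N..int N}. (complex_of_real (fejer_weight N n) * cis (lam * of_int n * x)) * (complex_of_real (f y) * cis (- (lam * of_int n * y)))) =
     complex_of_real (f y) * fejer_kernel lam N (x - y)" for y
  proof -
    have "cis (lam * of_int n * (x - y)) = cis (lam * of_int n * x) * cis (- (lam * of_int n * y))" for n
      unfolding cis_mult by (simp add: algebra_simps)
    then show ?thesis unfolding fejer_kernel_def sum_distrib_left by (simp only: mult_ac)
  qed
  moreover have "(\<Sum>n\<in>{- int N..int N}. (complex_of_real (fejer_weight N n) * cis (lam * of_int n * x)) * (complex_of_real (2 * pi / lam) * fourier_coeff lam f n)) =
     complex_of_real (2 * pi / lam) * fser lam (fejer_coeff N (fourier_coeff lam f)) x"
  proof -
    have "fser lam (fejer_coeff N (fourier_coeff lam f)) x = (\<Sum>\<^sub>\<infinity>n\<in>{- int N..int N}. fejer_coeff N (fourier_coeff lam f) n * cis (lam * of_int n * x))"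
      unfolding fser_def by (rule infsum_cong_neutral) (use fejer_weight_eq_0[OF assms(3)] in \<open>auto simp: fejer_coeff_def\<close>)
    then show ?thesis by (simp add: sum_distrib_left fejer_coeff_def mult_ac)
  qed
  ultimately show ?thesis by simp
qed

lemma norm_fejer_kernel: "0 < N \<Longrightarrow> cmod (fejer_kernel lam N z) = Re (fejer_kernel lam N z)"
  unfolding fejer_kernel_eq norm_of_real Re_complex_of_real by simp

lemma has_integral_norm_le:
  assumes "(f has_integral I) {a..b::real}" "(g has_integral J) {a..b}" "\<And>y. y \<in> {a..b} \<Longrightarrow> norm (f y :: complex) \<le> g y"
  shows "norm I \<le> J"
  using integral_norm_bound_integral[of f "{a..b}" g] assms by (auto simp: has_integral_iff)

text \<open>A nonnegative kernel of mean 1 cannot enlarge the supremum. The partial sums of the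
  Fourier series have no such bound uniformly in \<open>N\<close>.\<close>

lemma fejer_mean_bound:
  assumes "continuous_on UNIV f" "0 < lam" "0 < N" "\<And>y. y \<in> {0..2 * pi / lam} \<Longrightarrow> \<bar>f y\<bar> \<le> M"
  shows "cmod (fser lam (fejer_coeff N (fourier_coeff lam f)) x) \<le> M"
proof -
  have "((\<lambda>y. M * Re (fejer_kernel lam N (x - y))) has_integral M * (2 * pi / lam)) {0..2 * pi / lam}"
    using has_integral_linear[OF fejer_kernel_integrals(1)[OF assms(2,3), of x] bounded_linear_Re]
    by (intro has_integral_mult_right) (simp add: o_def)
  from has_integral_norm_le[OF fejer_mean_integral[OF assms(1-3)] this]
  have "cmod (complex_of_real (2 * pi / lam) * fser lam (fejer_coeff N (fourier_coeff lam f)) x) \<le> M * (2 * pi / lam)"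
    using assms(4) norm_fejer_kernel[OF assms(3)]
    by (simp add: norm_mult mult_right_mono) (metis mult_right_mono norm_ge_zero)
  moreover have "0 < 2 * pi / lam" using assms(2) by simp
  ultimately show ?thesis
    unfolding norm_mult norm_of_real by (simp only: abs_of_pos mult.commute[of M] mult_le_cancel_left_pos)
qed

text \<open>Where \<open>f\<close> differs from \<open>f x\<close> by at least \<open>e\<close>, a
  compact set, \<open>1 - cos\<close> has a positive minimum: at a zero, \<open>y\<close> would
  differ from \<open>x\<close> by a multiple of the period, and the values of \<open>f\<close> would
  agree.\<close>

lemma continuous_periodic_korovkin:
  assumes "continuous_on UNIV f" "periodic_fun_simple f (2 * pi / lam)" "0 < lam" "0 < e"
  obtains C where "0 \<le> C" "\<And>y. y \<in> {0..2 * pi / lam} \<Longrightarrow> \<bar>f x - f y\<bar> \<le> e + C * (1 - cos (lam * (x - y)))"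
proof -
  define D where "D = {0..2 * pi / lam}"
  define A where "A = D \<inter> (\<lambda>y. \<bar>f x - f y\<bar> - e) -` {0..}"
  have cf: "continuous_on D (\<lambda>y. \<bar>f x - f y\<bar> - e)"
    by (intro continuous_intros continuous_on_subset[OF assms(1)]) auto
  have "closed A" unfolding A_def by (rule continuous_closed_preimage[OF cf]) (auto simp: D_def)
  then have A: "compact A" using compact_Int_closed[of D A] by (auto simp: A_def D_def Int_assoc Int_absorb)
  show ?thesis
  proof (cases "A = {}")
    case True
    then have "\<bar>f x - f y\<bar> \<le> e + 0 * (1 - cos (lam * (x - y)))" if "y \<in> {0..2 * pi / lam}" for y
      using that by (force simp: A_def D_def)
    then show ?thesis using that[of 0] by blast
  next
    case False
    have cc: "continuous_on A (\<lambda>y. 1 - cos (lam * (x - y)))" by (intro continuous_intros)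
    obtain y0 where y0: "y0 \<in> A" "\<And>y. y \<in> A \<Longrightarrow> 1 - cos (lam * (x - y0)) \<le> 1 - cos (lam * (x - y))"
      using continuous_attains_inf[OF A False cc] by blast
    obtain y1 where y1: "\<And>y. y \<in> A \<Longrightarrow> \<bar>f x - f y\<bar> - e \<le> \<bar>f x - f y1\<bar> - e"
    proof -
      have "continuous_on A (\<lambda>y. \<bar>f x - f y\<bar> - e)" by (rule continuous_on_subset[OF cf]) (simp add: A_def)
      from continuous_attains_sup[OF A False this] show ?thesis using that by blast
    qed
    define c where "c = 1 - cos (lam * (x - y0))"
    interpret periodic_fun_simple f "2 * pi / lam" by (rule assms(2))
    have "cos (lam * (x - y0)) \<noteq> 1"
    proof
      assume "cos (lam * (x - y0)) = 1"
      then obtain n :: int where "lam * (x - y0) = of_int n * 2 * pi" using cos_one_2pi_int by blast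
      then have "x = y0 + of_int n * (2 * pi / lam)" using assms(3) by (simp add: field_simps)
      then have "f x = f y0"
        using plus_of_int[of y0 n] by simp
      then show False using y0(1) assms(4) by (simp add: A_def)
    qed
    then have c: "0 < c" unfolding c_def using cos_le_one[of "lam * (x - y0)"] by linarith
    define G where "G = \<bar>\<bar>f x - f y1\<bar> - e\<bar>"
    have "\<bar>f x - f y\<bar> \<le> e + G / c * (1 - cos (lam * (x - y)))" if y: "y \<in> {0..2 * pi / lam}" for y
    proof (cases "y \<in> A")
      case True
      have "\<bar>f x - f y\<bar> - e \<le> G / c * c" using y1[OF True] c by (simp add: G_def)
      also have "\<dots> \<le> G / c * (1 - cos (lam * (x - y)))"
        using y0(2)[OF True] c by (intro mult_left_mono) (auto simp: c_def[symmetric] G_def)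
      finally show ?thesis by simp
    next
      case False
      then have "\<bar>f x - f y\<bar> < e" using y by (auto simp: A_def D_def)
      moreover have "0 \<le> G / c * (1 - cos (lam * (x - y)))" using c by (intro mult_nonneg_nonneg) (auto simp: G_def)
      ultimately show ?thesis by simp
    qed
    moreover have "0 \<le> G / c" using c by (simp add: G_def)
    ultimately show ?thesis using that by blast
  qed
qed

text \<open>Korovkin's argument: integrating the preceding estimate against the nonnegative kernel
  leaves the error \<open>r / 2 + C * (1 - fejer_weight N 1)\<close>, and the last factor is at most
  \<open>1 / N\<close>.\<close>

lemma fejer_mean_tendsto:
  assumes "continuous_on UNIV f" "periodic_fun_simple f (2 * pi / lam)" "0 < lam"
  shows "(\<lambda>N. fser lam (fejer_coeff N (fourier_coeff lam f)) x) \<longlonglongrightarrow> complex_of_real (f x)"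
proof (rule LIMSEQ_I)
  fix r :: real assume r: "0 < r"
  obtain C where C: "0 \<le> C" "\<And>y. y \<in> {0..2 * pi / lam} \<Longrightarrow> \<bar>f x - f y\<bar> \<le> r / 2 + C * (1 - cos (lam * (x - y)))"
    using continuous_periodic_korovkin[OF assms, of "r / 2" x] r by auto
  obtain N0 :: nat where N0: "2 * (C + 1) / r < real N0" using reals_Archimedean2 by blast
  have "cmod (fser lam (fejer_coeff N (fourier_coeff lam f)) x - complex_of_real (f x)) < r" if N: "N0 + 1 \<le> N" for N
  proof -
    have N': "0 < N" "real N0 \<le> real N" using N by auto
    define X where "X = 2 * pi / lam"
    have X: "0 < X" using assms(3) by (simp add: X_def)
    note k1 = fejer_kernel_integrals(1)[OF assms(3) N'(1), of x] and k2 = fejer_kernel_integrals(2)[OF assms(3) N'(1), of x]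
    have "((\<lambda>y. complex_of_real (f y) * fejer_kernel lam N (x - y) - complex_of_real (f x) * fejer_kernel lam N (x - y)) has_integral
        complex_of_real X * fser lam (fejer_coeff N (fourier_coeff lam f)) x - complex_of_real (f x) * complex_of_real X) {0..X}"
      unfolding X_def by (intro has_integral_diff fejer_mean_integral[OF assms(1,3) N'(1)] has_integral_mult_right k1)
    moreover have "((\<lambda>y. (r / 2 + C) * Re (fejer_kernel lam N (x - y)) - C * Re (cis (lam * (x - y)) * fejer_kernel lam N (x - y))) has_integral
        (r / 2 + C) * X - C * (X * fejer_weight N 1)) {0..X}"
      using has_integral_linear[OF k1 bounded_linear_Re] has_integral_linear[OF k2 bounded_linear_Re]
      unfolding X_def by (intro has_integral_diff has_integral_mult_right) (simp_all add: o_def)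
    ultimately have "cmod (complex_of_real X * fser lam (fejer_coeff N (fourier_coeff lam f)) x - complex_of_real (f x) * complex_of_real X) \<le> (r / 2 + C) * X - C * (X * fejer_weight N 1)"
    proof (rule has_integral_norm_le)
      fix y assume y: "y \<in> {0..X}"
      define k where "k = Re (fejer_kernel lam N (x - y))"
      have fk: "fejer_kernel lam N (x - y) = complex_of_real k" "0 \<le> k" using N'(1) by (auto simp: k_def fejer_kernel_eq)
      have "cmod (complex_of_real (f y) * fejer_kernel lam N (x - y) - complex_of_real (f x) * fejer_kernel lam N (x - y)) = \<bar>f x - f y\<bar> * k"
        unfolding fk(1) using fk(2) by (simp add: abs_mult abs_minus_commute flip: of_real_mult of_real_diff left_diff_distrib)
      also have "\<dots> \<le> (r / 2 + C * (1 - cos (lam * (x - y)))) * k"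
        using C(2)[of y] y fk(2) by (intro mult_right_mono) (auto simp: X_def)
      also have "\<dots> = (r / 2 + C) * Re (fejer_kernel lam N (x - y)) - C * Re (cis (lam * (x - y)) * fejer_kernel lam N (x - y))"
        unfolding fk(1) by (simp add: algebra_simps)
      finally show "cmod (complex_of_real (f y) * fejer_kernel lam N (x - y) - complex_of_real (f x) * fejer_kernel lam N (x - y)) \<le>
         (r / 2 + C) * Re (fejer_kernel lam N (x - y)) - C * Re (cis (lam * (x - y)) * fejer_kernel lam N (x - y))" .
    qed
    also have "\<dots> \<le> (r / 2 + C / real N) * X"
    proof -
      have "1 - 1 / real N \<le> fejer_weight N 1" by (simp add: fejer_weight_def)
      then have "C * (1 - fejer_weight N 1) \<le> C * (1 / real N)" using C(1) by (intro mult_left_mono) auto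
      then have "(r / 2 + C * (1 - fejer_weight N 1)) * X \<le> (r / 2 + C / real N) * X" using X by (intro mult_right_mono) auto
      then show ?thesis by (simp add: algebra_simps)
    qed
    also have "\<dots> < r * X"
    proof -
      have "2 * (C + 1) / r < real N" using N0 N' by linarith
      then have "2 * (C + 1) < real N * r" using r by (simp add: field_simps)
      then have "C / real N < r / 2" using N'(1) by (simp add: field_simps)
      then have "r / 2 + C / real N < r" by linarith
      from mult_strict_right_mono[OF this X] show ?thesis .
    qed
    finally have "cmod (complex_of_real X * (fser lam (fejer_coeff N (fourier_coeff lam f)) x - complex_of_real (f x))) < r * X"
      by (simp add: algebra_simps)
    then show ?thesis using X by (simp add: norm_mult)
  qed
  then show "\<exists>N0. \<forall>N\<ge>N0. cmod (fser lam (fejer_coeff N (fourier_coeff lam f)) x - complex_of_real (f x)) < r" by blast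
qed

text \<open>Dominated convergence in disguise: with \<open>r = 1 / N\<close> the sum is a uniformly
  convergent series of continuous functions of \<open>r\<close>, and it vanishes at
  \<open>r = 0\<close>.\<close>

lemma fejer_coeff_error_tendsto:
  assumes "coeff_summable a"
  shows "(\<lambda>N. \<Sum>\<^sub>\<infinity>n. (1 - fejer_weight N n) * cmod (a n)) \<longlonglongrightarrow> 0"
proof -
  define g where "g r = (\<Sum>\<^sub>\<infinity>n. (1 - max 0 (1 - \<bar>of_int n\<bar> * r)) * cmod (a n))" for r :: real
  have "continuous_on {0..1} g"
    unfolding g_def
  proof (rule continuous_on_infsum[OF _ _ assms])
    fix n and r :: real assume r: "r \<in> {0..1}"
    have "\<bar>1 - max 0 (1 - \<bar>of_int n\<bar> * r)\<bar> * cmod (a n) \<le> 1 * cmod (a n)"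
      using r by (intro mult_right_mono) auto
    then show "norm ((1 - max 0 (1 - \<bar>of_int n\<bar> * r)) * cmod (a n)) \<le> cmod (a n)" by (simp add: abs_mult)
  qed (intro continuous_intros)
  then have "(g \<longlongrightarrow> g 0) (at 0 within {0..1})" by (auto simp: continuous_on_def)
  moreover have "filterlim (\<lambda>N. 1 / real (Suc N)) (at 0 within {0..1}) sequentially"
    unfolding filterlim_at using LIMSEQ_Suc[OF lim_1_over_n] by (auto simp: eventually_sequentially)
  ultimately have "(\<lambda>N. g (1 / real (Suc N))) \<longlonglongrightarrow> g 0" by (rule filterlim_compose)
  moreover have "g 0 = 0" by (simp add: g_def)
  moreover have "g (1 / real (Suc N)) = (\<Sum>\<^sub>\<infinity>n. (1 - fejer_weight (Suc N) n) * cmod (a n))" for N by (simp add: g_def fejer_weight_def)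
  ultimately show ?thesis by (intro LIMSEQ_imp_Suc[of "\<lambda>N. \<Sum>\<^sub>\<infinity>n. (1 - fejer_weight N n) * cmod (a n)"]) simp
qed

lemma fejer_coeff_summable: "coeff_summable a \<Longrightarrow> coeff_summable (fejer_coeff N a)"
  by (rule summable_on_comparison_test)
    (use fejer_weight_bounds in \<open>auto simp: fejer_coeff_def norm_mult intro: mult_left_le_one_le\<close>)

lemma fser_fejer_diff:
  assumes "coeff_summable a"
  shows "cmod (fser lam (fejer_coeff N a) x - fser lam a x) \<le> (\<Sum>\<^sub>\<infinity>n. (1 - fejer_weight N n) * cmod (a n))"
proof -
  have "fser lam (\<lambda>n. fejer_coeff N a n + (-1) * a n) x = fser lam (fejer_coeff N a) x + (-1) * fser lam a x"
    by (simp only: fser_add[OF fejer_coeff_summable[OF assms] coeff_summable_cmult[OF assms]] fser_cmult)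
  moreover have "cmod (fser lam (\<lambda>n. fejer_coeff N a n + (-1) * a n) x) \<le> (\<Sum>\<^sub>\<infinity>n. (1 - fejer_weight N n) * cmod (a n))"
  proof (rule norm_fser_le)
    fix n
    have "fejer_coeff N a n + (-1) * a n = complex_of_real (fejer_weight N n - 1) * a n" by (simp add: fejer_coeff_def algebra_simps)
    then show "cmod (fejer_coeff N a n + (-1) * a n) \<le> (1 - fejer_weight N n) * cmod (a n)"
      using fejer_weight_bounds[of N n] by (simp only: norm_mult norm_of_real) (simp add: abs_if mult_right_mono)
    show "(\<lambda>n. (1 - fejer_weight N n) * cmod (a n)) summable_on UNIV"
      by (rule summable_on_comparison_test[OF assms]) (use fejer_weight_bounds in \<open>auto intro: mult_left_le_one_le\<close>)
  qed
  ultimately show ?thesis by simp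
qed

text \<open>The Fejer means converge to both sides: to \<open>f x\<close> by positivity of the
  kernel and to the series by summability of the coefficients.\<close>

lemma fourier_inversion:
  assumes "continuous_on UNIV f" "periodic_fun_simple f (2 * pi / lam)" "0 < lam" "coeff_summable (fourier_coeff lam f)"
  shows "fser lam (fourier_coeff lam f) x = complex_of_real (f x)"
proof -
  have "(\<lambda>N. fser lam (fejer_coeff N (fourier_coeff lam f)) x - fser lam (fourier_coeff lam f) x) \<longlonglongrightarrow> 0"
    by (rule Lim_null_comparison[OF _ fejer_coeff_error_tendsto[OF assms(4)]])
      (use fser_fejer_diff[OF assms(4)] in auto)
  then have "(\<lambda>N. fser lam (fejer_coeff N (fourier_coeff lam f)) x) \<longlonglongrightarrow> fser lam (fourier_coeff lam f) x"
    by (simp add: LIM_zero_iff)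
  then show ?thesis using fejer_mean_tendsto[OF assms(1-3)] LIMSEQ_unique by blast
qed

section \<open>Fourier coefficients and derivatives\<close>

lemma fourier_coeff_hermitian: "hermitian (fourier_coeff lam f)"
  unfolding hermitian_def
proof
  fix n
  have "integral {0..2 * pi / lam} (\<lambda>x. complex_of_real (f x) * cis (- (lam * of_int (- n) * x))) =
      integral {0..2 * pi / lam} (cnj \<circ> (\<lambda>x. complex_of_real (f x) * cis (- (lam * of_int n * x))))"
    by (intro integral_cong) (simp add: cis_cnj)
  also have "\<dots> = cnj (integral {0..2 * pi / lam} (\<lambda>x. complex_of_real (f x) * cis (- (lam * of_int n * x))))"
  proof (cases "(\<lambda>x. complex_of_real (f x) * cis (- (lam * of_int n * x))) integrable_on {0..2 * pi / lam}")
    case True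
    then show ?thesis by (rule integral_linear[OF _ bounded_linear_cnj])
  next
    \<comment> \<open>The integral of a non-integrable function is 0 by convention, and conjugation
      preserves non-integrability.\<close>
    case False
    moreover have "\<not> (cnj \<circ> (\<lambda>x. complex_of_real (f x) * cis (- (lam * of_int n * x)))) integrable_on {0..2 * pi / lam}"
    proof
      assume "(cnj \<circ> (\<lambda>x. complex_of_real (f x) * cis (- (lam * of_int n * x)))) integrable_on {0..2 * pi / lam}"
      from integrable_linear[OF this bounded_linear_cnj] False show False by (simp add: o_def)
    qed
    ultimately show ?thesis by (simp add: not_integrable_integral)
  qed
  finally show "fourier_coeff lam f (- n) = cnj (fourier_coeff lam f n)" by (simp add: fourier_coeff_def)
qed

lemma fourier_coeff_derivative:
  assumes "\<And>x. (f has_real_derivative f' x) (at x)" "continuous_on UNIV f'" "periodic_fun_simple f (2 * pi / lam)" "0 < lam"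
  shows "fourier_coeff lam f' n = dcoeff lam (fourier_coeff lam f) n"
proof -
  define X where "X = 2 * pi / lam"
  define c where "c = lam * of_int n"
  have X: "0 < X" using assms(4) by (simp add: X_def)
  have cf: "continuous_on UNIV f" using assms(1) by (intro DERIV_continuous_on) (auto intro: has_field_derivative_at_within)
  have "((\<lambda>y. complex_of_real (f' y) * cis (- (c * y)) + complex_of_real (f y) * (- \<i> * complex_of_real c * cis (- (c * y)))) has_integral
      (complex_of_real (f X) * cis (- (c * X)) - complex_of_real (f 0) * cis (- (c * 0)))) {0..X}"
  proof (rule fundamental_theorem_of_calculus)
    fix y
    have "((\<lambda>y. complex_of_real (f y)) has_vector_derivative complex_of_real (f' y)) (at y within {0..X})"
      using bounded_linear.has_vector_derivative[OF bounded_linear_of_real, of f "f' y" "at y within {0..X}"] assms(1)[of y]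
      by (simp add: has_real_derivative_iff_has_vector_derivative has_vector_derivative_at_within)
    moreover have "((\<lambda>y. cis (- (c * y))) has_vector_derivative - \<i> * complex_of_real c * cis (- (c * y))) (at y within {0..X})"
      unfolding has_vector_derivative_def
      by (rule derivative_eq_intros refl)+ (auto simp: fun_eq_iff scaleR_conv_of_real)
    ultimately have "((\<lambda>y. complex_of_real (f y) * cis (- (c * y))) has_vector_derivative
        complex_of_real (f y) * (- \<i> * complex_of_real c * cis (- (c * y))) + complex_of_real (f' y) * cis (- (c * y))) (at y within {0..X})"
      by (rule has_vector_derivative_mult)
    then show "((\<lambda>y. complex_of_real (f y) * cis (- (c * y))) has_vector_derivative
        complex_of_real (f' y) * cis (- (c * y)) + complex_of_real (f y) * (- \<i> * complex_of_real c * cis (- (c * y)))) (at y within {0..X})"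
      by (simp add: add.commute)
  qed (use X in auto)
  moreover have "complex_of_real (f X) * cis (- (c * X)) = complex_of_real (f 0) * cis (- (c * 0))"
  proof -
    have "f X = f 0" using assms(3) by (auto simp: periodic_fun_simple_def X_def dest: spec[of _ 0])
    moreover have "- (c * X) = 2 * pi * of_int (- n)" using assms(4) by (simp add: c_def X_def)
    ultimately show ?thesis by (metis Ints_of_int cis_multiple_2pi cis_zero minus_zero mult_zero_right)
  qed
  ultimately have 1: "((\<lambda>y. complex_of_real (f' y) * cis (- (c * y)) + complex_of_real (f y) * (- \<i> * complex_of_real c * cis (- (c * y)))) has_integral 0) {0..X}" by simp
  have 2: "((\<lambda>y. complex_of_real (f' y) * cis (- (c * y)) + (- \<i> * complex_of_real c) * (complex_of_real (f y) * cis (- (c * y)))) has_integral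
      complex_of_real X * fourier_coeff lam f' n + (- \<i> * complex_of_real c) * (complex_of_real X * fourier_coeff lam f n)) {0..X}"
    using fourier_coeff_has_integral[OF assms(2,4), of n] fourier_coeff_has_integral[OF cf assms(4), of n]
    unfolding X_def c_def by (intro has_integral_add has_integral_mult_right)
  have "complex_of_real X * fourier_coeff lam f' n + (- \<i> * complex_of_real c) * (complex_of_real X * fourier_coeff lam f n) = 0"
    by (rule has_integral_unique[OF 2]) (use 1 in \<open>simp add: algebra_simps\<close>)
  then have "complex_of_real X * (fourier_coeff lam f' n - dcoeff lam (fourier_coeff lam f) n) = 0"
    by (simp add: dcoeff_def c_def algebra_simps)
  then show ?thesis using X by simp
qed

lemma C_space_derivatives:
  assumes "C_space l f" "j \<le> l"
  shows "j < l \<Longrightarrow> ((deriv ^^ j) f has_real_derivative (deriv ^^ Suc j) f x) (at x)" "continuous_on UNIV ((deriv ^^ j) f)"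
proof -
  have d: "((deriv ^^ j) f has_real_derivative (deriv ^^ Suc j) f x) (at x)" if "j < l" for j x
  proof -
    have "(deriv ^^ j) f differentiable at x" using assms(1) that unfolding C_space_def differentiable_on_def by auto
    then have "(deriv ^^ j) f field_differentiable at x"
      by (meson field_differentiable_def real_differentiable_def)
    then show ?thesis by (simp add: DERIV_deriv_iff_field_differentiable)
  qed
  show "j < l \<Longrightarrow> ((deriv ^^ j) f has_real_derivative (deriv ^^ Suc j) f x) (at x)" by (rule d)
  show "continuous_on UNIV ((deriv ^^ j) f)"
  proof (cases "j = l")
    case True
    then show ?thesis using assms(1) by (simp add: C_space_def)
  next
    case False
    then have "j < l" using assms(2) by simp
    show ?thesis by (rule DERIV_continuous_on[of UNIV]) (use d[OF \<open>j < l\<close>] in auto)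
  qed
qed

lemma deriv_iterate_periodic:
  fixes f :: "real \<Rightarrow> real"
  assumes "periodic_fun_simple f L" shows "periodic_fun_simple ((deriv ^^ j) f) L"
proof (induction j)
  case (Suc j)
  define g where "g = (deriv ^^ j) f"
  have "(\<lambda>x. g (x + L)) = g" using Suc by (auto simp: periodic_fun_simple_def g_def)
  then have "deriv g (x + L) = deriv g x" for x
    unfolding deriv_def using DERIV_shift[of g _ x L] by simp
  then show ?case by (simp add: periodic_fun_simple_def g_def)
qed (use assms in simp)

lemma fourier_coeff_deriv_iterate:
  assumes "C_space l f" "periodic_fun_simple f (2 * pi / lam)" "0 < lam" "j \<le> l"
  shows "fourier_coeff lam ((deriv ^^ j) f) = (dcoeff lam ^^ j) (fourier_coeff lam f)"
  using assms(4)
proof (induction j)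
  case (Suc j)
  have "fourier_coeff lam ((deriv ^^ Suc j) f) n = dcoeff lam (fourier_coeff lam ((deriv ^^ j) f)) n" for n
    using Suc.prems by (intro fourier_coeff_derivative C_space_derivatives(1)[OF assms(1)] C_space_derivatives(2)[OF assms(1)] deriv_iterate_periodic assms) auto
  then show ?case using Suc by (auto simp: fun_eq_iff)
qed simp

text \<open>A pointwise limit together with equi-Lipschitz derivatives forces convergence of the derivatives.\<close>

lemma derivative_tendsto:
  fixes g g' :: "nat \<Rightarrow> real \<Rightarrow> real"
  assumes "\<And>N x. (g N has_real_derivative g' N x) (at x)" "\<And>N x. (g' N has_real_derivative g'' N x) (at x)" "\<And>N x. \<bar>g'' N x\<bar> \<le> C"
    "\<And>x. (f has_real_derivative f' x) (at x)" "\<And>x. (f' has_real_derivative f'' x) (at x)" "\<And>x. \<bar>f'' x\<bar> \<le> C"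
    "\<And>x. (\<lambda>N. g N x) \<longlonglongrightarrow> f x"
  shows "(\<lambda>N. g' N x) \<longlonglongrightarrow> f' x"
proof (rule LIMSEQ_I)
  fix r :: real assume r: "0 < r"
  have C: "0 \<le> C" using assms(6)[of 0] by linarith
  define h where "h = r / (4 * (C + 1))"
  have h: "0 < h" "C * h \<le> r / 4" using r C by (auto simp: h_def field_simps)
  have quot: "\<bar>(F (x + h) - F x) / h - F' x\<bar> \<le> C * h"
    if F: "\<And>x. (F has_real_derivative F' x) (at x)" "\<And>x. (F' has_real_derivative F'' x) (at x)" "\<And>x. \<bar>F'' x\<bar> \<le> C" for F F' F'' :: "real \<Rightarrow> real"
  proof -
    obtain z where z: "x < z" "z < x + h" "F (x + h) - F x = (x + h - x) * F' z" using MVT2[of x "x + h" F F', OF _ F(1)] h by auto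
    obtain w where w: "F' z - F' x = (z - x) * F'' w" using MVT2[of x z F' F'', OF _ F(2)] z by auto
    have "\<bar>F' z - F' x\<bar> \<le> h * C" unfolding w abs_mult using z F(3)[of w] h by (intro mult_mono) auto
    then show ?thesis using z(3) h by (simp add: mult.commute)
  qed
  have "(\<lambda>N. (g N (x + h) - g N x) / h) \<longlonglongrightarrow> (f (x + h) - f x) / h" using h by (intro tendsto_intros assms(7)) auto
  then obtain N0 where N0: "\<And>N. N0 \<le> N \<Longrightarrow> \<bar>(g N (x + h) - g N x) / h - (f (x + h) - f x) / h\<bar> < r / 4"
    using LIMSEQ_D[of _ _ "r / 4"] r unfolding real_norm_def by fastforce
  have "\<bar>g' N x - f' x\<bar> < r" if "N0 \<le> N" for N
    using N0[OF that] quot[of "g N" "g' N" "g'' N", OF assms(1-3)] quot[of f f' f'', OF assms(4-6)] h(2) r by linarith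
  then show "\<exists>N0. \<forall>N\<ge>N0. norm (g' N x - f' x) < r" by auto
qed

section \<open>Uniqueness and decay up to the initial time\<close>

lemma C_norm_le:
  assumes "0 < lam" "\<And>j x. j \<le> l \<Longrightarrow> \<bar>(deriv ^^ j) f x\<bar> \<le> B"
  shows "C_norm lam l f \<le> B"
proof -
  have "(SUP x\<in>{0..2 * pi / lam}. \<bar>(deriv ^^ j) f x\<bar>) \<le> B" if "j \<le> l" for j
    using assms that by (intro cSUP_least) auto
  then show ?thesis unfolding C_norm_def by (subst Max_le_iff) auto
qed

text \<open>The factor 2 comes from \<open>cmod z \<le> \<bar>Re z\<bar> + \<bar>Im z\<bar>\<close>,
  since the seminorm treats the two parts separately. An infinite seminorm contradicts the second
  hypothesis.\<close>

lemma fourier_seminorm_coeff_bound: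
  assumes "0 < c" "ereal c * fourier_seminorm lam 2 f \<le> ereal m" "n \<noteq> 0"
  shows "c * ((of_int n)\<^sup>2 * cmod (fourier_coeff lam f n)) \<le> 2 * m"
proof -
  define N where "N = (of_int n :: real)\<^sup>2"
  have N: "\<bar>of_int n :: real\<bar> powr 2 = N" using assms(3) by (simp add: N_def)
  have "ereal (N * \<bar>Re (fourier_coeff lam f n)\<bar>) \<le> fourier_seminorm lam 2 f" "ereal (N * \<bar>Im (fourier_coeff lam f n)\<bar>) \<le> fourier_seminorm lam 2 f"
    unfolding fourier_seminorm_def N[symmetric] using assms(3)
    by (intro max.coboundedI1 max.coboundedI2 SUP_upper; simp)+
  then have "ereal c * ereal (N * \<bar>Re (fourier_coeff lam f n)\<bar>) \<le> ereal m" "ereal c * ereal (N * \<bar>Im (fourier_coeff lam f n)\<bar>) \<le> ereal m"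
    using assms(1) by (intro order_trans[OF ereal_mult_left_mono assms(2)]; simp)+
  then have "c * (N * \<bar>Re (fourier_coeff lam f n)\<bar>) + c * (N * \<bar>Im (fourier_coeff lam f n)\<bar>) \<le> 2 * m" by simp
  moreover have "c * (N * cmod (fourier_coeff lam f n)) \<le> c * (N * (\<bar>Re (fourier_coeff lam f n)\<bar> + \<bar>Im (fourier_coeff lam f n)\<bar>))"
    using assms(1) by (intro mult_left_mono cmod_le) (auto simp: N_def)
  ultimately show ?thesis by (simp add: N_def algebra_simps)
qed

lemma periodic_bounded:
  assumes "continuous_on UNIV (f :: real \<Rightarrow> real)" "periodic_fun_simple f L" "0 < L"
  shows "\<exists>K. \<forall>x. \<bar>f x\<bar> \<le> K"
proof -
  have "compact (f ` {0..L})" by (intro compact_continuous_image continuous_on_subset[OF assms(1)]) auto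
  then obtain K where K: "\<And>x. x \<in> {0..L} \<Longrightarrow> \<bar>f x\<bar> \<le> K" using compact_imp_bounded bounded_iff by (metis imageI real_norm_def)
  have "\<bar>f x\<bar> \<le> K" for x
  proof -
    interpret periodic_fun_simple f L by (rule assms(2))
    have "of_int \<lfloor>x / L\<rfloor> * L \<le> x" by (rule pos_le_divide_eq[THEN iffD1, OF assms(3) of_int_floor_le])
    moreover have "x < (of_int \<lfloor>x / L\<rfloor> + 1) * L" by (rule pos_divide_less_eq[THEN iffD1, OF assms(3)]) linarith
    ultimately have "x - of_int \<lfloor>x / L\<rfloor> * L \<in> {0..L}" by (simp add: algebra_simps)
    from K[OF this] show ?thesis by (simp only: minus_of_int)
  qed
  then show ?thesis by blast
qed

context flow_solution
begin

text \<open>The bound contains neither \<open>phi\<close> nor \<open>s0\<close>, so it holds for all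
  approximating solutions at once: it uses the analyticity gained by time \<open>t\<close>, and
  \<open>c\<close> bounds the elapsed new time from below. Growth of the amplitude is outweighed by
  the decay of the deviation because \<open>1 / p < mu\<close>.\<close>

lemma kk_uniform_bound:
  assumes "0 < t" "t < life" "0 < j" "c = t * (m * exp (- 1)) ^ (p + 1)"
  shows "\<bar>kk j x t\<bar> \<le> m * exp 1 * (rad * (\<bar>lam\<bar> ^ j * (\<Sum>\<^sub>\<infinity>n::int. \<bar>of_int n\<bar> ^ j * exp (- (min c 1 / 4) * \<bar>of_int n\<bar>))))"
proof -
  define s where "s = tau t"
  have s: "0 < s" "clock s = t" using tau[of t] tau_pos[of t] assms by (auto simp: s_def)
  have c: "0 < c" using assms m by simp
  have "t \<le> s / (m * exp (0 / real p - 1)) ^ (p + 1)" using clock_increment(2)[of 0 s] s clock_0 by simp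
  then have cs: "c \<le> s" using m unfolding assms(4) by (simp add: field_simps)
  define r where "r = min c 1 / 4"
  have r: "0 < r" "r \<le> radius c" using c s0 by (auto simp: r_def)
  have sm: "(\<lambda>n::int. \<bar>of_int n\<bar> ^ j * exp (- e * \<bar>of_int n\<bar>)) summable_on UNIV" if "0 < e" for e :: real
    by (rule summable_exp_decay[OF that])
  have le: "(\<Sum>\<^sub>\<infinity>n::int. \<bar>of_int n\<bar> ^ j * exp (- radius c * \<bar>of_int n\<bar>)) \<le> (\<Sum>\<^sub>\<infinity>n::int. \<bar>of_int n\<bar> ^ j * exp (- r * \<bar>of_int n\<bar>))"
  proof (intro infsum_mono sm mult_left_mono)
    show "exp (- radius c * \<bar>of_int n\<bar>) \<le> exp (- r * \<bar>of_int n :: real\<bar>)" for n :: int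
      using mult_right_mono[OF r(2), of "\<bar>of_int n\<bar>"] by (simp only: exp_le_cancel_iff mult_minus_left neg_le_iff_le abs_ge_zero simp_thms)
  qed (use r in auto)
  have "\<bar>vjet j x s\<bar> \<le> exp (- mu * s) * (rad * (\<bar>lam\<bar> ^ j * (\<Sum>\<^sub>\<infinity>n::int. \<bar>of_int n\<bar> ^ j * exp (- radius c * \<bar>of_int n\<bar>))))"
    using c cs s0 by (intro vjet_decay) auto
  also have "\<dots> \<le> exp (- mu * s) * (rad * (\<bar>lam\<bar> ^ j * (\<Sum>\<^sub>\<infinity>n::int. \<bar>of_int n\<bar> ^ j * exp (- r * \<bar>of_int n\<bar>))))"
    using rad(1) by (intro mult_left_mono le) auto
  finally have v: "\<bar>vjet j x s\<bar> \<le> exp (- mu * s) * (rad * (\<bar>lam\<bar> ^ j * (\<Sum>\<^sub>\<infinity>n::int. \<bar>of_int n\<bar> ^ j * exp (- r * \<bar>of_int n\<bar>))))" .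
  define J where "J = rad * (\<bar>lam\<bar> ^ j * (\<Sum>\<^sub>\<infinity>n::int. \<bar>of_int n\<bar> ^ j * exp (- r * \<bar>of_int n\<bar>)))"
  have J: "0 \<le> J" unfolding J_def using rad(1) by (intro mult_nonneg_nonneg infsum_nonneg) auto
  have "\<bar>kk j x t\<bar> = amp s * \<bar>vjet j x s\<bar>"
    using ujet_vjet[of s j x] s assms(3) amp_pos[of s] by (simp add: kk_def s_def[symmetric] abs_mult)
  also have "\<dots> \<le> (m * exp (s / real p + 1)) * (exp (- mu * s) * J)"
    using v s amp_bounds(2)[of s] m unfolding J_def by (intro mult_mono) auto
  also have "\<dots> = m * J * (exp (s / real p + 1) * exp (- mu * s))" by simp
  also have "\<dots> \<le> m * J * exp 1"
  proof (rule mult_left_mono)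
    have "s * (1 / real p) \<le> s * mu" using mu_gt s by (intro mult_left_mono) auto
    then show "exp (s / real p + 1) * exp (- mu * s) \<le> exp 1" by (simp add: mult.commute flip: exp_add)
  qed (use m J in simp)
  finally show ?thesis by (simp add: J_def r_def mult_ac)
qed

lemma kk_stability:
  assumes "0 < T'" "T' < life"
  obtains C e0 where "0 < C" "0 < e0"
    "\<And>k1 psi T1 e x t. T' < T1 \<Longrightarrow> classical_solution p lam T1 psi k1 \<Longrightarrow> 0 < e \<Longrightarrow> e \<le> e0 \<Longrightarrow>
       (\<And>x. \<bar>psi x - kk 0 x 0\<bar> < e) \<Longrightarrow> t \<in> {0..T'} \<Longrightarrow> \<bar>k1 x t - kk 0 x t\<bar> < C * e"
proof -
  obtain H where H: "0 \<le> H" "\<And>t x. 0 < t \<Longrightarrow> t \<le> T' \<Longrightarrow> (kk 1 x t)\<^sup>2 \<le> H * t powr (- 3 / 4)"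
    "\<And>t x. 0 < t \<Longrightarrow> t \<le> T' \<Longrightarrow> \<bar>kk 2 x t\<bar> \<le> H * t powr (- 3 / 4)"
    using kk_singular_bound[OF assms(2)] by blast
  have lower: "m * exp (- 1) / 2 \<le> kk 0 x t" if "t \<in> {0..T'}" for x t
  proof -
    have t: "0 \<le> t" "t < life" using that assms by auto
    have "m * exp (- 1) \<le> m * exp (tau t / real p - 1)" using m tau(1)[OF t] by simp
    also have "\<dots> \<le> amp (tau t)" by (rule amp_bounds(1)[OF tau(1)[OF t]])
    finally show ?thesis using kk_0_bounds(1)[OF t, of x] by linarith
  qed
  have upper: "kk 0 x t \<le> 2 * (m * exp (tau T' / real p + 1))" if "t \<in> {0..T'}" for x t
    using kk_0_bounds(2)[of t x] amp_tau_bound[of t T'] that assms by auto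
  show ?thesis
  proof (rule stability[where ?k2.0="kk 0" and k2t="kdot 0" and k2x="kk 1" and k2xx="kk 2" and p=p and lam=lam and T'=T' and H=H])
    show "1 \<le> p" "0 < lam" "0 < T'" "0 < m * exp (- 1) / 2" "0 \<le> H" using p lam_pos assms m H by simp_all
    show "periodic_fun_simple (\<lambda>x. kk 0 x t) (2 * pi / lam)" for t by unfold_locales (rule jet_periodic)
    show "continuous_on (UNIV \<times> {0..T'}) (\<lambda>(x, t). kk 0 x t)"
      by (rule continuous_on_subset[OF kk_continuous(3)]) (use assms in auto)
    show "m * exp (- 1) / 2 \<le> kk 0 x t" "kk 0 x t \<le> 2 * (m * exp (tau T' / real p + 1))" if "t \<in> {0..T'}" for x t
      using lower upper that by auto
    fix x t assume t: "t \<in> {0<..T'}"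
    then have t': "0 < t" "0 \<le> t" "t < life" "0 < s0 + t" "t \<le> T'" using assms s0 by auto
    show "((\<lambda>s. kk 0 x s) has_real_derivative kdot 0 x t) (at t)" by (rule kk_t_derivative[OF t'(1,3)])
    show "((\<lambda>x. kk 0 x t) has_real_derivative kk 1 x t) (at x)" using kk_x_derivative(1)[OF t'(2-4), of 0] by simp
    show "((\<lambda>x. kk 1 x t) has_real_derivative kk 2 x t) (at x)" using kk_x_derivative(1)[OF t'(2-4), of 1] by (simp add: numeral_2_eq_2)
    show "kdot 0 x t = kk 0 x t ^ (p + 1) * kk 2 x t + (real p - 1) * kk 0 x t ^ p * (kk 1 x t)\<^sup>2 + kk 0 x t ^ (p + 2) / real p"
      unfolding kdot_0[OF t'(2-4)] rhs_poly_def ..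
    show "(kk 1 x t)\<^sup>2 \<le> H * t powr (- 3 / 4)" "\<bar>kk 2 x t\<bar> \<le> H * t powr (- 3 / 4)" using H(2,3) t' by auto
  qed (use that in blast)
qed

text \<open>With equal data the stability estimate applies for every small \<open>e\<close>.\<close>

lemma kk_unique:
  assumes "classical_solution p lam T (\<lambda>x. kk 0 x 0) k" "0 \<le> t" "t < T" "t < life"
  shows "k x t = kk 0 x t"
proof -
  obtain T' where T': "t < T'" "T' < T" "T' < life" using assms dense[of t "min T life"] by auto
  have T0: "0 < T'" using T' assms by simp
  obtain C e0 where C: "0 < C" "0 < e0"
    "\<And>k1 psi T1 e x t. T' < T1 \<Longrightarrow> classical_solution p lam T1 psi k1 \<Longrightarrow> 0 < e \<Longrightarrow> e \<le> e0 \<Longrightarrow>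
       (\<And>x. \<bar>psi x - kk 0 x 0\<bar> < e) \<Longrightarrow> t \<in> {0..T'} \<Longrightarrow> \<bar>k1 x t - kk 0 x t\<bar> < C * e"
    using kk_stability[OF T0 T'(3)] by blast
  have "\<bar>k x t - kk 0 x t\<bar> \<le> 0"
  proof (rule field_le_epsilon)
    fix d :: real assume d: "0 < d"
    define e where "e = min e0 (d / C)"
    have e: "0 < e" "e \<le> e0" "C * e \<le> d" using C(1,2) d by (auto simp: e_def min_def field_simps)
    have "\<bar>k x t - kk 0 x t\<bar> < C * e"
      by (rule C(3)[OF T'(2) assms(1) e(1,2)]) (use e T' assms in auto)
    then show "\<bar>k x t - kk 0 x t\<bar> \<le> 0 + d" using e(3) by simp
  qed
  then show ?thesis by simp
qed

text \<open>If \<open>T < life\<close>, the solution agrees before \<open>T\<close> with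
  \<open>kk 0\<close>, which is bounded there, so it cannot blow up at \<open>T\<close>. If
  \<open>life < T\<close>, it is continuous at \<open>life\<close>, whereas \<open>kk 0\<close>
  exceeds every bound just before.\<close>

lemma life_unique:
  assumes "solution_with_blowup_time p lam T (\<lambda>x. kk 0 x 0) k"
  shows "T = life"
proof -
  have T: "0 < T" and cs: "classical_solution p lam T (\<lambda>x. kk 0 x 0) k" and bl: "blows_up_at T k"
    using assms by (auto simp: solution_with_blowup_time_def)
  show ?thesis
  proof (rule linorder_cases[of T life])
    assume TL: "T < life"
    define M where "M = 2 * (m * exp (tau T / real p + 1))"
    have "\<bar>k x t\<bar> \<le> M" if "0 < t" "t < T" for x t
    proof -
      have "k x t = kk 0 x t" using that TL by (intro kk_unique[OF cs]) auto
      then show ?thesis using kk_0_pos[of t x] kk_0_bounds(2)[of t x] amp_tau_bound[of t T] that TL by (simp add: M_def)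
    qed
    then have "\<forall>\<^sub>F t in at_left T. \<not> (\<exists>x. M < \<bar>k x t\<bar>)"
      by (intro eventually_mono[OF eventually_at_left_real[OF T]]) (simp add: not_less)
    then show ?thesis using bl unfolding blows_up_at_def frequently_def by blast
  next
    assume TL: "life < T"
    have "continuous_on (UNIV \<times> {0..<T}) (\<lambda>(x, t). k x t)" using cs by (simp add: classical_solution_def)
    then have "continuous_on {0..<T} (\<lambda>t. (\<lambda>(x, t). k x t) (0, t))"
      by (rule continuous_on_compose2) (auto intro: continuous_intros)
    then have "isCont (\<lambda>t. k 0 t) life" using TL life_pos
      by (simp add: continuous_on_interior[of "{0..<T}"])
    then have "((\<lambda>t. k 0 t) \<longlongrightarrow> k 0 life) (at_left life)" by (simp add: isCont_def filterlim_at_split)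
    then have ev: "\<forall>\<^sub>F t in at_left life. k 0 t < k 0 life + 1" by (rule order_tendstoD) simp
    obtain t1 where t1: "0 \<le> t1" "t1 < life" "\<And>t x. t1 < t \<Longrightarrow> t < life \<Longrightarrow> k 0 life + 1 < kk 0 x t" using kk_0_blowup by blast
    have "\<forall>\<^sub>F t in at_left life. t1 < t \<and> t < life" using eventually_at_left_real[OF t1(2)] by simp
    with ev have "\<forall>\<^sub>F t in at_left life. False"
    proof eventually_elim
      case (elim t)
      have "k 0 t = kk 0 0 t" using elim t1 TL by (intro kk_unique[OF cs]) auto
      then show ?case using t1(3)[of t 0] elim by simp
    qed
    then show ?thesis by simp
  qed
qed

lemma deriv_iterate_kk:
  assumes "0 < t" "t < life"
  shows "(deriv ^^ j) (\<lambda>x. kk 0 x t - a) = (\<lambda>x. kk j x t - (if j = 0 then a else 0))"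
proof (induction j)
  case (Suc j)
  have "deriv (\<lambda>x. kk j x t - (if j = 0 then a else 0)) x = kk (Suc j) x t" for x
    using kk_x_derivative(1)[of t j x] assms s0 DERIV_diff[of _ _ _ _ "\<lambda>_. if j = 0 then a else 0" 0]
    by (intro DERIV_imp_deriv) (auto intro!: derivative_eq_intros)
  then show ?case by (simp only: funpow.simps o_apply Suc.IH) simp
qed simp

lemma C_norm_decay_positive_time:
  assumes "0 < t0" "t0 < life"
  shows "\<exists>E\<ge>0. \<forall>t\<in>{t0..<life}. C_norm lam l (\<lambda>x. kk 0 x t - amp (tau t)) \<le> E * (life - t) powr decay_exponent"
proof -
  have "\<forall>j. \<exists>E\<ge>0. \<forall>t x. t0 \<le> t \<and> t < life \<longrightarrow> \<bar>kk j x t - (if j = 0 then amp (tau t) else 0)\<bar> \<le> E * (life - t) powr decay_exponent"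
    using kk_decay[of t0] assms s0 by auto
  then obtain E where E: "\<And>j. 0 \<le> E j" "\<And>j t x. t0 \<le> t \<Longrightarrow> t < life \<Longrightarrow> \<bar>kk j x t - (if j = 0 then amp (tau t) else 0)\<bar> \<le> E j * (life - t) powr decay_exponent"
    by metis
  have "C_norm lam l (\<lambda>x. kk 0 x t - amp (tau t)) \<le> (\<Sum>j\<le>l. E j) * (life - t) powr decay_exponent" if t: "t \<in> {t0..<life}" for t
  proof (rule C_norm_le[OF lam_pos])
    fix j x assume j: "j \<le> l"
    have t': "0 < t" "t < life" "t0 \<le> t" using t assms by auto
    have "\<bar>kk j x t - (if j = 0 then amp (tau t) else 0)\<bar> \<le> E j * (life - t) powr decay_exponent" by (rule E(2)[OF t'(3,2)])
    also have "\<dots> \<le> (\<Sum>j\<le>l. E j) * (life - t) powr decay_exponent"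
      using j E(1) by (intro mult_right_mono member_le_sum) auto
    finally show "\<bar>(deriv ^^ j) (\<lambda>x. kk 0 x t - amp (tau t)) x\<bar> \<le> (\<Sum>j\<le>l. E j) * (life - t) powr decay_exponent"
      unfolding deriv_iterate_kk[OF t'(1,2)] .
  qed
  then show ?thesis using E(1) by (intro exI[of _ "\<Sum>j\<le>l. E j"]) (auto intro: sum_nonneg)
qed

end

text \<open>The bound \<open>rad / 8\<close> is half of what \<open>admissible\<close> asks for; the
  spare factor 2 pays for the exponential weights into which the Fejer means are placed.\<close>

locale flow_data = flow +
  fixes psi :: "real \<Rightarrow> real" and m :: real
  assumes cont: "continuous_on UNIV psi" and per: "periodic_fun_simple psi (2 * pi / lam)" and m: "0 < m"
    and coeff_0: "fourier_coeff lam psi 0 = complex_of_real m"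
    and coeff_small: "\<And>n. n \<noteq> 0 \<Longrightarrow> cmod (fourier_coeff lam psi n) \<le> m * (rad / 8 * time_profile 0 0 n)"
begin

definition phi :: "int \<Rightarrow> complex" where
  "phi n = (if n = 0 then 0 else fourier_coeff lam psi n / complex_of_real m)"

lemma phi_bound: "n \<noteq> 0 \<Longrightarrow> cmod (phi n) \<le> rad / 8 * time_profile 0 0 n"
  using coeff_small[of n] m by (simp add: phi_def norm_divide field_simps)

lemma phi_hermitian: "hermitian phi"
  using fourier_coeff_hermitian[of lam psi] by (simp add: hermitian_def phi_def)

lemma tp_pos: "0 < time_profile 0 0 n"
  by (rule profile_pos[OF profile_time_profile]) auto

lemma admissible_phi: "admissible 0 phi"
  unfolding admissible_def
proof (intro conjI allI impI phi_hermitian order_refl)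
  fix n :: int assume "n \<noteq> 0"
  have "rad / 8 * time_profile 0 0 n \<le> rad / 4 * time_profile 0 0 n" using rad(1) tp_pos[of n] by (intro mult_right_mono) auto
  then show "cmod (phi n) \<le> rad / 4 * time_profile 0 0 n" using phi_bound[OF \<open>n \<noteq> 0\<close>] by linarith
qed

sublocale flow_solution p lam 0 phi m
  by unfold_locales (rule admissible_phi, rule m)

lemma psi_coeff: "complex_of_real m * u_coeff phi n = fourier_coeff lam psi n"
  using m by (simp add: u_coeff_def phi_def coeff_0)

lemma psi_coeff_summable: "coeff_summable (fourier_coeff lam psi)"
proof -
  have P: "profile (time_profile 0 0)" by (rule profile_time_profile) auto
  have "coeff_summable phi"
  proof (rule summable_on_comparison_test)
    show "(\<lambda>n. rad / 8 * time_profile 0 0 n) summable_on UNIV" using P by (intro summable_on_cmult_right) (simp add: profile_def)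
    show "cmod (phi n) \<le> rad / 8 * time_profile 0 0 n" for n
      using phi_bound[of n] rad(1) tp_pos[of n] by (cases "n = 0") (auto simp: phi_def)
  qed auto
  then have "coeff_summable (\<lambda>n. complex_of_real m * u_coeff phi n)"
    unfolding u_coeff_def by (intro coeff_summable_cmult coeff_summable_add coeff_summable_single)
  then show ?thesis by (simp add: psi_coeff)
qed

lemma kk_initial_psi: "kk 0 x 0 = psi x"
proof -
  have "kk 0 x 0 = Re (fser lam (\<lambda>n. complex_of_real m * u_coeff phi n) x)"
    using kk_initial[of 0 x] by (simp add: phi_def fser_cmult)
  also have "\<dots> = psi x" using fourier_inversion[OF cont per lam_pos psi_coeff_summable] by (simp add: psi_coeff)
  finally show ?thesis .
qed

definition phiN :: "nat \<Rightarrow> int \<Rightarrow> complex" where "phiN N = fejer_coeff (Suc N) phi"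

definition sN :: "nat \<Rightarrow> real" where "sN N = ln 2 / real (Suc N)"

lemma sN: "0 < sN N" by (simp add: sN_def)

text \<open>Fejer means of the data are trigonometric polynomials, so they lie in a space with exponential
  weights; the exponential rate is chosen so small that it costs at most a factor 2.\<close>

lemma approx: "flow_solution p lam (sN N) (phiN N) m"
proof (unfold_locales, unfold admissible_def, intro conjI allI impI)
  show "0 \<le> sN N" using sN[of N] by simp
  show "hermitian (phiN N)" using phi_hermitian by (simp add: hermitian_def phiN_def fejer_coeff_def fejer_weight_minus)
  fix n :: int assume n: "n \<noteq> 0"
  show "cmod (phiN N n) \<le> rad / 4 * time_profile (sN N) 0 n"
  proof (cases "n \<in> {- int (Suc N)..int (Suc N)}")
    case True
    have "\<bar>real_of_int n\<bar> \<le> real (Suc N)" using True by auto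
    then have "sN N * \<bar>of_int n\<bar> \<le> sN N * real (Suc N)" using sN[of N] by (intro mult_left_mono) auto
    then have "sN N * \<bar>of_int n\<bar> \<le> ln 2" by (simp add: sN_def)
    then have "exp (sN N * \<bar>of_int n\<bar>) \<le> exp (ln 2)" by (simp only: exp_le_cancel_iff)
    then have "exp (sN N * \<bar>of_int n\<bar>) \<le> 2" by simp
    then have "1 / 2 \<le> exp (- (sN N * \<bar>of_int n\<bar>))" by (simp add: exp_minus field_simps)
    then have "rad / 4 * (time_profile 0 0 n * (1 / 2)) \<le> rad / 4 * (time_profile 0 0 n * exp (- (sN N * \<bar>of_int n\<bar>)))"
      using rad(1) tp_pos[of n] by (intro mult_left_mono) auto
    also have "time_profile 0 0 n * exp (- (sN N * \<bar>of_int n\<bar>)) = time_profile (sN N) 0 n"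
      by (simp add: time_profile_def decay_profile_def exp_minus field_simps)
    finally have "rad / 8 * time_profile 0 0 n \<le> rad / 4 * time_profile (sN N) 0 n" by simp
    moreover have "cmod (phiN N n) \<le> 1 * cmod (phi n)"
      unfolding phiN_def fejer_coeff_def norm_mult using fejer_weight_bounds[of "Suc N" n] by (intro mult_right_mono) auto
    ultimately show ?thesis using phi_bound[OF n] by simp
  next
    case False
    then have "phiN N n = 0" using fejer_weight_eq_0[of "Suc N" n] by (simp add: phiN_def fejer_coeff_def)
    moreover have "0 < time_profile (sN N) 0 n" using sN[of N] by (intro profile_pos[OF profile_time_profile]) auto
    ultimately show ?thesis using rad(1) by simp
  qed
qed (rule m)

abbreviation kN :: "nat \<Rightarrow> nat \<Rightarrow> real \<Rightarrow> real \<Rightarrow> real" where "kN N \<equiv> flow_solution.kk p lam (phiN N) m"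
abbreviation yN :: "nat \<Rightarrow> nat \<Rightarrow> real \<Rightarrow> real \<Rightarrow> real" where "yN N \<equiv> flow_solution.kdot p lam (phiN N) m"
abbreviation lifeN :: "nat \<Rightarrow> real" where "lifeN N \<equiv> flow_solution.life p lam (phiN N) m"

text \<open>Half of the bound in \<open>life_lower_bound\<close>, so the limit and all
  approximations exist strictly beyond \<open>T1\<close>.\<close>

definition T1 :: real where "T1 = 1 / (m * exp (1 / real p + 1)) ^ (p + 1) / 2"

lemma T1: "0 < T1" "T1 < life" "T1 < lifeN N"
proof -
  have half: "a / 2 < b" if "0 < a / 2" "a \<le> b" for a b :: real using that by linarith
  show T1: "0 < T1" using m by (simp add: T1_def)
  show "T1 < life" "T1 < lifeN N"
    using half[OF T1[unfolded T1_def]] life_lower_bound flow_solution.life_lower_bound[OF approx[of N]] unfolding T1_def by blast+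
qed

lemma kN_initial: "kN N j x 0 = Re (fser lam ((dcoeff lam ^^ j) (fejer_coeff (Suc N) (fourier_coeff lam psi))) x)"
proof -
  have 0: "phiN N 0 = 0" by (simp add: phiN_def fejer_coeff_def phi_def)
  have "complex_of_real m * u_coeff (phiN N) n = fejer_coeff (Suc N) (fourier_coeff lam psi) n" for n
    using psi_coeff[of n] coeff_0 fejer_weight_0[of "Suc N"]
    using m by (cases "n = 0") (simp_all add: u_coeff_def phiN_def fejer_coeff_def phi_def algebra_simps)
  then have eq: "(\<lambda>n. complex_of_real m * (dcoeff lam ^^ j) (u_coeff (phiN N)) n) = (dcoeff lam ^^ j) (fejer_coeff (Suc N) (fourier_coeff lam psi))"
    by (auto simp: dcoeff_iterate mult.left_commute)
  have "kN N j x 0 = m * Re (fser lam ((dcoeff lam ^^ j) (u_coeff (phiN N))) x)"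
    using flow_solution.kk_initial[OF approx 0] by simp
  also have "\<dots> = Re (fser lam (\<lambda>n. complex_of_real m * (dcoeff lam ^^ j) (u_coeff (phiN N)) n) x)" by (simp add: fser_cmult)
  finally show ?thesis unfolding eq .
qed

lemma smooth_flow_kN: "smooth_flow T1 (kN N) (yN N)"
proof -
  note A = approx[of N]
  have t: "0 \<le> t" "t < lifeN N" "0 < sN N + t" if "t \<in> {0<..T1}" for t using that T1(3)[of N] sN[of N] by auto
  show ?thesis
    unfolding smooth_flow_def jet_chain_def
  proof (intro conjI allI ballI)
    show "periodic_fun_simple (\<lambda>x. kN N j x t) (2 * pi / lam)" for j t
      by unfold_locales (rule flow_solution.jet_periodic[OF A])
    show "continuous_on (UNIV \<times> {0..T1}) (\<lambda>(x, t). kN N j x t)" for j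
      by (rule continuous_on_subset[OF flow_solution.kk_continuous(4)[OF A sN]]) (use T1(3)[of N] in auto)
    fix t assume t': "t \<in> {0<..T1}"
    show "0 \<le> kN N 0 x t" for x using flow_solution.kk_0_pos[OF A t(1,2)[OF t'], of x] by simp
    show "((\<lambda>x. kN N j x t) has_real_derivative kN N (Suc j) x t) (at x)" "((\<lambda>x. yN N j x t) has_real_derivative yN N (Suc j) x t) (at x)" for j x
      using flow_solution.kk_x_derivative[OF A t[OF t']] by auto
    show "yN N 0 x t = rhs_poly (\<lambda>j. kN N j x t)" for x by (rule flow_solution.kdot_0[OF A t[OF t']])
    show "((\<lambda>s. kN N j x s) has_real_derivative yN N j x t) (at t)" for j x
      by (rule flow_solution.kk_t_derivative[OF A]) (use t' t in auto)
  qed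
qed

text \<open>Order 0 is stability with the limit \<open>kk 0\<close> as reference solution. Each
  further order follows from the one before, because the derivatives two orders up are bounded
  uniformly in \<open>N\<close> at the fixed positive time.\<close>

lemma kN_tendsto:
  assumes "0 < t" "t \<le> T1"
  shows "(\<lambda>N. kN N j x t) \<longlonglongrightarrow> kk j x t"
proof (induction j arbitrary: x)
  case 0
  \<comment> \<open>The summand \<open>1 / Suc N\<close> makes the error strictly positive and the
    comparison at time 0 strict, as stability requires.\<close>
  define err where "err N = (\<Sum>\<^sub>\<infinity>n. (1 - fejer_weight (Suc N) n) * cmod (fourier_coeff lam psi n)) + 1 / real (Suc N)" for N
  have "(\<lambda>N. err N) \<longlonglongrightarrow> 0 + 0"
    unfolding err_def by (intro tendsto_add LIMSEQ_Suc[OF fejer_coeff_error_tendsto[OF psi_coeff_summable]] LIMSEQ_Suc[OF lim_1_over_n])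
  then have err: "err \<longlonglongrightarrow> 0" by simp
  obtain C e0 where C: "0 < C" "0 < e0"
    "\<And>k1 psi T e x t. T1 < T \<Longrightarrow> classical_solution p lam T psi k1 \<Longrightarrow> 0 < e \<Longrightarrow> e \<le> e0 \<Longrightarrow>
       (\<And>x. \<bar>psi x - kk 0 x 0\<bar> < e) \<Longrightarrow> t \<in> {0..T1} \<Longrightarrow> \<bar>k1 x t - kk 0 x t\<bar> < C * e"
    using kk_stability[OF T1(1,2)] by blast
  have close: "\<bar>kN N 0 x 0 - kk 0 x 0\<bar> < err N" for N x
  proof -
    have "kN N 0 x 0 - kk 0 x 0 = Re (fser lam (fejer_coeff (Suc N) (fourier_coeff lam psi)) x - fser lam (fourier_coeff lam psi) x)"
      using fourier_inversion[OF cont per lam_pos psi_coeff_summable, of x] kN_initial[of N 0 x] by (simp add: kk_initial_psi)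
    then have "\<bar>kN N 0 x 0 - kk 0 x 0\<bar> \<le> (\<Sum>\<^sub>\<infinity>n. (1 - fejer_weight (Suc N) n) * cmod (fourier_coeff lam psi n))"
      using fser_fejer_diff[OF psi_coeff_summable, of lam "Suc N" x] abs_Re_le_cmod order_trans by metis
    moreover have "0 < 1 / real (Suc N)" by simp
    ultimately show ?thesis unfolding err_def by linarith
  qed
  have pos: "0 < err N" for N using close[of N 0] by linarith
  have "\<forall>\<^sub>F N in sequentially. err N < e0" using err C(2) by (rule order_tendstoD)
  then have "\<forall>\<^sub>F N in sequentially. norm (kN N 0 x t - kk 0 x t) \<le> C * err N"
  proof eventually_elim
    case (elim N)
    have "\<bar>kN N 0 x t - kk 0 x t\<bar> < C * err N"
      by (rule C(3)[OF T1(3) flow_solution.kk_classical_solution[OF approx] pos]) (use elim close assms in auto)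
    then show ?case by simp
  qed
  then have "(\<lambda>N. kN N 0 x t - kk 0 x t) \<longlonglongrightarrow> 0"
    by (rule Lim_null_comparison) (use tendsto_mult_right_zero[OF err, of C] in simp)
  then show ?case by (rule LIM_zero_cancel)
next
  case (Suc j)
  define c where "c = t * (m * exp (- 1)) ^ (p + 1)"
  define B where "B = m * exp 1 * (rad * (\<bar>lam\<bar> ^ Suc (Suc j) * (\<Sum>\<^sub>\<infinity>n::int. \<bar>of_int n\<bar> ^ Suc (Suc j) * exp (- (min c 1 / 4) * \<bar>of_int n\<bar>))))"
  have tl: "t < life" "\<And>N. t < lifeN N" using assms T1 by (auto intro: le_less_trans)
  have tN: "0 < sN N + t" for N using sN[of N] assms by simp
  show ?case
  proof (rule derivative_tendsto[where x=x and g="\<lambda>N x. kN N j x t" and g'="\<lambda>N x. kN N (Suc j) x t" and f'="\<lambda>x. kk (Suc j) x t" and f="\<lambda>x. kk j x t" and g''="\<lambda>N x. kN N (Suc (Suc j)) x t" and f''="\<lambda>x. kk (Suc (Suc j)) x t" and C=B])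
    show "((\<lambda>x. kN N j x t) has_real_derivative kN N (Suc j) x t) (at x)" "((\<lambda>x. kN N (Suc j) x t) has_real_derivative kN N (Suc (Suc j)) x t) (at x)" for N x
      using flow_solution.kk_x_derivative(1)[OF approx _ tl(2) tN] assms(1) by auto
    show "\<bar>kN N (Suc (Suc j)) x t\<bar> \<le> B" for N x
      unfolding B_def by (rule flow_solution.kk_uniform_bound[OF approx assms(1) tl(2) _ c_def]) simp
    show "((\<lambda>x. kk j x t) has_real_derivative kk (Suc j) x t) (at x)" "((\<lambda>x. kk (Suc j) x t) has_real_derivative kk (Suc (Suc j)) x t) (at x)" for x
      using kk_x_derivative(1)[OF _ tl(1)] assms(1) by auto
    show "\<bar>kk (Suc (Suc j)) x t\<bar> \<le> B" for x
      unfolding B_def by (rule kk_uniform_bound[OF assms(1) tl(1) _ c_def]) simp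
  qed (rule Suc.IH)
qed

lemma psi_derivatives_bounded:
  assumes "C_space l psi"
  shows "\<exists>K. \<forall>j\<le>l. \<forall>x. \<bar>(deriv ^^ j) psi x\<bar> \<le> K"
proof -
  have "\<exists>K. \<forall>x. \<bar>(deriv ^^ j) psi x\<bar> \<le> K" if "j \<le> l" for j
    using lam_pos by (intro periodic_bounded[of _ "2 * pi / lam"] C_space_derivatives(2)[OF assms that] deriv_iterate_periodic per) auto
  then obtain K where K: "\<And>j x. j \<le> l \<Longrightarrow> \<bar>(deriv ^^ j) psi x\<bar> \<le> K j" by metis
  have "\<bar>(deriv ^^ j) psi x\<bar> \<le> (\<Sum>i\<le>l. K i)" if "j \<le> l" for j x
  proof -
    have "K j \<le> (\<Sum>i\<le>l. K i)" using that order_trans[OF abs_ge_zero K] by (intro member_le_sum) auto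
    then show ?thesis using K[OF that, of x] by linarith
  qed
  then show ?thesis by blast
qed

text \<open>The maximum principle for the differentiated equations needs all derivatives continuous
  down to time 0. For \<open>kN\<close> the positive radius \<open>sN\<close> guarantees this, for
  \<open>kk\<close> the radius is 0; so the bound is proved for the approximations, with constants
  free of \<open>N\<close>, and then passed to the limit at positive times.\<close>

lemma kk_bounded_near_0:
  assumes "C_space l psi"
  shows "\<exists>M t0. 0 < t0 \<and> t0 < life \<and> (\<forall>j\<le>l. \<forall>x t. 0 < t \<longrightarrow> t \<le> t0 \<longrightarrow> \<bar>kk j x t\<bar> \<le> M)"
proof -
  obtain K where K: "\<And>j x. j \<le> l \<Longrightarrow> \<bar>(deriv ^^ j) psi x\<bar> \<le> K" using psi_derivatives_bounded[OF assms] by blast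
  have init: "\<bar>kN N j x 0\<bar> \<le> K" if "j \<le> l" for N j x
  proof -
    have "(dcoeff lam ^^ j) (fejer_coeff (Suc N) (fourier_coeff lam psi)) = fejer_coeff (Suc N) ((dcoeff lam ^^ j) (fourier_coeff lam psi))"
      by (auto simp: dcoeff_iterate fejer_coeff_def)
    then have "kN N j x 0 = Re (fser lam (fejer_coeff (Suc N) (fourier_coeff lam ((deriv ^^ j) psi))) x)"
      unfolding kN_initial fourier_coeff_deriv_iterate[OF assms per lam_pos that] by simp
    moreover have "cmod (fser lam (fejer_coeff (Suc N) (fourier_coeff lam ((deriv ^^ j) psi))) x) \<le> K"
      by (rule fejer_mean_bound[OF C_space_derivatives(2)[OF assms that] lam_pos]) (use K that in auto)
    ultimately show ?thesis using abs_Re_le_cmod order_trans by metis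
  qed
  obtain M t0 where M: "0 < t0" "t0 \<le> T1" "\<And>z y. smooth_flow T1 z y \<Longrightarrow> (\<forall>j<Suc l. \<forall>x. \<bar>z j x 0\<bar> \<le> K) \<Longrightarrow>
     (\<forall>j<Suc l. \<forall>x. \<forall>t\<in>{0..t0}. \<bar>z j x t\<bar> \<le> M)"
    using smooth_flow_bounds[OF T1(1), of "Suc l" K] by blast
  have "\<bar>kk j x t\<bar> \<le> M" if "j \<le> l" "0 < t" "t \<le> t0" for j x t
  proof -
    have "\<bar>kN N j x t\<bar> \<le> M" for N
      using M(3)[OF smooth_flow_kN[of N]] init that by auto
    moreover have "(\<lambda>N. \<bar>kN N j x t\<bar>) \<longlonglongrightarrow> \<bar>kk j x t\<bar>" using that M(2) by (intro tendsto_rabs kN_tendsto) auto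
    ultimately show ?thesis by (intro LIMSEQ_le_const2) auto
  qed
  moreover have "t0 < life" using M(2) T1(2) by linarith
  ultimately show ?thesis using M(1) by blast
qed

text \<open>Until \<open>t1\<close> boundedness is enough, because \<open>life - t\<close> stays
  away from 0 and its power is at least \<open>q\<close>; the decay estimate for positive times
  takes over from \<open>t1\<close>. At \<open>t = 0\<close> the derivatives are those of
  \<open>psi\<close>.\<close>

lemma C_norm_decay:
  assumes "0 \<le> t0" "t0 < life" "0 < t0 \<or> C_space l psi"
  shows "\<exists>E. \<forall>t\<in>{t0..<life}. C_norm lam l (\<lambda>x. kk 0 x t - amp (tau t)) \<le> E * (life - t) powr decay_exponent"
proof (cases "0 < t0")
  case True
  then show ?thesis using C_norm_decay_positive_time[OF True assms(2), of l] by blast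
next
  case False
  then have t0: "t0 = 0" and C: "C_space l psi" using assms by auto
  obtain K where K: "\<And>j x. j \<le> l \<Longrightarrow> \<bar>(deriv ^^ j) psi x\<bar> \<le> K" using psi_derivatives_bounded[OF C] by blast
  obtain M t1 where M: "0 < t1" "t1 < life" "\<And>j x t. j \<le> l \<Longrightarrow> 0 < t \<Longrightarrow> t \<le> t1 \<Longrightarrow> \<bar>kk j x t\<bar> \<le> M"
    using kk_bounded_near_0[OF C] by blast
  obtain E where E: "0 \<le> E" "\<And>t. t \<in> {t1..<life} \<Longrightarrow> C_norm lam l (\<lambda>x. kk 0 x t - amp (tau t)) \<le> E * (life - t) powr decay_exponent"
    using C_norm_decay_positive_time[OF M(1,2), of l] by blast
  define B where "B = \<bar>M\<bar> + \<bar>K\<bar> + m * exp (tau t1 / real p + 1)"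
  have amp: "amp (tau t) \<le> m * exp (tau t1 / real p + 1)" if "0 \<le> t" "t \<le> t1" for t
    by (rule amp_tau_bound[OF that M(2)])
  have psi_deriv: "(deriv ^^ j) (\<lambda>x. psi x - a) = (\<lambda>x. (deriv ^^ j) psi x - (if j = 0 then a else 0))" if "j \<le> l" for j a
    using that
  proof (induction j)
    case (Suc j)
    have "deriv (\<lambda>x. (deriv ^^ j) psi x - (if j = 0 then a else 0)) x = (deriv ^^ Suc j) psi x" for x
      using C_space_derivatives(1)[OF C, of j x] Suc.prems by (intro DERIV_imp_deriv) (auto intro!: derivative_eq_intros)
    moreover have "(deriv ^^ j) (\<lambda>x. psi x - a) = (\<lambda>x. (deriv ^^ j) psi x - (if j = 0 then a else 0))" using Suc by simp
    ultimately show ?case by (simp only: funpow.simps o_apply) simp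
  qed simp
  have near: "C_norm lam l (\<lambda>x. kk 0 x t - amp (tau t)) \<le> B" if t: "0 \<le> t" "t \<le> t1" for t
  proof (rule C_norm_le[OF lam_pos])
    fix j x assume j: "j \<le> l"
    show "\<bar>(deriv ^^ j) (\<lambda>x. kk 0 x t - amp (tau t)) x\<bar> \<le> B"
    proof (cases "t = 0")
      case True
      have "(\<lambda>x. kk 0 x t - amp (tau t)) = (\<lambda>x. psi x - amp (tau t))" using True by (simp add: kk_initial_psi)
      then show ?thesis using psi_deriv[OF j, of "amp (tau t)"] K[OF j, of x] amp[OF t] amp_pos[of "tau t"] by (auto simp: B_def)
    next
      case False
      then have t': "0 < t" "t < life" using t M by auto
      show ?thesis
        unfolding deriv_iterate_kk[OF t'] using M(3)[OF j t'(1) t(2), of x] amp[OF t] amp_pos[of "tau t"] by (auto simp: B_def)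
    qed
  qed
  have B: "0 \<le> B" using m by (simp add: B_def)
  define q where "q = (life - t1) powr decay_exponent"
  have q: "0 < q" using M(2) by (simp add: q_def)
  have "C_norm lam l (\<lambda>x. kk 0 x t - amp (tau t)) \<le> (E + B / q) * (life - t) powr decay_exponent" if t: "t \<in> {t0..<life}" for t
  proof (cases "t1 \<le> t")
    case True
    then have "C_norm lam l (\<lambda>x. kk 0 x t - amp (tau t)) \<le> E * (life - t) powr decay_exponent" using t by (intro E) auto
    also have "\<dots> \<le> (E + B / q) * (life - t) powr decay_exponent" using B q by (intro mult_right_mono) auto
    finally show ?thesis .
  next
    case False
    have "C_norm lam l (\<lambda>x. kk 0 x t - amp (tau t)) \<le> B / q * q" using near[of t] False t t0 q by simp
    also have "\<dots> \<le> (E + B / q) * (life - t) powr decay_exponent"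
    proof (rule mult_mono)
      show "q \<le> (life - t) powr decay_exponent"
        unfolding q_def using False M(2) decay_exponent_pos by (intro powr_mono2) auto
    qed (use E(1) B q in auto)
    finally show ?thesis .
  qed
  then show ?thesis by blast
qed

end

theorem theorem2p1:
  fixes p :: nat and lam :: real
  assumes "1 \<le> p" and "sqrt ((real p + 2) / real p) < lam"
  shows "\<exists>c>0. \<forall>\<psi> :: real \<Rightarrow> real.
    periodic_fun_simple \<psi> (2 * pi / lam) \<and> (\<forall>\<theta>. 0 < \<psi> \<theta>) \<and>
    ereal c * fourier_seminorm lam 2 \<psi> \<le> ereal (lam / (2 * pi) * integral {0..2 * pi / lam} \<psi>)
    \<longrightarrow> (\<exists>E :: nat \<Rightarrow> real \<Rightarrow> real. \<forall>T k. solution_with_blowup_time p lam T \<psi> k \<longrightarrow>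
          (\<forall>t\<in>{0<..<T}. real_analytic (\<lambda>\<theta>. k \<theta> t)) \<and>
          (\<forall>l. \<forall>t0\<in>{0..<T}. 0 < t0 \<or> C_space l \<psi> \<longrightarrow>
             (\<forall>t\<in>{t0..<T}.
                C_norm lam l (\<lambda>\<theta>. k \<theta> t - Re (fourier_coeff lam (\<lambda>x. k x t) 0))
                  \<le> E l t0 * (T - t) powr
                      ((lam\<^sup>2 - (real p + 2) / real p) * (real p / (real p + 1))))))"
proof -
  interpret flow p lam by unfold_locales (rule assms)+
  \<comment> \<open>The data must satisfy
    \<open>cmod \<le> m * rad / (64 * quad_sum * (1 + n^2))\<close>, the 64 being 8 from
    \<open>flow_data\<close> times 8 from the normalisation of the profile. A factor 2 replaces
    \<open>1 + n^2\<close> by \<open>n^2\<close>, and another 2 comes from treating real and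
    imaginary parts separately.\<close>
  define c where "c = 256 * quad_sum / rad"
  have c: "0 < c" using quad_sum_ge_1 rad(1) by (simp add: c_def)
  show ?thesis
  proof (intro exI[of _ c] conjI c allI impI, elim conjE)
    fix \<psi> :: "real \<Rightarrow> real"
    assume per: "periodic_fun_simple \<psi> (2 * pi / lam)" and pos: "\<forall>\<theta>. 0 < \<psi> \<theta>"
      and small: "ereal c * fourier_seminorm lam 2 \<psi> \<le> ereal (lam / (2 * pi) * integral {0..2 * pi / lam} \<psi>)"
    define G where "G = (lam\<^sup>2 - (real p + 2) / real p) * (real p / (real p + 1))"
    show "\<exists>E :: nat \<Rightarrow> real \<Rightarrow> real. \<forall>T k. solution_with_blowup_time p lam T \<psi> k \<longrightarrow>
          (\<forall>t\<in>{0<..<T}. real_analytic (\<lambda>\<theta>. k \<theta> t)) \<and>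
          (\<forall>l. \<forall>t0\<in>{0..<T}. 0 < t0 \<or> C_space l \<psi> \<longrightarrow>
             (\<forall>t\<in>{t0..<T}. C_norm lam l (\<lambda>\<theta>. k \<theta> t - Re (fourier_coeff lam (\<lambda>x. k x t) 0)) \<le> E l t0 * (T - t) powr G))"
    proof (cases "\<exists>T k. solution_with_blowup_time p lam T \<psi> k")
      case False
      then show ?thesis by blast
    next
      \<comment> \<open>Continuity of the data is read off from some solution at time 0; if there is
        none, the claim is vacuous.\<close>
      case True
      then obtain T' k' where "0 < T'" "classical_solution p lam T' \<psi> k'" by (auto simp: solution_with_blowup_time_def)
      then have k': "continuous_on (UNIV \<times> {0..<T'}) (\<lambda>(x, t). k' x t)" "\<And>x. k' x 0 = \<psi> x" "0 \<in> {0..<T'}"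
        by (auto simp: classical_solution_def)
      have cont: "continuous_on UNIV \<psi>"
      proof -
        have "continuous_on UNIV (\<lambda>x. (x, 0 :: real))" by (intro continuous_intros)
        from continuous_on_compose2[OF k'(1) this] k'(2,3) show ?thesis by (simp add: image_subset_iff)
      qed
      define m where "m = lam / (2 * pi) * integral {0..2 * pi / lam} \<psi>"
      have int: "(\<psi> has_integral integral {0..2 * pi / lam} \<psi>) {0..2 * pi / lam}"
        by (intro integrable_integral integrable_continuous_real continuous_on_subset[OF cont]) auto
      have m: "0 < m"
      proof -
        have "0 \<le> integral {0..2 * pi / lam} \<psi>" by (rule integral_nonneg[OF has_integral_integrable[OF int]]) (use pos in \<open>simp add: less_imp_le\<close>)
        moreover have "integral {0..2 * pi / lam} \<psi> \<noteq> 0"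
        proof
          assume "integral {0..2 * pi / lam} \<psi> = 0"
          then have "\<forall>x\<in>{0..2 * pi / lam}. \<psi> x = 0"
            by (subst (asm) integral_eq_0_iff) (use pos lam_pos continuous_on_subset[OF cont subset_UNIV] in \<open>simp_all add: less_imp_le\<close>)
          then have "\<psi> 0 = 0" using lam_pos by simp
          with pos show False by (metis less_numeral_extra(3))
        qed
        ultimately show ?thesis using lam_pos by (simp add: m_def)
      qed
      interpret flow_data p lam \<psi> m
      proof (intro flow_data.intro flow_data_axioms.intro flow_axioms cont per m)
        show "fourier_coeff lam \<psi> 0 = complex_of_real m" unfolding m_def by (rule fourier_coeff_0[OF int])
        fix n :: int assume n: "n \<noteq> 0"
        define N where "N = (of_int n :: real)\<^sup>2"
        have N: "1 \<le> N" unfolding N_def by (rule of_int_square_ge_1[OF n])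
        have "c * (N * cmod (fourier_coeff lam \<psi> n)) \<le> 2 * m"
          unfolding N_def by (rule fourier_seminorm_coeff_bound[OF c _ n]) (use small in \<open>simp add: m_def\<close>)
        then have "128 * quad_sum * N * cmod (fourier_coeff lam \<psi> n) \<le> m * rad" using rad(1) by (simp add: c_def field_simps)
        moreover have "64 * quad_sum * (1 + N) * cmod (fourier_coeff lam \<psi> n) \<le> 128 * quad_sum * N * cmod (fourier_coeff lam \<psi> n)"
          using N quad_sum_ge_1 by (intro mult_right_mono) auto
        ultimately have *: "64 * quad_sum * (1 + N) * cmod (fourier_coeff lam \<psi> n) \<le> m * rad" by linarith
        have p: "0 < 64 * quad_sum * (1 + N)" using N quad_sum_ge_1 by simp
        have "cmod (fourier_coeff lam \<psi> n) \<le> m * rad / (64 * quad_sum * (1 + N))"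
          using * p by (simp only: pos_le_divide_eq mult.commute[of "cmod _"])
        then show "cmod (fourier_coeff lam \<psi> n) \<le> m * (rad / 8 * time_profile 0 0 n)"
          by (simp add: time_profile_def decay_profile_def N_def mult_ac)
      qed
      have G: "G = decay_exponent" by (simp add: G_def decay_exponent_def)
      have "\<forall>l t0. \<exists>E. 0 \<le> t0 \<longrightarrow> t0 < life \<longrightarrow> 0 < t0 \<or> C_space l \<psi> \<longrightarrow>
          (\<forall>t\<in>{t0..<life}. C_norm lam l (\<lambda>x. kk 0 x t - amp (tau t)) \<le> E * (life - t) powr G)"
        using C_norm_decay unfolding G by blast
      then obtain E where E: "\<And>l t0 t. 0 \<le> t0 \<Longrightarrow> t0 < life \<Longrightarrow> 0 < t0 \<or> C_space l \<psi> \<Longrightarrow> t \<in> {t0..<life} \<Longrightarrow>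
          C_norm lam l (\<lambda>x. kk 0 x t - amp (tau t)) \<le> E l t0 * (life - t) powr G"
        by metis
      show ?thesis
      proof (intro exI[of _ E] allI impI)
        fix T k assume sol: "solution_with_blowup_time p lam T \<psi> k"
        have init: "(\<lambda>x. kk 0 x 0) = \<psi>" using kk_initial_psi by blast
        have T: "T = life" using life_unique[of T k] sol unfolding init by blast
        have "classical_solution p lam T \<psi> k" using sol by (simp add: solution_with_blowup_time_def)
        then have k: "(\<lambda>x. k x t) = (\<lambda>x. kk 0 x t)" if "0 \<le> t" "t < life" for t
          using kk_unique[of T k t] that T unfolding init by blast
        show "(\<forall>t\<in>{0<..<T}. real_analytic (\<lambda>\<theta>. k \<theta> t)) \<and>
          (\<forall>l. \<forall>t0\<in>{0..<T}. 0 < t0 \<or> C_space l \<psi> \<longrightarrow>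
             (\<forall>t\<in>{t0..<T}. C_norm lam l (\<lambda>\<theta>. k \<theta> t - Re (fourier_coeff lam (\<lambda>x. k x t) 0)) \<le> E l t0 * (T - t) powr G))"
        proof (intro conjI ballI allI impI)
          show "real_analytic (\<lambda>\<theta>. k \<theta> t)" if "t \<in> {0<..<T}" for t
            using k[of t] kk_analytic[of t] that T by simp
          fix l t0 t assume t0: "t0 \<in> {0..<T}" "0 < t0 \<or> C_space l \<psi>" and t: "t \<in> {t0..<T}"
          then have t': "0 \<le> t" "t < life" using T by auto
          have "(\<lambda>\<theta>. k \<theta> t - Re (fourier_coeff lam (\<lambda>x. k x t) 0)) = (\<lambda>x. kk 0 x t - amp (tau t))"
            using fun_cong[OF k[OF t']] unfolding k[OF t'] kk_mean[OF t'] by simp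
          then show "C_norm lam l (\<lambda>\<theta>. k \<theta> t - Re (fourier_coeff lam (\<lambda>x. k x t) 0)) \<le> E l t0 * (T - t) powr G"
            using E[of t0 l t] t0 t T by simp
        qed
      qed
    qed
  qed
qed

end
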